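(* There exists $\epsilon_0>0$ such that for every $0<\epsilon\le\epsilon_0$ the following holds. Let $u_0\in\dot H^{1/2}(\mathbb R^3)$ be an $\mathbb{R}^3$-valued vector field with $\operatorname{div}u_0=0$ and $\|u_0\|_{\dot H^{1/2}}<\epsilon$, and suppose that the decay character $q^\ast=r^\ast(\Lambda^{1/2}u_0)$ exists and satisfies $-\frac32<q^\ast<\infty$. Then, for any mild solution $u$ of the Navier-Stokes equations $$\partial_t u+(u\cdot\nabla)u+\nabla p=\Delta u,\qquad \operatorname{div}u=0,\qquad u(x,0)=u_0(x)\qquad\text{in }\mathbb R^3,$$ we have that for some constant $C=C(\epsilon,q^\ast)$ $$\|u(t)\|_{\dot H^{1/2}}^2\le C(1+t)^{-\min\{\frac32+q^\ast,\,1\}}\qquad\text{for all }t>0.$$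
   Context: $\Lambda=(-\Delta)^{1/2}$ is the Fourier multiplier with symbol $|\xi|$, and $\|f\|_{\dot H^{s}}=\|\Lambda^{s}f\|_{L^2}$ is the homogeneous Sobolev norm. Leray projector: $\mathbb P$ is the Fourier multiplier $\widehat{(\mathbb Pv)}^j(\xi)=\sum_{k=1}^3\left(\delta_{jk}-\frac{\xi_j\xi_k}{|\xi|^2}\right)\widehat{v^k}(\xi)$. Mild solution: a function $u\in L^4([0,\infty);\dot H^1(\mathbb R^3))$ which satisfies, for all $t$, $$u(t)=e^{t\Delta}u_0-\int_0^te^{(t-s)\Delta}\,\mathbb P\,\nabla\cdot(u\otimes u)(s)\,ds.$$ (It is a known fact that for $\|u_0\|_{\dot H^{1/2}}<\epsilon$ with $\epsilon$ small enough there is a unique such $u$, and that it also lies in $C([0,\infty);\dot H^{1/2}(\mathbb R^3))\cap L^2([0,\infty);\dot H^{3/2}(\mathbb R^3))$ and satisfies $\|u(t)\|_{\dot H^{1/2}}<2\epsilon$ for all $t>0$.) Decay character: for $v_0\in L^2(\mathbb R^n)$ (possibly vector-valued) and $r\in(-\frac n2,\infty)$, the decay indicator is $$P_r(v_0)=\lim_{\rho\to0}\rho^{-2r-n}\int_{B(\rho)}|\widehat{v_0}(\xi)|^2\,d\xi,$$ provided the limit exists, where $B(\rho)$ is the ball of radius $\rho$ centred at the origin. The decay character $r^\ast(v_0)$ is the unique $r\in(-\frac n2,\infty)$ with $0<P_r(v_0)<\infty$, provided this number exists; one sets $r^\ast=-\frac n2$ if $P_r(v_0)=\infty$ for all $r\in(-\frac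 n2,\infty)$, and $r^\ast=\infty$ if $P_r(v_0)=0$ for all $r\in(-\frac n2,\infty)$. Here $n=3$ and $v_0=\Lambda^{1/2}u_0\in L^2(\mathbb R^3)$.
   Formalization: The constant C may depend on the datum u_0 (but not on u or t), because a C depending only on ε and q* is impossible: replacing u_0 by λu_0(λx) keeps the norm and q* but rescales time in the solution. *)

theory Defs
  imports "HOL-Analysis.Analysis"
begin

text \<open>
  Functions are considered up to Lebesgue null sets.  A function \<open>f\<close> is identified with the
  tempered distribution \<open>\<phi> \<mapsto> \<integral> f \<phi>\<close>; the Fourier transform is the one of tempered distributions,
  with the convention \<open>exp (- i x \<bullet> \<xi>)\<close>, for those \<open>f\<close> whose transform is again a function.
  For \<open>0 \<le> s < n / 2\<close> (here \<open>s = 1/2\<close> and \<open>s = 1\<close> with \<open>n = 3\<close>) every element of the homogeneous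
  Sobolev space of order \<open>s\<close> is of this kind.
\<close>

fun iterated_partial ::
  "(real^'n) list \<Rightarrow> (real^'n \<Rightarrow> complex) \<Rightarrow> real^'n \<Rightarrow> complex" where
  "iterated_partial [] f = f"
| "iterated_partial (b # bs) f = (\<lambda>x. frechet_derivative (iterated_partial bs f) (at x) b)"

definition schwartz :: "(real^'n \<Rightarrow> complex) \<Rightarrow> bool" where
  "schwartz \<phi> \<longleftrightarrow>
     (\<forall>bs \<in> lists Basis.
        (\<forall>x. iterated_partial bs \<phi> differentiable (at x)) \<and>
        (\<forall>N::nat. \<exists>M. \<forall>x. (1 + norm x) ^ N * norm (iterated_partial bs \<phi> x) \<le> M))"

definition fourier_integral :: "(real^'n \<Rightarrow> complex) \<Rightarrow> real^'n \<Rightarrow> complex" where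
  "fourier_integral \<phi> \<xi> = (LINT x|lebesgue. exp (- \<i> * of_real (x \<bullet> \<xi>)) * \<phi> x)"

definition tempered :: "(real^'n \<Rightarrow> complex) \<Rightarrow> bool" where
  "tempered f \<longleftrightarrow>
     f \<in> borel_measurable lebesgue \<and>
     (\<forall>\<phi>. schwartz \<phi> \<longrightarrow> integrable lebesgue (\<lambda>x. f x * \<phi> x))"

definition has_fourier :: "(real^'n \<Rightarrow> complex) \<Rightarrow> (real^'n \<Rightarrow> complex) \<Rightarrow> bool" where
  "has_fourier f g \<longleftrightarrow>
     tempered f \<and> tempered g \<and>
     (\<forall>\<phi>. schwartz \<phi> \<longrightarrow>
        (LINT x|lebesgue. f x * fourier_integral \<phi> x) = (LINT \<xi>|lebesgue. g \<xi> * \<phi> \<xi>))"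

text \<open>
  Both the transform and its inverse are determined almost everywhere only, so the choice
  operator picks a representative.  It is used below only under integrals, and where
  existence is known.
\<close>

definition fourier :: "(real^'n \<Rightarrow> complex) \<Rightarrow> real^'n \<Rightarrow> complex" where
  "fourier f = (SOME g. has_fourier f g)"

definition fourier_multiplier ::
  "(real^'n \<Rightarrow> complex) \<Rightarrow> (real^'n \<Rightarrow> complex) \<Rightarrow> real^'n \<Rightarrow> complex" where
  "fourier_multiplier m f = (SOME h. has_fourier h (\<lambda>\<xi>. m \<xi> * fourier f \<xi>))"

definition vfourier :: "(real^'n \<Rightarrow> complex^'m) \<Rightarrow> real^'n \<Rightarrow> complex^'m" where
  "vfourier f \<xi> = (\<chi> j. fourier (\<lambda>x. f x $ j) \<xi>)"

definition complexify :: "(real^'n \<Rightarrow> real^'m) \<Rightarrow> real^'n \<Rightarrow> complex^'m" where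
  "complexify u x = (\<chi> j. complex_of_real (u x $ j))"


subsection \<open>Homogeneous Sobolev spaces\<close>

definition Lambda_symbol :: "real \<Rightarrow> real^'n \<Rightarrow> complex" where
  "Lambda_symbol s \<xi> = of_real (norm \<xi> powr s)"

definition Lambda_pow :: "real \<Rightarrow> (real^'n \<Rightarrow> complex^'m) \<Rightarrow> real^'n \<Rightarrow> complex^'m" where
  "Lambda_pow s f x = (\<chi> j. fourier_multiplier (Lambda_symbol s) (\<lambda>y. f y $ j) x)"

definition in_Hdot :: "real \<Rightarrow> (real^'n \<Rightarrow> complex^'m) \<Rightarrow> bool" where
  "in_Hdot s f \<longleftrightarrow>
     (\<forall>j. (\<exists>g. has_fourier (\<lambda>x. f x $ j) g) \<and>
          (\<exists>h. has_fourier h (\<lambda>\<xi>. Lambda_symbol s \<xi> * fourier (\<lambda>x. f x $ j) \<xi>) \<and>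
               integrable lebesgue (\<lambda>x. (norm (h x))\<^sup>2)))"

definition L2norm :: "(real^'n \<Rightarrow> complex^'m) \<Rightarrow> real" where
  "L2norm f = sqrt (LINT x|lebesgue. (norm (f x))\<^sup>2)"

text \<open>Meaningful only for \<open>f\<close> with \<open>in_Hdot s f\<close>.\<close>

definition Hdot_norm :: "real \<Rightarrow> (real^'n \<Rightarrow> complex^'m) \<Rightarrow> real" where
  "Hdot_norm s f = L2norm (Lambda_pow s f)"

text \<open>
  The Bochner space of \<open>p\<close>-integrable functions on the half-line with values in the
  homogeneous Sobolev space of order \<open>s\<close>; strong measurability is approximability almost
  everywhere by simple functions.
\<close>

definition strongly_measurable_Hdot :: "real \<Rightarrow> (real \<Rightarrow> real^'n \<Rightarrow> complex^'m) \<Rightarrow> bool" where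
  "strongly_measurable_Hdot s u \<longleftrightarrow>
     (\<exists>S :: nat \<Rightarrow> real \<Rightarrow> real^'n \<Rightarrow> complex^'m.
        (\<forall>k. simple_function (lebesgue_on {0..}) (S k) \<and> (\<forall>t\<ge>0. in_Hdot s (S k t))) \<and>
        (AE t in lebesgue_on {0..}.
           (\<lambda>k. Hdot_norm s (\<lambda>x. S k t x - u t x)) \<longlonglongrightarrow> 0))"

definition in_Lp_Hdot :: "nat \<Rightarrow> real \<Rightarrow> (real \<Rightarrow> real^'n \<Rightarrow> complex^'m) \<Rightarrow> bool" where
  "in_Lp_Hdot p s u \<longleftrightarrow>
     (AE t in lebesgue_on {0..}. in_Hdot s (u t)) \<and>
     strongly_measurable_Hdot s u \<and>
     integrable (lebesgue_on {0..}) (\<lambda>t. Hdot_norm s (u t) ^ p)"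


subsection \<open>Decay character\<close>

text \<open>
  For square integrable \<open>v\<close>.  The limits are taken in the extended reals, so that the value
  \<open>\<infinity>\<close> of the decay indicator is allowed.
\<close>

definition has_decay_indicator :: "(real^'n \<Rightarrow> complex^'m) \<Rightarrow> real \<Rightarrow> ereal \<Rightarrow> bool" where
  "has_decay_indicator v r P \<longleftrightarrow>
     ((\<lambda>\<rho>. ereal (\<rho> powr (- 2 * r - real CARD('n)) *
                  (LINT \<xi>:ball 0 \<rho>|lebesgue. (norm (vfourier v \<xi>))\<^sup>2))) \<longlongrightarrow> P) (at_right 0)"

definition finite_positive_indicator :: "(real^'n \<Rightarrow> complex^'m) \<Rightarrow> real \<Rightarrow> bool" where
  "finite_positive_indicator v r \<longleftrightarrow> (\<exists>P. has_decay_indicator v r P \<and> 0 < P \<and> P < \<infinity>)"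

definition has_decay_character :: "(real^'n \<Rightarrow> complex^'m) \<Rightarrow> ereal \<Rightarrow> bool" where
  "has_decay_character v q \<longleftrightarrow>
     (\<exists>r > - real CARD('n) / 2. q = ereal r \<and> finite_positive_indicator v r \<and>
        (\<forall>r' > - real CARD('n) / 2. finite_positive_indicator v r' \<longrightarrow> r' = r)) \<or>
     q = ereal (- real CARD('n) / 2) \<and>
        (\<forall>r > - real CARD('n) / 2. has_decay_indicator v r \<infinity>) \<or>
     q = \<infinity> \<and>
        (\<forall>r > - real CARD('n) / 2. has_decay_indicator v r 0)"


subsection \<open>Navier-Stokes equations\<close>

definition weakly_div_free :: "(real^3 \<Rightarrow> real^3) \<Rightarrow> bool" where
  "weakly_div_free u \<longleftrightarrow>
     (\<forall>\<phi>. schwartz \<phi> \<longrightarrow>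
        (LINT x|lebesgue.
           (\<Sum>j\<in>UNIV. of_real (u x $ j) * iterated_partial [axis j 1] \<phi> x)) = 0)"

text \<open>
  The operators below act on Fourier transforms: a space derivative of a function in the
  spaces above need not be a function, but its Fourier transform is.
\<close>

definition heat_hat :: "real \<Rightarrow> (real^3 \<Rightarrow> complex^3) \<Rightarrow> real^3 \<Rightarrow> complex^3" where
  "heat_hat t V \<xi> = (\<chi> j. of_real (exp (- t * (norm \<xi>)\<^sup>2)) * V \<xi> $ j)"

definition leray_hat :: "(real^3 \<Rightarrow> complex^3) \<Rightarrow> real^3 \<Rightarrow> complex^3" where
  "leray_hat V \<xi> =
     (\<chi> j. \<Sum>k\<in>UNIV.
        of_real ((if j = k then 1 else 0) - \<xi> $ j * \<xi> $ k / (norm \<xi>)\<^sup>2) * V \<xi> $ k)"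

definition div_hat :: "(real^3 \<Rightarrow> complex^3^3) \<Rightarrow> real^3 \<Rightarrow> complex^3" where
  "div_hat T \<xi> = (\<chi> k. \<Sum>l\<in>UNIV. \<i> * of_real (\<xi> $ l) * T \<xi> $ k $ l)"

definition tensor_hat :: "(real^3 \<Rightarrow> real^3) \<Rightarrow> real^3 \<Rightarrow> complex^3^3" where
  "tensor_hat u \<xi> = (\<chi> k l. fourier (\<lambda>x. of_real (u x $ k * u x $ l)) \<xi>)"

text \<open>
  Duhamel's formula is an identity of tempered distributions, for every time \<open>t\<close>, with the
  time integral taken in the weak sense.  It is tested on the Fourier side, which is the same
  as testing in physical space because the Fourier transform permutes the Schwartz functions.
\<close>

definition mild_solution ::
  "(real^3 \<Rightarrow> real^3) \<Rightarrow> (real \<Rightarrow> real^3 \<Rightarrow> real^3) \<Rightarrow> bool" where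
  "mild_solution u0 u \<longleftrightarrow>
     in_Lp_Hdot 4 1 (\<lambda>t. complexify (u t)) \<and>
     (\<forall>t\<ge>0. (\<forall>j. \<exists>g. has_fourier (\<lambda>x. complexify (u t) x $ j) g) \<and>
        (\<forall>\<phi> j. schwartz \<phi> \<longrightarrow>
           (let N = (\<lambda>s. LINT \<xi>|lebesgue.
                       heat_hat (t - s) (leray_hat (div_hat (tensor_hat (u s)))) \<xi> $ j * \<phi> \<xi>)
            in set_integrable lebesgue {0..t} N \<and>
               (LINT \<xi>|lebesgue. vfourier (complexify (u t)) \<xi> $ j * \<phi> \<xi>) =
               (LINT \<xi>|lebesgue. heat_hat t (vfourier (complexify u0)) \<xi> $ j * \<phi> \<xi>) -
               (LINT s:{0..t}|lebesgue. N s))))"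

end

theory Submission
  imports Defs "HOL-Probability.Probability" "HOL-Real_Asymp.Real_Asymp"
begin

text \<open>
  On the Fourier side a mild solution satisfies, for \<open>f = |\<xi>|\<^sup>1\<^sup>/\<^sup>2 |u^|\<close>, the scalar inequality
  \<open>f(t) \<le> exp (- (t - \<tau>) |\<xi>|\<^sup>2) f(\<tau>) + \<integral> |\<xi>| exp (- (t - s) |\<xi>|\<^sup>2) D(s) ds\<close> over \<open>[\<tau>, t]\<close>, where \<open>D\<close> is a multiple of
  \<open>|\<xi>|\<^sup>1\<^sup>/\<^sup>2 (|u^| * |u^|)\<close>.  The Cauchy-Schwarz inequality and \<open>\<integral> |\<eta>|\<^sup>-\<^sup>2 |\<xi> - \<eta>|\<^sup>-\<^sup>2 d\<eta> \<le> K / |\<xi>|\<close> bound the square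
  integral of \<open>D(s)\<close> by that of \<open>|\<xi>| |u^(s)|\<close>, squared, and the interpolation of the latter between \<open>Y = \<integral> f\<^sup>2\<close> and
  the dissipation \<open>Z = \<integral> |\<xi>|\<^sup>2 f\<^sup>2\<close> makes the system closed.  Small data keep the total dissipation small.
  Splitting the time integral at \<open>t/2\<close> then yields decay: the late half is absorbed by smallness, and the
  early half is controlled by the integrated dissipation.  This gives the rate of the linear flow up to
  \<open>3/4\<close>; the resulting decay of the dissipation, fed back into the same splitting, improves it up to \<open>1\<close>.
  The linear flow decays like \<open>t\<^sup>-\<^sup>\<theta>\<close> because, by the decay character, the mass of \<open>f(0)\<^sup>2\<close> in the ball of
  radius \<open>\<rho>\<close> is at most of order \<open>\<rho>\<^sup>2\<^sup>\<theta>\<close>.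
\<close>

subsection \<open>A scalar heat inequality\<close>

text \<open>The obstacle is regularity: a mild solution is only given in L^4 in time with values in
  the space of order 1, so neither an energy identity nor continuity in time, nor even finiteness of
  the norm of order 1/2, is at hand. Hence all quantities are \<open>ennreal\<close> integrals of
  moduli of transforms, and Duhamel's formula serves as an inequality that can be restarted at any
  time \<open>\<tau>\<close>. The one finiteness put in is that of the time integral of
  \<open>(E s)^2\<close>; its primitive is continuous and carries the smallness argument. Factors 2
  and 3 from squaring sums are accepted, so norms are only compared from both sides. The
  intermediate rate 3/4 could be any number strictly between 1/2 and 1. Below 1, the integral of
  \<open>(1 + s) powr - b\<close> over \<open>[0, t]\<close> is of order
  \<open>t * (1 + t) powr - b\<close> without a logarithm; above 1/2, the dissipation it yields can
  pay for an integrable weight. Exchanging integrals in time and frequency needs a jointly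
  measurable transform of \<open>u\<close>. It comes from the simple functions of the Bochner space
  at almost every time, and then from Duhamel's formula at every time.\<close>

abbreviation nn_integral_lborel :: "('a::euclidean_space \<Rightarrow> ennreal) \<Rightarrow> ennreal" (binder "NNI " 10) where
  "nn_integral_lborel f \<equiv> \<integral>\<^sup>+x. f x \<partial>lborel"

abbreviation ennorm2 :: "'a::real_normed_vector \<Rightarrow> ennreal" where
  "ennorm2 x \<equiv> ennreal ((norm x)^2)"

text \<open>Half of \<open>Q\<close> may be moved to the left only because \<open>Q\<close> is
  finite; each use below first secures that finiteness. A negative \<open>d\<close> is harmless, as
  \<open>ennreal d\<close> is then 0.\<close>

lemma ennreal_absorb:
  fixes Q :: ennreal
  assumes "Q \<le> c + ennreal d * Q" "Q < \<infinity>" "d \<le> 1/2"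
  shows "Q \<le> 2 * c"
proof (cases c)
  case (real c')
  obtain q where q: "Q = ennreal q" "q \<ge> 0"
    using assms(2) by (cases Q) auto
  show ?thesis
  proof (cases "d \<ge> 0")
    case True
    have "ennreal q \<le> ennreal (c' + d * q)"
      using assms(1) q real True by (simp add: ennreal_mult)
    hence "q \<le> c' + d * q" using q True real by (subst (asm) ennreal_le_iff) auto
    moreover have "d * q \<le> (1/2) * q"
      using assms(3) q by (intro mult_right_mono) auto
    ultimately have "q \<le> 2 * c'" by linarith
    thus ?thesis using q real by (metis ennreal_leI ennreal_mult ennreal_numeral zero_le_numeral)
  next
    case False
    hence "Q \<le> c" using assms(1) by (simp add: ennreal_neg)
    also have "c \<le> 2 * c" by (metis add.right_neutral add_left_mono mult_2 zero_le)
    finally show ?thesis .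
  qed
qed (simp add: ennreal_mult_top)

lemma ennreal_sum2_sq: "((a::ennreal) + b)^2 \<le> 2 * a^2 + 2 * b^2"
proof (cases "a = \<infinity> \<or> b = \<infinity>")
  case True thus ?thesis by (auto simp: power2_eq_square ennreal_mult_top ennreal_top_mult)
next
  case False
  then obtain x y where xy: "a = ennreal x" "b = ennreal y" "x \<ge> 0" "y \<ge> 0"
    by (metis ennreal_cases infinity_ennreal_def)
  have "(x + y)^2 \<le> 2 * x^2 + 2 * y^2"
    using sum_squares_ge_zero[of "x - y" 0] by (simp add: power2_eq_square algebra_simps)
  hence "ennreal ((x + y)^2) \<le> ennreal (2 * x^2 + 2 * y^2)" by (rule ennreal_leI)
  moreover have "(a + b)^2 = ennreal ((x + y)^2)"
    using xy by (simp add: ennreal_power flip: ennreal_plus)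
  ultimately show ?thesis using xy by (simp add: ennreal_power ennreal_mult)
qed

lemma ennreal_sum3_sq: "((a::ennreal) + b + c)^2 \<le> 3 * a^2 + 3 * b^2 + 3 * c^2"
proof (cases "a = \<infinity> \<or> b = \<infinity> \<or> c = \<infinity>")
  case True thus ?thesis by (auto simp: power2_eq_square ennreal_mult_top ennreal_top_mult)
next
  case False
  then obtain x y z where xy: "a = ennreal x" "b = ennreal y" "c = ennreal z" "x \<ge> 0" "y \<ge> 0" "z \<ge> 0"
    by (metis ennreal_cases infinity_ennreal_def)
  have "(x + y + z)^2 \<le> 3 * x^2 + 3 * y^2 + 3 * z^2"
    using zero_le_power2[of "x - y"] zero_le_power2[of "x - z"] zero_le_power2[of "y - z"]
    by (simp add: power2_eq_square algebra_simps)
  hence "ennreal ((x + y + z)^2) \<le> ennreal (3 * x^2 + 3 * y^2 + 3 * z^2)" by (rule ennreal_leI)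
  moreover have "(a + b + c)^2 = ennreal ((x + y + z)^2)"
    using xy by (simp add: ennreal_power flip: ennreal_plus)
  ultimately show ?thesis using xy by (simp add: ennreal_power ennreal_mult)
qed

text \<open>With \<open>nn_integral_exp_kernel_right\<close>, these are the two bounds of Schur's
  test for the heat kernel in time. With \<open>c\<close> the square of the frequency they are
  uniform in the frequency.\<close>

lemma nn_integral_exp_kernel_left:
  assumes "c \<ge> 0"
  shows "(NNI s. ennreal (c * exp (- (t - s) * c)) * indicator {a..t} s) \<le> 1"
proof (cases "a \<le> t")
  case True
  have "(NNI s. ennreal (c * exp (- (t - s) * c)) * indicator {a..t} s)
    = ennreal (exp (- (t - t) * c) - exp (- (t - a) * c))"
    using assms True
    by (intro nn_integral_FTC_Icc) (auto intro!: derivative_eq_intros)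
  also have "\<dots> \<le> ennreal 1" by (intro ennreal_leI) simp
  finally show ?thesis by simp
qed (simp)

lemma nn_integral_exp_kernel_right:
  assumes "c \<ge> 0"
  shows "(NNI t. ennreal (c * exp (- (t - s) * c)) * indicator {s..b} t) \<le> 1"
proof (cases "s \<le> b")
  case True
  have "(NNI t. ennreal (c * exp (- (t - s) * c)) * indicator {s..b} t)
    = ennreal ((- exp (- (b - s) * c)) - (- exp (- (s - s) * c)))"
    using assms True
    by (intro nn_integral_FTC_Icc) (auto intro!: derivative_eq_intros)
  also have "\<dots> \<le> ennreal 1" by (intro ennreal_leI) simp
  finally show ?thesis by simp
qed (simp)

lemma nn_integral_powr_Icc:
  assumes "p > -1" "t \<ge> 0"
  shows "(NNI s. ennreal ((1 + s) powr p) * indicator {0..t} s)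
     = ennreal (((1 + t) powr (p + 1) - 1) / (p + 1))"
proof -
  have "(NNI s. ennreal ((1 + s) powr p) * indicator {0..t} s)
     = ennreal ((1 + t) powr (p + 1) / (p + 1) - (1 + 0) powr (p + 1) / (p + 1))"
    using assms by (intro nn_integral_FTC_Icc) (auto intro!: derivative_eq_intros)
  thus ?thesis by (simp add: diff_divide_distrib)
qed

lemma nn_integral_powr_Ici:
  assumes "p < -1"
  shows "(NNI s. ennreal ((1 + s) powr p) * indicator {0..} s) = ennreal (- 1 / (p + 1))"
proof -
  have "((\<lambda>s::real. (1 + s) powr (p + 1) / (p + 1)) \<longlongrightarrow> 0) at_top"
    using assms by real_asymp
  hence "(NNI s. ennreal ((1 + s) powr p) * indicator {0..} s)
     = ennreal (0 - (1 + 0) powr (p + 1) / (p + 1))"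
    using assms by (intro nn_integral_FTC_atLeast) (auto intro!: derivative_eq_intros)
  thus ?thesis by (simp)
qed

lemma nn_integral_Ici_le:
  fixes g :: "real \<Rightarrow> ennreal"
  assumes [measurable]: "g \<in> borel_measurable borel"
    and le: "\<And>b. (NNI t. g t * indicator {a..b} t) \<le> c"
  shows "(NNI t. g t * indicator {a..} t) \<le> c"
proof -
  have "(NNI t. g t * indicator {a..} t) = (NNI t. (SUP n::nat. g t * indicator {a..real n} t))"
  proof (rule nn_integral_cong)
    fix t :: real
    obtain m :: nat where "t \<le> real m" using real_arch_simple by blast
    thus "g t * indicator {a..} t = (SUP n::nat. g t * indicator {a..real n} t)"
      by (intro antisym SUP_upper2[of m] SUP_least) (auto split: split_indicator)
  qed
  also have "\<dots> = (SUP n::nat. (NNI t. g t * indicator {a..real n} t))"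
    by (intro nn_integral_monotone_convergence_SUP) 
       (auto simp: incseq_def le_fun_def split: split_indicator)
  also have "\<dots> \<le> c" by (intro SUP_least le)
  finally show ?thesis .
qed

text \<open>Here \<open>r\<close> stands for the modulus of the frequency, \<open>f\<close> for its square root times the modulus of the
  transformed solution, and \<open>D\<close> for its square root times the convolution of that modulus with itself.\<close>

locale heat_inequality = sigma_finite_measure M for M :: "'a measure" +
  fixes r :: "'a \<Rightarrow> real" and f D :: "real \<Rightarrow> 'a \<Rightarrow> ennreal" and K :: real
  assumes r_measurable [measurable]: "r \<in> borel_measurable M"
    and r_nonneg [simp]: "r x \<ge> 0"
    and f_measurable: "case_prod f \<in> borel_measurable (borel \<Otimes>\<^sub>M M)"
    and D_measurable: "case_prod D \<in> borel_measurable (borel \<Otimes>\<^sub>M M)"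
    and duhamel: "0 \<le> \<tau> \<Longrightarrow> \<tau> \<le> t \<Longrightarrow>
      AE x in M. f t x \<le> ennreal (exp (- (t - \<tau>) * (r x)^2)) * f \<tau> x +
        (NNI s. ennreal (r x * exp (- (t - s) * (r x)^2)) * D s x * indicator {\<tau>..t} s)"
    and D_bound: "AE s in lborel. 0 \<le> s \<longrightarrow>
      (\<integral>\<^sup>+x. (D s x)^2 \<partial>M) \<le> ennreal K * (\<integral>\<^sup>+x. ennreal (r x) * (f s x)^2 \<partial>M)^2"
    and E_finite: "(NNI s. (\<integral>\<^sup>+x. ennreal (r x) * (f s x)^2 \<partial>M)^2 * indicator {0..} s) < \<infinity>"
    and K_nonneg [simp]: "K \<ge> 0"
begin

abbreviation nn_integral_M :: "('a \<Rightarrow> ennreal) \<Rightarrow> ennreal" (binder "NNM " 10) where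
  "nn_integral_M g \<equiv> \<integral>\<^sup>+x. g x \<partial>M"

lemma f_measurable2 [measurable (raw)]:
  assumes [measurable]: "g \<in> borel_measurable N" "h \<in> measurable N M"
  shows "(\<lambda>y. f (g y) (h y)) \<in> borel_measurable N"
  using measurable_compose[OF measurable_Pair[OF assms] f_measurable] by simp

lemma D_measurable2 [measurable (raw)]:
  assumes [measurable]: "g \<in> borel_measurable N" "h \<in> measurable N M"
  shows "(\<lambda>y. D (g y) (h y)) \<in> borel_measurable N"
  using measurable_compose[OF measurable_Pair[OF assms] D_measurable] by simp

text \<open>With the reading of \<open>f\<close> given above, \<open>Y\<close>, \<open>E\<close> and
  \<open>Z\<close> are up to equivalence the squares of the homogeneous norms of order 1/2, 1 and
  3/2, since each power of \<open>r\<close> in the weight raises the order by 1/2.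
  \<open>B a t\<close> is the Duhamel integral over \<open>[a, t]\<close>.\<close>

definition Y :: "real \<Rightarrow> ennreal" where "Y t = (NNM x. (f t x)^2)"
definition Z :: "real \<Rightarrow> ennreal" where "Z t = (NNM x. ennreal ((r x)^2) * (f t x)^2)"
definition E :: "real \<Rightarrow> ennreal" where "E t = (NNM x. ennreal (r x) * (f t x)^2)"
definition DD :: "real \<Rightarrow> ennreal" where "DD t = (NNM x. (D t x)^2)"
definition B :: "real \<Rightarrow> real \<Rightarrow> 'a \<Rightarrow> ennreal" where
  "B a t x = (NNI s. ennreal (r x * exp (- (t - s) * (r x)^2)) * D s x * indicator {a..t} s)"

lemma YZE_measurable [measurable]:
  "Y \<in> borel_measurable borel" "Z \<in> borel_measurable borel"
  "E \<in> borel_measurable borel" "DD \<in> borel_measurable borel"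
  unfolding Y_def[abs_def] Z_def[abs_def] E_def[abs_def] DD_def[abs_def] by measurable

lemma tonelli:
  assumes "case_prod h \<in> borel_measurable (borel \<Otimes>\<^sub>M M)"
  shows "(NNM x. (NNI s. h s x)) = (NNI s. (NNM x. h s x))"
proof -
  interpret P: pair_sigma_finite lborel M
    by (intro pair_sigma_finite.intro lborel.sigma_finite_measure_axioms sigma_finite_measure_axioms)
  show ?thesis
    using assms by (intro P.Fubini') (simp cong: measurable_cong_sets sets_pair_measure_cong)
qed

lemma B_measurable2 [measurable (raw)]:
  assumes [measurable]: "g \<in> borel_measurable N" "h \<in> measurable N M"
  shows "(\<lambda>y. B a (g y) (h y)) \<in> borel_measurable N"
proof -
  have [measurable]: "(\<lambda>p. ennreal (r (h (fst p)) * exp (- (g (fst p) - snd p) * (r (h (fst p)))^2)) 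
     * D (snd p) (h (fst p)) * (if a \<le> snd p \<and> snd p \<le> g (fst p) then 1 else 0)) \<in> borel_measurable (N \<Otimes>\<^sub>M lborel)"
    by measurable
  have "B a (g y) (h y) = (NNI s. (\<lambda>p. ennreal (r (h (fst p)) * exp (- (g (fst p) - snd p) * (r (h (fst p)))^2)) 
     * D (snd p) (h (fst p)) * (if a \<le> snd p \<and> snd p \<le> g (fst p) then 1 else 0)) (y, s))" for y
    unfolding B_def by (intro nn_integral_cong) (auto split: split_indicator)
  thus ?thesis by (simp only:) (intro lborel.borel_measurable_nn_integral, simp add: case_prod_unfold)
qed

lemma E_sq_le: "(E t)^2 \<le> Y t * Z t"
proof -
  have "(NNM x. f t x * (ennreal (r x) * f t x))^2 \<le> (NNM x. (f t x)^2) * (NNM x. (ennreal (r x) * f t x)^2)"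
    by (rule Cauchy_Schwarz_nn_integral) measurable
  thus ?thesis
    by (simp add: E_def Y_def Z_def power2_eq_square ac_simps ennreal_mult)
qed

text \<open>The factor \<open>r x\<close> makes the kernel square integrable in time with norm at
  most 1: a number in [0, 1] dominates its square, so the squared kernel lies below the one of
  \<open>nn_integral_exp_kernel_left\<close>. The Cauchy-Schwarz inequality then leaves
  \<open>D\<close> alone.\<close>

lemma B_sq_le:
  assumes "x \<in> space M"
  shows "(B a t x)^2 \<le> (NNI s. (D s x)^2 * indicator {a..t} s)"
proof -
  note [measurable] = assms
  have "(B a t x)^2 = (NNI s. (ennreal (r x * exp (- (t - s) * (r x)^2)) * indicator {a..t} s) * (D s x * indicator {a..t} s))^2"
    unfolding B_def by (intro arg_cong[where f="\<lambda>z. z^2"] nn_integral_cong) (auto split: split_indicator)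
  also have "\<dots> \<le> (NNI s. (ennreal (r x * exp (- (t - s) * (r x)^2)) * indicator {a..t} s)^2) 
      * (NNI s. (D s x * indicator {a..t} s)^2)"
    by (rule Cauchy_Schwarz_nn_integral) measurable
  also have "(NNI s. (ennreal (r x * exp (- (t - s) * (r x)^2)) * indicator {a..t} s)^2)
     \<le> (NNI s. ennreal ((r x)^2 * exp (- (t - s) * (r x)^2)) * indicator {a..t} s)"
  proof (intro nn_integral_mono)
    fix s
    have "(r x * exp (- (t - s) * (r x)^2))^2 \<le> (r x)^2 * exp (- (t - s) * (r x)^2)" if "s \<le> t"
    proof -
      have "- (t - s) * (r x)^2 \<le> 0" using that by (intro mult_nonpos_nonneg) auto
      hence "exp (- (t - s) * (r x)^2) \<le> 1" by simp
      hence "(exp (- (t - s) * (r x)^2))^2 \<le> exp (- (t - s) * (r x)^2)"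
        by (simp add: power2_eq_square del: exp_le_one_iff)
      thus ?thesis unfolding power_mult_distrib by (intro mult_left_mono) auto
    qed
    thus "(ennreal (r x * exp (- (t - s) * (r x)^2)) * indicator {a..t} s)^2
       \<le> ennreal ((r x)^2 * exp (- (t - s) * (r x)^2)) * indicator {a..t} s"
      by (auto split: split_indicator simp: ennreal_power intro!: ennreal_leI)
  qed
  also have "\<dots> \<le> 1" by (rule nn_integral_exp_kernel_left) simp
  finally have "(B a t x)^2 \<le> (NNI s. (D s x * indicator {a..t} s)^2)"
    by (simp add: mult_right_mono)
  also have "\<dots> = (NNI s. (D s x)^2 * indicator {a..t} s)"
    by (intro nn_integral_cong) (auto split: split_indicator)
  finally show ?thesis .
qed

lemma nn_integral_B_sq: "(NNM x. (B a t x)^2) \<le> (NNI s. DD s * indicator {a..t} s)"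
proof -
  have "(NNM x. (B a t x)^2) \<le> (NNM x. (NNI s. (D s x)^2 * indicator {a..t} s))"
    by (intro nn_integral_mono B_sq_le)
  also have "\<dots> = (NNI s. (NNM x. (D s x)^2 * indicator {a..t} s))"
    by (rule tonelli) measurable
  also have "\<dots> = (NNI s. DD s * indicator {a..t} s)"
    by (simp add: DD_def nn_integral_multc)
  finally show ?thesis .
qed

text \<open>Here part of the kernel must stay with \<open>D\<close>, because the bound is integrated
  over \<open>t\<close> afterwards. Hence the split into two copies of the square root
  \<open>k\<close>, each carrying one factor \<open>r x\<close>, with only one of them spent in the
  Cauchy-Schwarz inequality.\<close>

lemma r_sq_B_sq_le:
  assumes "x \<in> space M"
  shows "ennreal ((r x)^2) * (B a t x)^2
    \<le> (NNI s. ennreal ((r x)^2 * exp (- (t - s) * (r x)^2)) * (D s x)^2 * indicator {a..t} s)"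
proof -
  note [measurable] = assms
  define k where "k = (\<lambda>s. ennreal (r x * exp (- (t - s) * (r x)^2 / 2)) * indicator {a..t} s)"
  have [measurable]: "k \<in> borel_measurable borel" unfolding k_def by measurable
  have k2: "(k s)^2 = ennreal ((r x)^2 * exp (- (t - s) * (r x)^2)) * indicator {a..t} s" for s
  proof -
    have "(r x * exp (- (t - s) * (r x)^2 / 2))^2 = (r x)^2 * exp (- (t - s) * (r x)^2)"
      unfolding power_mult_distrib exp_double[symmetric] by simp
    thus ?thesis by (auto simp: k_def ennreal_power split: split_indicator)
  qed
  have "ennreal ((r x)^2) * (B a t x)^2 = (ennreal (r x) * B a t x)^2"
    by (simp add: power_mult_distrib ennreal_power)
  also have "ennreal (r x) * B a t x = (NNI s. k s * (k s * D s x))"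
  proof -
    have "ennreal (r x) * B a t x = (NNI s. ennreal (r x) * (ennreal (r x * exp (- (t - s) * (r x)^2)) * D s x * indicator {a..t} s))"
      unfolding B_def by (rule nn_integral_cmult[symmetric]) measurable
    also have "\<dots> = (NNI s. k s * (k s * D s x))"
    proof (rule nn_integral_cong)
      fix s
      have "ennreal (r x) * (ennreal (r x * exp (- (t - s) * (r x)^2)) * D s x * indicator {a..t} s)
        = (ennreal (r x * (r x * exp (- (t - s) * (r x)^2))) * indicator {a..t} s) * D s x"
        by (subst ennreal_mult) (simp_all add: mult.assoc mult.commute mult.left_commute del: ennreal_mult)
      also have "\<dots> = k s * k s * D s x"
        using k2[of s] by (simp only: power2_eq_square mult.assoc)
      finally show "ennreal (r x) * (ennreal (r x * exp (- (t - s) * (r x)^2)) * D s x * indicator {a..t} s) = k s * (k s * D s x)"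
        by (simp only: mult.assoc)
    qed
    finally show ?thesis .
  qed
  also have "(NNI s. k s * (k s * D s x))^2 \<le> (NNI s. (k s)^2) * (NNI s. (k s * D s x)^2)"
    by (rule Cauchy_Schwarz_nn_integral) measurable
  also have "(NNI s. (k s)^2) \<le> 1"
    unfolding k2 by (rule nn_integral_exp_kernel_left) simp
  finally have "ennreal ((r x)^2) * (B a t x)^2 \<le> (NNI s. (k s * D s x)^2)"
    by (simp add: mult_right_mono)
  also have "\<dots> = (NNI s. ennreal ((r x)^2 * exp (- (t - s) * (r x)^2)) * (D s x)^2 * indicator {a..t} s)"
    by (intro nn_integral_cong) (auto simp: power_mult_distrib k2 split: split_indicator)
  finally show ?thesis .
qed

text \<open>Maximal regularity in the square mean: half of the kernel was spent pointwise in
  \<open>r_sq_B_sq_le\<close>, the other half is integrated out in \<open>t\<close> after the two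
  time integrals are exchanged.\<close>

lemma nn_integral_r_sq_B_sq:
  "(NNI t. (NNM x. ennreal ((r x)^2) * (B a t x)^2) * indicator {a..b} t)
     \<le> (NNI s. DD s * indicator {a..b} s)"
proof -
  \<comment> \<open>One function with the triangle \<open>a \<le> s \<le> t \<le> b\<close> built
    in, so that the exchange of \<open>s\<close> and \<open>t\<close> needs no change of
    limits.\<close>
  let ?g = "\<lambda>x t s. ennreal ((r x)^2 * exp (- (t - s) * (r x)^2)) * (D s x)^2 * (if a \<le> s \<and> s \<le> t \<and> t \<le> b then 1 else 0)"
  have "(NNI t. (NNM x. ennreal ((r x)^2) * (B a t x)^2) * indicator {a..b} t)
    = (NNI t. (NNM x. ennreal ((r x)^2) * (B a t x)^2 * indicator {a..b} t))"
    by (intro nn_integral_cong) (auto split: split_indicator)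
  also have "\<dots> = (NNM x. (NNI t. ennreal ((r x)^2) * (B a t x)^2 * indicator {a..b} t))"
    by (rule tonelli[symmetric]) measurable
  also have "\<dots> \<le> (NNM x. (NNI t. (NNI s. ?g x t s)))"
  proof (intro nn_integral_mono)
    fix x t assume x: "x \<in> space M"
    show "ennreal ((r x)^2) * (B a t x)^2 * indicator {a..b} t \<le> (NNI s. ?g x t s)"
    proof (cases "t \<in> {a..b}")
      case True
      hence "(NNI s. ?g x t s) = (NNI s. ennreal ((r x)^2 * exp (- (t - s) * (r x)^2)) * (D s x)^2 * indicator {a..t} s)"
        by (intro nn_integral_cong) (auto split: split_indicator)
      thus ?thesis using r_sq_B_sq_le[OF x, of a t] True by simp
    qed auto
  qed
  also have "\<dots> = (NNM x. (NNI s. (NNI t. ?g x t s)))"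
  proof (rule nn_integral_cong)
    fix x assume [measurable]: "x \<in> space M"
    show "(NNI t. (NNI s. ?g x t s)) = (NNI s. (NNI t. ?g x t s))"
      by (rule lborel_pair.Fubini') measurable
  qed
  also have "\<dots> \<le> (NNM x. (NNI s. (D s x)^2 * indicator {a..b} s))"
  proof (intro nn_integral_mono)
    fix x s assume x: "x \<in> space M"
    show "(NNI t. ?g x t s) \<le> (D s x)^2 * indicator {a..b} s"
    proof (cases "s \<in> {a..b}")
      case True
      hence "(NNI t. ?g x t s) = (NNI t. (D s x)^2 * (ennreal ((r x)^2 * exp (- (t - s) * (r x)^2)) * indicator {s..b} t))"
        by (intro nn_integral_cong) (auto split: split_indicator simp: ac_simps)
      also have "\<dots> = (D s x)^2 * (NNI t. (ennreal ((r x)^2 * exp (- (t - s) * (r x)^2)) * indicator {s..b} t))"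
        by (rule nn_integral_cmult) measurable
      also have "\<dots> \<le> (D s x)^2 * 1"
        by (intro mult_left_mono nn_integral_exp_kernel_right) auto
      finally show ?thesis using True by simp
    next
      case False
      hence "(NNI t. ?g x t s) = (\<integral>\<^sup>+t. 0 \<partial>(lborel :: real measure))"
        by (intro nn_integral_cong) auto
      thus ?thesis by simp
    qed
  qed
  also have "\<dots> = (NNI s. (NNM x. (D s x)^2 * indicator {a..b} s))"
    by (rule tonelli) measurable
  also have "\<dots> = (NNI s. DD s * indicator {a..b} s)"
    by (simp add: DD_def nn_integral_multc)
  finally show ?thesis .
qed

lemma duhamel_B:
  assumes "0 \<le> \<tau>" "\<tau> \<le> t"
  shows "AE x in M. f t x \<le> ennreal (exp (- (t - \<tau>) * (r x)^2)) * f \<tau> x + B \<tau> t x"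
  using duhamel[OF assms] unfolding B_def .

text \<open>Together with \<open>nn_integral_Z_le\<close> a substitute for the energy inequality,
  starting at an arbitrary time; the factors 2 come from squaring a sum of two terms.\<close>

lemma Y_le:
  assumes "0 \<le> \<tau>" "\<tau> \<le> t"
  shows "Y t \<le> 2 * Y \<tau> + 2 * (NNI s. DD s * indicator {\<tau>..t} s)"
proof -
  have "Y t \<le> (NNM x. 2 * (f \<tau> x)^2 + 2 * (B \<tau> t x)^2)"
    unfolding Y_def
  proof (rule nn_integral_mono_AE, use duhamel_B[OF assms] in eventually_elim)
    fix x assume *: "f t x \<le> ennreal (exp (- (t - \<tau>) * (r x)^2)) * f \<tau> x + B \<tau> t x"
    have "ennreal (exp (- (t - \<tau>) * (r x)^2)) \<le> 1"
      using assms by (simp add: ennreal_le_1 mult_nonpos_nonneg)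
    hence "ennreal (exp (- (t - \<tau>) * (r x)^2)) * f \<tau> x \<le> 1 * f \<tau> x"
      by (rule mult_right_mono) simp
    hence "ennreal (exp (- (t - \<tau>) * (r x)^2)) * f \<tau> x + B \<tau> t x \<le> f \<tau> x + B \<tau> t x"
      by (intro add_right_mono) simp
    with * have "f t x \<le> f \<tau> x + B \<tau> t x" by (rule order_trans)
    hence "(f t x)^2 \<le> (f \<tau> x + B \<tau> t x)^2" by (intro power_mono) auto
    thus "(f t x)^2 \<le> 2 * (f \<tau> x)^2 + 2 * (B \<tau> t x)^2"
      using ennreal_sum2_sq by (rule order_trans)
  qed
  also have "\<dots> = 2 * Y \<tau> + 2 * (NNM x. (B \<tau> t x)^2)"
    by (simp add: Y_def nn_integral_add nn_integral_cmult)
  also have "\<dots> \<le> 2 * Y \<tau> + 2 * (NNI s. DD s * indicator {\<tau>..t} s)"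
    by (intro add_left_mono mult_left_mono nn_integral_B_sq) auto
  finally show ?thesis .
qed

text \<open>For the linear part, integrating the heat factor over time costs exactly the weight
  \<open>(r x)^2\<close> by which \<open>Z\<close> exceeds \<open>Y\<close>; for the Duhamel part
  the same gain is maximal regularity.\<close>

lemma nn_integral_Z_le:
  assumes "0 \<le> \<tau>"
  shows "(NNI t. Z t * indicator {\<tau>..b} t) \<le> 2 * Y \<tau> + 2 * (NNI s. DD s * indicator {\<tau>..b} s)"
proof -
  let ?L = "\<lambda>t x. ennreal ((r x)^2 * exp (- (t - \<tau>) * (r x)^2)) * (f \<tau> x)^2"
  let ?N = "\<lambda>t x. ennreal ((r x)^2) * (B \<tau> t x)^2"
  have "(NNI t. Z t * indicator {\<tau>..b} t) \<le> 
     (NNI t. (2 * (NNM x. ?L t x) + 2 * (NNM x. ?N t x)) * indicator {\<tau>..b} t)"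
  proof (intro nn_integral_mono)
    fix t
    show "Z t * indicator {\<tau>..b} t \<le> (2 * (NNM x. ?L t x) + 2 * (NNM x. ?N t x)) * indicator {\<tau>..b} t"
    proof (cases "t \<in> {\<tau>..b}")
      case True
      hence t: "\<tau> \<le> t" by simp
      have "Z t \<le> (NNM x. 2 * ?L t x + 2 * ?N t x)"
        unfolding Z_def
      proof (rule nn_integral_mono_AE, use duhamel_B[OF assms t] in eventually_elim)
        fix x 
        let ?e = "exp (- (t - \<tau>) * (r x)^2)"
        assume *: "f t x \<le> ennreal ?e * f \<tau> x + B \<tau> t x"
        hence "(f t x)^2 \<le> (ennreal ?e * f \<tau> x + B \<tau> t x)^2" by (intro power_mono) auto
        also have "\<dots> \<le> 2 * (ennreal ?e * f \<tau> x)^2 + 2 * (B \<tau> t x)^2" by (rule ennreal_sum2_sq)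
        also have "\<dots> \<le> 2 * (ennreal ?e * (f \<tau> x)^2) + 2 * (B \<tau> t x)^2"
        proof (intro add_right_mono mult_left_mono)
          have "?e^2 \<le> ?e" using t by (simp add: power2_eq_square mult_nonpos_nonneg)
          hence "ennreal (?e^2) \<le> ennreal ?e" by (rule ennreal_leI)
          thus "(ennreal ?e * f \<tau> x)^2 \<le> ennreal ?e * (f \<tau> x)^2"
            by (simp only: power_mult_distrib) (intro mult_right_mono, simp_all add: ennreal_power)
        qed simp
        finally have "ennreal ((r x)^2) * (f t x)^2 \<le> ennreal ((r x)^2) * (2 * (ennreal ?e * (f \<tau> x)^2) + 2 * (B \<tau> t x)^2)"
          by (intro mult_left_mono) auto
        thus "ennreal ((r x)^2) * (f t x)^2 \<le> 2 * ?L t x + 2 * ?N t x"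
          by (simp add: distrib_left ennreal_mult ac_simps)
      qed
      also have "\<dots> = 2 * (NNM x. ?L t x) + 2 * (NNM x. ?N t x)"
        by (simp add: nn_integral_add nn_integral_cmult)
      finally show ?thesis using True by simp
    qed simp
  qed
  also have "\<dots> = 2 * (NNI t. (NNM x. ?L t x) * indicator {\<tau>..b} t) + 2 * (NNI t. (NNM x. ?N t x) * indicator {\<tau>..b} t)"
    by (simp add: distrib_right nn_integral_add nn_integral_cmult mult.assoc)
  also have "(NNI t. (NNM x. ?L t x) * indicator {\<tau>..b} t) = (NNI t. (NNM x. ?L t x * indicator {\<tau>..b} t))"
    by (intro nn_integral_cong) (auto split: split_indicator)
  also have "\<dots> = (NNM x. (NNI t. ?L t x * indicator {\<tau>..b} t))"
    by (rule tonelli[symmetric]) measurable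
  also have "\<dots> \<le> (NNM x. (f \<tau> x)^2)"
  proof (intro nn_integral_mono)
    fix x assume [measurable]: "x \<in> space M"
    have "(NNI t. ?L t x * indicator {\<tau>..b} t) = (NNI t. (f \<tau> x)^2 * (ennreal ((r x)^2 * exp (- (t - \<tau>) * (r x)^2)) * indicator {\<tau>..b} t))"
      by (simp add: ac_simps)
    also have "\<dots> = (f \<tau> x)^2 * (NNI t. (ennreal ((r x)^2 * exp (- (t - \<tau>) * (r x)^2)) * indicator {\<tau>..b} t))"
      by (rule nn_integral_cmult) measurable
    also have "\<dots> \<le> (f \<tau> x)^2 * 1"
      by (intro mult_left_mono nn_integral_exp_kernel_right) auto
    finally show "(NNI t. ?L t x * indicator {\<tau>..b} t) \<le> (f \<tau> x)^2" by simp
  qed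
  also have "(NNM x. (f \<tau> x)^2) = Y \<tau>" by (simp add: Y_def)
  also have "2 * Y \<tau> + 2 * (NNI t. (NNM x. ?N t x) * indicator {\<tau>..b} t) \<le> 2 * Y \<tau> + 2 * (NNI s. DD s * indicator {\<tau>..b} s)"
    by (intro add_left_mono mult_left_mono nn_integral_r_sq_B_sq) auto
  finally show ?thesis by (simp add: mult_left_mono)
qed

lemma DD_le: "AE s in lborel. 0 \<le> s \<longrightarrow> DD s \<le> ennreal K * (E s)^2"
  using D_bound by (simp add: DD_def E_def)

lemma nn_integral_DD_le:
  assumes "0 \<le> a"
  shows "(NNI s. DD s * indicator {a..b} s) \<le> ennreal K * (NNI s. (E s)^2 * indicator {a..b} s)"
proof -
  have "(NNI s. DD s * indicator {a..b} s) \<le> (NNI s. ennreal K * ((E s)^2 * indicator {a..b} s))"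
    by (rule nn_integral_mono_AE, use DD_le in eventually_elim)
       (use assms in \<open>auto split: split_indicator simp: mult_left_mono\<close>)
  thus ?thesis by (simp add: nn_integral_cmult)
qed

end

section \<open>Smallness by a continuity argument\<close>

context heat_inequality
begin

text \<open>The quantity whose finiteness is assumed, as a function of the end time. As the
  primitive of an integrable function it is continuous, which a continuity argument requires and
  which \<open>Y\<close> need not be.\<close>

definition X :: "real \<Rightarrow> ennreal" where "X T = (NNI s. (E s)^2 * indicator {0..T} s)"

lemma X_finite: "X T < \<infinity>"
proof -
  have "X T \<le> (NNI s. (E s)^2 * indicator {0..} s)"
    unfolding X_def by (intro nn_integral_mono) (auto split: split_indicator)
  thus ?thesis using E_finite by (auto simp: E_def intro: le_less_trans)
qed

lemma X_mono: "s \<le> t \<Longrightarrow> X s \<le> X t"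
  unfolding X_def by (intro nn_integral_mono) (auto split: split_indicator)

lemma Y_X_le:
  assumes "Y 0 \<le> ennreal a" "X T \<le> ennreal x" "a \<ge> 0" "x \<ge> 0" "0 \<le> t" "t \<le> T"
  shows "Y t \<le> ennreal (2 * a + 2 * K * x)"
    and "(NNI t. Z t * indicator {0..T} t) \<le> ennreal (2 * a + 2 * K * x)"
proof -
  have *: "2 * Y 0 + 2 * (NNI s. DD s * indicator {0..t} s) \<le> ennreal (2 * a + 2 * K * x)"
    if "0 \<le> t" "t \<le> T" for t
  proof -
    have "2 * Y 0 + 2 * (NNI s. DD s * indicator {0..t} s) \<le> 2 * ennreal a + 2 * (ennreal K * X t)"
      unfolding X_def using assms(1) by (intro add_mono mult_left_mono nn_integral_DD_le) auto
    also have "\<dots> \<le> 2 * ennreal a + 2 * (ennreal K * ennreal x)"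
      using X_mono[OF that(2)] assms(2) by (intro add_left_mono mult_left_mono) auto
    also have "\<dots> = ennreal (2 * a + 2 * K * x)"
      using assms by (simp add: ennreal_mult mult.assoc)
    finally show ?thesis .
  qed
  show "Y t \<le> ennreal (2 * a + 2 * K * x)"
    by (rule order_trans[OF Y_le *]) (use assms in auto)
  show "(NNI t. Z t * indicator {0..T} t) \<le> ennreal (2 * a + 2 * K * x)"
    by (rule order_trans[OF nn_integral_Z_le *]) (use assms in auto)
qed

text \<open>Since \<open>(E s)^2 \<le> Y s * Z s\<close>, the supremum of \<open>Y\<close> times the
  integral of \<open>Z\<close> bounds \<open>X T\<close>. Both are affine in the bound
  \<open>x\<close>, so the improved bound is quadratic in the small quantities.\<close>

lemma X_le:
  assumes "Y 0 \<le> ennreal a" "X T \<le> ennreal x" "a \<ge> 0" "x \<ge> 0"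
  shows "X T \<le> ennreal ((2 * a + 2 * K * x)^2)"
proof (cases "0 \<le> T")
  case True
  let ?c = "ennreal (2 * a + 2 * K * x)"
  have "X T \<le> (NNI s. ?c * (Z s * indicator {0..T} s))"
    unfolding X_def
  proof (intro nn_integral_mono)
    fix s
    have "(E s)^2 \<le> ?c * Z s" if "0 \<le> s" "s \<le> T"
      using E_sq_le[of s] mult_right_mono[OF Y_X_le(1)[OF assms that], of "Z s"] by (rule order_trans) simp
    thus "(E s)^2 * indicator {0..T} s \<le> ?c * (Z s * indicator {0..T} s)"
      by (auto split: split_indicator)
  qed
  also have "\<dots> = ?c * (NNI s. Z s * indicator {0..T} s)"
    by (rule nn_integral_cmult) measurable
  also have "\<dots> \<le> ?c * ?c"
    using Y_X_le(2)[OF assms, of 0] True by (intro mult_left_mono) auto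
  also have "\<dots> = ennreal ((2 * a + 2 * K * x)^2)"
    using assms by (simp add: power2_eq_square ennreal_mult[symmetric] del: ennreal_plus)
  finally show ?thesis .
qed (simp add: X_def)

lemma X_continuous: "continuous_on {0..T} (\<lambda>t. enn2real (X t))"
proof -
  \<comment> \<open>\<open>enn2real\<close> sends infinity to 0; this affects a null set only,
    because \<open>(E s)^2\<close> has a finite integral over the half-line.\<close>
  define g where "g = (\<lambda>s. enn2real ((E s)^2) * indicator {0..} s)"
  have [measurable]: "g \<in> borel_measurable borel" unfolding g_def by measurable
  have "AE s in lborel. (E s)^2 * indicator {0..} s \<noteq> \<infinity>"
    using E_finite unfolding E_def[symmetric] by (intro nn_integral_PInf_AE) auto
  hence eq: "AE s in lborel. ennreal (g s) = (E s)^2 * indicator {0..} s"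
  proof eventually_elim
    case (elim s)
    thus ?case by (auto simp: g_def less_top split: split_indicator)
  qed
  have "(NNI s. ennreal (g s)) < \<infinity>"
    using E_finite nn_integral_cong_AE[OF eq] by (simp add: E_def)
  hence g: "integrable lborel g"
    by (intro integrableI_nonneg) (auto simp: g_def)
  have "enn2real (X t) = integral {0..t} g" for t
  proof -
    have "X t = (NNI s. ennreal (g s * indicator {0..t} s))"
      unfolding X_def by (rule nn_integral_cong_AE, use eq in eventually_elim) (auto split: split_indicator)
    also have "\<dots> = ennreal (LINT s|lborel. g s * indicator {0..t} s)"
      using integrable_mult_indicator[OF _ g, of "{0..t}"]
      by (intro nn_integral_eq_integral) (auto simp: g_def mult.commute)
    finally have "enn2real (X t) = (LINT s:{0..t}|lborel. g s)"
      by (simp add: set_lebesgue_integral_def mult.commute integral_nonneg_AE g_def)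
    also have "\<dots> = integral {0..t} g"
      using integrable_mult_indicator[OF _ g, of "{0..t}"]
      by (intro set_borel_integral_eq_integral) (auto simp: set_integrable_def)
    finally show ?thesis .
  qed
  moreover have "g integrable_on {0..T}"
    using integrable_mult_indicator[OF _ g, of "{0..T}"]
    by (intro set_borel_integral_eq_integral) (auto simp: set_integrable_def)
  ultimately show ?thesis
    using indefinite_integral_continuous_1[of g 0 T] by simp
qed

text \<open>At a time where \<open>X\<close> equals \<open>16 * a^2\<close>, \<open>X_le\<close>
  would give \<open>16 * a^2 \<le> (2 * a * (1 + 16 * K * a))^2\<close>, whose right side is below
  \<open>(4 * a)^2\<close>. So \<open>X\<close>, continuous and 0 at time 0, never reaches this
  value.\<close>

lemma X_small:
  assumes "Y 0 \<le> ennreal a" "a > 0" "16 * K * a < 1" "0 \<le> T"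
  shows "X T \<le> ennreal (16 * a^2)"
proof (rule ccontr)
  assume "\<not> X T \<le> ennreal (16 * a^2)"
  hence "enn2real (X T) \<ge> 16 * a^2"
    using X_finite[of T] by (cases "X T") auto
  moreover have "X 0 = 0"
  proof -
    have "AE s in lborel. s \<noteq> (0::real)" by (rule AE_lborel_singleton)
    hence "X 0 = (\<integral>\<^sup>+s. 0 \<partial>(lborel :: real measure))"
      unfolding X_def by (intro nn_integral_cong_AE, eventually_elim) (auto split: split_indicator)
    thus ?thesis by simp
  qed
  ultimately obtain t where t: "0 \<le> t" "t \<le> T" "enn2real (X t) = 16 * a^2"
    using IVT'[of "\<lambda>t. enn2real (X t)" 0 "16 * a^2" T] X_continuous[of T] assms by auto
  have "X t \<le> ennreal (16 * a^2)"
    unfolding t(3)[symmetric] using X_finite[of t] by (simp add: ennreal_enn2real_if less_top)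
  hence "X t \<le> ennreal ((2 * a + 2 * K * (16 * a^2))^2)"
    using assms by (intro X_le) auto
  hence "16 * a^2 \<le> (2 * a + 2 * K * (16 * a^2))^2"
    unfolding t(3)[symmetric] by (intro enn2real_leI) auto
  also have "2 * a + 2 * K * (16 * a^2) = 2 * a * (1 + 16 * K * a)"
    by (simp add: power2_eq_square algebra_simps)
  also have "(2 * a * (1 + 16 * K * a))^2 < (2 * a * 2)^2"
    using assms by (intro power_strict_mono mult_strict_left_mono) auto
  finally show False by (simp add: power_mult_distrib)
qed

end

text \<open>The constant 144 is twice the 72 of \<open>decay_slow\<close>, the largest coefficient
  to be absorbed under \<open>d * K * a \<le> 1/2\<close>. The weaker conditions of
  \<open>X_small\<close> and \<open>Z_tail_Icc\<close> follow from it.\<close>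

locale small_heat_inequality = heat_inequality +
  fixes a :: real
  assumes a_pos: "a > 0" and small: "144 * K * a \<le> 1" and Y0: "Y 0 \<le> ennreal a"
begin

lemma small16: "16 * K * a < 1" "2 * a + 2 * K * (16 * a^2) \<le> 4 * a"
proof -
  have "K * a \<le> 1/144" using small by simp
  thus "16 * K * a < 1" by simp
  have "2 * a + 2 * K * (16 * a^2) = 2 * a * (1 + 16 * (K * a))"
    by (simp add: power2_eq_square algebra_simps)
  also have "\<dots> \<le> 2 * a * 2"
    using a_pos \<open>K * a \<le> 1/144\<close> by (intro mult_left_mono) auto
  finally show "2 * a + 2 * K * (16 * a^2) \<le> 4 * a" by simp
qed

lemma Y_bound:
  assumes "0 \<le> t" shows "Y t \<le> ennreal (4 * a)"
proof -
  have "Y t \<le> ennreal (2 * a + 2 * K * (16 * a^2))"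
    using Y_X_le(1)[OF Y0 X_small[OF Y0 a_pos small16(1) assms], of t] assms a_pos by simp
  also have "\<dots> \<le> ennreal (4 * a)" by (intro ennreal_leI small16(2))
  finally show ?thesis .
qed

lemma Z_bound: "(NNI t. Z t * indicator {0..} t) \<le> ennreal (4 * a)"
proof -
  have "(NNI t. Z t * indicator {0..T} t) \<le> ennreal (4 * a)" for T
  proof (cases "0 \<le> T")
    case True
    have "(NNI t. Z t * indicator {0..T} t) \<le> ennreal (2 * a + 2 * K * (16 * a^2))"
      using a_pos True by (intro Y_X_le(2)[OF Y0 X_small[OF Y0 a_pos small16(1)], of T 0]) auto
    thus ?thesis
      using ennreal_leI[OF small16(2)] by (rule order_trans)
  qed simp
  thus ?thesis by (intro nn_integral_Ici_le) measurable
qed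

lemma DD_le_YZ: "AE s in lborel. 0 \<le> s \<longrightarrow> DD s \<le> ennreal K * (Y s * Z s)"
  using DD_le
proof eventually_elim
  case (elim s)
  have "ennreal K * (E s)^2 \<le> ennreal K * (Y s * Z s)" by (intro mult_left_mono E_sq_le) simp
  thus ?case using elim by (auto intro: order_trans)
qed

text \<open>Restarted at \<open>\<tau>\<close>, the nonlinear term is at most
  \<open>8 * K * a\<close> times the integral itself and is absorbed, the integral being finite by
  \<open>Z_bound\<close>. Thus any decay of \<open>Y\<close> passes to the tails of the
  dissipation.\<close>

lemma Z_tail_Icc:
  assumes "0 \<le> \<tau>" 
  shows "(NNI t. Z t * indicator {\<tau>..b} t) \<le> 4 * Y \<tau>"
proof -
  let ?I = "\<integral>\<^sup>+t. Z t * indicator {\<tau>..b} t \<partial>lborel"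
  have "?I \<le> 2 * Y \<tau> + 2 * (NNI s. DD s * indicator {\<tau>..b} s)"
    by (rule nn_integral_Z_le[OF assms])
  also have "(NNI s. DD s * indicator {\<tau>..b} s) \<le> (NNI s. ennreal (4 * K * a) * (Z s * indicator {\<tau>..b} s))"
  proof (rule nn_integral_mono_AE, use DD_le_YZ in eventually_elim)
    fix s assume *: "0 \<le> s \<longrightarrow> DD s \<le> ennreal K * (Y s * Z s)"
    have "DD s \<le> ennreal (4 * K * a) * Z s" if "0 \<le> s"
    proof -
      have "DD s \<le> ennreal K * (Y s * Z s)" using * that by simp
      also have "\<dots> \<le> ennreal K * (ennreal (4 * a) * Z s)"
        by (intro mult_left_mono mult_right_mono Y_bound that) auto
      also have "\<dots> = ennreal (4 * K * a) * Z s"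
        using a_pos by (simp add: ennreal_mult mult.assoc mult.left_commute)
      finally show ?thesis .
    qed
    thus "DD s * indicator {\<tau>..b} s \<le> ennreal (4 * K * a) * (Z s * indicator {\<tau>..b} s)"
      using assms by (auto split: split_indicator)
  qed
  also have "\<dots> = ennreal (4 * K * a) * ?I"
    by (rule nn_integral_cmult) measurable
  finally have "?I \<le> 2 * Y \<tau> + 2 * (ennreal (4 * K * a) * ?I)"
    by (simp add: mult_left_mono)
  also have "2 * (ennreal (4 * K * a) * ?I) = ennreal (8 * (K * a)) * ?I"
    using a_pos by (simp add: ennreal_mult mult.assoc flip: mult.assoc[of 2 "4::ennreal"])
  finally have "?I \<le> 2 * Y \<tau> + ennreal (8 * (K * a)) * ?I" .
  moreover have "?I < \<infinity>"
  proof -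
    have "?I \<le> (NNI t. Z t * indicator {0..} t)"
      using assms by (intro nn_integral_mono) (auto split: split_indicator)
    also have "\<dots> < \<infinity>" using Z_bound by (auto intro: le_less_trans)
    finally show ?thesis .
  qed
  ultimately have "?I \<le> 2 * (2 * Y \<tau>)"
    using small by (intro ennreal_absorb[where d = "8 * (K * a)"]) auto
  thus ?thesis by (simp flip: mult.assoc)
qed

lemma Z_tail:
  assumes "0 \<le> \<tau>" 
  shows "(NNI t. Z t * indicator {\<tau>..} t) \<le> 4 * Y \<tau>"
  using Z_tail_Icc[OF assms] by (intro nn_integral_Ici_le) measurable

end

section \<open>Splitting the time integral at half time\<close>

lemma powr_le_move:
  assumes "s \<ge> 0" "ennreal ((1 + s) powr b) * y \<le> q"
  shows "y \<le> ennreal ((1 + s) powr - b) * q"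
proof -
  have "y = ennreal ((1 + s) powr - b * (1 + s) powr b) * y"
    using assms(1) by (simp flip: powr_add)
  also have "\<dots> = ennreal ((1 + s) powr - b) * (ennreal ((1 + s) powr b) * y)"
    by (simp add: ennreal_mult mult.assoc)
  also have "\<dots> \<le> ennreal ((1 + s) powr - b) * q"
    by (intro mult_left_mono assms) auto
  finally show ?thesis .
qed

lemma powr_le_move':
  assumes "s \<ge> 0" "y \<le> ennreal ((1 + s) powr - b) * q"
  shows "ennreal ((1 + s) powr b) * y \<le> q"
proof -
  have "ennreal ((1 + s) powr b) * y \<le> ennreal ((1 + s) powr b) * (ennreal ((1 + s) powr - b) * q)"
    by (intro mult_left_mono assms) auto
  also have "\<dots> = ennreal ((1 + s) powr b * (1 + s) powr - b) * q"
    by (simp add: ennreal_mult mult.assoc)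
  also have "\<dots> = q"
    using assms(1) by (simp flip: powr_add)
  finally show ?thesis .
qed

context heat_inequality
begin

text \<open>For \<open>s \<le> t/2\<close> the heat factor has acted for a time at least
  \<open>t/2\<close>, so with \<open>u = t * (r x)^2\<close> the squared kernel is at most
  \<open>u * exp (- u) / t \<le> 1 / t\<close>. The Cauchy-Schwarz inequality is then applied with
  the weights \<open>w\<close> and \<open>1 / w\<close>.\<close>

lemma B_split_early:
  assumes "t > 0" "x \<in> space M" and [measurable]: "w \<in> borel_measurable borel" and w: "\<And>s. w s > 0"
  shows "(NNI s. ennreal (r x * exp (- (t - s) * (r x)^2)) * D s x * indicator {0..t/2} s)^2
    \<le> ennreal (1 / t) * (NNI s. ennreal (w s) * indicator {0..t/2} s) *
      (NNI s. ennreal (1 / w s) * (D s x)^2 * indicator {0..t/2} s)"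
proof -
  note [measurable] = assms(2)
  have kern: "r x * exp (- (t - s) * (r x)^2) \<le> 1 / sqrt t" if "s \<le> t / 2" for s
  proof -
    define u where "u = t * (r x)^2"
    have "u \<ge> 0" using assms(1) by (simp add: u_def)
    have "u \<le> exp u" using exp_ge_add_one_self[of u] by linarith
    have "- (t - s) * (r x)^2 \<le> - u / 2"
      using mult_right_mono[of "t / 2" "t - s" "(r x)^2"] that by (simp add: u_def algebra_simps)
    hence "r x * exp (- (t - s) * (r x)^2) \<le> r x * exp (- u / 2)"
      by (intro mult_left_mono) auto
    also have "\<dots> \<le> 1 / sqrt t"
    proof (rule power2_le_imp_le)
      have "(r x * exp (- u / 2))^2 = (r x)^2 * exp (- u)"
        unfolding power_mult_distrib exp_double[symmetric] by simp
      also have "\<dots> = (u * exp (- u)) / t" using assms(1) by (simp add: u_def)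
      also have "\<dots> \<le> 1 / t"
        using \<open>u \<le> exp u\<close> assms(1) by (intro divide_right_mono) (auto simp: exp_minus field_simps)
      also have "\<dots> = (1 / sqrt t)^2" using assms(1) by (simp add: power_divide)
      finally show "(r x * exp (- u / 2))^2 \<le> (1 / sqrt t)^2" .
    qed (use assms(1) in auto)
    finally show ?thesis .
  qed
  have "(NNI s. ennreal (r x * exp (- (t - s) * (r x)^2)) * D s x * indicator {0..t/2} s)
     \<le> (NNI s. (ennreal (1 / sqrt t * sqrt (w s)) * indicator {0..t/2} s) * (ennreal (1 / sqrt (w s)) * D s x * indicator {0..t/2} s))"
  proof (rule nn_integral_mono)
    fix s
    have "ennreal (r x * exp (- (t - s) * (r x)^2)) * D s x
        \<le> ennreal (1 / sqrt t * sqrt (w s)) * (ennreal (1 / sqrt (w s)) * D s x)" if "s \<le> t / 2"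
    proof -
      have "1 / sqrt t * sqrt (w s) * (1 / sqrt (w s)) = 1 / sqrt t" using w[of s] by simp
      hence "ennreal (1 / sqrt t * sqrt (w s)) * (ennreal (1 / sqrt (w s)) * D s x) = ennreal (1 / sqrt t) * D s x"
        using w[of s] assms(1) by (subst mult.assoc[symmetric], subst ennreal_mult[symmetric]) auto
      thus ?thesis using kern[OF that] by (auto intro!: mult_right_mono ennreal_leI)
    qed
    thus "ennreal (r x * exp (- (t - s) * (r x)^2)) * D s x * indicator {0..t/2} s
      \<le> (ennreal (1 / sqrt t * sqrt (w s)) * indicator {0..t/2} s) * (ennreal (1 / sqrt (w s)) * D s x * indicator {0..t/2} s)"
      by (auto split: split_indicator)
  qed
  hence "(NNI s. ennreal (r x * exp (- (t - s) * (r x)^2)) * D s x * indicator {0..t/2} s)^2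
     \<le> (NNI s. (ennreal (1 / sqrt t * sqrt (w s)) * indicator {0..t/2} s) * (ennreal (1 / sqrt (w s)) * D s x * indicator {0..t/2} s))^2"
    by (intro power_mono) auto
  also have "\<dots> \<le> (NNI s. (ennreal (1 / sqrt t * sqrt (w s)) * indicator {0..t/2} s)^2) *
      (NNI s. (ennreal (1 / sqrt (w s)) * D s x * indicator {0..t/2} s)^2)"
    by (rule Cauchy_Schwarz_nn_integral) measurable
  also have "(NNI s. (ennreal (1 / sqrt t * sqrt (w s)) * indicator {0..t/2} s)^2)
     = (NNI s. ennreal (1 / t) * (ennreal (w s) * indicator {0..t/2} s))"
  proof (rule nn_integral_cong)
    fix s
    have "(1 / sqrt t * sqrt (w s))^2 = 1 / t * w s"
      unfolding power_mult_distrib using w[of s] assms(1) by (simp add: power_divide)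
    hence "(ennreal (1 / sqrt t * sqrt (w s)))^2 = ennreal (1 / t) * ennreal (w s)"
      using w[of s] assms(1) by (subst ennreal_power) (auto simp: less_imp_le simp flip: ennreal_mult)
    thus "(ennreal (1 / sqrt t * sqrt (w s)) * indicator {0..t/2} s)^2 = ennreal (1 / t) * (ennreal (w s) * indicator {0..t/2} s)"
      by (auto split: split_indicator)
  qed
  also have "\<dots> = ennreal (1 / t) * (NNI s. (ennreal (w s) * indicator {0..t/2} s))"
    by (rule nn_integral_cmult) measurable
  also have "(NNI s. (ennreal (1 / sqrt (w s)) * D s x * indicator {0..t/2} s)^2)
     = (NNI s. ennreal (1 / w s) * (D s x)^2 * indicator {0..t/2} s)"
  proof (rule nn_integral_cong)
    fix s
    have "(ennreal (1 / sqrt (w s)) * D s x)^2 = ennreal (1 / w s) * (D s x)^2"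
      unfolding power_mult_distrib using w[of s] by (subst ennreal_power) (auto simp: power_divide less_imp_le)
    thus "(ennreal (1 / sqrt (w s)) * D s x * indicator {0..t/2} s)^2 = ennreal (1 / w s) * (D s x)^2 * indicator {0..t/2} s"
      by (auto split: split_indicator)
  qed
  finally show ?thesis .
qed

text \<open>The weight stays free because the two decay proofs choose it differently: the rate
  sought itself in \<open>decay_slow\<close>, an integrable power in \<open>decay_fast\<close>. On
  the late half the kernel offers no decay in \<open>t\<close>, and smallness has to do.\<close>

lemma Y_split:
  assumes "t > 0" and [measurable]: "w \<in> borel_measurable borel" and w: "\<And>s. w s > 0"
  shows "Y t \<le> 3 * (NNM x. ennreal (exp (- 2 * t * (r x)^2)) * (f 0 x)^2)
    + 3 * (ennreal (1 / t) * (NNI s. ennreal (w s) * indicator {0..t/2} s) *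
      (NNI s. ennreal (1 / w s) * DD s * indicator {0..t/2} s))
    + 3 * (NNI s. DD s * indicator {t/2..t} s)"
proof -
  let ?L = "\<lambda>x. ennreal (exp (- 2 * t * (r x)^2)) * (f 0 x)^2"
  let ?c = "ennreal (1 / t) * (NNI s. ennreal (w s) * indicator {0..t/2} s)"
  let ?V = "\<lambda>x. \<integral>\<^sup>+s. ennreal (1 / w s) * (D s x)^2 * indicator {0..t/2} s \<partial>lborel"
  let ?B1 = "\<lambda>x. \<integral>\<^sup>+s. ennreal (r x * exp (- (t - s) * (r x)^2)) * D s x * indicator {0..t/2} s \<partial>lborel"
  have "Y t \<le> (NNM x. 3 * ?L x + 3 * (?c * ?V x) + 3 * (B (t/2) t x)^2)"
    unfolding Y_def
  proof (rule nn_integral_mono_AE, use duhamel_B[OF order_refl less_imp_le[OF assms(1)]] AE_space in eventually_elim)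
    fix x assume *: "f t x \<le> ennreal (exp (- (t - 0) * (r x)^2)) * f 0 x + B 0 t x" and x: "x \<in> space M"
    note [measurable] = x
    have "B 0 t x \<le> (NNI s. ennreal (r x * exp (- (t - s) * (r x)^2)) * D s x * indicator {0..t/2} s
        + ennreal (r x * exp (- (t - s) * (r x)^2)) * D s x * indicator {t/2..t} s)"
      unfolding B_def by (intro nn_integral_mono) (auto split: split_indicator)
    also have "\<dots> = ?B1 x + B (t/2) t x"
      unfolding B_def by (rule nn_integral_add) measurable
    finally have "f t x \<le> ennreal (exp (- t * (r x)^2)) * f 0 x + (?B1 x + B (t/2) t x)"
      using * by (auto intro: order_trans add_left_mono)
    hence "(f t x)^2 \<le> (ennreal (exp (- t * (r x)^2)) * f 0 x + ?B1 x + B (t/2) t x)^2"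
      by (intro power_mono) (auto simp: add.assoc)
    also have "\<dots> \<le> 3 * (ennreal (exp (- t * (r x)^2)) * f 0 x)^2 + 3 * (?B1 x)^2 + 3 * (B (t/2) t x)^2"
      by (rule ennreal_sum3_sq)
    also have "(ennreal (exp (- t * (r x)^2)) * f 0 x)^2 = ?L x"
    proof -
      have "(exp (- t * (r x)^2))^2 = exp (- 2 * t * (r x)^2)"
        unfolding exp_double[symmetric] by (simp add: mult.assoc)
      thus ?thesis unfolding power_mult_distrib by (subst ennreal_power) auto
    qed
    also have "3 * ?L x + 3 * (?B1 x)^2 + 3 * (B (t/2) t x)^2 \<le> 3 * ?L x + 3 * (?c * ?V x) + 3 * (B (t/2) t x)^2"
      by (intro add_right_mono add_left_mono mult_left_mono B_split_early assms x) auto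
    finally show "(f t x)^2 \<le> 3 * ?L x + 3 * (?c * ?V x) + 3 * (B (t/2) t x)^2" .
  qed
  also have "\<dots> = (NNM x. 3 * ?L x + 3 * (?c * ?V x)) + (NNM x. 3 * (B (t/2) t x)^2)"
    by (rule nn_integral_add) measurable
  also have "(NNM x. 3 * ?L x + 3 * (?c * ?V x)) = (NNM x. 3 * ?L x) + (NNM x. 3 * (?c * ?V x))"
    by (rule nn_integral_add) measurable
  also have "(NNM x. 3 * ?L x) = 3 * (NNM x. ?L x)"
    by (rule nn_integral_cmult) measurable
  also have "(NNM x. 3 * (?c * ?V x)) = 3 * (NNM x. ?c * ?V x)"
    by (rule nn_integral_cmult) measurable
  also have "(NNM x. ?c * ?V x) = ?c * (NNM x. ?V x)"
    by (rule nn_integral_cmult) measurable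
  also have "(NNM x. ?V x) = (NNI s. (NNM x. ennreal (1 / w s) * (D s x)^2 * indicator {0..t/2} s))"
    by (rule tonelli) measurable
  also have "\<dots> = (NNI s. ennreal (1 / w s) * DD s * indicator {0..t/2} s)"
    by (simp add: DD_def nn_integral_multc nn_integral_cmult)
  also have "(NNM x. 3 * (B (t/2) t x)^2) = 3 * (NNM x. (B (t/2) t x)^2)"
    by (rule nn_integral_cmult) measurable
  also have "\<dots> \<le> 3 * (NNI s. DD s * indicator {t/2..t} s)"
    by (intro mult_left_mono nn_integral_B_sq) auto
  finally show ?thesis by (simp add: add_left_mono)
qed

end

text \<open>From \<open>(1 + t) powr (1 - b) - 1 \<le> t * (1 + t) powr - b\<close>, divided by
  \<open>1 - b \<ge> 1/4\<close>. The factor \<open>t\<close>, rather than \<open>1 + t\<close>,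
  cancels the \<open>1 / t\<close> of \<open>B_split_early\<close> for small times as well.\<close>

lemma nn_integral_powr_neg_le:
  assumes "0 \<le> b" "b \<le> 3/4" "0 \<le> t"
  shows "(NNI s. ennreal ((1 + s) powr - b) * indicator {0..t} s) \<le> ennreal (4 * t * (1 + t) powr - b)"
proof -
  have "(1 + t) powr (1 - b) - 1 \<le> t * (1 + t) powr - b"
  proof -
    have "(1 + t) powr (1 - b) = (1 + t) * (1 + t) powr - b"
      using assms by (simp add: powr_diff powr_minus divide_simps)
    moreover have "(1 + t) powr - b \<le> 1"
      using assms powr_mono[of "- b" 0 "1 + t"] by simp
    ultimately show ?thesis by (simp add: algebra_simps)
  qed
  moreover have "0 \<le> (1 + t) powr (1 - b) - 1"
    using assms by (simp add: ge_one_powr_ge_zero)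
  ultimately have "((1 + t) powr (1 - b) - 1) / (1 - b) \<le> (t * (1 + t) powr - b) / (1/4)"
    using assms by (intro frac_le) auto
  thus ?thesis
    using assms by (subst nn_integral_powr_Icc) (auto intro!: ennreal_leI simp: mult.commute add.commute)
qed

context small_heat_inequality
begin

text \<open>The weight \<open>w\<close> in the time integral is what allows one to avoid Minkowski's inequality.\<close>

lemma weighted_DD_le:
  assumes [measurable]: "w \<in> borel_measurable borel" "A \<in> sets borel"
    and "A \<subseteq> {0..}" and "\<And>s. s \<in> A \<Longrightarrow> ennreal (w s) * Y s \<le> Q * v s"
    and [measurable]: "v \<in> borel_measurable borel"
  shows "(NNI s. ennreal (w s) * DD s * indicator A s) \<le> ennreal K * Q * (NNI s. v s * Z s * indicator A s)"
proof -
  have "(NNI s. ennreal (w s) * DD s * indicator A s) \<le> (NNI s. ennreal K * Q * (v s * Z s * indicator A s))"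
  proof (rule nn_integral_mono_AE, use DD_le_YZ in eventually_elim)
    fix s assume *: "0 \<le> s \<longrightarrow> DD s \<le> ennreal K * (Y s * Z s)"
    have "ennreal (w s) * DD s \<le> ennreal K * Q * (v s * Z s)" if "s \<in> A"
    proof -
      have "ennreal (w s) * DD s \<le> ennreal (w s) * (ennreal K * (Y s * Z s))"
        using * that assms(3) by (intro mult_left_mono) auto
      also have "\<dots> = ennreal K * ((ennreal (w s) * Y s) * Z s)" by (simp add: ac_simps)
      also have "\<dots> \<le> ennreal K * ((Q * v s) * Z s)"
        by (intro mult_left_mono mult_right_mono assms that) auto
      finally show ?thesis by (simp add: ac_simps)
    qed
    thus "ennreal (w s) * DD s * indicator A s \<le> ennreal K * Q * (v s * Z s * indicator A s)"
      by (auto split: split_indicator)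
  qed
  also have "\<dots> = ennreal K * Q * (NNI s. v s * Z s * indicator A s)"
    by (rule nn_integral_cmult) measurable
  finally show ?thesis .
qed

lemma Z_bound_subset:
  assumes "A \<subseteq> {0..}"
  shows "(NNI s. Z s * indicator A s) \<le> ennreal (4 * a)"
proof -
  have "(NNI s. Z s * indicator A s) \<le> (NNI s. Z s * indicator {0..} s)"
    using assms by (intro nn_integral_mono) (auto split: split_indicator)
  thus ?thesis using Z_bound by (rule order_trans)
qed

text \<open>Finite by \<open>Y_bound\<close> before any decay is known, thanks to the finite horizon
  \<open>T\<close>; the bounds deduced from it are free of \<open>T\<close>.\<close>

definition weighted_sup :: "real \<Rightarrow> real \<Rightarrow> ennreal" where
  "weighted_sup b T = (SUP s\<in>{0..T}. ennreal ((1 + s) powr b) * Y s)"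

lemma weighted_sup_upper: "0 \<le> s \<Longrightarrow> s \<le> T \<Longrightarrow> ennreal ((1 + s) powr b) * Y s \<le> weighted_sup b T"
  unfolding weighted_sup_def by (rule SUP_upper) auto

lemma weighted_sup_finite:
  assumes "0 \<le> b"
  shows "weighted_sup b T < \<infinity>"
proof -
  have "weighted_sup b T \<le> ennreal ((1 + T) powr b) * ennreal (4 * a)"
    unfolding weighted_sup_def using assms
    by (intro SUP_least mult_mono Y_bound ennreal_leI powr_mono2) auto
  thus ?thesis by (auto intro: le_less_trans simp: ennreal_mult_less_top)
qed

text \<open>On \<open>[t/2, t]\<close> the rates at \<open>s\<close> and at \<open>t\<close> differ
  by at most \<open>2 powr b \<le> 2\<close>; with the bound \<open>4 * a\<close> for the
  dissipation this gives the 8. The factor \<open>a\<close> is the smallness that allows the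
  absorption.\<close>

lemma late_part:
  assumes "0 \<le> b" "b \<le> 1" "0 \<le> t" "t \<le> T"
  shows "(NNI s. DD s * indicator {t/2..t} s) \<le> ennreal (8 * K * a * (1 + t) powr - b) * weighted_sup b T"
proof -
  have "Y s \<le> weighted_sup b T * ennreal (2 * (1 + t) powr - b)" if s: "s \<in> {t/2..t}" for s
  proof -
    have "Y s \<le> ennreal ((1 + s) powr - b) * weighted_sup b T"
      using s assms by (intro powr_le_move weighted_sup_upper) auto
    also have "(1 + s) powr - b \<le> 2 * (1 + t) powr - b"
    proof -
      have "(1 + s) powr - b \<le> ((1 + t) / 2) powr - b"
        using s assms by (intro powr_mono2') auto
      also have "\<dots> = 2 powr b * (1 + t) powr - b"
        using assms by (simp add: powr_divide powr_minus divide_simps)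
      also have "\<dots> \<le> 2 powr 1 * (1 + t) powr - b"
        using assms by (intro mult_right_mono powr_mono) auto
      finally show ?thesis by simp
    qed
    finally show ?thesis by (simp add: mult.commute mult_right_mono ennreal_leI)
  qed
  hence "(NNI s. ennreal 1 * DD s * indicator {t/2..t} s) \<le> ennreal K * weighted_sup b T * 
      (NNI s. ennreal (2 * (1 + t) powr - b) * Z s * indicator {t/2..t} s)"
    using assms by (intro weighted_DD_le) auto
  also have "(NNI s. ennreal (2 * (1 + t) powr - b) * Z s * indicator {t/2..t} s)
    = ennreal (2 * (1 + t) powr - b) * (NNI s. Z s * indicator {t/2..t} s)"
    unfolding mult.assoc by (rule nn_integral_cmult) measurable
  also have "ennreal K * weighted_sup b T * \<dots> \<le> ennreal K * weighted_sup b T * (ennreal (2 * (1 + t) powr - b) * ennreal (4 * a))"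
    using assms by (intro mult_left_mono Z_bound_subset) auto
  also have "\<dots> = (ennreal K * (ennreal (2 * (1 + t) powr - b) * ennreal (4 * a))) * weighted_sup b T"
    by (simp only: ac_simps)
  also have "ennreal K * (ennreal (2 * (1 + t) powr - b) * ennreal (4 * a)) = ennreal (8 * K * a * (1 + t) powr - b)"
    using a_pos by (simp add: ac_simps flip: ennreal_mult)
  finally show ?thesis by simp
qed

lemma weighted_sup_absorb:
  assumes "0 \<le> b" "d * K * a \<le> 1/2"
    "\<And>t. 0 \<le> t \<Longrightarrow> t \<le> T \<Longrightarrow> Y t \<le> ennreal (c * (1 + t) powr - b) + ennreal (d * K * a * (1 + t) powr - b) * weighted_sup b T"
    "0 \<le> t" "t \<le> T" "c \<ge> 0" "d \<ge> 0"
  shows "Y t \<le> ennreal (2 * c * (1 + t) powr - b)"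
proof -
  have "weighted_sup b T \<le> ennreal c + ennreal (d * K * a) * weighted_sup b T"
  proof (unfold weighted_sup_def[of b T], rule SUP_least, fold weighted_sup_def[of b T])
    fix s assume s: "s \<in> {0..T}"
    have "Y s \<le> ennreal ((1 + s) powr - b) * (ennreal c + ennreal (d * K * a) * weighted_sup b T)"
      using assms(3)[of s] s a_pos assms(6,7) by (simp add: distrib_left ennreal_mult ac_simps)
    thus "ennreal ((1 + s) powr b) * Y s \<le> ennreal c + ennreal (d * K * a) * weighted_sup b T"
      using s by (intro powr_le_move') auto
  qed
  hence "weighted_sup b T \<le> 2 * ennreal c"
    using assms weighted_sup_finite by (intro ennreal_absorb) auto
  hence "Y t \<le> ennreal ((1 + t) powr - b) * (2 * ennreal c)"
    using weighted_sup_upper[of t T b] assms by (intro powr_le_move) auto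
  also have "\<dots> = ennreal (2 * c * (1 + t) powr - b)"
    using assms by (simp add: ennreal_mult ac_simps)
  finally show ?thesis .
qed

end

section \<open>Decay rates for the scalar inequality\<close>

locale decaying_heat_inequality = small_heat_inequality +
  fixes C \<theta> :: real
  assumes C_nonneg: "C \<ge> 0" and \<theta>_pos: "\<theta> > 0"
    and linear_decay: "0 \<le> t \<Longrightarrow>
      (NNM x. ennreal (exp (- 2 * t * (r x)^2)) * (f 0 x)^2) \<le> ennreal (C * (1 + t) powr - \<theta>)"
begin

lemma linear_decay':
  assumes "0 \<le> t" "b \<le> \<theta>"
  shows "(NNM x. ennreal (exp (- 2 * t * (r x)^2)) * (f 0 x)^2) \<le> ennreal (C * (1 + t) powr - b)"
proof -
  have "C * (1 + t) powr - \<theta> \<le> C * (1 + t) powr - b"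
    using assms C_nonneg by (intro mult_left_mono powr_mono) auto
  show ?thesis by (rule order_trans[OF linear_decay[OF assms(1)] ennreal_leI]) fact
qed

lemma Y0_decay: "Y 0 \<le> ennreal C"
  using linear_decay[of 0] by (simp add: Y_def)

text \<open>With the desired rate as the weight, \<open>1 / w\<close> times \<open>Y\<close> is at
  most the weighted supremum, so the early half, like the late one, is a small multiple of it. The
  coefficient 72 is \<open>3 * 16 + 3 * 8\<close>, from the early and the late half.\<close>

lemma decay_slow:
  assumes b: "0 \<le> b" "b \<le> 3/4" "b \<le> \<theta>" and "0 \<le> t"
  shows "Y t \<le> ennreal (6 * C * (1 + t) powr - b)"
proof -
  have "Y t' \<le> ennreal (3 * C * (1 + t') powr - b) + ennreal (72 * K * a * (1 + t') powr - b) * weighted_sup b t"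
    if t': "0 \<le> t'" "t' \<le> t" for t'
  proof (cases "t' = 0")
    case True
    have "Y 0 \<le> ennreal C" by (rule Y0_decay)
    also have "\<dots> \<le> ennreal (3 * C)" using C_nonneg by (intro ennreal_leI) auto
    finally show ?thesis using True by (simp add: add_increasing2)
  next
    case False
    let ?Q = "weighted_sup b t"
    have "Y t' \<le> 3 * (NNM x. ennreal (exp (- 2 * t' * (r x)^2)) * (f 0 x)^2)
      + 3 * (ennreal (1 / t') * (NNI s. ennreal ((1 + \<bar>s\<bar>) powr - b) * indicator {0..t'/2} s) *
        (NNI s. ennreal (1 / (1 + \<bar>s\<bar>) powr - b) * DD s * indicator {0..t'/2} s))
      + 3 * (NNI s. DD s * indicator {t'/2..t'} s)"
      using False that by (intro Y_split) auto
    also have "\<dots> \<le> 3 * ennreal (C * (1 + t') powr - b) 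
      + 3 * (ennreal (1 / t') * ennreal (4 * t' * (1 + t') powr - b) * (ennreal K * ?Q * ennreal (4 * a)))
      + 3 * (ennreal (8 * K * a * (1 + t') powr - b) * ?Q)"
    proof (intro add_mono mult_left_mono mult_mono)
      have "(NNI s. ennreal ((1 + \<bar>s\<bar>) powr - b) * indicator {0..t'/2} s) \<le>
        (NNI s. ennreal ((1 + s) powr - b) * indicator {0..t'} s)"
        by (intro nn_integral_mono) (use t' in \<open>auto split: split_indicator\<close>)
      also have "\<dots> \<le> ennreal (4 * t' * (1 + t') powr - b)"
        using t' b by (intro nn_integral_powr_neg_le) auto
      finally show "(NNI s. ennreal ((1 + \<bar>s\<bar>) powr - b) * indicator {0..t'/2} s) \<le> ennreal (4 * t' * (1 + t') powr - b)" .
      have "(NNI s. ennreal (1 / (1 + \<bar>s\<bar>) powr - b) * DD s * indicator {0..t'/2} s)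
        \<le> ennreal K * ?Q * (NNI s. 1 * Z s * indicator {0..t'/2} s)"
      proof (rule weighted_DD_le)
        fix s assume "s \<in> {0..t'/2}"
        thus "ennreal (1 / (1 + \<bar>s\<bar>) powr - b) * Y s \<le> ?Q * 1"
          using weighted_sup_upper[of s t b] t' by (simp add: powr_minus_divide)
      qed auto
      also have "\<dots> \<le> ennreal K * ?Q * ennreal (4 * a)"
        using Z_bound_subset[of "{0..t'/2}"] by (intro mult_left_mono) auto
      finally show "(NNI s. ennreal (1 / (1 + \<bar>s\<bar>) powr - b) * DD s * indicator {0..t'/2} s) \<le> ennreal K * ?Q * ennreal (4 * a)" .
      show "(NNM x. ennreal (exp (- 2 * t' * (r x)^2)) * (f 0 x)^2) \<le> ennreal (C * (1 + t') powr - b)"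
        using t' b by (intro linear_decay') auto
      show "(NNI s. DD s * indicator {t'/2..t'} s) \<le> ennreal (8 * K * a * (1 + t') powr - b) * ?Q"
        using t' b by (intro late_part) auto
    qed auto
    also have "ennreal (1 / t') * ennreal (4 * t' * (1 + t') powr - b) * (ennreal K * ?Q * ennreal (4 * a))
       = (ennreal (1 / t') * ennreal (4 * t' * (1 + t') powr - b) * (ennreal K * ennreal (4 * a))) * ?Q"
      by (simp only: ac_simps)
    also have "ennreal (1 / t') * ennreal (4 * t' * (1 + t') powr - b) * (ennreal K * ennreal (4 * a)) = ennreal (16 * K * a * (1 + t') powr - b)"
      using False t' a_pos by (simp add: ac_simps flip: ennreal_mult)
    also have "3 * ennreal (C * (1 + t') powr - b) + 3 * (ennreal (16 * K * a * (1 + t') powr - b) * ?Q)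
      + 3 * (ennreal (8 * K * a * (1 + t') powr - b) * ?Q) = 
      3 * ennreal (C * (1 + t') powr - b) + (3 * ennreal (16 * K * a * (1 + t') powr - b) + 3 * ennreal (8 * K * a * (1 + t') powr - b)) * ?Q"
      by (simp only: distrib_right mult.assoc add.assoc)
    also have "3 * ennreal (C * (1 + t') powr - b) = ennreal (3 * C * (1 + t') powr - b)"
      using C_nonneg by (simp add: ennreal_mult mult.assoc)
    also have "3 * ennreal (16 * K * a * (1 + t') powr - b) + 3 * ennreal (8 * K * a * (1 + t') powr - b)
       = ennreal (3 * (16 * K * a * (1 + t') powr - b) + 3 * (8 * K * a * (1 + t') powr - b))"
    proof -
      have *: "3 * ennreal x + 3 * ennreal y = ennreal (3 * x + 3 * y)" if "x \<ge> 0" "y \<ge> 0" for x y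
        using that by (simp add: ennreal_mult)
      show ?thesis by (rule *) (use a_pos in auto)
    qed
    finally show ?thesis by (simp add: algebra_simps)
  qed
  note bound = this
  have "72 * K * a \<le> 1 / 2" using small by linarith
  thus ?thesis
    using weighted_sup_absorb[OF b(1) _ bound \<open>0 \<le> t\<close> order_refl] C_nonneg by simp
qed

text \<open>The rate \<open>3/4\<close> of \<open>Y\<close>, being larger than \<open>1/2\<close>, lets the dissipation absorb the weight \<open>(1 + s)\<^sup>1\<^sup>/\<^sup>2\<close>.\<close>

lemma weighted_Z_bound:
  assumes "3/4 \<le> \<theta>"
  shows "(NNI s. ennreal ((1 + \<bar>s\<bar>) powr (1/2)) * Z s * indicator {0..} s) \<le> ennreal (4 * a + 96 * C)"
proof -
  \<comment> \<open>Layer-cake form of the weight: \<open>(1 + s) powr (1/2)\<close> is at most 1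
    plus the integral of \<open>(1 + \<tau>) powr (-1/2)\<close> over \<open>[0, s]\<close>.
    Exchanging \<open>s\<close> and \<open>\<tau>\<close> turns the weighted dissipation into an
    integral of its tails, to which \<open>Z_tail\<close> applies.\<close>
  define h where "h = (\<lambda>\<tau> s. ennreal ((1 + \<bar>\<tau>\<bar>) powr (-1/2)) * Z s * (if 0 \<le> \<tau> \<and> \<tau> \<le> s then 1 else 0))"
  have h_meas: "case_prod h \<in> borel_measurable (lborel \<Otimes>\<^sub>M lborel)"
    unfolding h_def case_prod_unfold by measurable
  have "(NNI s. ennreal ((1 + \<bar>s\<bar>) powr (1/2)) * Z s * indicator {0..} s)
    \<le> (NNI s. Z s * indicator {0..} s + (NNI \<tau>. h \<tau> s))"
  proof (rule nn_integral_mono)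
    fix s :: real
    show "ennreal ((1 + \<bar>s\<bar>) powr (1/2)) * Z s * indicator {0..} s \<le> Z s * indicator {0..} s + (NNI \<tau>. h \<tau> s)"
    proof (cases "0 \<le> s")
      case True
      have "(NNI \<tau>. h \<tau> s) = (NNI \<tau>. Z s * (ennreal ((1 + \<tau>) powr (-1/2)) * indicator {0..s} \<tau>))"
        unfolding h_def by (intro nn_integral_cong) (auto split: split_indicator simp: ac_simps)
      also have "\<dots> = Z s * (NNI \<tau>. (ennreal ((1 + \<tau>) powr (-1/2)) * indicator {0..s} \<tau>))"
        by (rule nn_integral_cmult) measurable
      also have "(NNI \<tau>. (ennreal ((1 + \<tau>) powr (-1/2)) * indicator {0..s} \<tau>)) = ennreal (((1 + s) powr (1/2) - 1) / (1/2))"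
        using nn_integral_powr_Icc[of "-1/2" s] True by simp
      finally have eq: "(NNI \<tau>. h \<tau> s) = Z s * ennreal (((1 + s) powr (1/2) - 1) / (1/2))" .
      have ge1: "(1 + s) powr (1/2) \<ge> 1" using True by (simp add: ge_one_powr_ge_zero)
      hence "ennreal ((1 + s) powr (1/2)) \<le> ennreal (1 + ((1 + s) powr (1/2) - 1) / (1/2))"
        by (intro ennreal_leI) (simp add: field_simps)
      also have "\<dots> = 1 + ennreal (((1 + s) powr (1/2) - 1) / (1/2))"
        using ge1 by (subst ennreal_plus) auto
      finally have "ennreal ((1 + s) powr (1/2)) * Z s \<le> (1 + ennreal (((1 + s) powr (1/2) - 1) / (1/2))) * Z s"
        by (rule mult_right_mono) simp
      thus ?thesis using True unfolding eq by (simp add: distrib_left distrib_right mult.commute)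
    qed simp
  qed
  also have "\<dots> = (NNI s. Z s * indicator {0..} s) + (NNI s. (NNI \<tau>. h \<tau> s))"
    unfolding h_def by (intro nn_integral_add) measurable
  also have "(NNI s. (NNI \<tau>. h \<tau> s)) = (NNI \<tau>. (NNI s. h \<tau> s))"
    using h_meas by (rule lborel_pair.Fubini')
  \<comment> \<open>The 24 is \<open>4 * 6\<close>, from \<open>Z_tail\<close> and from
    \<open>decay_slow\<close> at the rate 3/4. The exponent \<open>-5/4 = -1/2 - 3/4\<close> is
    integrable with integral 4, whence the 96.\<close>
  also have "\<dots> \<le> (NNI \<tau>. ennreal (24 * C) * (ennreal ((1 + \<tau>) powr (-5/4)) * indicator {0..} \<tau>))"
  proof (rule nn_integral_mono)
    fix \<tau> :: real
    show "(NNI s. h \<tau> s) \<le> ennreal (24 * C) * (ennreal ((1 + \<tau>) powr (-5/4)) * indicator {0..} \<tau>)"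
    proof (cases "0 \<le> \<tau>")
      case True
      have "(NNI s. h \<tau> s) = (NNI s. ennreal ((1 + \<tau>) powr (-1/2)) * (Z s * indicator {\<tau>..} s))"
        unfolding h_def using True by (intro nn_integral_cong) (auto split: split_indicator)
      also have "\<dots> = ennreal ((1 + \<tau>) powr (-1/2)) * (NNI s. (Z s * indicator {\<tau>..} s))"
        by (rule nn_integral_cmult) measurable
      also have "\<dots> \<le> ennreal ((1 + \<tau>) powr (-1/2)) * (4 * ennreal (6 * C * (1 + \<tau>) powr -(3/4)))"
        using assms True by (intro mult_left_mono order_trans[OF Z_tail] decay_slow) auto
      also have "\<dots> = ennreal (24 * C * ((1 + \<tau>) powr (-1/2) * (1 + \<tau>) powr -(3/4)))"
      proof -
        have "ennreal ((1 + \<tau>) powr (-1/2)) * (4 * ennreal (6 * C * (1 + \<tau>) powr -(3/4)))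
          = ennreal ((1 + \<tau>) powr (-1/2)) * (ennreal 4 * ennreal (6 * C * (1 + \<tau>) powr -(3/4)))" by simp
        also have "\<dots> = ennreal ((1 + \<tau>) powr (-1/2) * (4 * (6 * C * (1 + \<tau>) powr -(3/4))))"
          using C_nonneg by (subst ennreal_mult, simp, simp, subst ennreal_mult) auto
        also have "(1 + \<tau>) powr (-1/2) * (4 * (6 * C * (1 + \<tau>) powr -(3/4))) = 24 * C * ((1 + \<tau>) powr (-1/2) * (1 + \<tau>) powr -(3/4))"
          by simp
        finally show ?thesis .
      qed
      also have "(1 + \<tau>) powr (-1/2) * (1 + \<tau>) powr -(3/4) = (1 + \<tau>) powr (-5/4)"
        by (simp flip: powr_add)
      finally show ?thesis using True C_nonneg by (simp add: ennreal_mult)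
    qed (simp add: h_def)
  qed
  also have "\<dots> = ennreal (24 * C) * (NNI \<tau>. (ennreal ((1 + \<tau>) powr (-5/4)) * indicator {0..} \<tau>))"
    by (rule nn_integral_cmult) measurable
  also have "(NNI \<tau>. (ennreal ((1 + \<tau>) powr (-5/4)) * indicator {0..} \<tau>)) = ennreal 4"
    by (subst nn_integral_powr_Ici) auto
  also have "ennreal (24 * C) * ennreal 4 = ennreal (96 * C)"
    using C_nonneg by (simp del: ennreal_numeral flip: ennreal_mult)
  also have "(NNI s. Z s * indicator {0..} s) + ennreal (96 * C) \<le> ennreal (4 * a) + ennreal (96 * C)"
    by (intro add_right_mono Z_bound)
  also have "\<dots> = ennreal (4 * a + 96 * C)"
    using C_nonneg a_pos by simp
  finally show ?thesis by (simp add: add_left_mono)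
qed

text \<open>The weight \<open>(1 + \<bar>s\<bar>) powr (-5/4)\<close> is integrable, so the early
  half keeps the full factor \<open>1 / t\<close>. The inverse weight times the known rate 3/4
  leaves \<open>(1 + s) powr (1/2)\<close>, which \<open>weighted_Z_bound\<close> pays for. Only the
  late half, with coefficient \<open>24 = 3 * 8\<close>, remains to be absorbed.\<close>

lemma decay_fast:
  assumes b: "0 \<le> b" "b \<le> 1" "b \<le> \<theta>" and \<theta>: "3/4 \<le> \<theta>" and "0 \<le> t"
  shows "Y t \<le> ennreal (2 * (3 * C + 144 * K * C * (4 * a + 96 * C) + 8 * a) * (1 + t) powr - b)"
proof -
  let ?W = "4 * a + 96 * C"
  let ?c = "3 * C + 144 * K * C * ?W + 8 * a"
  let ?Q = "weighted_sup b t"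
  have nonneg: "0 \<le> K * C * ?W" using C_nonneg a_pos by simp
  have "Y t' \<le> ennreal (?c * (1 + t') powr - b) + ennreal (24 * K * a * (1 + t') powr - b) * ?Q"
    if t': "0 \<le> t'" "t' \<le> t" for t'
  \<comment> \<open>Near 0 the factor \<open>1 / t'\<close> is not comparable to
    \<open>1 / (1 + t')\<close>. There \<open>Y_bound\<close> suffices and
    \<open>(1 + t') powr - b \<ge> 1/2\<close>, which puts \<open>8 * a\<close> into the
    constant.\<close>
  proof (cases "t' \<le> 1")
    case True
    have "8 * a * ((1 + t') powr - b) \<ge> 8 * a * (1 / 2)"
    proof (intro mult_left_mono)
      have "(1 + t') powr b \<le> (1 + t') powr 1" using t' b by (intro powr_mono) auto
      hence "(1 + t') powr b \<le> 2" using True t' by simp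
      thus "1 / 2 \<le> (1 + t') powr - b" using t' by (simp add: powr_minus field_simps)
    qed (use a_pos in auto)
    hence "4 * a \<le> 8 * a * (1 + t') powr - b" by simp
    also have "\<dots> \<le> ?c * (1 + t') powr - b"
      using C_nonneg a_pos nonneg by (intro mult_right_mono) auto
    finally have "ennreal (4 * a) \<le> ennreal (?c * (1 + t') powr - b)" by (rule ennreal_leI)
    thus ?thesis using Y_bound[OF t'(1)] by (intro add_increasing2) auto
  next
    case False
    have "Y t' \<le> 3 * (NNM x. ennreal (exp (- 2 * t' * (r x)^2)) * (f 0 x)^2)
      + 3 * (ennreal (1 / t') * (NNI s. ennreal ((1 + \<bar>s\<bar>) powr (-5/4)) * indicator {0..t'/2} s) *
        (NNI s. ennreal (1 / (1 + \<bar>s\<bar>) powr (-5/4)) * DD s * indicator {0..t'/2} s))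
      + 3 * (NNI s. DD s * indicator {t'/2..t'} s)"
      using False by (intro Y_split) auto
    also have "\<dots> \<le> 3 * ennreal (C * (1 + t') powr - b) 
      + 3 * (ennreal (2 * (1 + t') powr - b) * ennreal 4 * (ennreal K * ennreal (6 * C) * ennreal ?W))
      + 3 * (ennreal (8 * K * a * (1 + t') powr - b) * ?Q)"
    proof (intro add_mono mult_left_mono mult_mono)
      have "1 / t' \<le> 2 * (1 + t') powr - 1"
        using False by (simp add: powr_minus divide_simps)
      also have "\<dots> \<le> 2 * (1 + t') powr - b"
        using t' b by (intro mult_left_mono powr_mono) auto
      finally show "ennreal (1 / t') \<le> ennreal (2 * (1 + t') powr - b)" by (rule ennreal_leI)
      have "(NNI s. ennreal ((1 + \<bar>s\<bar>) powr (-5/4)) * indicator {0..t'/2} s) \<le>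
        (NNI s. ennreal ((1 + s) powr (-5/4)) * indicator {0..} s)"
        by (intro nn_integral_mono) (auto split: split_indicator)
      also have "\<dots> = ennreal 4" by (subst nn_integral_powr_Ici) auto
      finally show "(NNI s. ennreal ((1 + \<bar>s\<bar>) powr (-5/4)) * indicator {0..t'/2} s) \<le> ennreal 4" .
      have "(NNI s. ennreal (1 / (1 + \<bar>s\<bar>) powr (-5/4)) * DD s * indicator {0..t'/2} s)
        \<le> ennreal K * ennreal (6 * C) * (NNI s. ennreal ((1 + \<bar>s\<bar>) powr (1/2)) * Z s * indicator {0..t'/2} s)"
      proof (rule weighted_DD_le)
        fix s assume s: "s \<in> {0..t'/2}"
        have "ennreal (1 / (1 + \<bar>s\<bar>) powr (-5/4)) * Y s \<le> ennreal (1 / (1 + \<bar>s\<bar>) powr (-5/4)) * ennreal (6 * C * (1 + s) powr - (3/4))"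
          using s \<theta> by (intro mult_left_mono decay_slow) auto
        also have "\<dots> = ennreal (6 * C * ((1 + s) powr (5/4) * (1 + s) powr - (3/4)))"
          using s C_nonneg by (simp add: powr_minus_divide ac_simps flip: ennreal_mult)
        also have "(1 + s) powr (5/4) * (1 + s) powr - (3/4) = (1 + s) powr (1/2)"
          by (simp flip: powr_add)
        finally show "ennreal (1 / (1 + \<bar>s\<bar>) powr (-5/4)) * Y s \<le> ennreal (6 * C) * ennreal ((1 + \<bar>s\<bar>) powr (1/2))"
          using s C_nonneg by (simp add: ennreal_mult)
      qed auto
      also have "\<dots> \<le> ennreal K * ennreal (6 * C) * (NNI s. ennreal ((1 + \<bar>s\<bar>) powr (1/2)) * Z s * indicator {0..} s)"
        by (intro mult_left_mono nn_integral_mono) (auto split: split_indicator)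
      also have "\<dots> \<le> ennreal K * ennreal (6 * C) * ennreal ?W"
        by (intro mult_left_mono weighted_Z_bound \<theta>) auto
      finally show "(NNI s. ennreal (1 / (1 + \<bar>s\<bar>) powr (-5/4)) * DD s * indicator {0..t'/2} s) \<le> ennreal K * ennreal (6 * C) * ennreal ?W" .
      show "(NNM x. ennreal (exp (- 2 * t' * (r x)^2)) * (f 0 x)^2) \<le> ennreal (C * (1 + t') powr - b)"
        using t' b by (intro linear_decay') auto
      show "(NNI s. DD s * indicator {t'/2..t'} s) \<le> ennreal (8 * K * a * (1 + t') powr - b) * ?Q"
        using t' b by (intro late_part) auto
    qed auto
    also have "3 * ennreal (C * (1 + t') powr - b) = ennreal (3 * C * (1 + t') powr - b)"
      using C_nonneg by (simp add: ennreal_mult mult.assoc)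
    also have "3 * (ennreal (2 * (1 + t') powr - b) * ennreal 4 * (ennreal K * ennreal (6 * C) * ennreal ?W)) = ennreal (144 * K * C * ?W * (1 + t') powr - b)"
    proof -
      have *: "ennreal 3 * (ennreal (2 * p) * ennreal 4 * (ennreal K * ennreal (6 * C) * ennreal W)) = ennreal (144 * K * C * W * p)"
        if "p \<ge> 0" "W \<ge> 0" for p W
        using that C_nonneg by (simp add: ac_simps del: ennreal_numeral flip: ennreal_mult)
      show ?thesis using *[of "(1 + t') powr - b" ?W] C_nonneg a_pos by simp
    qed
    also have "3 * (ennreal (8 * K * a * (1 + t') powr - b) * ?Q) = ennreal (24 * K * a * (1 + t') powr - b) * ?Q"
    proof -
      have "3 * (ennreal (8 * K * a * (1 + t') powr - b) * ?Q) = (ennreal 3 * ennreal (8 * K * a * (1 + t') powr - b)) * ?Q"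
        by (simp add: mult.assoc)
      also have "ennreal 3 * ennreal (8 * K * a * (1 + t') powr - b) = ennreal (24 * K * a * (1 + t') powr - b)"
        using a_pos by (simp del: ennreal_numeral flip: ennreal_mult)
      finally show ?thesis .
    qed
    also have "ennreal (3 * C * (1 + t') powr - b) + ennreal (144 * K * C * ?W * (1 + t') powr - b) \<le> ennreal (?c * (1 + t') powr - b)"
      using C_nonneg a_pos by (subst ennreal_plus[symmetric]) (auto intro!: ennreal_leI simp: algebra_simps)
    finally show ?thesis by (simp add: add_right_mono)
  qed
  note bound = this
  have "24 * K * a \<le> 1 / 2" using small by linarith
  moreover have "?c \<ge> 0" using C_nonneg a_pos nonneg by linarith
  ultimately show ?thesis
    using weighted_sup_absorb[OF b(1) _ bound \<open>0 \<le> t\<close> order_refl] by simp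
qed

theorem Y_decay:
  assumes "0 \<le> t"
  shows "Y t \<le> ennreal ((6 * C + 2 * (3 * C + 144 * K * C * (4 * a + 96 * C) + 8 * a)) * (1 + t) powr - min \<theta> 1)"
proof (cases "\<theta> \<le> 3/4")
  case True
  have "Y t \<le> ennreal (6 * C * (1 + t) powr - min \<theta> 1)"
    using True \<theta>_pos assms by (intro decay_slow) auto
  also have "\<dots> \<le> ennreal ((6 * C + 2 * (3 * C + 144 * K * C * (4 * a + 96 * C) + 8 * a)) * (1 + t) powr - min \<theta> 1)"
    using C_nonneg a_pos by (intro ennreal_leI mult_right_mono) auto
  finally show ?thesis .
next
  case False
  have "Y t \<le> ennreal (2 * (3 * C + 144 * K * C * (4 * a + 96 * C) + 8 * a) * (1 + t) powr - min \<theta> 1)"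
    using False \<theta>_pos assms by (intro decay_fast) auto
  also have "\<dots> \<le> ennreal ((6 * C + 2 * (3 * C + 144 * K * C * (4 * a + 96 * C) + 8 * a)) * (1 + t) powr - min \<theta> 1)"
    using C_nonneg by (intro ennreal_leI mult_right_mono) auto
  finally show ?thesis .
qed

end

subsection \<open>The convolution estimate\<close>

lemma nn_integral_lborel_affine:
  fixes g :: "'a::euclidean_space \<Rightarrow> ennreal"
  assumes [measurable]: "g \<in> borel_measurable borel" and "c \<noteq> 0"
  shows "(NNI x. g x) = ennreal (\<bar>c\<bar> ^ DIM('a)) * (NNI x. g (t + c *\<^sub>R x))"
proof -
  have "(NNI x. g x) = (\<integral>\<^sup>+x. g x \<partial>density (distr lborel borel (\<lambda>x. t + c *\<^sub>R x)) (\<lambda>_. ennreal (\<bar>c\<bar> ^ DIM('a))))"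
    using lborel_affine[OF assms(2), of t] by simp
  also have "\<dots> = (NNI x. ennreal (\<bar>c\<bar> ^ DIM('a)) * g (t + c *\<^sub>R x))"
    by (simp add: nn_integral_density nn_integral_distr)
  also have "\<dots> = ennreal (\<bar>c\<bar> ^ DIM('a)) * (NNI x. g (t + c *\<^sub>R x))"
    by (rule nn_integral_cmult) measurable
  finally show ?thesis .
qed

lemma nn_integral_lborel_reflect:
  fixes g :: "'a::euclidean_space \<Rightarrow> ennreal"
  assumes "g \<in> borel_measurable borel"
  shows "(NNI x. g (t - x)) = (NNI x. g x)"
  using nn_integral_lborel_affine[OF assms, of "-1" t] by simp

lemma nn_integral_lborel_translate:
  fixes g :: "'a::euclidean_space \<Rightarrow> ennreal"
  assumes "g \<in> borel_measurable borel"
  shows "(NNI x. g (x + t)) = (NNI x. g x)"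
  using nn_integral_lborel_affine[OF assms, of 1 t] by (simp add: add.commute)

lemma ennreal_le_suminf: "f k \<le> (\<Sum>k. f k)" for f :: "nat \<Rightarrow> ennreal"
  using sum_le_suminf[of f "{k}"] by simp

lemma emeasure_ball_power2:
  "emeasure lborel (ball (0::'a::euclidean_space) (2 powr a)) = ennreal (unit_ball_vol (DIM('a)) * 2 powr (a * DIM('a)))"
  by (subst emeasure_ball) (auto simp: powr_powr simp flip: powr_realpow)

text \<open>Dyadic shells in place of polar coordinates: the shell between \<open>2 ^ k\<close> and
  \<open>2 ^ (k + 1)\<close> is enlarged to a ball, which leaves a geometric series of ratio
  1/2.\<close>

lemma nn_integral_outer_power:
  "(NNI (x::'a::euclidean_space). ennreal (1 / norm x ^ (DIM('a) + 1)) * indicator (- ball 0 1) x)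
     \<le> ennreal (unit_ball_vol (DIM('a)) * 2 ^ (DIM('a) + 1))"
proof -
  let ?n = "DIM('a)"
  let ?b = "\<lambda>k x::'a. ennreal (2 powr (- (real k * (?n + 1)))) * indicator (ball 0 (2 powr (real k + 1))) x"
  have "(NNI (x::'a). ennreal (1 / norm x ^ (?n + 1)) * indicator (- ball 0 1) x) \<le> (NNI x. (\<Sum>k. ?b k x))"
  proof (rule nn_integral_mono)
    fix x :: 'a
    show "ennreal (1 / norm x ^ (?n + 1)) * indicator (- ball 0 1) x \<le> (\<Sum>k. ?b k x)"
    proof (cases "norm x \<ge> 1")
      case True
      define k where "k = nat \<lfloor>log 2 (norm x)\<rfloor>"
      have "norm x > 0" using True by linarith
      hence l: "log 2 (norm x) \<ge> 0" using True by (simp only: zero_le_log_cancel_iff)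
      have k: "real k \<le> log 2 (norm x)" "log 2 (norm x) < real k + 1"
        using l by (auto simp: k_def)
      have n: "2 powr (log 2 (norm x)) = norm x" using True by (intro powr_log_cancel) auto
      have "2 powr real k \<le> norm x" by (subst n[symmetric]) (intro powr_mono k, simp)
      have "norm x < 2 powr (real k + 1)" by (subst n[symmetric]) (intro powr_less_mono k, simp)
      have "2 powr (real k * (?n + 1)) = (2 powr real k) ^ (?n + 1)"
        by (subst powr_realpow[symmetric], simp, subst powr_powr, simp)
      also have "\<dots> \<le> norm x ^ (?n + 1)" using \<open>2 powr real k \<le> norm x\<close> by (intro power_mono) auto
      finally have "1 / norm x ^ (?n + 1) \<le> 1 / 2 powr (real k * (?n + 1))"
        by (intro divide_left_mono mult_pos_pos zero_less_power) (use \<open>norm x > 0\<close> in auto)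
      also have "\<dots> = 2 powr (- (real k * (?n + 1)))" by (simp add: powr_minus_divide)
      finally have "ennreal (1 / norm x ^ (?n + 1)) * indicator (- ball 0 1) x \<le> ?b k x"
        using True \<open>norm x < 2 powr (real k + 1)\<close> by (auto intro!: ennreal_leI)
      also have "\<dots> \<le> (\<Sum>k. ?b k x)"
        by (rule ennreal_le_suminf)
      finally show ?thesis .
    qed auto
  qed
  also have "\<dots> = (\<Sum>k. \<integral>\<^sup>+x. ?b k x \<partial>lborel)"
    by (intro nn_integral_suminf borel_measurable_times_ennreal borel_measurable_const borel_measurable_indicator) simp
  also have "\<dots> = (\<Sum>k. ennreal (unit_ball_vol ?n * 2 ^ ?n * (1/2) ^ k))"
  proof (rule suminf_cong)
    fix k :: nat
    have "(NNI x. ?b k x) = ennreal (2 powr (- (real k * (?n + 1)))) * ennreal (unit_ball_vol ?n * 2 powr ((real k + 1) * ?n))"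
      by (subst nn_integral_cmult_indicator) (simp_all only: emeasure_ball_power2 sets_lborel open_ball borel_open)
    also have "\<dots> = ennreal (unit_ball_vol ?n * (2 powr (- (real k * (?n + 1))) * 2 powr ((real k + 1) * ?n)))"
      by (simp add: ac_simps flip: ennreal_mult)
    also have "2 powr (- (real k * (?n + 1))) * 2 powr ((real k + 1) * ?n) = 2 ^ ?n * (1/2) ^ k"
      by (simp add: algebra_simps power_one_over powr_minus_divide powr_realpow flip: powr_add)
         (simp add: powr_diff powr_realpow)
    finally show "(NNI x. ?b k x) = ennreal (unit_ball_vol ?n * 2 ^ ?n * (1/2) ^ k)" by (simp only: mult.assoc)
  qed
  also have "\<dots> = ennreal (\<Sum>k. unit_ball_vol ?n * 2 ^ ?n * (1/2) ^ k)"
    by (intro suminf_ennreal2 summable_mult summable_geometric) auto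
  also have "(\<Sum>k. unit_ball_vol ?n * 2 ^ ?n * (1/2) ^ k) = unit_ball_vol ?n * 2 ^ ?n * (\<Sum>k. (1/2) ^ k)"
    by (intro suminf_mult summable_geometric) auto
  also have "(\<Sum>k. (1/2::real) ^ k) = 2" by (subst suminf_geometric) auto
  finally show ?thesis by (simp add: ac_simps)
qed

text \<open>The same with shells shrinking to the origin: the volume, of order \<open>8 ^ k\<close>
  in the denominator, beats the singularity of order \<open>4 ^ k\<close>. At the origin itself the
  integrand is 0, as \<open>1 / 0 = 0\<close>.\<close>

lemma nn_integral_inner_square:
  "(NNI (x::real^3). ennreal (1 / (norm x)^2) * indicator (ball 0 1) x) \<le> ennreal (unit_ball_vol 3 * 8)"
proof -
  let ?b = "\<lambda>k x::real^3. ennreal (2 powr (2 * (real k + 1))) * indicator (ball 0 (2 powr (- real k))) x"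
  have "(NNI (x::real^3). ennreal (1 / (norm x)^2) * indicator (ball 0 1) x) \<le> (NNI x. (\<Sum>k. ?b k x))"
  proof (rule nn_integral_mono)
    fix x :: "real^3"
    show "ennreal (1 / (norm x)^2) * indicator (ball 0 1) x \<le> (\<Sum>k. ?b k x)"
    proof (cases "x \<noteq> 0 \<and> norm x < 1")
      case True
      define k where "k = nat (- \<lfloor>log 2 (norm x)\<rfloor> - 1)"
      have "log 2 (norm x) < 0" using True by simp
      hence "\<lfloor>log 2 (norm x)\<rfloor> < 0" by simp
      hence rk: "real k = - real_of_int \<lfloor>log 2 (norm x)\<rfloor> - 1" by (simp add: k_def)
      have k: "- real k - 1 \<le> log 2 (norm x)" "log 2 (norm x) < - real k"
        unfolding rk by linarith+
      have n: "2 powr (log 2 (norm x)) = norm x" using True by (intro powr_log_cancel) auto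
      have 1: "2 powr (- real k - 1) \<le> norm x" by (subst n[symmetric]) (intro powr_mono k, simp)
      have 2: "norm x < 2 powr (- real k)" by (subst n[symmetric]) (intro powr_less_mono k, simp)
      have "1 / (norm x)^2 \<le> 1 / (2 powr (- real k - 1))^2"
        using True 1 by (intro divide_left_mono power_mono) auto
      also have "(2 powr (- real k - 1))^2 = 2 powr (- (2 * (real k + 1)))"
        by (simp add: power2_eq_square flip: powr_add)
      also have "1 / \<dots> = 2 powr (2 * (real k + 1))" by (subst powr_minus_divide) simp
      finally have "ennreal (1 / (norm x)^2) * indicator (ball 0 1) x \<le> ?b k x"
        using True 2 by (auto intro!: ennreal_leI)
      also have "\<dots> \<le> (\<Sum>k. ?b k x)"
        by (rule ennreal_le_suminf)
      finally show ?thesis .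
    qed auto
  qed
  also have "\<dots> = (\<Sum>k. \<integral>\<^sup>+x. ?b k x \<partial>lborel)"
    by (intro nn_integral_suminf borel_measurable_times_ennreal borel_measurable_const borel_measurable_indicator) simp
  also have "\<dots> = (\<Sum>k. ennreal (unit_ball_vol 3 * 4 * (1/2) ^ k))"
  proof (rule suminf_cong)
    fix k :: nat
    have e: "emeasure lborel (ball (0::real^3) (2 powr - real k)) = ennreal (unit_ball_vol 3 * 2 powr ((- real k) * 3))"
      using emeasure_ball_power2[where 'a = "real^3", of "- real k"] by simp
    have "(NNI x. ?b k x) = ennreal (2 powr (2 * (real k + 1))) * ennreal (unit_ball_vol 3 * 2 powr ((- real k) * 3))"
      by (subst nn_integral_cmult_indicator) (simp_all only: e sets_lborel open_ball borel_open)
    also have "\<dots> = ennreal (unit_ball_vol 3 * (2 powr (2 * (real k + 1)) * 2 powr ((- real k) * 3)))"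
      by (simp add: ac_simps flip: ennreal_mult)
    also have "2 powr (2 * (real k + 1)) * 2 powr ((- real k) * 3) = 2 powr (2 - real k)"
      by (simp add: algebra_simps flip: powr_add)
    also have "2 powr (2 - real k) = 4 * (1/2) ^ k"
      by (simp add: powr_diff powr_realpow power_one_over)
    finally show "(NNI x. ?b k x) = ennreal (unit_ball_vol 3 * 4 * (1/2) ^ k)" by (simp only: mult.assoc)
  qed
  also have "\<dots> = ennreal (\<Sum>k. unit_ball_vol 3 * 4 * (1/2) ^ k)"
    by (intro suminf_ennreal2 summable_mult summable_geometric) auto
  also have "(\<Sum>k. unit_ball_vol 3 * 4 * (1/2) ^ k) = unit_ball_vol 3 * 4 * (\<Sum>k. (1/2) ^ k)"
    by (intro suminf_mult summable_geometric) auto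
  also have "(\<Sum>k. (1/2::real) ^ k) = 2" by (subst suminf_geometric) auto
  finally show ?thesis by (simp add: ac_simps)
qed

text \<open>The 96 is \<open>2 * 24 * 2\<close>: two symmetric contributions of 24 unit ball volumes
  each, divided by \<open>norm \<xi> / 2\<close>.\<close>

definition kernel_const :: real where "kernel_const = unit_ball_vol 3 * 96"

lemma kernel_const_pos: "kernel_const > 0"
  unfolding kernel_const_def by (intro mult_pos_pos unit_ball_vol_pos) auto

text \<open>Of \<open>\<eta>\<close> and \<open>\<xi> - \<eta>\<close>, the one with the larger norm
  has norm at least \<open>norm \<xi> / 2\<close>. So the integrand is bounded by a function
  \<open>H c\<close> of the nearer point alone, and scaling reduces \<open>H c\<close> to
  \<open>H 1\<close>, whose integral is at most \<open>8 + 16\<close> unit ball volumes.\<close>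

lemma nn_integral_kernel:
  fixes \<xi> :: "real^3"
  assumes "\<xi> \<noteq> 0"
  shows "(NNI \<eta>. ennreal (1 / ((norm \<eta>)^2 * (norm (\<xi> - \<eta>))^2))) \<le> ennreal (kernel_const / norm \<xi>)"
proof -
  define c where "c = norm \<xi> / 2"
  have c: "c > 0" using assms by (simp add: c_def)
  define H where "H = (\<lambda>d (\<eta>::real^3). ennreal (1 / ((norm \<eta>)^2 * (max d (norm \<eta>))^2)))"
  have [measurable]: "H d \<in> borel_measurable borel" for d unfolding H_def by measurable
  have le: "ennreal (1 / ((norm \<eta>)^2 * (norm (\<xi> - \<eta>))^2)) \<le> H c \<eta> + H c (\<xi> - \<eta>)" for \<eta>
  proof -
    have tri: "norm \<xi> \<le> norm \<eta> + norm (\<xi> - \<eta>)" using norm_triangle_ineq[of \<eta> "\<xi> - \<eta>"] by simp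
    have *: "1 / (x^2 * y^2) \<le> 1 / (x^2 * (max c x)^2)" if "0 \<le> x" "x \<le> y" "norm \<xi> \<le> x + y" for x y :: real
    proof (cases "x = 0")
      case False
      have "max c x \<le> y" using that c by (auto simp: c_def)
      hence "(max c x)^2 \<le> y^2" using c by (intro power_mono) auto
      thus ?thesis using False c that
        by (intro divide_left_mono mult_left_mono) (auto simp: max_def)
    qed simp
    show ?thesis
    proof (cases "norm \<eta> \<le> norm (\<xi> - \<eta>)")
      case True
      have "ennreal (1 / ((norm \<eta>)^2 * (norm (\<xi> - \<eta>))^2)) \<le> H c \<eta>"
        unfolding H_def using True tri by (intro ennreal_leI *) auto
      thus ?thesis by (simp add: add_increasing2)
    next
      case False
      have "ennreal (1 / ((norm (\<xi> - \<eta>))^2 * (norm \<eta>)^2)) \<le> H c (\<xi> - \<eta>)"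
        unfolding H_def using False tri by (intro ennreal_leI *) auto
      thus ?thesis by (simp add: add_increasing mult.commute)
    qed
  qed
  have "(NNI \<eta>. ennreal (1 / ((norm \<eta>)^2 * (norm (\<xi> - \<eta>))^2))) \<le> (NNI \<eta>. H c \<eta> + H c (\<xi> - \<eta>))"
    by (intro nn_integral_mono le)
  also have "\<dots> = (NNI \<eta>. H c \<eta>) + (NNI \<eta>. H c (\<xi> - \<eta>))"
    by (rule nn_integral_add) measurable
  also have "(NNI \<eta>. H c (\<xi> - \<eta>)) = (NNI \<eta>. H c \<eta>)"
    by (rule nn_integral_lborel_reflect) measurable
  also have "(NNI \<eta>. H c \<eta>) = ennreal (c ^ 3) * (NNI \<eta>. H c (c *\<^sub>R \<eta>))"
    using nn_integral_lborel_affine[of "H c" c 0] c by simp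
  also have "(NNI \<eta>. H c (c *\<^sub>R \<eta>)) = (NNI \<eta>. ennreal (1 / c ^ 4) * H 1 \<eta>)"
  proof (rule nn_integral_cong)
    fix \<eta> :: "real^3"
    have "max c (c * norm \<eta>) = c * max 1 (norm \<eta>)" using c by (simp add: max_mult_distrib_left)
    hence "1 / ((norm (c *\<^sub>R \<eta>))^2 * (max c (norm (c *\<^sub>R \<eta>)))^2) = 1 / c ^ 4 * (1 / ((norm \<eta>)^2 * (max 1 (norm \<eta>))^2))"
      using c by (simp add: power_mult_distrib eval_nat_numeral mult_ac)
    thus "H c (c *\<^sub>R \<eta>) = ennreal (1 / c ^ 4) * H 1 \<eta>"
      unfolding H_def using c by (simp only:) (simp flip: ennreal_mult)
  qed
  also have "\<dots> = ennreal (1 / c ^ 4) * (NNI \<eta>. H 1 \<eta>)"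
    by (rule nn_integral_cmult) measurable
  also have "(NNI \<eta>. H 1 \<eta>) \<le> ennreal (unit_ball_vol 3 * 24)"
  proof -
    have [measurable]: "ball (0::real^3) 1 \<in> sets borel" by simp
    have "(NNI \<eta>. H 1 \<eta>) \<le> (NNI (\<eta>::real^3). ennreal (1 / (norm \<eta>)^2) * indicator (ball 0 1) \<eta>
       + ennreal (1 / (norm \<eta>) ^ 4) * indicator (- ball 0 1) \<eta>)"
      unfolding H_def by (intro nn_integral_mono) (auto split: split_indicator simp: max_def simp flip: power_add)
    also have "\<dots> = (NNI (\<eta>::real^3). ennreal (1 / (norm \<eta>)^2) * indicator (ball 0 1) \<eta>)
       + (NNI (\<eta>::real^3). ennreal (1 / (norm \<eta>) ^ 4) * indicator (- ball 0 1) \<eta>)"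
      by (rule nn_integral_add) measurable
    also have "\<dots> \<le> ennreal (unit_ball_vol 3 * 8) + ennreal (unit_ball_vol 3 * 16)"
      using nn_integral_outer_power[where 'a = "real^3"]
      by (intro add_mono nn_integral_inner_square) simp
    also have "\<dots> = ennreal (unit_ball_vol 3 * 24)"
      by (subst ennreal_plus[symmetric]) auto
    finally show ?thesis .
  qed
  also have "ennreal (c ^ 3) * (ennreal (1 / c ^ 4) * ennreal (unit_ball_vol 3 * 24)) = ennreal (unit_ball_vol 3 * 24 / c)"
    using c by (subst ennreal_mult[symmetric], simp, simp, subst ennreal_mult[symmetric]) (auto simp: eval_nat_numeral)
  also have "ennreal (unit_ball_vol 3 * 24 / c) + ennreal (unit_ball_vol 3 * 24 / c) = ennreal (kernel_const / norm \<xi>)"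
    using c by (subst ennreal_plus[symmetric]) (auto simp: c_def kernel_const_def field_simps)
  finally show ?thesis by (simp add: mult_left_mono add_mono)
qed

definition nnconv :: "('a::euclidean_space \<Rightarrow> ennreal) \<Rightarrow> ('a \<Rightarrow> ennreal) \<Rightarrow> 'a \<Rightarrow> ennreal" where
  "nnconv v w \<xi> = (NNI \<eta>. v \<eta> * w (\<xi> - \<eta>))"

lemma nnconv_measurable [measurable]:
  assumes [measurable]: "v \<in> borel_measurable borel" "w \<in> borel_measurable borel"
  shows "nnconv v w \<in> borel_measurable borel"
  unfolding nnconv_def[abs_def] by measurable

lemma nn_integral_nnconv:
  fixes v w :: "'a::euclidean_space \<Rightarrow> ennreal"
  assumes [measurable]: "v \<in> borel_measurable borel" "w \<in> borel_measurable borel"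
  shows "(NNI \<xi>. nnconv v w \<xi>) = (NNI \<eta>. v \<eta>) * (NNI \<eta>. w \<eta>)"
proof -
  have "(NNI \<xi>. nnconv v w \<xi>) = (NNI \<eta>. (NNI \<xi>. v \<eta> * w (\<xi> - \<eta>)))"
    unfolding nnconv_def by (rule lborel_pair.Fubini') measurable
  also have "\<dots> = (NNI \<eta>. v \<eta> * (NNI \<xi>. w \<xi>))"
  proof (rule nn_integral_cong)
    fix \<eta> :: 'a
    have "(NNI \<xi>. v \<eta> * w (\<xi> - \<eta>)) = v \<eta> * (NNI \<xi>. w (\<xi> + (- \<eta>)))"
      by (simp add: nn_integral_cmult)
    also have "(NNI \<xi>. w (\<xi> + (- \<eta>))) = (NNI \<xi>. w \<xi>)"
      by (rule nn_integral_lborel_translate) measurable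
    finally show "(NNI \<xi>. v \<eta> * w (\<xi> - \<eta>)) = v \<eta> * (NNI \<xi>. w \<xi>)" .
  qed
  also have "\<dots> = (NNI \<eta>. v \<eta>) * (NNI \<eta>. w \<eta>)"
    by (rule nn_integral_multc) measurable
  finally show ?thesis .
qed

text \<open>The weight \<open>norm \<xi>\<close> on the left cancels exactly the factor
  \<open>1 / norm \<xi>\<close> of \<open>nn_integral_kernel\<close>. The right side is again a
  convolution and therefore integrates to a product.\<close>

lemma nnconv_sq_le:
  fixes v w :: "real^3 \<Rightarrow> ennreal"
  assumes [measurable]: "v \<in> borel_measurable borel" "w \<in> borel_measurable borel"
  shows "ennreal (norm \<xi>) * (nnconv v w \<xi>)^2 \<le> 
    ennreal kernel_const * nnconv (\<lambda>\<eta>. ennorm2 \<eta> * (v \<eta>)^2) (\<lambda>\<eta>. ennorm2 \<eta> * (w \<eta>)^2) \<xi>"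
proof (cases "\<xi> = 0")
  case False
  let ?N = "nnconv (\<lambda>\<eta>. ennorm2 \<eta> * (v \<eta>)^2) (\<lambda>\<eta>. ennorm2 \<eta> * (w \<eta>)^2) \<xi>"
  have "AE \<eta> in lborel. \<eta> \<noteq> (0 :: real^3)" "AE \<eta> in lborel. \<eta> \<noteq> \<xi>"
    by (rule AE_lborel_singleton)+
  hence "nnconv v w \<xi> = (NNI \<eta>. ennreal (1 / (norm \<eta> * norm (\<xi> - \<eta>))) * ((ennreal (norm \<eta>) * v \<eta>) * (ennreal (norm (\<xi> - \<eta>)) * w (\<xi> - \<eta>))))"
    unfolding nnconv_def
  proof (intro nn_integral_cong_AE, eventually_elim)
    fix \<eta> assume \<eta>: "\<eta> \<noteq> 0" "\<eta> \<noteq> \<xi>"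
    have "ennreal (1 / (norm \<eta> * norm (\<xi> - \<eta>))) * ((ennreal (norm \<eta>) * v \<eta>) * (ennreal (norm (\<xi> - \<eta>)) * w (\<xi> - \<eta>)))
      = (ennreal (1 / (norm \<eta> * norm (\<xi> - \<eta>))) * (ennreal (norm \<eta>) * ennreal (norm (\<xi> - \<eta>)))) * (v \<eta> * w (\<xi> - \<eta>))"
      by (simp only: ac_simps)
    also have "ennreal (1 / (norm \<eta> * norm (\<xi> - \<eta>))) * (ennreal (norm \<eta>) * ennreal (norm (\<xi> - \<eta>))) = 1"
      using \<eta> by (simp flip: ennreal_mult)
    finally show "v \<eta> * w (\<xi> - \<eta>) = ennreal (1 / (norm \<eta> * norm (\<xi> - \<eta>))) * ((ennreal (norm \<eta>) * v \<eta>) * (ennreal (norm (\<xi> - \<eta>)) * w (\<xi> - \<eta>)))"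
      by simp
  qed
  hence "(nnconv v w \<xi>)^2 \<le> (NNI \<eta>. (ennreal (1 / (norm \<eta> * norm (\<xi> - \<eta>))))^2)
     * (NNI \<eta>. ((ennreal (norm \<eta>) * v \<eta>) * (ennreal (norm (\<xi> - \<eta>)) * w (\<xi> - \<eta>)))^2)"
    by (simp only:) (rule Cauchy_Schwarz_nn_integral, measurable)
  also have "(NNI \<eta>. (ennreal (1 / (norm \<eta> * norm (\<xi> - \<eta>))))^2) = (NNI \<eta>. ennreal (1 / ((norm \<eta>)^2 * (norm (\<xi> - \<eta>))^2)))"
    by (intro nn_integral_cong) (simp add: ennreal_power power_divide power_mult_distrib)
  also have "(NNI \<eta>. ((ennreal (norm \<eta>) * v \<eta>) * (ennreal (norm (\<xi> - \<eta>)) * w (\<xi> - \<eta>)))^2) = ?N"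
    unfolding nnconv_def by (intro nn_integral_cong) (simp add: power_mult_distrib ennreal_power)
  finally have "(nnconv v w \<xi>)^2 \<le> (NNI \<eta>. ennreal (1 / ((norm \<eta>)^2 * (norm (\<xi> - \<eta>))^2))) * ?N" .
  also have "\<dots> \<le> ennreal (kernel_const / norm \<xi>) * ?N"
    by (intro mult_right_mono nn_integral_kernel False) auto
  finally have "ennreal (norm \<xi>) * (nnconv v w \<xi>)^2 \<le> ennreal (norm \<xi>) * (ennreal (kernel_const / norm \<xi>) * ?N)"
    by (intro mult_left_mono) auto
  also have "\<dots> = ennreal (norm \<xi> * (kernel_const / norm \<xi>)) * ?N"
    using kernel_const_pos by (subst ennreal_mult) (auto simp: mult.assoc)
  finally show ?thesis using False by simp
qed simp

text \<open>In physical space this is the product law in dimension 3 that sends two functions of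
  order 1 to one of order 1/2.\<close>

theorem nn_integral_nnconv_sq:
  fixes v w :: "real^3 \<Rightarrow> ennreal"
  assumes [measurable]: "v \<in> borel_measurable borel" "w \<in> borel_measurable borel"
  shows "(NNI \<xi>. ennreal (norm \<xi>) * (nnconv v w \<xi>)^2) \<le> 
    ennreal kernel_const * ((NNI \<eta>. ennorm2 \<eta> * (v \<eta>)^2) * (NNI \<eta>. ennorm2 \<eta> * (w \<eta>)^2))"
proof -
  have "(NNI \<xi>. ennreal (norm \<xi>) * (nnconv v w \<xi>)^2) \<le> (NNI \<xi>. ennreal kernel_const * 
     nnconv (\<lambda>\<eta>. ennorm2 \<eta> * (v \<eta>)^2) (\<lambda>\<eta>. ennorm2 \<eta> * (w \<eta>)^2) \<xi>)"
    by (intro nn_integral_mono nnconv_sq_le assms)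
  thus ?thesis by (simp add: nn_integral_cmult nn_integral_nnconv)
qed

lemma integral_lborel_affine:
  fixes g :: "'a::euclidean_space \<Rightarrow> 'b::{banach, second_countable_topology}"
  assumes [measurable]: "g \<in> borel_measurable borel" and c: "c \<noteq> 0"
  shows "(LINT x|lborel. g (t + c *\<^sub>R x)) = (1 / \<bar>c\<bar> ^ DIM('a)) *\<^sub>R (LINT x|lborel. g x)"
proof -
  have "(LINT x|lborel. g x) = (LINT x|density (distr lborel borel (\<lambda>x. t + c *\<^sub>R x)) (\<lambda>_. ennreal (\<bar>c\<bar> ^ DIM('a))). g x)"
    using lborel_affine[OF c, of t] by simp
  also have "\<dots> = \<bar>c\<bar> ^ DIM('a) *\<^sub>R (LINT x|lborel. g (t + c *\<^sub>R x))"
    by (simp add: integral_density integral_distr)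
  finally show ?thesis using c by simp
qed

lemma integrable_lborel_affine:
  fixes g :: "'a::euclidean_space \<Rightarrow> 'b::{banach, second_countable_topology}"
  assumes g: "integrable lborel g" and c: "c \<noteq> 0"
  shows "integrable lborel (\<lambda>x. g (t + c *\<^sub>R x))"
proof -
  have [measurable]: "g \<in> borel_measurable borel" using g by auto
  have "integrable (density (distr lborel borel (\<lambda>x. t + c *\<^sub>R x)) (\<lambda>_. ennreal (\<bar>c\<bar> ^ DIM('a)))) g"
    using g lborel_affine[OF c, of t] by simp
  hence "integrable lborel (\<lambda>x. \<bar>c\<bar> ^ DIM('a) *\<^sub>R g (t + c *\<^sub>R x))"
    by (simp add: integrable_density integrable_distr_eq)
  from integrable_scaleR_right[OF this, of "1 / \<bar>c\<bar> ^ DIM('a)"] show ?thesis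
    using c by simp
qed

subsection \<open>Rapidly decreasing functions\<close>

text \<open>Schwartz decay without derivatives. Transforms of Schwartz functions are shown to be of
  this kind only, which is why several integrability statements below are made for all
  \<open>rapid\<close> functions.\<close>

definition rapid :: "('a::euclidean_space \<Rightarrow> complex) \<Rightarrow> bool" where
  "rapid \<phi> \<longleftrightarrow> \<phi> \<in> borel_measurable borel \<and> (\<forall>N::nat. \<exists>M. \<forall>x. (1 + norm x) ^ N * norm (\<phi> x) \<le> M)"

lemma rapid_measurable: "rapid \<phi> \<Longrightarrow> \<phi> \<in> borel_measurable borel"
  by (simp add: rapid_def)

lemma rapid_bound:
  assumes "rapid \<phi>"
  obtains M where "M > 0" "\<And>x. (1 + norm x) ^ N * norm (\<phi> x) \<le> M"
proof -
  obtain M where M: "\<And>x. (1 + norm x) ^ N * norm (\<phi> x) \<le> M" using assms by (auto simp: rapid_def)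
  show ?thesis by (rule that[of "max M 1"]) (use M in \<open>auto simp: le_max_iff_disj\<close>)
qed

lemma rapid_bounded:
  assumes "rapid \<phi>"
  obtains M where "M > 0" "\<And>x. norm (\<phi> x) \<le> M"
  using rapid_bound[OF assms, of 0] by auto

lemma integrable_decay: "integrable lborel (\<lambda>x::'a::euclidean_space. 1 / (1 + norm x) ^ (DIM('a) + 1))"
proof (rule integrableI_nonneg)
  have [measurable]: "ball (0::'a) 1 \<in> sets borel" by simp
  have "(NNI x. ennreal (1 / (1 + norm (x::'a)) ^ (DIM('a) + 1))) \<le>
    (NNI (x::'a). indicator (ball 0 1) x + ennreal (1 / norm x ^ (DIM('a) + 1)) * indicator (- ball 0 1) x)"
  proof (rule nn_integral_mono)
    fix x :: 'a
    show "ennreal (1 / (1 + norm x) ^ (DIM('a) + 1)) \<le> indicator (ball 0 1) x + ennreal (1 / norm x ^ (DIM('a) + 1)) * indicator (- ball 0 1) x"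
    proof (cases "norm x < 1")
      case True
      have "1 / (1 + norm x) ^ (DIM('a) + 1) \<le> 1 / 1" 
        by (intro divide_left_mono one_le_power mult_pos_pos zero_less_power) (auto simp: add_pos_nonneg)
      thus ?thesis using True by (simp add: ennreal_le_1)
    next
      case False
      hence "norm x > 0" by linarith
      hence "1 / (1 + norm x) ^ (DIM('a) + 1) \<le> 1 / norm x ^ (DIM('a) + 1)"
        by (intro divide_left_mono power_mono mult_pos_pos zero_less_power) (auto simp: add_pos_nonneg)
      thus ?thesis using False by (simp add: ennreal_leI)
    qed
  qed
  also have "\<dots> = (NNI x. indicator (ball (0::'a) 1) x) + 
     (NNI (x::'a). ennreal (1 / norm x ^ (DIM('a) + 1)) * indicator (- ball 0 1) x)"
    by (rule nn_integral_add) measurable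
  also have "\<dots> < \<infinity>"
    using nn_integral_outer_power[where 'a = 'a] by (auto simp: emeasure_ball less_top[symmetric] top_unique)
  finally show "(NNI x. ennreal (1 / (1 + norm (x::'a)) ^ (DIM('a) + 1))) < \<infinity>" .
qed auto

lemma rapid_times_bounded:
  assumes "rapid \<phi>" and [measurable]: "g \<in> borel_measurable borel" and B: "\<And>x. norm (g x) \<le> B"
  shows "rapid (\<lambda>x. g x * \<phi> x)"
  unfolding rapid_def
proof (intro conjI allI)
  show "(\<lambda>x. g x * \<phi> x) \<in> borel_measurable borel" using rapid_measurable[OF assms(1)] by measurable
  fix N
  obtain M where M: "M > 0" "\<And>x. (1 + norm x) ^ N * norm (\<phi> x) \<le> M" using rapid_bound[OF assms(1)] by blast
  have "B \<ge> 0" using B[of 0] norm_ge_zero order_trans by blast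
  have "(1 + norm x) ^ N * norm (g x * \<phi> x) \<le> B * M" for x
  proof -
    have "norm (g x) * ((1 + norm x) ^ N * norm (\<phi> x)) \<le> B * M"
      by (intro mult_mono B M) (use \<open>B \<ge> 0\<close> in auto)
    thus ?thesis by (simp add: norm_mult mult_ac)
  qed
  thus "\<exists>M. \<forall>x. (1 + norm x) ^ N * norm (g x * \<phi> x) \<le> M" by blast
qed

lemma rapid_integrable:
  assumes "rapid \<phi>" shows "integrable lborel (\<phi> :: 'a::euclidean_space \<Rightarrow> complex)"
proof -
  obtain M where M: "M > 0" "\<And>x. (1 + norm x) ^ (DIM('a) + 1) * norm (\<phi> x) \<le> M" using rapid_bound[OF assms] by blast
  have "integrable lborel (\<lambda>x::'a. M * (1 / (1 + norm x) ^ (DIM('a) + 1)))"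
    by (intro integrable_mult_right integrable_decay)
  thus ?thesis
  proof (rule Bochner_Integration.integrable_bound)
    show "AE x in lborel. norm (\<phi> x) \<le> norm (M * (1 / (1 + norm x) ^ (DIM('a) + 1)))"
    proof (rule AE_I2)
      fix x :: 'a
      have "(1 + norm x) ^ (DIM('a) + 1) > 0" by (intro zero_less_power) (auto simp: add_pos_nonneg)
      hence "norm (\<phi> x) \<le> M / (1 + norm x) ^ (DIM('a) + 1)"
        using M(2)[of x] by (subst pos_le_divide_eq) (auto simp: mult.commute)
      thus "norm (\<phi> x) \<le> norm (M * (1 / (1 + norm x) ^ (DIM('a) + 1)))" 
        using M(1) by simp
    qed
  qed (use rapid_measurable[OF assms] in auto)
qed

lemma cnj_measurable [measurable]: "cnj \<in> borel_measurable borel"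
  by (intro borel_measurable_continuous_onI continuous_intros)

lemma rapid_cnj_sq: "rapid \<phi> \<Longrightarrow> rapid (\<lambda>x. cnj (\<phi> x) * \<phi> x)"
proof -
  assume *: "rapid \<phi>"
  have [measurable]: "\<phi> \<in> borel_measurable borel" using * by (rule rapid_measurable)
  obtain M where "\<And>x. norm (\<phi> x) \<le> M" using rapid_bounded[OF *] by blast
  thus ?thesis by (intro rapid_times_bounded[OF *, where B = M]) auto
qed

lemma rapid_L2:
  assumes "rapid \<phi>" shows "(NNI x. ennorm2 (\<phi> x)) < \<infinity>"
proof -
  have "integrable lborel (\<lambda>x. cnj (\<phi> x) * \<phi> x)" by (intro rapid_integrable rapid_cnj_sq assms)
  hence "(NNI x. ennreal (norm (cnj (\<phi> x) * \<phi> x))) < \<infinity>" by (simp add: integrable_iff_bounded)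
  thus ?thesis by (simp add: norm_mult power2_eq_square)
qed

subsection \<open>Schwartz functions\<close>

lemma iterated_partial_append: "iterated_partial bs (iterated_partial cs f) = iterated_partial (bs @ cs) f"
  by (induction bs) auto

lemma schwartz_partial:
  fixes \<phi> :: "real^'n \<Rightarrow> complex"
  assumes "schwartz \<phi>" "b \<in> Basis"
  shows "schwartz (iterated_partial [b] \<phi>)"
  unfolding schwartz_def
proof
  fix bs :: "(real^'n) list" assume "bs \<in> lists Basis"
  hence "bs @ [b] \<in> lists Basis" using assms by auto
  with assms(1)[unfolded schwartz_def, rule_format, of "bs @ [b]"]
  show "(\<forall>x. iterated_partial bs (iterated_partial [b] \<phi>) differentiable at x) \<and>
       (\<forall>N::nat. \<exists>M. \<forall>x. (1 + norm x) ^ N * cmod (iterated_partial bs (iterated_partial [b] \<phi>) x) \<le> M)"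
    unfolding iterated_partial_append by auto
qed

lemma schwartz_differentiable: "schwartz \<phi> \<Longrightarrow> \<phi> differentiable (at x)"
  unfolding schwartz_def by (drule bspec[where x = "[]"]) simp_all

lemma schwartz_continuous: "schwartz \<phi> \<Longrightarrow> continuous_on A \<phi>"
  by (intro continuous_at_imp_continuous_on ballI differentiable_imp_continuous_within schwartz_differentiable)

lemma schwartz_rapid:
  assumes "schwartz \<phi>" shows "rapid \<phi>"
  unfolding rapid_def
proof
  show "\<phi> \<in> borel_measurable borel"
    by (intro borel_measurable_continuous_onI schwartz_continuous assms)
  have "[] \<in> lists Basis" by simp
  with assms[unfolded schwartz_def, rule_format, of "[]"]
  show "\<forall>N. \<exists>M. \<forall>x. (1 + norm x) ^ N * cmod (\<phi> x) \<le> M" by simp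
qed

text \<open>The sign treats the transform (\<open>\<sigma> = -1\<close>) and, up to a power of
  \<open>2 * pi\<close>, its inverse (\<open>\<sigma> = 1\<close>) at once. Over
  \<open>lborel\<close>, the measurability of parameter integrals and Fubini's theorem apply
  directly.\<close>

definition ft :: "real \<Rightarrow> ('a::euclidean_space \<Rightarrow> complex) \<Rightarrow> 'a \<Rightarrow> complex" where
  "ft \<sigma> f \<xi> = (LINT x|lborel. cis (\<sigma> * (x \<bullet> \<xi>)) * f x)"

lemma fourier_integral_ft:
  assumes [measurable]: "\<phi> \<in> borel_measurable borel"
  shows "fourier_integral \<phi> = ft (-1) \<phi>"
proof
  fix \<xi>
  have "fourier_integral \<phi> \<xi> = (LINT x|lborel. exp (- \<i> * of_real (x \<bullet> \<xi>)) * \<phi> x)"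
    unfolding fourier_integral_def by (rule integral_completion) measurable
  also have "\<dots> = ft (-1) \<phi> \<xi>"
    unfolding ft_def by (intro Bochner_Integration.integral_cong) (auto simp: cis_conv_exp)
  finally show "fourier_integral \<phi> \<xi> = ft (-1) \<phi> \<xi>" .
qed

lemma cis_measurable [measurable]: "cis \<in> borel_measurable borel"
  by (intro borel_measurable_continuous_onI continuous_intros)

lemma ft_measurable [measurable]:
  assumes [measurable]: "f \<in> borel_measurable borel"
  shows "ft \<sigma> f \<in> borel_measurable borel"
  unfolding ft_def[abs_def] by measurable

lemma integrable_cis_times:
  assumes "integrable lborel f"
  shows "integrable lborel (\<lambda>x. cis (\<sigma> * (x \<bullet> \<xi>)) * f x)"
proof -
  have [measurable]: "f \<in> borel_measurable borel" using assms by auto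
  show ?thesis
    by (rule Bochner_Integration.integrable_bound[OF assms]) (auto simp: norm_mult)
qed

lemma ft_bound: "norm (ft \<sigma> f \<xi>) \<le> (LINT x|lborel. norm (f x))"
  unfolding ft_def using integral_norm_bound[of lborel "\<lambda>x. cis (\<sigma> * (x \<bullet> \<xi>)) * f x"]
  by (simp add: norm_mult)

lemma vector_derivative_quotient:
  assumes "(f has_vector_derivative D) (at 0)"
  shows "((\<lambda>h. (f h - f 0) /\<^sub>R h) \<longlongrightarrow> D) (at 0)"
proof -
  have "((\<lambda>h. norm (f h - f 0 - h *\<^sub>R D) / norm h) \<longlongrightarrow> 0) (at 0)"
    using assms by (simp add: has_vector_derivative_def has_derivative_iff_norm)
  moreover have "eventually (\<lambda>h. norm (f h - f 0 - h *\<^sub>R D) / norm h = norm ((f h - f 0) /\<^sub>R h - D)) (at 0)"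
    unfolding eventually_at_filter
  proof (intro always_eventually allI impI)
    fix h :: real assume h: "h \<noteq> 0"
    have "(f h - f 0) /\<^sub>R h - D = (f h - f 0 - h *\<^sub>R D) /\<^sub>R h"
      using h by (simp add: scaleR_diff_right)
    thus "norm (f h - f 0 - h *\<^sub>R D) / norm h = norm ((f h - f 0) /\<^sub>R h - D)"
      by (simp add: divide_inverse mult.commute)
  qed
  ultimately have "((\<lambda>h. norm ((f h - f 0) /\<^sub>R h - D)) \<longlongrightarrow> 0) (at 0)"
    by (rule Lim_transform_eventually)
  thus ?thesis by (simp only: tendsto_norm_zero_iff LIM_zero_iff)
qed

lemma cis_vector_derivative:
  "((\<lambda>h. cis (h * y)) has_vector_derivative \<i> * of_real y) (at 0)"
proof -
  have "((\<lambda>z. exp (\<i> * (z * of_real y))) has_field_derivative \<i> * of_real y) (at (of_real 0))"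
    by (auto intro!: derivative_eq_intros)
  from has_vector_derivative_real_field[OF this, of UNIV] show ?thesis
    by (simp add: cis_conv_exp)
qed

text \<open>Integration by parts, obtained by differentiating under the integral the translation
  invariance of Lebesgue measure.\<close>

lemma ft_partial:
  fixes \<phi> :: "real^'n \<Rightarrow> complex"
  assumes S: "schwartz \<phi>" and b: "b \<in> Basis"
  shows "ft \<sigma> (iterated_partial [b] \<phi>) \<xi> = - \<i> * of_real (\<sigma> * (b \<bullet> \<xi>)) * ft \<sigma> \<phi> \<xi>"
proof -
  define D where "D = iterated_partial [b] \<phi>"
  have [measurable]: "\<phi> \<in> borel_measurable borel" by (intro rapid_measurable schwartz_rapid S)
  have [measurable]: "D \<in> borel_measurable borel" unfolding D_def by (intro rapid_measurable schwartz_rapid schwartz_partial S b)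
  have nb: "norm b = 1" using b by simp
  have der: "((\<lambda>h. \<phi> (x + h *\<^sub>R b)) has_vector_derivative D (x + h *\<^sub>R b)) (at h)" for x and h :: real
  proof -
    have "(\<phi> has_derivative frechet_derivative \<phi> (at (x + h *\<^sub>R b))) (at (x + h *\<^sub>R b))"
      using schwartz_differentiable[OF S] by (simp add: frechet_derivative_works)
    moreover have "((\<lambda>h. x + h *\<^sub>R b) has_derivative (\<lambda>h. h *\<^sub>R b)) (at h)"
      by (auto intro!: derivative_eq_intros)
    ultimately have *: "((\<lambda>h. \<phi> (x + h *\<^sub>R b)) has_derivative (\<lambda>k. frechet_derivative \<phi> (at (x + h *\<^sub>R b)) (k *\<^sub>R b))) (at h)"
      by (rule has_derivative_compose[rotated])
    have "linear (frechet_derivative \<phi> (at (x + h *\<^sub>R b)))"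
      using schwartz_differentiable[OF S] by (rule linear_frechet_derivative)
    thus ?thesis using * by (simp add: has_vector_derivative_def D_def linear_scale)
  qed
  obtain M where M: "M > 0" "\<And>x. (1 + norm x) ^ (CARD('n) + 1) * norm (D x) \<le> M"
    using rapid_bound[OF schwartz_rapid[OF schwartz_partial[OF S b]], of "CARD('n) + 1"] unfolding D_def by blast
  let ?q = "\<lambda>h x. (\<phi> (x + h *\<^sub>R b) - \<phi> x) /\<^sub>R h"
  let ?h = "\<lambda>n. 1 / real (Suc n)"
  let ?dom = "\<lambda>x::real^'n. M * 2 ^ (CARD('n) + 1) * (1 / (1 + norm x) ^ (CARD('n) + 1))"
  \<comment> \<open>A shift by at most 1 changes \<open>1 + norm x\<close> by a factor of at most 2;
    this gives a dominating function independent of \<open>h\<close>.\<close>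
  have Dbound: "norm (D (x + h *\<^sub>R b)) \<le> ?dom x" if "0 \<le> h" "h \<le> 1" for x :: "real^'n" and h
  proof -
    have "norm x \<le> norm (x + h *\<^sub>R b) + norm (h *\<^sub>R b)"
      using norm_triangle_ineq4[of "x + h *\<^sub>R b" "h *\<^sub>R b"] by simp
    moreover have "norm (h *\<^sub>R b) \<le> 1" using that nb by simp
    moreover have "1 + p \<le> 2 * (1 + q)" if "p \<le> q + s" "s \<le> 1" "0 \<le> q" for p q s :: real
      using that by argo
    ultimately have "1 + norm x \<le> 2 * (1 + norm (x + h *\<^sub>R b))" by (meson norm_ge_zero)
    hence "(1 + norm x) ^ (CARD('n) + 1) \<le> (2 * (1 + norm (x + h *\<^sub>R b))) ^ (CARD('n) + 1)"
      by (intro power_mono) auto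
    hence "(1 + norm x) ^ (CARD('n) + 1) * norm (D (x + h *\<^sub>R b)) \<le> (2 * (1 + norm (x + h *\<^sub>R b))) ^ (CARD('n) + 1) * norm (D (x + h *\<^sub>R b))"
      by (intro mult_right_mono) auto
    also have "\<dots> = 2 ^ (CARD('n) + 1) * ((1 + norm (x + h *\<^sub>R b)) ^ (CARD('n) + 1) * norm (D (x + h *\<^sub>R b)))"
      by (simp only: power_mult_distrib mult.assoc)
    also have "\<dots> \<le> 2 ^ (CARD('n) + 1) * M" by (intro mult_left_mono M) auto
    finally have "(1 + norm x) ^ (CARD('n) + 1) * norm (D (x + h *\<^sub>R b)) \<le> 2 ^ (CARD('n) + 1) * M" .
    moreover have "(1 + norm x) ^ (CARD('n) + 1) > 0" by (intro zero_less_power) (auto simp: add_pos_nonneg)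
    ultimately show ?thesis by (simp add: field_simps)
  qed
  have qbound: "norm (?q h x) \<le> ?dom x" if h: "0 < h" "h \<le> 1" for x h
  proof -
    have "norm (\<phi> (x + h *\<^sub>R b) - \<phi> (x + 0 *\<^sub>R b)) \<le> ?dom x * norm (h - 0)"
    proof (rule differentiable_bound[where S = "{0..h}" and f' = "\<lambda>y k. k *\<^sub>R D (x + y *\<^sub>R b)"])
      fix y assume y: "y \<in> {0..h}"
      show "((\<lambda>h. \<phi> (x + h *\<^sub>R b)) has_derivative (\<lambda>k. k *\<^sub>R D (x + y *\<^sub>R b))) (at y within {0..h})"
        using der[of x y] by (simp add: has_vector_derivative_def has_derivative_at_withinI)
      show "onorm (\<lambda>k. k *\<^sub>R D (x + y *\<^sub>R b)) \<le> ?dom x"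
      proof (rule onorm_bound)
        fix k :: real
        have "\<bar>k\<bar> * norm (D (x + y *\<^sub>R b)) \<le> \<bar>k\<bar> * ?dom x"
          using y h by (intro mult_left_mono Dbound) auto
        thus "norm (k *\<^sub>R D (x + y *\<^sub>R b)) \<le> ?dom x * norm k"
          unfolding norm_scaleR real_norm_def by (simp only: mult.commute)
      qed (use M in simp)
    qed (use h in auto)
    hence "norm (\<phi> (x + h *\<^sub>R b) - \<phi> x) \<le> ?dom x * h"
      using h by (simp only: scaleR_zero_left add_0_right diff_0_right real_norm_def abs_of_pos)
    moreover have "norm (?q h x) = norm (\<phi> (x + h *\<^sub>R b) - \<phi> x) / h"
      unfolding norm_scaleR using h by (simp add: divide_inverse mult.commute)
    ultimately show ?thesis using h by (simp only: pos_divide_le_eq)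
  qed
  have dom: "integrable lborel ?dom"
    using integrable_decay[where 'a = "real^'n"] by (intro integrable_mult_right) simp
  have h0: "?h \<longlonglongrightarrow> 0" by real_asymp
  have lim1: "(\<lambda>n. LINT x|lborel. cis (\<sigma> * (x \<bullet> \<xi>)) * ?q (?h n) x) \<longlonglongrightarrow> ft \<sigma> D \<xi>"
    unfolding ft_def
  proof (rule integral_dominated_convergence[OF _ _ dom])
    show "AE x in lborel. (\<lambda>n. cis (\<sigma> * (x \<bullet> \<xi>)) * ?q (?h n) x) \<longlonglongrightarrow> cis (\<sigma> * (x \<bullet> \<xi>)) * D x"
    proof (intro AE_I2 tendsto_mult tendsto_const)
      fix x
      have "((\<lambda>h. \<phi> (x + h *\<^sub>R b)) has_vector_derivative D x) (at 0)" using der[of x 0] by simp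
      hence "((\<lambda>h. ?q h x) \<longlongrightarrow> D x) (at 0)"
        using vector_derivative_quotient[of "\<lambda>h. \<phi> (x + h *\<^sub>R b)"] by simp
      thus "(\<lambda>n. ?q (?h n) x) \<longlonglongrightarrow> D x"
        by (rule filterlim_compose) (use h0 in \<open>auto simp: filterlim_at\<close>)
    qed
    show "AE x in lborel. norm (cis (\<sigma> * (x \<bullet> \<xi>)) * ?q (?h n) x) \<le> ?dom x" for n
      using qbound[of "?h n"] by (auto simp: norm_mult)
  qed measurable
  \<comment> \<open>Translation invariance moves the difference quotient from \<open>\<phi>\<close>
    to the character, where its limit is explicit.\<close>
  have eqh: "(LINT x|lborel. cis (\<sigma> * (x \<bullet> \<xi>)) * ?q h x) = ((cis (h * (- \<sigma> * (b \<bullet> \<xi>))) - 1) / of_real h) * ft \<sigma> \<phi> \<xi>" for h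
  proof -
    have int: "integrable lborel (\<lambda>x. cis (\<sigma> * (x \<bullet> \<xi>)) * \<phi> x)"
      by (intro integrable_cis_times rapid_integrable schwartz_rapid S)
    have 1: "integrable lborel (\<lambda>x. cis (- \<sigma> * h * (b \<bullet> \<xi>)) * (cis (\<sigma> * ((h *\<^sub>R b + 1 *\<^sub>R x) \<bullet> \<xi>)) * \<phi> (h *\<^sub>R b + 1 *\<^sub>R x)))"
      by (intro integrable_mult_right integrable_lborel_affine int) simp
    have eq: "cis (- \<sigma> * h * (b \<bullet> \<xi>)) * (cis (\<sigma> * ((h *\<^sub>R b + 1 *\<^sub>R x) \<bullet> \<xi>)) * \<phi> (h *\<^sub>R b + 1 *\<^sub>R x)) = cis (\<sigma> * (x \<bullet> \<xi>)) * \<phi> (x + h *\<^sub>R b)" for x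
    proof -
      have "- \<sigma> * h * (b \<bullet> \<xi>) + \<sigma> * ((h *\<^sub>R b + 1 *\<^sub>R x) \<bullet> \<xi>) = \<sigma> * (x \<bullet> \<xi>)"
        by (simp add: inner_add_left distrib_left)
      thus ?thesis by (simp only: mult.assoc[symmetric] cis_mult scaleR_one add.commute[of "h *\<^sub>R b"])
    qed
    have "(LINT x|lborel. cis (\<sigma> * (x \<bullet> \<xi>)) * \<phi> (x + h *\<^sub>R b)) = cis (- \<sigma> * h * (b \<bullet> \<xi>)) * ft \<sigma> \<phi> \<xi>"
      unfolding eq[symmetric] ft_def
      using integral_lborel_affine[of "\<lambda>x. cis (\<sigma> * (x \<bullet> \<xi>)) * \<phi> x" 1 "h *\<^sub>R b"] by simp
    moreover have "(LINT x|lborel. cis (\<sigma> * (x \<bullet> \<xi>)) * ?q h x) = (LINT x|lborel. cis (\<sigma> * (x \<bullet> \<xi>)) * \<phi> (x + h *\<^sub>R b) - cis (\<sigma> * (x \<bullet> \<xi>)) * \<phi> x) /\<^sub>R h"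
      unfolding integral_scaleR_right[symmetric] by (intro Bochner_Integration.integral_cong) (auto simp: algebra_simps)
    moreover have "(LINT x|lborel. cis (\<sigma> * (x \<bullet> \<xi>)) * \<phi> (x + h *\<^sub>R b) - cis (\<sigma> * (x \<bullet> \<xi>)) * \<phi> x)
       = (LINT x|lborel. cis (\<sigma> * (x \<bullet> \<xi>)) * \<phi> (x + h *\<^sub>R b)) - ft \<sigma> \<phi> \<xi>"
      unfolding ft_def using 1 int by (intro Bochner_Integration.integral_diff) (simp_all only: eq)
    moreover have "(c * F - F) /\<^sub>R h = ((c - 1) / of_real h) * F" for c F :: complex
      by (simp add: scaleR_conv_of_real divide_inverse left_diff_distrib right_diff_distrib mult.commute)
    moreover have "- \<sigma> * h * (b \<bullet> \<xi>) = h * (- \<sigma> * (b \<bullet> \<xi>))" by simp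
    ultimately show ?thesis by (simp only:)
  qed
  have lim1': "(\<lambda>n. ((cis (?h n * (- \<sigma> * (b \<bullet> \<xi>))) - 1) / of_real (?h n)) * ft \<sigma> \<phi> \<xi>) \<longlonglongrightarrow> ft \<sigma> D \<xi>"
    using lim1 unfolding eqh .
  have "((\<lambda>h. cis (h * (- \<sigma> * (b \<bullet> \<xi>)))) has_vector_derivative \<i> * of_real (- \<sigma> * (b \<bullet> \<xi>))) (at 0)"
    by (rule cis_vector_derivative)
  hence "((\<lambda>h. (cis (h * (- \<sigma> * (b \<bullet> \<xi>))) - 1) / of_real h) \<longlongrightarrow> \<i> * of_real (- \<sigma> * (b \<bullet> \<xi>))) (at 0)"
  proof -
    assume "((\<lambda>h. cis (h * (- \<sigma> * (b \<bullet> \<xi>)))) has_vector_derivative \<i> * of_real (- \<sigma> * (b \<bullet> \<xi>))) (at 0)"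
    from vector_derivative_quotient[OF this]
    have "((\<lambda>h. (cis (h * (- \<sigma> * (b \<bullet> \<xi>))) - 1) /\<^sub>R h) \<longlongrightarrow> \<i> * of_real (- \<sigma> * (b \<bullet> \<xi>))) (at 0)"
      by (simp only: mult_zero_left cis_zero)
    moreover have "z /\<^sub>R h = z / of_real h" for z :: complex and h
      by (simp add: scaleR_conv_of_real divide_inverse)
    ultimately show ?thesis by (simp only:)
  qed
  hence "(\<lambda>n. (cis (?h n * (- \<sigma> * (b \<bullet> \<xi>))) - 1) / of_real (?h n)) \<longlonglongrightarrow> \<i> * of_real (- \<sigma> * (b \<bullet> \<xi>))"
    by (rule filterlim_compose) (use h0 in \<open>auto simp: filterlim_at\<close>)
  hence "(\<lambda>n. ((cis (?h n * (- \<sigma> * (b \<bullet> \<xi>))) - 1) / of_real (?h n)) * ft \<sigma> \<phi> \<xi>) \<longlonglongrightarrow> \<i> * of_real (- \<sigma> * (b \<bullet> \<xi>)) * ft \<sigma> \<phi> \<xi>"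
    by (intro tendsto_mult tendsto_const)
  with lim1' have "ft \<sigma> D \<xi> = \<i> * of_real (- \<sigma> * (b \<bullet> \<xi>)) * ft \<sigma> \<phi> \<xi>" by (rule LIMSEQ_unique)
  thus ?thesis by (simp add: D_def)
qed

text \<open>Each integration by parts in a direction \<open>b\<close> trades a derivative for a
  factor \<open>b \<bullet> \<xi>\<close>. The largest coordinate controls the norm up to the
  dimension, so repeated derivatives in a single direction are enough.\<close>

lemma ft_rapid:
  fixes \<phi> :: "real^'n \<Rightarrow> complex"
  assumes S: "schwartz \<phi>"
  shows "rapid (ft (-1) \<phi>)"
proof -
  have [measurable]: "\<phi> \<in> borel_measurable borel" by (intro rapid_measurable schwartz_rapid S)
  have comp: "\<exists>M. \<forall>\<xi>. \<bar>b \<bullet> \<xi>\<bar> ^ N * norm (ft (-1) \<psi> \<xi>) \<le> M"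
    if b: "b \<in> Basis" and "schwartz \<psi>" for b N and \<psi> :: "real^'n \<Rightarrow> complex"
    using that(2)
  proof (induction N arbitrary: \<psi>)
    case 0
    thus ?case using ft_bound[of "-1" \<psi>] by auto
  next
    case (Suc N)
    from Suc.IH[OF schwartz_partial[OF Suc.prems b]] obtain M where
      M: "\<And>\<xi>. \<bar>b \<bullet> \<xi>\<bar> ^ N * norm (ft (-1) (iterated_partial [b] \<psi>) \<xi>) \<le> M" by auto
    have "\<bar>b \<bullet> \<xi>\<bar> ^ Suc N * norm (ft (-1) \<psi> \<xi>) \<le> M" for \<xi>
      using M[of \<xi>] unfolding ft_partial[OF Suc.prems b] by (simp add: norm_mult mult_ac)
    thus ?case by blast
  qed
  show ?thesis unfolding rapid_def
  proof (intro conjI allI)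
    fix N :: nat
    obtain M where M: "\<And>b \<xi>. b \<in> Basis \<Longrightarrow> \<bar>b \<bullet> \<xi>\<bar> ^ N * norm (ft (-1) \<phi> \<xi>) \<le> M b"
      using comp[OF _ S, of _ N] by metis
    define M0 where "M0 = (LINT x|lborel. norm (\<phi> x))"
    have M0: "norm (ft (-1) \<phi> \<xi>) \<le> M0" for \<xi> unfolding M0_def by (rule ft_bound)
    let ?n = "CARD('n)"
    let ?M = "2 ^ N * (M0 + real ?n ^ N * (\<Sum>b\<in>Basis. \<bar>M b\<bar>))"
    have "(1 + norm \<xi>) ^ N * norm (ft (-1) \<phi> \<xi>) \<le> ?M" for \<xi>
    proof -
      let ?F = "norm (ft (-1) \<phi> \<xi>)"
      obtain b where b: "b \<in> Basis" "\<And>c. c \<in> Basis \<Longrightarrow> \<bar>c \<bullet> \<xi>\<bar> \<le> \<bar>b \<bullet> \<xi>\<bar>"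
      proof -
        have "Max ((\<lambda>c. \<bar>c \<bullet> \<xi>\<bar>) ` Basis) \<in> (\<lambda>c. \<bar>c \<bullet> \<xi>\<bar>) ` Basis" by (intro Max_in) auto
        then obtain b where b: "b \<in> Basis" "Max ((\<lambda>c. \<bar>c \<bullet> \<xi>\<bar>) ` Basis) = \<bar>b \<bullet> \<xi>\<bar>" by (elim imageE)
        show ?thesis by (rule that[OF b(1)], unfold b(2)[symmetric]) (intro Max_ge, auto)
      qed
      have "norm \<xi> \<le> (\<Sum>c\<in>Basis. \<bar>\<xi> \<bullet> c\<bar>)" by (rule norm_le_l1)
      also have "\<dots> \<le> (\<Sum>c\<in>(Basis :: (real^'n) set). \<bar>b \<bullet> \<xi>\<bar>)" using b(2) by (intro sum_mono) (simp add: inner_commute)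
      finally have n: "norm \<xi> \<le> real ?n * \<bar>b \<bullet> \<xi>\<bar>" by simp
      have "norm \<xi> ^ N * ?F \<le> (real ?n * \<bar>b \<bullet> \<xi>\<bar>) ^ N * ?F"
        by (intro mult_right_mono power_mono n) auto
      also have "\<dots> = real ?n ^ N * (\<bar>b \<bullet> \<xi>\<bar> ^ N * ?F)" by (simp add: power_mult_distrib mult.assoc)
      also have "\<dots> \<le> real ?n ^ N * (\<Sum>b\<in>Basis. \<bar>M b\<bar>)"
      proof (intro mult_left_mono)
        have "\<bar>b \<bullet> \<xi>\<bar> ^ N * ?F \<le> \<bar>M b\<bar>" using M[OF b(1), of \<xi>] by linarith
        also have "\<dots> \<le> (\<Sum>b\<in>Basis. \<bar>M b\<bar>)" using b(1) by (intro member_le_sum) auto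
        finally show "\<bar>b \<bullet> \<xi>\<bar> ^ N * ?F \<le> (\<Sum>b\<in>Basis. \<bar>M b\<bar>)" .
      qed auto
      finally have 1: "norm \<xi> ^ N * ?F \<le> real ?n ^ N * (\<Sum>b\<in>Basis. \<bar>M b\<bar>)" .
      have "(1 + norm \<xi>) ^ N \<le> (2 * max 1 (norm \<xi>)) ^ N" by (intro power_mono) auto
      also have "\<dots> \<le> 2 ^ N * (1 + norm \<xi> ^ N)" by (auto simp: power_mult_distrib max_def)
      finally have "(1 + norm \<xi>) ^ N * ?F \<le> 2 ^ N * (1 + norm \<xi> ^ N) * ?F" by (intro mult_right_mono) auto
      also have "\<dots> = 2 ^ N * (?F + norm \<xi> ^ N * ?F)" by (simp add: algebra_simps)
      also have "\<dots> \<le> ?M" by (intro mult_left_mono add_mono 1 M0) auto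
      finally show ?thesis .
    qed
    thus "\<exists>M. \<forall>\<xi>. (1 + norm \<xi>) ^ N * norm (ft (-1) \<phi> \<xi>) \<le> M" by blast
  qed measurable
qed

subsection \<open>Gaussians\<close>

text \<open>A Gaussian with width parameter \<open>a\<close>, centre \<open>b\<close> and modulation
  \<open>c\<close>. Transforms of modulated Gaussians are translated ones, so the family provides
  test functions on both sides of the transform.\<close>

definition gauss :: "real \<Rightarrow> 'a::euclidean_space \<Rightarrow> 'a \<Rightarrow> 'a \<Rightarrow> complex" where
  "gauss a b c x = of_real (exp (- a * (norm (x - b))^2)) * cis (c \<bullet> x)"

lemma gauss_measurable [measurable]: "gauss a b c \<in> borel_measurable borel"
  unfolding gauss_def[abs_def] by measurable

lemma norm_gauss: "norm (gauss a b c x) = exp (- a * (norm (x - b))^2)"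
  by (simp add: gauss_def norm_mult)

lemma power_times_gaussian_bounded:
  assumes "a > 0"
  obtains M where "\<And>t::real. t \<ge> 0 \<Longrightarrow> (1 + t) ^ N * exp (- a * t^2) \<le> M"
proof -
  have "((\<lambda>t::real. (1 + t) ^ N * exp (- a * t^2)) \<longlongrightarrow> 0) at_top"
    using assms by real_asymp
  hence "eventually (\<lambda>t. (1 + t) ^ N * exp (- a * t^2) < 1) at_top"
    by (rule order_tendstoD) simp
  then obtain T where T: "\<And>t. t \<ge> T \<Longrightarrow> (1 + t) ^ N * exp (- a * t^2) < 1"
    by (auto simp: eventually_at_top_linorder)
  show ?thesis
  proof (rule that)
    fix t :: real assume t: "t \<ge> 0"
    show "(1 + t) ^ N * exp (- a * t^2) \<le> max 1 ((1 + \<bar>T\<bar>) ^ N)"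
    proof (cases "t \<ge> T")
      case True
      show ?thesis by (rule max.coboundedI1) (use T[OF True] in linarith)
    next
      case False
      have "(1 + t) ^ N * exp (- a * t^2) \<le> (1 + \<bar>T\<bar>) ^ N * 1"
        using False t assms by (intro mult_mono power_mono) auto
      thus ?thesis by simp
    qed
  qed
qed

lemma gauss_rapid:
  fixes b :: "'a::euclidean_space"
  assumes "a > 0" shows "rapid (gauss a b c)"
  unfolding rapid_def
proof (intro conjI allI)
  fix N :: nat
  obtain M where M: "\<And>t::real. t \<ge> 0 \<Longrightarrow> (1 + t) ^ N * exp (- a * t^2) \<le> M"
    using power_times_gaussian_bounded[OF assms] by blast
  have "(1 + norm x) ^ N * norm (gauss a b c x) \<le> (1 + norm b) ^ N * M" for x
  proof -
    have "norm x \<le> norm (x - b) + norm b" using norm_triangle_ineq[of "x - b" b] by simp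
    moreover have "1 + (p + q) \<le> (1 + q) * (1 + p)" if "p \<ge> 0" "q \<ge> 0" for p q :: real
      using that by (simp add: distrib_left distrib_right)
    from this[of "norm (x - b)" "norm b"]
    have "1 + (norm (x - b) + norm b) \<le> (1 + norm b) * (1 + norm (x - b))" by simp
    ultimately have "1 + norm x \<le> (1 + norm b) * (1 + norm (x - b))" by linarith
    hence "(1 + norm x) ^ N \<le> ((1 + norm b) * (1 + norm (x - b))) ^ N" by (intro power_mono) auto
    hence "(1 + norm x) ^ N * norm (gauss a b c x) \<le> ((1 + norm b) * (1 + norm (x - b))) ^ N * norm (gauss a b c x)"
      by (rule mult_right_mono) simp
    also have "\<dots> = (1 + norm b) ^ N * ((1 + norm (x - b)) ^ N * exp (- a * (norm (x - b))^2))"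
      by (simp only: power_mult_distrib norm_gauss mult.assoc)
    also have "\<dots> \<le> (1 + norm b) ^ N * M" by (intro mult_left_mono M) auto
    finally show ?thesis .
  qed
  thus "\<exists>M. \<forall>x. (1 + norm x) ^ N * norm (gauss a b c x) \<le> M" by blast
qed measurable

text \<open>The prefactors that arise when a Gaussian is differentiated. The inductive form makes
  polynomial growth and closure under derivatives plain inductions.\<close>

inductive poly_fun :: "(real^'n \<Rightarrow> complex) \<Rightarrow> bool" where
  const: "poly_fun (\<lambda>x. k)"
| linear: "poly_fun (\<lambda>x. of_real (x \<bullet> v))"
| add: "poly_fun p \<Longrightarrow> poly_fun q \<Longrightarrow> poly_fun (\<lambda>x. p x + q x)"
| mult: "poly_fun p \<Longrightarrow> poly_fun q \<Longrightarrow> poly_fun (\<lambda>x. p x * q x)"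

lemma poly_fun_growth:
  assumes "poly_fun p"
  shows "\<exists>M k. M \<ge> 0 \<and> (\<forall>x. norm (p x) \<le> M * (1 + norm x) ^ k)"
  using assms
proof induction
  case (const k)
  show ?case by (intro exI[of _ "norm k"] exI[of _ 0]) auto
next
  case (linear v)
  show ?case
  proof (intro exI[of _ "norm v"] exI[of _ "1::nat"] conjI allI)
    fix x
    have "\<bar>x \<bullet> v\<bar> \<le> norm x * norm v" by (rule Cauchy_Schwarz_ineq2)
    thus "norm (complex_of_real (x \<bullet> v)) \<le> norm v * (1 + norm x) ^ 1" 
      by (simp add: algebra_simps add_increasing)
  qed simp
next
  case (add p q)
  then obtain M k M' k' where *: "M \<ge> 0" "\<And>x. norm (p x) \<le> M * (1 + norm x) ^ k"
    "M' \<ge> 0" "\<And>x. norm (q x) \<le> M' * (1 + norm x) ^ k'" by blast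
  show ?case
  proof (intro exI[of _ "M + M'"] exI[of _ "k + k'"] conjI allI)
    fix x
    have "norm (p x + q x) \<le> M * (1 + norm x) ^ k + M' * (1 + norm x) ^ k'"
      using *(2)[of x] *(4)[of x] norm_triangle_ineq[of "p x" "q x"] by linarith
    also have "\<dots> \<le> M * (1 + norm x) ^ (k + k') + M' * (1 + norm x) ^ (k + k')"
      using * by (intro add_mono mult_left_mono power_increasing) auto
    finally show "norm (p x + q x) \<le> (M + M') * (1 + norm x) ^ (k + k')" by (simp add: distrib_right)
  qed (use * in auto)
next
  case (mult p q)
  then obtain M k M' k' where *: "M \<ge> 0" "\<And>x. norm (p x) \<le> M * (1 + norm x) ^ k"
    "M' \<ge> 0" "\<And>x. norm (q x) \<le> M' * (1 + norm x) ^ k'" by blast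
  show ?case
  proof (intro exI[of _ "M * M'"] exI[of _ "k + k'"] conjI allI)
    fix x
    have "norm (p x * q x) \<le> (M * (1 + norm x) ^ k) * (M' * (1 + norm x) ^ k')"
      unfolding norm_mult using * by (intro mult_mono) auto
    thus "norm (p x * q x) \<le> (M * M') * (1 + norm x) ^ (k + k')" by (simp add: power_add mult_ac)
  qed (use * in auto)
qed

lemma poly_fun_derivative:
  assumes "poly_fun p"
  shows "\<exists>D. (\<forall>x. (p has_derivative D x) (at x)) \<and> (\<forall>v. poly_fun (\<lambda>x. D x v))"
  using assms
proof induction
  case (const k)
  show ?case by (intro exI[of _ "\<lambda>x v. 0"]) (auto intro: poly_fun.const)
next
  case (linear w)
  show ?case
    by (intro exI[of _ "\<lambda>x v. of_real (v \<bullet> w)"]) (auto intro!: poly_fun.const derivative_eq_intros)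
next
  case (add p q)
  then obtain D D' where *: "\<And>x. (p has_derivative D x) (at x)" "\<And>v. poly_fun (\<lambda>x. D x v)"
    "\<And>x. (q has_derivative D' x) (at x)" "\<And>v. poly_fun (\<lambda>x. D' x v)" by blast
  show ?case
    by (intro exI[of _ "\<lambda>x v. D x v + D' x v"]) (auto intro!: poly_fun.add * has_derivative_add)
next
  case (mult p q)
  then obtain D D' where *: "\<And>x. (p has_derivative D x) (at x)" "\<And>v. poly_fun (\<lambda>x. D x v)"
    "\<And>x. (q has_derivative D' x) (at x)" "\<And>v. poly_fun (\<lambda>x. D' x v)" by blast
  show ?case
    by (intro exI[of _ "\<lambda>x v. p x * D' x v + D x v * q x"])
       (auto intro!: poly_fun.add poly_fun.mult mult.hyps * has_derivative_mult)
qed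

lemma gauss_derivative:
  fixes b c :: "real^'n"
  shows "(gauss a b c has_derivative (\<lambda>v. (of_real (- 2 * a * ((x - b) \<bullet> v)) + \<i> * of_real (c \<bullet> v)) * gauss a b c x)) (at x)"
proof -
  have eq: "gauss a b c = (\<lambda>x. exp (of_real (- a * ((x - b) \<bullet> (x - b))) + \<i> * of_real (c \<bullet> x)))"
    by (simp only: fun_eq_iff gauss_def exp_add cis_conv_exp exp_of_real power2_norm_eq_inner) simp
  have "((\<lambda>x. of_real (- a * ((x - b) \<bullet> (x - b))) + \<i> * of_real (c \<bullet> x)) has_derivative 
     (\<lambda>v. of_real (- 2 * a * ((x - b) \<bullet> v)) + \<i> * of_real (c \<bullet> v))) (at x)"
    by (auto intro!: derivative_eq_intros simp: inner_commute algebra_simps)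
  from has_derivative_compose[OF this DERIV_exp[unfolded has_field_derivative_def]] show ?thesis
    unfolding eq by (simp add: mult.commute)
qed

lemma iterated_partial_gauss:
  fixes b c :: "real^'n"
  assumes "poly_fun q"
  shows "\<exists>p. poly_fun p \<and> iterated_partial bs (\<lambda>x. q x * gauss a b c x) = (\<lambda>x. p x * gauss a b c x)"
proof (induction bs)
  case Nil
  show ?case using assms by auto
next
  case (Cons v bs)
  then obtain p where p: "poly_fun p" "iterated_partial bs (\<lambda>x. q x * gauss a b c x) = (\<lambda>x. p x * gauss a b c x)" by auto
  obtain D where D: "\<And>x. (p has_derivative D x) (at x)" "\<And>v. poly_fun (\<lambda>x. D x v)"
    using poly_fun_derivative[OF p(1)] by blast
  let ?L = "\<lambda>x. of_real (- 2 * a * ((x - b) \<bullet> v)) + \<i> * of_real (c \<bullet> v)"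
  have L: "poly_fun ?L"
  proof -
    have "?L = (\<lambda>x. (of_real (x \<bullet> ((- 2 * a) *\<^sub>R v)) + (of_real (2 * a * (b \<bullet> v)) + \<i> * of_real (c \<bullet> v))))"
      by (auto simp: fun_eq_iff inner_diff_left algebra_simps)
    thus ?thesis by (simp only:) (intro poly_fun.add poly_fun.linear poly_fun.const)
  qed
  have "((\<lambda>x. p x * gauss a b c x) has_derivative (\<lambda>v. p x * ((of_real (- 2 * a * ((x - b) \<bullet> v)) + \<i> * of_real (c \<bullet> v)) * gauss a b c x) + D x v * gauss a b c x)) (at x)" for x
    by (intro has_derivative_mult D gauss_derivative)
  hence "frechet_derivative (\<lambda>x. p x * gauss a b c x) (at x) = (\<lambda>v. p x * ((of_real (- 2 * a * ((x - b) \<bullet> v)) + \<i> * of_real (c \<bullet> v)) * gauss a b c x) + D x v * gauss a b c x)" for x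
    by (rule frechet_derivative_at[symmetric])
  hence "iterated_partial (v # bs) (\<lambda>x. q x * gauss a b c x) = (\<lambda>x. (p x * ?L x + D x v) * gauss a b c x)"
    by (simp add: p(2) fun_eq_iff distrib_right mult.assoc)
  moreover have "poly_fun (\<lambda>x. p x * ?L x + D x v)"
    by (intro poly_fun.add poly_fun.mult p L D)
  ultimately show ?case by blast
qed

lemma schwartz_gauss:
  fixes b c :: "real^'n"
  assumes a: "a > 0" shows "schwartz (gauss a b c)"
  unfolding schwartz_def
proof (intro ballI conjI allI)
  fix bs :: "(real^'n) list"
  obtain p where p: "poly_fun p" "iterated_partial bs (gauss a b c) = (\<lambda>x. p x * gauss a b c x)"
    using iterated_partial_gauss[OF poly_fun.const[of 1], of bs a b c] by auto
  obtain D where D: "\<And>x. (p has_derivative D x) (at x)" using poly_fun_derivative[OF p(1)] by blast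
  show "iterated_partial bs (gauss a b c) differentiable at x" for x
    unfolding p(2) using has_derivative_mult[OF D gauss_derivative] differentiableI by blast
  fix N :: nat
  obtain M k where M: "M \<ge> 0" "\<And>x. norm (p x) \<le> M * (1 + norm x) ^ k"
    using poly_fun_growth[OF p(1)] by blast
  obtain M' where M': "\<And>x. (1 + norm x) ^ (N + k) * norm (gauss a b c x) \<le> M'"
    using rapid_bound[OF gauss_rapid[OF a, of b c]] by blast
  have "(1 + norm x) ^ N * norm (iterated_partial bs (gauss a b c) x) \<le> M * M'" for x
  proof -
    have "(1 + norm x) ^ N * norm (iterated_partial bs (gauss a b c) x) = (1 + norm x) ^ N * (norm (p x) * norm (gauss a b c x))"
      by (simp add: p(2) norm_mult)
    also have "\<dots> \<le> (1 + norm x) ^ N * ((M * (1 + norm x) ^ k) * norm (gauss a b c x))"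
      by (intro mult_left_mono mult_right_mono M) auto
    also have "\<dots> = M * ((1 + norm x) ^ (N + k) * norm (gauss a b c x))" by (simp add: power_add mult_ac)
    also have "\<dots> \<le> M * M'" by (intro mult_left_mono M M')
    finally show ?thesis .
  qed
  thus "\<exists>M. \<forall>x. (1 + norm x) ^ N * norm (iterated_partial bs (gauss a b c) x) \<le> M" by blast
qed

text \<open>Rescaled by \<open>s = sqrt (2 * a)\<close>, the integral is the characteristic function
  of the standard normal distribution.\<close>

lemma gaussian_fourier_real:
  assumes a: "a > 0"
  shows "integrable lborel (\<lambda>t::real. of_real (exp (- a * t^2)) * cis (c * t))"
    and "(LINT t|lborel. of_real (exp (- a * t^2)) * cis (c * t)) = of_real (sqrt (pi / a) * exp (- c\<^sup>2 / (4 * a)))"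
proof -
  define s where "s = sqrt (2 * a)"
  have s: "s > 0" "s^2 = 2 * a" using a by (auto simp: s_def)
  have std: "integrable lborel (\<lambda>x. std_normal_density x *\<^sub>R cis (t * x))" for t
  proof (rule Bochner_Integration.integrable_bound)
    show "integrable lborel std_normal_density" by simp
  qed (auto simp: norm_scaleR)
  have "char std_normal_distribution t = (LINT x|lborel. std_normal_density x *\<^sub>R cis (t * x))" for t
    unfolding char_def by (subst integral_density) (auto simp: cis_conv_exp)
  hence val: "(LINT x|lborel. std_normal_density x *\<^sub>R cis (t * x)) = of_real (exp (- t\<^sup>2 / 2))" for t
    by (simp add: char_std_normal_distribution)
  have eq: "of_real (exp (- a * t^2)) * cis (c * t) = of_real (sqrt (2 * pi)) * (std_normal_density (0 + s * t) *\<^sub>R cis ((c / s) * (0 + s * t)))" for t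
  proof -
    have "(s * t)^2 / 2 = a * t^2" using s by (simp add: power_mult_distrib)
    thus ?thesis using s(1) by (simp add: std_normal_density_def scaleR_conv_of_real)
  qed
  show "integrable lborel (\<lambda>t::real. of_real (exp (- a * t^2)) * cis (c * t))"
    unfolding eq using s(1) by (intro integrable_mult_right lborel_integrable_real_affine std) auto
  have "(LINT x|lborel. std_normal_density x *\<^sub>R cis ((c / s) * x)) = \<bar>s\<bar> *\<^sub>R (LINT x|lborel. std_normal_density (0 + s * x) *\<^sub>R cis ((c / s) * (0 + s * x)))"
    using s(1) by (intro lborel_integral_real_affine) auto
  hence "(LINT x|lborel. std_normal_density (0 + s * x) *\<^sub>R cis ((c / s) * (0 + s * x))) = of_real (exp (- (c / s)\<^sup>2 / 2) / s)"
    using s(1) unfolding val by (simp add: scaleR_conv_of_real field_simps)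
  hence "(LINT t|lborel. of_real (exp (- a * t^2)) * cis (c * t)) = of_real (sqrt (2 * pi) * (exp (- (c / s)\<^sup>2 / 2) / s))"
    unfolding eq by (simp only: integral_mult_right_zero of_real_mult)
  also have "sqrt (2 * pi) * (exp (- (c / s)\<^sup>2 / 2) / s) = sqrt (pi / a) * exp (- c\<^sup>2 / (4 * a))"
    using s a by (simp add: s_def real_sqrt_mult real_sqrt_divide power_divide)
  finally show "(LINT t|lborel. of_real (exp (- a * t^2)) * cis (c * t)) = of_real (sqrt (pi / a) * exp (- c\<^sup>2 / (4 * a)))" .
qed

lemma integral_lborel_prod:
  fixes f :: "'a::euclidean_space \<Rightarrow> real \<Rightarrow> complex"
  assumes "\<And>b. b \<in> Basis \<Longrightarrow> integrable lborel (f b)"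
  shows "(LINT x|lborel. (\<Prod>b\<in>Basis. f b (x \<bullet> b))) = (\<Prod>b\<in>Basis. (LINT t|lborel. f b t))"
proof -
  interpret product_sigma_finite "\<lambda>_::'a. lborel :: real measure"
    by (intro product_sigma_finite.intro lborel.sigma_finite_measure_axioms)
  have [measurable]: "\<And>b. b \<in> Basis \<Longrightarrow> f b \<in> borel_measurable borel" using assms by auto
  have "(LINT x|lborel. (\<Prod>b\<in>Basis. f b (x \<bullet> b))) = (LINT x|(\<Pi>\<^sub>M b\<in>(Basis::'a set). lborel). (\<Prod>b\<in>Basis. f b ((\<Sum>b\<in>Basis. x b *\<^sub>R b) \<bullet> b)))"
    by (subst lborel_eq, subst integral_distr) auto
  also have "\<dots> = (LINT x|(\<Pi>\<^sub>M b\<in>(Basis::'a set). lborel). (\<Prod>b\<in>Basis. f b (x b)))"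
    by (intro Bochner_Integration.integral_cong prod.cong) simp_all
  also have "\<dots> = (\<Prod>b\<in>Basis. (LINT t|lborel. f b t))"
    using assms by (intro product_integral_prod) auto
  finally show ?thesis .
qed

definition gauss_const :: "real \<Rightarrow> 'a::euclidean_space itself \<Rightarrow> real" where
  "gauss_const a _ = sqrt (pi / a) ^ DIM('a)"

lemma gauss_const_pos: "a > 0 \<Longrightarrow> gauss_const a TYPE('a::euclidean_space) > 0"
  by (simp add: gauss_const_def)

lemma integral_gauss:
  fixes c :: "'a::euclidean_space"
  assumes a: "a > 0"
  shows "(LINT x|lborel. gauss a 0 c x) = of_real (gauss_const a TYPE('a) * exp (- (norm c)\<^sup>2 / (4 * a)))"
proof -
  have eq: "gauss a 0 c x = (\<Prod>b\<in>Basis. of_real (exp (- a * (x \<bullet> b)^2)) * cis ((c \<bullet> b) * (x \<bullet> b)))" for x :: 'a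
  proof -
    have "(norm x)^2 = (\<Sum>b\<in>Basis. (x \<bullet> b)^2)"
      unfolding power2_norm_eq_inner by (simp only: euclidean_inner[of x x] power2_eq_square)
    moreover have "c \<bullet> x = (\<Sum>b\<in>Basis. (c \<bullet> b) * (x \<bullet> b))" by (rule euclidean_inner)
    ultimately show ?thesis
      by (simp add: gauss_def prod.distrib exp_sum sum_distrib_left cis_conv_exp
          flip: sum_negf of_real_prod)
  qed
  have "(LINT x|lborel. gauss a 0 c x) = (\<Prod>b\<in>(Basis::'a set). (LINT t|lborel. of_real (exp (- a * t^2)) * cis ((c \<bullet> b) * t)))"
    unfolding eq by (intro integral_lborel_prod gaussian_fourier_real a)
  also have "\<dots> = (\<Prod>b\<in>(Basis::'a set). of_real (sqrt (pi / a) * exp (- (c \<bullet> b)\<^sup>2 / (4 * a))))"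
    by (intro prod.cong refl gaussian_fourier_real a)
  also have "\<dots> = of_real (\<Prod>b\<in>(Basis::'a set). sqrt (pi / a) * exp (- (c \<bullet> b)\<^sup>2 / (4 * a)))" by simp
  also have "(\<Prod>b\<in>(Basis::'a set). sqrt (pi / a) * exp (- (c \<bullet> b)\<^sup>2 / (4 * a)))
     = gauss_const a TYPE('a) * exp (\<Sum>b\<in>(Basis::'a set). - (c \<bullet> b)\<^sup>2 / (4 * a))"
    by (simp add: prod.distrib gauss_const_def exp_sum)
  also have "(\<Sum>b\<in>(Basis::'a set). - (c \<bullet> b)\<^sup>2 / (4 * a)) = - (norm c)\<^sup>2 / (4 * a)"
  proof -
    have "(norm c)^2 = (\<Sum>b\<in>Basis. (c \<bullet> b)^2)"
      unfolding power2_norm_eq_inner by (simp only: euclidean_inner[of c c] power2_eq_square)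
    thus ?thesis by (simp add: sum_negf sum_divide_distrib)
  qed
  finally show ?thesis .
qed

lemma ft_gauss:
  fixes c \<xi> :: "'a::euclidean_space"
  assumes a: "a > 0"
  shows "ft \<sigma> (gauss a 0 c) \<xi> = of_real (gauss_const a TYPE('a) * exp (- (norm (c + \<sigma> *\<^sub>R \<xi>))\<^sup>2 / (4 * a)))"
proof -
  have "cis (\<sigma> * (x \<bullet> \<xi>)) * gauss a 0 c x = gauss a 0 (c + \<sigma> *\<^sub>R \<xi>) x" for x
  proof -
    have "cis (\<sigma> * (x \<bullet> \<xi>)) * cis (c \<bullet> x) = cis ((c + \<sigma> *\<^sub>R \<xi>) \<bullet> x)"
      unfolding cis_mult by (simp add: inner_add_left inner_commute[of x \<xi>] add.commute)
    thus ?thesis by (simp add: gauss_def mult.left_commute)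
  qed
  thus ?thesis unfolding ft_def using integral_gauss[OF a, of "c + \<sigma> *\<^sub>R \<xi>"] by simp
qed

lemma gaussian_real_integrable:
  assumes "a > 0" shows "integrable lborel (\<lambda>x::'a::euclidean_space. exp (- a * (norm (x - b))^2))"
  using integrable_norm[OF rapid_integrable[OF gauss_rapid[OF assms, of b 0]]] by (simp add: norm_gauss)

lemma gaussian_real_integral:
  assumes a: "a > 0" shows "(LINT x|lborel. exp (- a * (norm (x::'a::euclidean_space))^2)) = gauss_const a TYPE('a)"
proof -
  have "complex_of_real (LINT x|lborel. exp (- a * (norm (x::'a))^2)) = of_real (gauss_const a TYPE('a))"
    using integral_gauss[OF a, of "0::'a"] by (simp add: gauss_def)
  thus ?thesis by (simp only: of_real_eq_iff)
qed

section \<open>Functions are determined by their Gaussian averages\<close>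

lemma integrable_conv_kernel:
  fixes g h :: "'a::euclidean_space \<Rightarrow> complex"
  assumes g: "integrable lborel g" and h: "integrable lborel h"
    and [measurable]: "k \<in> borel_measurable (borel \<Otimes>\<^sub>M borel)" and k: "\<And>x y. norm (k (x, y)) \<le> B"
  shows "integrable (lborel \<Otimes>\<^sub>M lborel) (\<lambda>(x, y). k (x, y) * g x * h (y - x))"
proof (rule lborel_pair.Fubini_integrable)
  have [measurable]: "g \<in> borel_measurable borel" "h \<in> borel_measurable borel" using g h by auto
  show meas: "(\<lambda>(x, y). k (x, y) * g x * h (y - x)) \<in> borel_measurable (lborel \<Otimes>\<^sub>M lborel)"
    unfolding case_prod_unfold by measurable
  have h': "integrable lborel (\<lambda>y. h (y - x))" for x
    using integrable_lborel_affine[OF h, of 1 "- x"] by simp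
  have hn: "(LINT y|lborel. norm (h (y - x))) = (LINT y|lborel. norm (h y))" for x
    using integral_lborel_affine[of "\<lambda>y. norm (h y)" 1 "- x"] by simp
  have B: "B \<ge> 0" using k[of undefined undefined] norm_ge_zero order_trans by blast
  have i1: "integrable lborel (\<lambda>y. k (x, y) * g x * h (y - x))" for x
  proof (rule Bochner_Integration.integrable_bound)
    show "integrable lborel (\<lambda>y. (B * norm (g x)) * norm (h (y - x)))"
      by (intro integrable_mult_right integrable_norm h')
    have "norm (k (x, y)) * norm (g x) * norm (h (y - x)) \<le> B * norm (g x) * norm (h (y - x))" for y
      by (intro mult_right_mono k) auto
    thus "AE y in lborel. norm (k (x, y) * g x * h (y - x)) \<le> norm ((B * norm (g x)) * norm (h (y - x)))"
      using B by (simp add: norm_mult)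
  qed measurable
  thus "AE x in lborel. integrable lborel (\<lambda>y. case (x, y) of (x, y) \<Rightarrow> k (x, y) * g x * h (y - x))"
    by simp
  show "integrable lborel (\<lambda>x. LINT y|lborel. norm (case (x, y) of (x, y) \<Rightarrow> k (x, y) * g x * h (y - x)))"
  proof (rule Bochner_Integration.integrable_bound)
    show "integrable lborel (\<lambda>x. (B * (LINT y|lborel. norm (h y))) * norm (g x))"
      by (intro integrable_mult_right integrable_norm g)
    show "(\<lambda>x. LINT y|lborel. norm (case (x, y) of (x, y) \<Rightarrow> k (x, y) * g x * h (y - x))) \<in> borel_measurable lborel"
      using meas by measurable
    have "norm (LINT y|lborel. norm (k (x, y) * g x * h (y - x))) \<le> norm ((B * (LINT y|lborel. norm (h y))) * norm (g x))" for x
    proof -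
      have "(LINT y|lborel. norm (k (x, y) * g x * h (y - x))) \<le> (LINT y|lborel. (B * norm (g x)) * norm (h (y - x)))"
      proof (rule integral_mono)
        show "integrable lborel (\<lambda>y. norm (k (x, y) * g x * h (y - x)))" by (intro integrable_norm i1)
        show "integrable lborel (\<lambda>y. (B * norm (g x)) * norm (h (y - x)))"
          by (intro integrable_mult_right integrable_norm h')
        show "norm (k (x, y) * g x * h (y - x)) \<le> (B * norm (g x)) * norm (h (y - x))" for y
          unfolding norm_mult by (intro mult_right_mono k) auto
      qed
      also have "\<dots> = B * norm (g x) * (LINT y|lborel. norm (h y))" by (simp add: hn)
      finally show ?thesis using B by (simp add: mult_ac)
    qed
    thus "AE x in lborel. norm (LINT y|lborel. norm (case (x, y) of (x, y) \<Rightarrow> k (x, y) * g x * h (y - x)))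
       \<le> norm ((B * (LINT y|lborel. norm (h y))) * norm (g x))" by simp
  qed
qed

text \<open>An integrable function is determined by its Gaussian averages: mollifying a bounded continuous
  test function by rescaled Gaussians gives back the test function in the limit.\<close>

lemma gaussian_average_continuous:
  fixes g :: "'a::euclidean_space \<Rightarrow> complex" and \<psi> :: "'a \<Rightarrow> real"
  assumes g: "integrable lborel g"
    and zero: "\<And>a b. a > 0 \<Longrightarrow> (LINT x|lborel. of_real (exp (- a * (norm (x - b))^2)) * g x) = 0"
    and \<psi>: "continuous_on UNIV \<psi>" and B: "\<And>x. \<bar>\<psi> x\<bar> \<le> B"
  shows "(LINT x|lborel. of_real (\<psi> x) * g x) = 0"
proof -
  have [measurable]: "g \<in> borel_measurable borel" using g by auto
  have [measurable]: "\<psi> \<in> borel_measurable borel" using \<psi> by (rule borel_measurable_continuous_onI)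
  have B0: "B \<ge> 0" using B[of undefined] by linarith
  define \<gamma> where "\<gamma> = (\<lambda>a (x::'a). complex_of_real (exp (- a * (norm x)^2)))"
  have [measurable]: "\<gamma> a \<in> borel_measurable borel" for a unfolding \<gamma>_def by measurable
  have \<gamma>_int: "integrable lborel (\<gamma> a)" if "a > 0" for a
    using integrable_of_real[OF gaussian_real_integrable[OF that, of "0::'a"], where 'a = complex] by (simp add: \<gamma>_def)
  \<comment> \<open>The average of \<open>\<psi>\<close> around \<open>x\<close> at scale
    \<open>1 / m\<close>, not normalised. Substituting \<open>b = x + (1 / m) *\<^sub>R y\<close>
    makes it an integral over centres \<open>b\<close>, and after Fubini the hypothesis
    \<open>zero\<close> applies to each centre.\<close>
  define P where "P = (\<lambda>m x. LINT y|lborel. \<gamma> 1 y * of_real (\<psi> (x + (1 / m) *\<^sub>R y)))"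
  have P_zero: "(LINT x|lborel. P m x * g x) = 0" if m: "m > 0" for m
  proof -
    have P_eq: "P m x = of_real (m ^ DIM('a)) * (LINT b|lborel. \<gamma> (m^2) (b - x) * of_real (\<psi> b))" for x
    proof -
      have "P m x = (LINT y|lborel. (\<lambda>b. \<gamma> (m^2) (b - x) * of_real (\<psi> b)) (x + (1 / m) *\<^sub>R y))"
        unfolding P_def \<gamma>_def using m
        by (intro Bochner_Integration.integral_cong) (auto simp: power_mult_distrib power_divide)
      also have "\<dots> = (1 / \<bar>1 / m\<bar> ^ DIM('a)) *\<^sub>R (LINT b|lborel. \<gamma> (m^2) (b - x) * of_real (\<psi> b))"
        using m by (intro integral_lborel_affine) auto
      finally show ?thesis using m by (simp add: scaleR_conv_of_real power_one_over)
    qed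
    have int: "integrable (lborel \<Otimes>\<^sub>M lborel) (\<lambda>(x, b). of_real (\<psi> b) * g x * \<gamma> (m^2) (b - x))"
      using integrable_conv_kernel[OF g \<gamma>_int[of "m^2"], of "\<lambda>p. of_real (\<psi> (snd p))" B] m B
      by simp
    have "(LINT x|lborel. P m x * g x) = (LINT x|lborel. of_real (m ^ DIM('a)) * (LINT b|lborel. of_real (\<psi> b) * g x * \<gamma> (m^2) (b - x)))"
      unfolding P_eq by (intro Bochner_Integration.integral_cong) 
        (simp_all add: mult_ac flip: integral_mult_left_zero integral_mult_right_zero)
    also have "\<dots> = of_real (m ^ DIM('a)) * (LINT x|lborel. (LINT b|lborel. of_real (\<psi> b) * g x * \<gamma> (m^2) (b - x)))"
      by (rule integral_mult_right_zero)
    also have "(LINT x|lborel. (LINT b|lborel. of_real (\<psi> b) * g x * \<gamma> (m^2) (b - x)))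
       = (LINT b|lborel. (LINT x|lborel. of_real (\<psi> b) * g x * \<gamma> (m^2) (b - x)))"
      by (rule lborel_pair.Fubini_integral[symmetric]) (rule int)
    also have "\<dots> = (LINT b|lborel. of_real (\<psi> b) * (LINT x|lborel. of_real (exp (- (m^2) * (norm (x - b))^2)) * g x))"
      by (intro Bochner_Integration.integral_cong)
         (simp_all add: \<gamma>_def norm_minus_commute mult_ac flip: integral_mult_right_zero)
    also have "\<dots> = 0" using zero[of "m^2"] m by simp
    finally show ?thesis by simp
  qed
  have P_lim: "(\<lambda>n. P (real (Suc n)) x) \<longlonglongrightarrow> (LINT y|lborel. \<gamma> 1 y * of_real (\<psi> x))" for x
    unfolding P_def
  proof (rule integral_dominated_convergence[where w = "\<lambda>y. B * norm (\<gamma> 1 y)"])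
    show "integrable lborel (\<lambda>y. B * norm (\<gamma> 1 y))" by (intro integrable_mult_right integrable_norm \<gamma>_int) simp
    show "AE y in lborel. norm (\<gamma> 1 y * of_real (\<psi> (x + (1 / real (Suc n)) *\<^sub>R y))) \<le> B * norm (\<gamma> 1 y)" for n
    proof (rule AE_I2)
      fix y
      show "norm (\<gamma> 1 y * of_real (\<psi> (x + (1 / real (Suc n)) *\<^sub>R y))) \<le> B * norm (\<gamma> 1 y)"
        unfolding norm_mult norm_of_real mult.commute[of B] by (intro mult_left_mono B) auto
    qed
    show "AE y in lborel. (\<lambda>n. \<gamma> 1 y * of_real (\<psi> (x + (1 / real (Suc n)) *\<^sub>R y))) \<longlonglongrightarrow> \<gamma> 1 y * of_real (\<psi> x)"
    proof (intro AE_I2 tendsto_mult tendsto_const tendsto_of_real)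
      fix y
      have "(\<lambda>n. 1 / real (Suc n)) \<longlonglongrightarrow> 0" by real_asymp
      hence "(\<lambda>n. x + (1 / real (Suc n)) *\<^sub>R y) \<longlonglongrightarrow> x + 0 *\<^sub>R y"
        by (intro tendsto_add tendsto_const tendsto_scaleR)
      moreover have "isCont \<psi> x" using \<psi> by (simp add: continuous_on_eq_continuous_at)
      ultimately show "(\<lambda>n. \<psi> (x + (1 / real (Suc n)) *\<^sub>R y)) \<longlonglongrightarrow> \<psi> x"
        using isCont_tendsto_compose[of x \<psi>] by simp
    qed
  qed measurable
  let ?c = "LINT y|lborel. \<gamma> 1 y"
  let ?c' = "LINT y|lborel. norm (\<gamma> 1 y)"
  have [measurable]: "P m \<in> borel_measurable borel" for m unfolding P_def by measurable
  have "(\<lambda>n. LINT x|lborel. P (real (Suc n)) x * g x) \<longlonglongrightarrow> (LINT x|lborel. (?c * of_real (\<psi> x)) * g x)"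
  proof (rule integral_dominated_convergence[where w = "\<lambda>x. (B * ?c') * norm (g x)"])
    show "integrable lborel (\<lambda>x. (B * ?c') * norm (g x))" by (intro integrable_mult_right integrable_norm g)
    show "AE x in lborel. norm (P (real (Suc n)) x * g x) \<le> (B * ?c') * norm (g x)" for n
    proof (rule AE_I2)
      fix x
      have "norm (P (real (Suc n)) x) \<le> (LINT y|lborel. norm (\<gamma> 1 y * of_real (\<psi> (x + (1 / real (Suc n)) *\<^sub>R y))))"
        unfolding P_def by (rule integral_norm_bound)
      also have "\<dots> \<le> (LINT y|lborel. B * norm (\<gamma> 1 y))"
      proof (rule integral_mono_AE')
        show "integrable lborel (\<lambda>y. B * norm (\<gamma> 1 y))" by (intro integrable_mult_right integrable_norm \<gamma>_int) simp
        show "AE y in lborel. norm (\<gamma> 1 y * of_real (\<psi> (x + (1 / real (Suc n)) *\<^sub>R y))) \<le> B * norm (\<gamma> 1 y)"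
        proof (rule AE_I2)
          fix y
          show "norm (\<gamma> 1 y * of_real (\<psi> (x + (1 / real (Suc n)) *\<^sub>R y))) \<le> B * norm (\<gamma> 1 y)"
            unfolding norm_mult norm_of_real mult.commute[of B] by (intro mult_left_mono B) auto
        qed
      qed (use B0 in auto)
      also have "\<dots> = B * ?c'" by simp
      finally show "norm (P (real (Suc n)) x * g x) \<le> (B * ?c') * norm (g x)"
        unfolding norm_mult by (intro mult_right_mono) auto
    qed
    show "AE x in lborel. (\<lambda>n. P (real (Suc n)) x * g x) \<longlonglongrightarrow> (?c * of_real (\<psi> x)) * g x"
    proof (intro AE_I2 tendsto_mult tendsto_const)
      fix x show "(\<lambda>n. P (real (Suc n)) x) \<longlonglongrightarrow> ?c * of_real (\<psi> x)" using P_lim[of x] by simp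
    qed
  qed measurable
  hence "(LINT x|lborel. (?c * of_real (\<psi> x)) * g x) = 0"
    using P_zero by (simp add: LIMSEQ_const_iff del: of_nat_Suc)
  hence "?c * (LINT x|lborel. of_real (\<psi> x) * g x) = 0" by (simp add: mult.assoc)
  moreover have "?c \<noteq> 0"
  proof -
    have "?c = of_real (LINT x|lborel. exp (- 1 * (norm (x::'a))^2))" unfolding \<gamma>_def using gaussian_real_integrable[of 1 "0::'a"] by (intro integral_of_real) simp
    also have "\<dots> = of_real (gauss_const 1 TYPE('a))" by (subst gaussian_real_integral) auto
    finally show ?thesis using gauss_const_pos[of 1, where 'a = 'a] by simp
  qed
  ultimately show ?thesis by simp
qed

text \<open>Closed sets are stable under intersection and generate the Borel sets, and the indicator
  of a closed set is a limit of the continuous functions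
  \<open>max 0 (1 - real n * infdist x C)\<close>. So the integral of \<open>g\<close> over every
  Borel set vanishes.\<close>

lemma gaussian_averages_zero:
  fixes g :: "'a::euclidean_space \<Rightarrow> complex"
  assumes g: "integrable lborel g"
    and zero: "\<And>a b. a > 0 \<Longrightarrow> (LINT x|lborel. of_real (exp (- a * (norm (x - b))^2)) * g x) = 0"
  shows "AE x in lborel. g x = 0"
proof (rule sigma_finite_measure.density_zero[OF lborel.sigma_finite_measure_axioms g])
  have [measurable]: "g \<in> borel_measurable borel" using g by auto
  fix A :: "'a set" assume "A \<in> sets lborel"
  hence A: "A \<in> sigma_sets UNIV (Collect closed)" by (simp add: borel_eq_closed)
  have univ: "(LINT x|lborel. g x) = 0"
    using gaussian_average_continuous[OF g zero, of "\<lambda>_. 1" 1] by simp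
  have sint: "set_integrable lborel A g" if "A \<in> sets borel" for A
    using that g unfolding set_integrable_def by (intro integrable_mult_indicator) auto
  have sigma: "sigma_sets UNIV (Collect closed) = sets (borel :: 'a measure)" by (simp add: borel_eq_closed)
  show "set_lebesgue_integral lborel A g = 0"
  proof (rule sigma_sets_induct_disjoint[OF _ _ A, where P = "\<lambda>A. set_lebesgue_integral lborel A g = 0"])
    show "Int_stable (Collect (closed :: 'a set \<Rightarrow> bool))" by (auto simp: Int_stable_def)
    show "Collect closed \<subseteq> Pow (UNIV :: 'a set)" by simp
  next
    fix C :: "'a set" assume basic: "C \<in> Collect closed"
    show "set_lebesgue_integral lborel C g = 0"
    \<comment> \<open>The distance \<open>infdist\<close> to the empty set is 0 by convention, so
      the approximation of the indicator fails there.\<close>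
    proof (cases "C = {}")
      case False
      have C: "closed C" using basic by simp
      hence [measurable]: "C \<in> sets borel" by simp
      define \<psi> where "\<psi> = (\<lambda>n x. max 0 (1 - real n * infdist x C))"
      have "(\<lambda>n. LINT x|lborel. of_real (\<psi> n x) * g x) \<longlonglongrightarrow> (LINT x|lborel. indicator C x *\<^sub>R g x)"
      proof (rule integral_dominated_convergence[where w = "\<lambda>x. norm (g x)"])
        show "integrable lborel (\<lambda>x. norm (g x))" using g by (rule integrable_norm)
        have "\<psi> n \<in> borel_measurable borel" for n unfolding \<psi>_def by (intro borel_measurable_continuous_onI continuous_intros)
        thus "(\<lambda>x. of_real (\<psi> n x) * g x) \<in> borel_measurable lborel" for n by measurable
        show "(\<lambda>x. indicator C x *\<^sub>R g x) \<in> borel_measurable lborel" by measurable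
        show "AE x in lborel. norm (of_real (\<psi> n x) * g x) \<le> norm (g x)" for n
        proof (rule AE_I2)
          fix x
          have "\<bar>\<psi> n x\<bar> \<le> 1" using infdist_nonneg[of x C] by (simp add: \<psi>_def)
          thus "norm (of_real (\<psi> n x) * g x) \<le> norm (g x)" by (simp add: norm_mult mult_left_le_one_le)
        qed
        show "AE x in lborel. (\<lambda>n. of_real (\<psi> n x) * g x) \<longlonglongrightarrow> indicator C x *\<^sub>R g x"
        proof (rule AE_I2)
          fix x
          have "(\<lambda>n. \<psi> n x) \<longlonglongrightarrow> indicator C x"
          proof (cases "x \<in> C")
            case True thus ?thesis by (simp add: \<psi>_def)
          next
            case False
            hence pos: "infdist x C > 0"
              using C \<open>C \<noteq> {}\<close> in_closed_iff_infdist_zero[of C x] infdist_nonneg[of x C] by linarith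
            have "eventually (\<lambda>n. \<psi> n x = 0) sequentially"
            proof -
              obtain N :: nat where N: "1 / infdist x C \<le> real N" using real_arch_simple by blast
              have "\<psi> n x = 0" if "n \<ge> N" for n
              proof -
                have "1 / infdist x C \<le> real n" using N that by (meson of_nat_mono order_trans)
                hence "1 \<le> real n * infdist x C" using pos by (simp add: pos_divide_le_eq)
                thus ?thesis by (simp add: \<psi>_def)
              qed
              thus ?thesis by (auto simp: eventually_sequentially)
            qed
            thus ?thesis using False by (simp add: tendsto_eventually)
          qed
          hence "(\<lambda>n. of_real (\<psi> n x) * g x) \<longlonglongrightarrow> of_real (indicator C x) * g x"
            by (intro tendsto_mult tendsto_const tendsto_of_real)
          thus "(\<lambda>n. of_real (\<psi> n x) * g x) \<longlonglongrightarrow> indicator C x *\<^sub>R g x"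
            by (simp add: scaleR_conv_of_real)
        qed
      qed
      moreover have "(LINT x|lborel. of_real (\<psi> n x) * g x) = 0" for n
      proof (rule gaussian_average_continuous[OF g zero])
        show "continuous_on UNIV (\<psi> n)" unfolding \<psi>_def by (intro continuous_intros)
        show "\<bar>\<psi> n x\<bar> \<le> 1" for x using infdist_nonneg[of x C] by (simp add: \<psi>_def)
      qed auto
      ultimately show ?thesis by (simp add: set_lebesgue_integral_def LIMSEQ_const_iff)
    qed (simp add: set_lebesgue_integral_def)
  next
    show "set_lebesgue_integral lborel {} g = 0" by (simp add: set_lebesgue_integral_def)
  next
    fix A :: "'a set" assume compl: "A \<in> sigma_sets UNIV (Collect closed)" "set_lebesgue_integral lborel A g = 0"
    hence [measurable]: "A \<in> sets borel" by (simp only: sigma)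
    have "(LINT x:A \<union> (UNIV - A)|lborel. g x) = (LINT x:A|lborel. g x) + (LINT x:UNIV - A|lborel. g x)"
      by (rule set_integral_Un) (auto intro!: sint)
    thus "set_lebesgue_integral lborel (UNIV - A) g = 0" using compl univ by (simp add: set_lebesgue_integral_def)
  next
    fix A :: "nat \<Rightarrow> 'a set" 
    assume union: "disjoint_family A" "range A \<subseteq> sigma_sets UNIV (Collect closed)" "\<And>i. set_lebesgue_integral lborel (A i) g = 0"
    have [measurable]: "A i \<in> sets borel" for i using union(2) unfolding sigma by auto
    have "(LINT x:(\<Union>i. A i)|lborel. g x) = (\<Sum>i. (LINT x:(A i)|lborel. g x))"
      using union(1) by (intro lebesgue_integral_countable_add sint) (auto simp: disjoint_family_on_def)
    thus "set_lebesgue_integral lborel (\<Union>i. A i) g = 0" using union by simp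
  qed
qed

text \<open>Completing the square: Gaussians centred at \<open>b\<close> and at 0 multiply to one
  centred at a point of the segment between them.\<close>

lemma gaussian_product:
  fixes b x :: "'a::real_inner"
  assumes "a > 0"
  shows "exp (- a * (norm (x - b))^2) * exp (- (norm x)\<^sup>2) =
    exp (- (a / (a + 1)) * (norm b)^2) * exp (- (a + 1) * (norm (x - (a / (a + 1)) *\<^sub>R b))^2)"
proof -
  define t where "t = a / (a + 1)"
  have t: "t * (a + 1) = a" using assms by (simp add: t_def)
  have "a * (norm (x - b))^2 + (norm x)^2 = (a + 1) * (x \<bullet> x) - 2 * a * (x \<bullet> b) + a * (b \<bullet> b)"
    by (simp add: power2_norm_eq_inner inner_diff_left inner_diff_right inner_commute algebra_simps)
  also have "\<dots> = (a + 1) * (x \<bullet> x) - 2 * (t * (a + 1)) * (x \<bullet> b) + (t * t * (a + 1) + t) * (b \<bullet> b)"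
  proof -
    have "t * t * (a + 1) + t = t * (t * (a + 1)) + t" by simp
    also have "\<dots> = a" using t by (simp add: distrib_left)
    finally show ?thesis by (simp only: t)
  qed
  also have "\<dots> = t * (norm b)^2 + (a + 1) * (norm (x - t *\<^sub>R b))^2"
    by (simp add: power2_norm_eq_inner inner_diff_left inner_diff_right inner_commute algebra_simps)
  finally have "- a * (norm (x - b))^2 + - (norm x)\<^sup>2 = - t * (norm b)^2 + - (a + 1) * (norm (x - t *\<^sub>R b))^2"
    by linarith
  thus ?thesis unfolding t_def by (simp only: exp_add[symmetric])
qed

lemma borel_representative:
  fixes f :: "'a::euclidean_space \<Rightarrow> complex"
  assumes "f \<in> borel_measurable lebesgue"
  obtains g where "g \<in> borel_measurable borel" "AE x in lborel. f x = g x"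
proof -
  have 1: "(\<lambda>x. Re (f x)) \<in> borel_measurable lebesgue" and 2: "(\<lambda>x. Im (f x)) \<in> borel_measurable lebesgue"
    using assms by measurable
  obtain p where p: "p \<in> borel_measurable lborel" "AE x in lborel. Re (f x) = p x"
    using completion_ex_borel_measurable_real[OF 1] by blast
  obtain q where q: "q \<in> borel_measurable lborel" "AE x in lborel. Im (f x) = q x"
    using completion_ex_borel_measurable_real[OF 2] by blast
  note pq = p q
  have "(\<lambda>x. Complex (p x) (q x)) \<in> borel_measurable borel"
  proof -
    have "(\<lambda>x. complex_of_real (p x) + \<i> * complex_of_real (q x)) \<in> borel_measurable borel"
      using pq(1,3) by simp
    thus ?thesis by (simp add: Complex_eq)
  qed
  moreover have "AE x in lborel. f x = Complex (p x) (q x)"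
    using pq(2,4) by eventually_elim (simp add: complex_eq_iff)
  ultimately show ?thesis by (rule that)
qed

text \<open>\<open>g\<close> itself need not be integrable, but \<open>g\<close> times a fixed
  Gaussian is. The averages of this product vanish as well, because the product of two Gaussians is
  a multiple of a third.\<close>

lemma gaussian_tested_zero:
  fixes g :: "real^'n \<Rightarrow> complex"
  assumes [measurable]: "g \<in> borel_measurable lebesgue"
    and int: "\<And>\<phi>. schwartz \<phi> \<Longrightarrow> integrable lebesgue (\<lambda>x. g x * \<phi> x)"
    and zero: "\<And>a b. a > 0 \<Longrightarrow> (LINT x|lebesgue. g x * of_real (exp (- a * (norm (x - b))^2))) = 0"
  shows "AE x in lborel. g x = 0"
proof -
  obtain h where h[measurable]: "h \<in> borel_measurable borel" and gh: "AE x in lborel. g x = h x"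
    using borel_representative[OF assms(1)] by blast
  have gh': "AE x in lebesgue. g x = h x" using gh by (rule AE_completion)
  have [measurable]: "h \<in> borel_measurable lebesgue" using h by (intro measurable_completion) simp
  have [measurable]: "(\<lambda>x::real^'n. complex_of_real (exp (- a * (norm (x - b))^2))) \<in> borel_measurable lebesgue" for a b
    by (intro measurable_completion) measurable
  have [measurable]: "(\<lambda>x::real^'n. complex_of_real (exp (- (norm x)\<^sup>2))) \<in> borel_measurable lebesgue"
    by (intro measurable_completion) measurable
  define h1 where "h1 = (\<lambda>x. of_real (exp (- (norm x)\<^sup>2)) * h x)"
  have [measurable]: "h1 \<in> borel_measurable borel" unfolding h1_def by measurable
  have G: "gauss 1 0 0 x = of_real (exp (- (norm x)\<^sup>2))" for x :: "real^'n" by (simp add: gauss_def)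
  have "integrable lebesgue (\<lambda>x. g x * gauss 1 0 0 x)" by (intro int schwartz_gauss) simp
  also have "?this \<longleftrightarrow> integrable lebesgue h1"
    by (rule integrable_cong_AE) (use gh' in \<open>auto simp: h1_def G elim!: AE_mp\<close>)
  also have "\<dots> \<longleftrightarrow> integrable lborel h1" by (rule integrable_completion) measurable
  finally have h1: "integrable lborel h1" .
  have "AE x in lborel. h1 x = 0"
  proof (rule gaussian_averages_zero[OF h1])
    fix a :: real and b :: "real^'n" assume a: "a > 0"
    define b' where "b' = (a / (a + 1)) *\<^sub>R b"
    define k where "k = complex_of_real (exp (- (a / (a + 1)) * (norm b)^2))"
    have "(LINT x|lborel. of_real (exp (- a * (norm (x - b))^2)) * h1 x) = (LINT x|lborel. k * (h x * of_real (exp (- (a + 1) * (norm (x - b'))^2))))"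
    proof (intro Bochner_Integration.integral_cong refl)
      fix x
      have "complex_of_real (exp (- a * (norm (x - b))^2)) * h1 x = of_real (exp (- a * (norm (x - b))^2) * exp (- (norm x)\<^sup>2)) * h x"
        by (simp add: h1_def)
      also have "\<dots> = k * (h x * of_real (exp (- (a + 1) * (norm (x - b'))^2)))"
        unfolding gaussian_product[OF a] k_def b'_def by (simp only: of_real_mult mult.assoc mult.commute mult.left_commute)
      finally show "complex_of_real (exp (- a * (norm (x - b))^2)) * h1 x = k * (h x * of_real (exp (- (a + 1) * (norm (x - b'))^2)))" .
    qed
    also have "\<dots> = k * (LINT x|lborel. h x * of_real (exp (- (a + 1) * (norm (x - b'))^2)))" by simp
    also have "(LINT x|lborel. h x * of_real (exp (- (a + 1) * (norm (x - b'))^2))) = (LINT x|lebesgue. h x * of_real (exp (- (a + 1) * (norm (x - b'))^2)))"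
      by (rule integral_completion[symmetric]) measurable
    also have "\<dots> = (LINT x|lebesgue. g x * of_real (exp (- (a + 1) * (norm (x - b'))^2)))"
    proof (rule integral_cong_AE)
      show "AE x in lebesgue. h x * of_real (exp (- (a + 1) * (norm (x - b'))^2)) = g x * of_real (exp (- (a + 1) * (norm (x - b'))^2))"
        using gh' by eventually_elim simp
    qed measurable
    also have "\<dots> = 0" using a by (intro zero) auto
    finally show "(LINT x|lborel. of_real (exp (- a * (norm (x - b))^2)) * h1 x) = 0" by simp
  qed
  with gh show ?thesis by eventually_elim (auto simp: h1_def)
qed

lemma gauss_0: "gauss a b 0 x = of_real (exp (- a * (norm (x - b))^2))"
  by (simp add: gauss_def)

lemma tempered_measurable: "tempered f \<Longrightarrow> f \<in> borel_measurable lebesgue"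
  by (simp add: tempered_def)

lemma tempered_integrable: "tempered f \<Longrightarrow> schwartz \<phi> \<Longrightarrow> integrable lebesgue (\<lambda>x. f x * \<phi> x)"
  by (simp add: tempered_def)

text \<open>Makes the choice inside \<open>fourier\<close> harmless: the two pairings agree on
  Gaussians, which determine a function up to a null set.\<close>

lemma has_fourier_unique:
  fixes f g g' :: "real^'n \<Rightarrow> complex"
  assumes "has_fourier f g" "has_fourier f g'"
  shows "AE x in lborel. g x = g' x"
proof -
  have g: "tempered g" "tempered g'" using assms by (auto simp: has_fourier_def)
  note [measurable] = tempered_measurable[OF g(1)] tempered_measurable[OF g(2)]
  have "AE x in lborel. g x - g' x = 0"
  proof (rule gaussian_tested_zero)
    show "integrable lebesgue (\<lambda>x. (g x - g' x) * \<phi> x)" if "schwartz \<phi>" for \<phi>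
      using tempered_integrable[OF g(1) that] tempered_integrable[OF g(2) that] by (simp add: left_diff_distrib)
    fix a :: real and b :: "real^'n" assume "a > 0"
    hence S: "schwartz (gauss a b 0)" by (rule schwartz_gauss)
    have "(LINT x|lebesgue. (g x - g' x) * gauss a b 0 x) = (LINT x|lebesgue. g x * gauss a b 0 x) - (LINT x|lebesgue. g' x * gauss a b 0 x)"
      using tempered_integrable[OF g(1) S] tempered_integrable[OF g(2) S] by (simp add: left_diff_distrib)
    also have "\<dots> = 0" using assms S by (simp add: has_fourier_def)
    finally show "(LINT x|lebesgue. (g x - g' x) * of_real (exp (- a * (norm (x - b))^2))) = 0"
      unfolding gauss_0 .
  qed measurable
  thus ?thesis by eventually_elim simp
qed

lemma has_fourier_unique_inv:
  fixes f f' g :: "real^'n \<Rightarrow> complex"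
  assumes "has_fourier f g" "has_fourier f' g"
  shows "AE x in lborel. f x = f' x"
proof -
  have f: "tempered f" "tempered f'" using assms by (auto simp: has_fourier_def)
  note [measurable] = tempered_measurable[OF f(1)] tempered_measurable[OF f(2)]
  have "AE x in lborel. f x - f' x = 0"
  proof (rule gaussian_tested_zero)
    show "integrable lebesgue (\<lambda>x. (f x - f' x) * \<phi> x)" if "schwartz \<phi>" for \<phi>
      using tempered_integrable[OF f(1) that] tempered_integrable[OF f(2) that] by (simp add: left_diff_distrib)
    fix a :: real and b :: "real^'n" assume a: "a > 0"
    hence S: "schwartz (gauss a b 0)" by (rule schwartz_gauss)
    \<comment> \<open>A modulated Gaussian whose transform is a multiple of the Gaussian with
      parameter \<open>a\<close> and centre \<open>b\<close>; so Gaussian averages of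
      \<open>f\<close> are values of the pairing with transforms.\<close>
    define \<phi> where "\<phi> = gauss (1 / (4 * a)) 0 b"
    have S': "schwartz \<phi>" unfolding \<phi>_def using a by (intro schwartz_gauss) auto
    define k where "k = complex_of_real (gauss_const (1 / (4 * a)) TYPE(real^'n))"
    have k: "k \<noteq> 0" using gauss_const_pos[of "1 / (4 * a)", where 'a = "real^'n"] a by (simp add: k_def)
    have F: "fourier_integral \<phi> x = k * gauss a b 0 x" for x
      unfolding \<phi>_def k_def gauss_0 using a
      by (subst fourier_integral_ft, measurable, subst ft_gauss) (auto simp: norm_minus_commute mult.commute)
    have "(LINT x|lebesgue. f x * fourier_integral \<phi> x) = (LINT x|lebesgue. g x * \<phi> x)"
         "(LINT x|lebesgue. f' x * fourier_integral \<phi> x) = (LINT x|lebesgue. g x * \<phi> x)"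
      using assms S' by (auto simp: has_fourier_def)
    hence "(LINT x|lebesgue. f x * (k * gauss a b 0 x)) = (LINT x|lebesgue. f' x * (k * gauss a b 0 x))"
      unfolding F by simp
    hence "k * (LINT x|lebesgue. f x * gauss a b 0 x) = k * (LINT x|lebesgue. f' x * gauss a b 0 x)"
      by (simp add: mult.left_commute)
    hence "(LINT x|lebesgue. f x * gauss a b 0 x) = (LINT x|lebesgue. f' x * gauss a b 0 x)" using k by simp
    hence "(LINT x|lebesgue. (f x - f' x) * gauss a b 0 x) = 0"
      using tempered_integrable[OF f(1) S] tempered_integrable[OF f(2) S] by (simp add: left_diff_distrib)
    thus "(LINT x|lebesgue. (f x - f' x) * of_real (exp (- a * (norm (x - b))^2))) = 0"
      unfolding gauss_0 .
  qed measurable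
  thus ?thesis by eventually_elim simp
qed

subsection \<open>Square integrable functions\<close>

definition L2sq :: "('a::euclidean_space \<Rightarrow> complex) \<Rightarrow> ennreal" where
  "L2sq f = (NNI x. ennorm2 (f x))"

definition L2 :: "('a::euclidean_space \<Rightarrow> complex) \<Rightarrow> bool" where
  "L2 f \<longleftrightarrow> f \<in> borel_measurable borel \<and> L2sq f < \<infinity>"

lemma L2_measurable: "L2 f \<Longrightarrow> f \<in> borel_measurable borel"
  by (simp add: L2_def)

lemma rapid_imp_L2: "rapid \<phi> \<Longrightarrow> L2 \<phi>"
  using rapid_L2 rapid_measurable by (auto simp: L2_def L2sq_def)

lemma nn_integral_mult_L2:
  assumes [measurable]: "f \<in> borel_measurable borel" "g \<in> borel_measurable borel"
  shows "(NNI x. ennreal (norm (f x * g x)))^2 \<le> L2sq f * L2sq g"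
  using Cauchy_Schwarz_nn_integral[of "\<lambda>x. ennreal (norm (f x))" lborel "\<lambda>x. ennreal (norm (g x))"]
  by (simp add: L2sq_def norm_mult ennreal_mult ennreal_power)

lemma L2_mult_integrable:
  assumes "L2 f" "L2 g" shows "integrable lborel (\<lambda>x. f x * g x)"
proof (rule integrableI_bounded)
  have [measurable]: "f \<in> borel_measurable borel" "g \<in> borel_measurable borel" using assms by (auto simp: L2_def)
  show "(\<lambda>x. f x * g x) \<in> borel_measurable lborel" by measurable
  have "(NNI x. ennreal (norm (f x * g x)))^2 < \<infinity>"
    using nn_integral_mult_L2[of f g] assms by (auto simp: L2_def ennreal_mult_less_top intro: le_less_trans)
  thus "(NNI x. ennreal (norm (f x * g x))) < \<infinity>"
    by (cases "(NNI x. ennreal (norm (f x * g x)))") (auto simp: power2_eq_square)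
qed

lemma L2_mult_integral_bound:
  assumes "L2 f" "L2 g" shows "ennorm2 (LINT x|lborel. f x * g x) \<le> L2sq f * L2sq g"
proof -
  have [measurable]: "f \<in> borel_measurable borel" "g \<in> borel_measurable borel" using assms by (auto simp: L2_def)
  have "ennreal (norm (LINT x|lborel. f x * g x)) \<le> (NNI x. ennreal (norm (f x * g x)))"
    by (rule integral_norm_bound_ennreal) (rule L2_mult_integrable[OF assms])
  hence "(ennreal (norm (LINT x|lborel. f x * g x)))^2 \<le> (NNI x. ennreal (norm (f x * g x)))^2"
    by (intro power_mono) auto
  also have "\<dots> \<le> L2sq f * L2sq g" by (rule nn_integral_mult_L2) measurable
  finally show ?thesis by (simp add: ennreal_power)
qed

lemma norm_add_sq_le: "(norm (x + y))^2 \<le> 2 * (norm x)^2 + 2 * (norm y)^2" for x y :: "'a::real_normed_vector"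
proof -
  have "(norm (x + y))^2 \<le> (norm x + norm y)^2" by (intro power_mono norm_triangle_ineq) auto
  also have "\<dots> \<le> 2 * (norm x)^2 + 2 * (norm y)^2"
    using zero_le_power2[of "norm x - norm y"] by (simp add: power2_eq_square algebra_simps)
  finally show ?thesis .
qed

lemma L2sq_add_le:
  assumes [measurable]: "f \<in> borel_measurable borel" "g \<in> borel_measurable borel"
  shows "L2sq (\<lambda>x. f x + g x) \<le> 2 * L2sq f + 2 * L2sq g"
proof -
  have "L2sq (\<lambda>x. f x + g x) \<le> (NNI x. 2 * ennorm2 (f x) + 2 * ennorm2 (g x))"
    unfolding L2sq_def
  proof (rule nn_integral_mono)
    fix x
    have "ennorm2 (f x + g x) \<le> ennreal (2 * (norm (f x))^2 + 2 * (norm (g x))^2)"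
      by (intro ennreal_leI norm_add_sq_le)
    thus "ennorm2 (f x + g x) \<le> 2 * ennorm2 (f x) + 2 * ennorm2 (g x)"
      by (simp add: ennreal_mult)
  qed
  thus ?thesis by (simp add: L2sq_def nn_integral_add nn_integral_cmult)
qed

lemma L2sq_cmult: "L2sq (\<lambda>x. c * f x) = ennorm2 c * L2sq f"
  if [measurable]: "f \<in> borel_measurable borel"
proof -
  have "L2sq (\<lambda>x. c * f x) = (NNI x. ennorm2 c * ennorm2 (f x))"
    unfolding L2sq_def by (simp add: norm_mult power_mult_distrib ennreal_mult)
  thus ?thesis unfolding L2sq_def by (simp add: nn_integral_cmult)
qed

lemma L2_add: "L2 f \<Longrightarrow> L2 g \<Longrightarrow> L2 (\<lambda>x. f x + g x)"
  using L2sq_add_le[of f g] by (auto simp: L2_def ennreal_mult_less_top intro: le_less_trans)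

lemma L2_cmult: "L2 f \<Longrightarrow> L2 (\<lambda>x. c * f x)"
  by (auto simp: L2_def L2sq_cmult ennreal_mult_less_top)

lemma L2_diff: "L2 f \<Longrightarrow> L2 g \<Longrightarrow> L2 (\<lambda>x. f x - g x)"
  using L2_add[OF _ L2_cmult[of g "-1"], of f] by simp

section \<open>Completeness in the square mean along fast sequences\<close>

lemma series_Cauchy_Schwarz:
  fixes a :: "nat \<Rightarrow> ennreal"
  shows "(\<Sum>k. a k)^2 \<le> (\<Sum>k. ennreal ((1/2) ^ k)) * (\<Sum>k. ennreal (2 ^ k) * (a k)^2)"
proof -
  have "(\<Sum>k. a k) = (\<Sum>k. ennreal (sqrt ((1/2) ^ k)) * (ennreal (sqrt (2 ^ k)) * a k))"
  proof (rule suminf_cong)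
    fix k
    have "sqrt ((1/2) ^ k) * sqrt (2 ^ k) = 1" by (simp flip: real_sqrt_mult power_mult_distrib)
    thus "a k = ennreal (sqrt ((1/2) ^ k)) * (ennreal (sqrt (2 ^ k)) * a k)"
      by (simp add: mult.assoc[symmetric] flip: ennreal_mult)
  qed
  also have "\<dots> = (\<integral>\<^sup>+k. ennreal (sqrt ((1/2) ^ k)) * (ennreal (sqrt (2 ^ k)) * a k) \<partial>count_space UNIV)"
    by (rule nn_integral_count_space_nat[symmetric])
  also have "\<dots>^2 \<le> (\<integral>\<^sup>+k. (ennreal (sqrt ((1/2) ^ k)))^2 \<partial>count_space UNIV) * (\<integral>\<^sup>+k. (ennreal (sqrt (2 ^ k)) * a k)^2 \<partial>count_space UNIV)"
    by (rule Cauchy_Schwarz_nn_integral) auto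
  also have "\<dots> = (\<Sum>k. ennreal ((1/2) ^ k)) * (\<Sum>k. ennreal (2 ^ k) * (a k)^2)"
    by (simp add: nn_integral_count_space_nat power_mult_distrib ennreal_power)
  finally show ?thesis .
qed

lemma suminf_half_powers: "(\<Sum>k. ennreal ((1/2) ^ k)) = 2"
proof -
  have "(\<Sum>k. ennreal ((1/2) ^ k)) = ennreal (\<Sum>k. (1/2) ^ k)"
    by (intro suminf_ennreal2 summable_geometric) auto
  also have "(\<Sum>k. (1/2::real) ^ k) = 2" by (subst suminf_geometric) auto
  finally show ?thesis by simp
qed

text \<open>The weights \<open>2 ^ k\<close> give absolute convergence by the Cauchy-Schwarz
  inequality for series. Applied to the tail from \<open>n\<close> on, they leave a factor
  \<open>1 / 2 ^ n\<close>; the 2 is the sum of the powers of 1/2.\<close>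

lemma pointwise_limit_bound:
  fixes s :: "nat \<Rightarrow> complex"
  assumes fin: "(\<Sum>k. ennreal (2 ^ k) * ennorm2 (s (Suc k) - s k)) < \<infinity>"
  shows "convergent s"
    and "ennorm2 (lim s - s n) \<le> ennreal (2 / 2 ^ n) * (\<Sum>k. ennreal (2 ^ k) * ennorm2 (s (Suc k) - s k))"
proof -
  let ?S = "\<Sum>k. ennreal (2 ^ k) * ennorm2 (s (Suc k) - s k)"
  let ?a = "\<lambda>k. norm (s (Suc k) - s k)"
  have tail: "(\<Sum>k. ennreal (?a (k + n)))^2 \<le> ennreal (2 / 2 ^ n) * ?S" for n
  proof -
    have "(\<Sum>k. ennreal (?a (k + n)))^2 \<le> 2 * (\<Sum>k. ennreal (2 ^ k) * ennreal ((?a (k + n))^2))"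
      using series_Cauchy_Schwarz[of "\<lambda>k. ennreal (?a (k + n))"] by (simp add: suminf_half_powers ennreal_power)
    also have "(\<Sum>k. ennreal (2 ^ k) * ennreal ((?a (k + n))^2)) = (\<Sum>k. ennreal (1 / 2 ^ n) * (ennreal (2 ^ (k + n)) * ennreal ((?a (k + n))^2)))"
      by (intro suminf_cong) (simp add: power_add mult.assoc[symmetric] flip: ennreal_mult)
    also have "\<dots> = ennreal (1 / 2 ^ n) * (\<Sum>k. ennreal (2 ^ (k + n)) * ennreal ((?a (k + n))^2))"
      by (rule ennreal_suminf_cmult)
    also have "2 * \<dots> \<le> 2 * (ennreal (1 / 2 ^ n) * ?S)"
      by (intro mult_left_mono, subst suminf_offset[where i = n and f = "\<lambda>k. ennreal (2 ^ k) * ennreal ((?a k)^2)"]) auto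
    also have "\<dots> = (2 * ennreal (1 / 2 ^ n)) * ?S" by (rule mult.assoc[symmetric])
    also have "2 * ennreal (1 / 2 ^ n) = ennreal (2 / 2 ^ n)"
      using ennreal_mult[of 2 "1 / 2 ^ n"] by simp
    finally show ?thesis .
  qed
  have "(\<Sum>k. ennreal (?a k))^2 < \<infinity>" using tail[of 0] fin by (auto simp: ennreal_mult_less_top intro: le_less_trans)
  hence "(\<Sum>k. ennreal (?a k)) \<noteq> \<infinity>" by (auto simp: power2_eq_square)
  hence sum: "summable ?a" by (intro summable_suminf_not_top) auto
  hence sum': "summable (\<lambda>k. s (Suc k) - s k)" by (rule summable_norm_cancel)
  have telescope: "(\<Sum>k<m. s (Suc k) - s k) = s m - s 0" for m by (rule sum_lessThan_telescope)
  have "(\<lambda>m. s m - s 0) \<longlonglongrightarrow> (\<Sum>k. s (Suc k) - s k)"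
    using summable_LIMSEQ[OF sum'] unfolding telescope .
  from tendsto_add[OF this tendsto_const[of "s 0"]] have lim: "s \<longlonglongrightarrow> (\<Sum>k. s (Suc k) - s k) + s 0" by simp
  thus "convergent s" by (auto simp: convergent_def)
  have "lim s - s n = (\<Sum>k. s (Suc (k + n)) - s (k + n))"
    using suminf_split_initial_segment[OF sum', of n] limI[OF lim] unfolding telescope by simp
  also have "norm \<dots> \<le> (\<Sum>k. ?a (k + n))"
    by (rule summable_norm) (use sum summable_ignore_initial_segment[of ?a n] in simp)
  finally have "ennreal (norm (lim s - s n)) \<le> (\<Sum>k. ennreal (?a (k + n)))"
    using sum summable_ignore_initial_segment[of ?a n] by (subst suminf_ennreal2) (auto intro: ennreal_leI)
  hence "(ennreal (norm (lim s - s n)))^2 \<le> (\<Sum>k. ennreal (?a (k + n)))^2" by (intro power_mono) auto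
  also note tail[of n]
  finally show "ennorm2 (lim s - s n) \<le> ennreal (2 / 2 ^ n) * ?S" by (simp add: ennreal_power)
qed

text \<open>Steps of size \<open>(1/4) ^ n\<close> beat the weights \<open>2 ^ n\<close>, so the
  weighted series of squared increments is integrable and hence finite almost everywhere. The limit
  is named by \<open>lim\<close>, which keeps its measurability in a further parameter visible; the
  weight \<open>c\<close> serves the norm of order 1.\<close>

lemma riesz_fischer:
  fixes s :: "nat \<Rightarrow> 'b \<Rightarrow> complex"
  assumes [measurable]: "\<And>n. s n \<in> borel_measurable M"
    and fast: "\<And>n. (\<integral>\<^sup>+x. ennreal (c x) * ennorm2 (s (Suc n) x - s n x) \<partial>M) \<le> ennreal ((1/4) ^ n)"
    and [measurable]: "c \<in> borel_measurable M" and c: "AE x in M. c x > 0"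
  shows "AE x in M. convergent (\<lambda>n. s n x)"
    and "(\<integral>\<^sup>+x. ennreal (c x) * ennorm2 (lim (\<lambda>n. s n x) - s n x) \<partial>M) \<le> ennreal (4 / 2 ^ n)"
proof -
  let ?S = "\<lambda>x. \<Sum>k. ennreal (2 ^ k) * ennorm2 (s (Suc k) x - s k x)"
  have "(\<integral>\<^sup>+x. ennreal (c x) * ?S x \<partial>M) = (\<integral>\<^sup>+x. (\<Sum>k. ennreal (c x) * (ennreal (2 ^ k) * ennorm2 (s (Suc k) x - s k x))) \<partial>M)"
    by (simp only: ennreal_suminf_cmult)
  also have "\<dots> = (\<Sum>k. \<integral>\<^sup>+x. ennreal (c x) * (ennreal (2 ^ k) * ennorm2 (s (Suc k) x - s k x)) \<partial>M)"
    by (rule nn_integral_suminf) measurable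
  also have "\<dots> = (\<Sum>k. ennreal (2 ^ k) * (\<integral>\<^sup>+x. ennreal (c x) * ennorm2 (s (Suc k) x - s k x) \<partial>M))"
  proof (rule suminf_cong)
    fix k
    have "(\<integral>\<^sup>+x. ennreal (c x) * (ennreal (2 ^ k) * ennorm2 (s (Suc k) x - s k x)) \<partial>M)
      = (\<integral>\<^sup>+x. ennreal (2 ^ k) * (ennreal (c x) * ennorm2 (s (Suc k) x - s k x)) \<partial>M)"
      by (simp only: mult.left_commute)
    also have "\<dots> = ennreal (2 ^ k) * (\<integral>\<^sup>+x. ennreal (c x) * ennorm2 (s (Suc k) x - s k x) \<partial>M)"
      by (rule nn_integral_cmult) measurable
    finally show "(\<integral>\<^sup>+x. ennreal (c x) * (ennreal (2 ^ k) * ennorm2 (s (Suc k) x - s k x)) \<partial>M)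
      = ennreal (2 ^ k) * (\<integral>\<^sup>+x. ennreal (c x) * ennorm2 (s (Suc k) x - s k x) \<partial>M)" .
  qed
  also have "\<dots> \<le> (\<Sum>k. ennreal ((1/2) ^ k))"
  proof (intro suminf_le)
    fix k :: nat
    have "ennreal (2 ^ k) * (\<integral>\<^sup>+x. ennreal (c x) * ennorm2 (s (Suc k) x - s k x) \<partial>M) \<le> ennreal (2 ^ k) * ennreal ((1/4) ^ k)"
      by (intro mult_left_mono fast) auto
    also have "\<dots> = ennreal ((1/2) ^ k)" by (simp flip: ennreal_mult power_mult_distrib)
    finally show "ennreal (2 ^ k) * (\<integral>\<^sup>+x. ennreal (c x) * ennorm2 (s (Suc k) x - s k x) \<partial>M) \<le> ennreal ((1/2) ^ k)" .
  qed auto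
  also have "\<dots> = 2" by (rule suminf_half_powers)
  finally have int: "(\<integral>\<^sup>+x. ennreal (c x) * ?S x \<partial>M) \<le> 2" .
  hence "AE x in M. ennreal (c x) * ?S x \<noteq> \<infinity>" by (intro nn_integral_PInf_AE) (auto simp: top_unique)
  hence fin: "AE x in M. ?S x < \<infinity>"
    using c by eventually_elim (auto simp: ennreal_mult_eq_top_iff less_top)
  show "AE x in M. convergent (\<lambda>n. s n x)"
    using fin by eventually_elim (rule pointwise_limit_bound)
  have "(\<integral>\<^sup>+x. ennreal (c x) * ennorm2 (lim (\<lambda>n. s n x) - s n x) \<partial>M) \<le> (\<integral>\<^sup>+x. ennreal (2 / 2 ^ n) * (ennreal (c x) * ?S x) \<partial>M)"
  proof (rule nn_integral_mono_AE, use fin in eventually_elim)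
    fix x assume *: "?S x < \<infinity>"
    have "ennreal (c x) * ennorm2 (lim (\<lambda>n. s n x) - s n x) \<le> ennreal (c x) * (ennreal (2 / 2 ^ n) * ?S x)"
      by (intro mult_left_mono pointwise_limit_bound(2)[OF *]) auto
    thus "ennreal (c x) * ennorm2 (lim (\<lambda>n. s n x) - s n x) \<le> ennreal (2 / 2 ^ n) * (ennreal (c x) * ?S x)"
      by (simp only: mult.left_commute)
  qed
  also have "\<dots> = ennreal (2 / 2 ^ n) * (\<integral>\<^sup>+x. ennreal (c x) * ?S x \<partial>M)"
    by (rule nn_integral_cmult) measurable
  also have "\<dots> \<le> ennreal (2 / 2 ^ n) * 2" by (intro mult_left_mono int) auto
  also have "\<dots> = ennreal (4 / 2 ^ n)" using ennreal_mult[of "2 / 2 ^ n" 2] by simp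
  finally show "(\<integral>\<^sup>+x. ennreal (c x) * ennorm2 (lim (\<lambda>n. s n x) - s n x) \<partial>M) \<le> ennreal (4 / 2 ^ n)" .
qed

subsection \<open>Fourier inversion and the square integrable theory\<close>

lemma integrable_prod_kernel:
  fixes f g :: "'a::euclidean_space \<Rightarrow> complex"
  assumes f: "integrable lborel f" and g: "integrable lborel g"
    and [measurable]: "k \<in> borel_measurable (borel \<Otimes>\<^sub>M borel)" and k: "\<And>x y. norm (k (x, y)) \<le> 1"
  shows "integrable (lborel \<Otimes>\<^sub>M lborel) (\<lambda>(x, y). k (x, y) * f x * g y)"
proof (rule integrableI_bounded)
  have [measurable]: "f \<in> borel_measurable borel" "g \<in> borel_measurable borel" using f g by auto
  show meas: "(\<lambda>(x, y). k (x, y) * f x * g y) \<in> borel_measurable (lborel \<Otimes>\<^sub>M lborel)"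
    unfolding case_prod_unfold by measurable
  have m: "(\<lambda>p. ennreal (norm (k p * f (fst p) * g (snd p)))) \<in> borel_measurable (lborel \<Otimes>\<^sub>M lborel)" by measurable
  have "(\<integral>\<^sup>+p. ennreal (norm (case p of (x, y) \<Rightarrow> k (x, y) * f x * g y)) \<partial>(lborel \<Otimes>\<^sub>M lborel))
     = (NNI x. (NNI y. ennreal (norm (k (x, y) * f x * g y))))"
    using lborel.nn_integral_fst[OF m] by (simp add: case_prod_unfold)
  also have "\<dots> \<le> (NNI x. (NNI y. ennreal (norm (f x)) * ennreal (norm (g y))))"
  proof (intro nn_integral_mono)
    fix x y
    have "norm (k (x, y)) * norm (f x) * norm (g y) \<le> 1 * norm (f x) * norm (g y)"
      by (intro mult_right_mono k) auto
    thus "ennreal (norm (k (x, y) * f x * g y)) \<le> ennreal (norm (f x)) * ennreal (norm (g y))"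
      by (simp add: norm_mult flip: ennreal_mult)
  qed
  also have "\<dots> = (NNI x. ennreal (norm (f x))) * (NNI y. ennreal (norm (g y)))"
    by (simp add: nn_integral_cmult nn_integral_multc)
  also have "\<dots> < \<infinity>" using f g by (simp add: integrable_iff_bounded ennreal_mult_less_top)
  finally show "(\<integral>\<^sup>+p. ennreal (norm (case p of (x, y) \<Rightarrow> k (x, y) * f x * g y)) \<partial>(lborel \<Otimes>\<^sub>M lborel)) < \<infinity>" .
qed

lemma ft_multiplication_formula:
  fixes f g :: "'a::euclidean_space \<Rightarrow> complex"
  assumes f: "integrable lborel f" and g: "integrable lborel g"
  shows "(LINT x|lborel. ft \<sigma> f x * g x) = (LINT x|lborel. f x * ft \<sigma> g x)"
proof -
  have int: "integrable (lborel \<Otimes>\<^sub>M lborel) (\<lambda>(x, y). cis (\<sigma> * (x \<bullet> y)) * f x * g y)"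
    using integrable_prod_kernel[OF f g, of "\<lambda>p. cis (\<sigma> * (fst p \<bullet> snd p))"] by simp
  have "(LINT y|lborel. ft \<sigma> f y * g y) = (LINT y|lborel. (LINT x|lborel. cis (\<sigma> * (x \<bullet> y)) * f x * g y))"
    by (simp add: ft_def)
  also have "\<dots> = (LINT x|lborel. (LINT y|lborel. cis (\<sigma> * (x \<bullet> y)) * f x * g y))"
    by (rule lborel_pair.Fubini_integral) (rule int)
  also have "\<dots> = (LINT x|lborel. f x * ft \<sigma> g x)"
    by (intro Bochner_Integration.integral_cong) 
       (simp_all add: ft_def inner_commute mult_ac flip: integral_mult_right_zero)
  finally show ?thesis .
qed

lemma cnj_ft:
  assumes "integrable lborel f"
  shows "cnj (ft \<sigma> f \<xi>) = ft (- \<sigma>) (\<lambda>x. cnj (f x)) \<xi>"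
proof -
  have "cnj (ft \<sigma> f \<xi>) = (LINT x|lborel. cnj (cis (\<sigma> * (x \<bullet> \<xi>)) * f x))"
    unfolding ft_def
    by (rule integral_bounded_linear[OF bounded_linear_cnj integrable_cis_times[OF assms], symmetric])
  thus ?thesis by (simp add: ft_def cis_cnj)
qed

lemma ft_gauss_pairing:
  fixes f :: "'a::euclidean_space \<Rightarrow> complex"
  assumes f: "integrable lborel f" and a: "a > 0"
  shows "(LINT \<xi>|lborel. gauss a 0 c \<xi> * ft \<sigma> f \<xi>) =
    of_real (gauss_const a TYPE('a)) * (LINT y|lborel. of_real (exp (- (norm (c + \<sigma> *\<^sub>R y))\<^sup>2 / (4 * a))) * f y)"
proof -
  have "(LINT \<xi>|lborel. gauss a 0 c \<xi> * ft \<sigma> f \<xi>) = (LINT y|lborel. ft \<sigma> (gauss a 0 c) y * f y)"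
    by (rule ft_multiplication_formula[symmetric]) (intro rapid_integrable gauss_rapid a f)+
  also have "\<dots> = (LINT y|lborel. of_real (gauss_const a TYPE('a)) * (of_real (exp (- (norm (c + \<sigma> *\<^sub>R y))\<^sup>2 / (4 * a))) * f y))"
    by (intro Bochner_Integration.integral_cong) (simp_all only: ft_gauss[OF a] of_real_mult mult.assoc refl)
  also have "\<dots> = of_real (gauss_const a TYPE('a)) * (LINT y|lborel. of_real (exp (- (norm (c + \<sigma> *\<^sub>R y))\<^sup>2 / (4 * a))) * f y)"
    by (rule integral_mult_right_zero)
  finally show ?thesis .
qed

text \<open>Damping the inverse integral by a Gaussian of parameter \<open>(e n)^2\<close> turns it,
  by the multiplication formula, into an average of \<open>\<phi>\<close> around \<open>x\<close> at
  scale \<open>2 * e n\<close>. Both sides converge as \<open>e n\<close> tends to 0.\<close>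

theorem fourier_inversion:
  fixes \<phi> :: "real^'n \<Rightarrow> complex"
  assumes S: "schwartz \<phi>"
  shows "ft 1 (ft (-1) \<phi>) x = of_real ((2 * pi) ^ CARD('n)) * \<phi> x"
proof -
  let ?N = "CARD('n)"
  have phi: "integrable lborel \<phi>" "integrable lborel (ft (-1) \<phi>)"
    by (intro rapid_integrable schwartz_rapid ft_rapid S)+
  have [measurable]: "\<phi> \<in> borel_measurable borel" by (intro rapid_measurable schwartz_rapid S)
  obtain M where M: "M > 0" "\<And>x. norm (\<phi> x) \<le> M" using rapid_bounded[OF schwartz_rapid[OF S]] by blast
  define e where "e = (\<lambda>n. 1 / real (Suc n))"
  have e: "e n > 0" for n by (simp add: e_def)
  have e0: "e \<longlonglongrightarrow> 0" unfolding e_def by real_asymp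
  \<comment> \<open>Substituting \<open>y = x + (2 * e n) *\<^sub>R z\<close> normalises the
    Gaussian; the Jacobian and \<open>gauss_const\<close> combine to a constant free of
    \<open>n\<close>.\<close>
  have A: "(LINT \<xi>|lborel. gauss ((e n)^2) 0 x \<xi> * ft (-1) \<phi> \<xi>) =
     of_real ((2 * sqrt pi) ^ ?N) * (LINT z|lborel. of_real (exp (- (norm z)\<^sup>2)) * \<phi> (x + (2 * e n) *\<^sub>R z))" for n
  proof -
    have "(LINT \<xi>|lborel. gauss ((e n)^2) 0 x \<xi> * ft (-1) \<phi> \<xi>) =
      of_real (gauss_const ((e n)^2) TYPE(real^'n)) * (LINT y|lborel. of_real (exp (- (norm (x + (-1) *\<^sub>R y))\<^sup>2 / (4 * (e n)^2))) * \<phi> y)"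
      using e[of n] by (intro ft_gauss_pairing phi) auto
    also have "(LINT y|lborel. of_real (exp (- (norm (x + (-1) *\<^sub>R y))\<^sup>2 / (4 * (e n)^2))) * \<phi> y) 
       = of_real ((2 * e n) ^ ?N) * (LINT z|lborel. (\<lambda>y. of_real (exp (- (norm (x + (-1) *\<^sub>R y))\<^sup>2 / (4 * (e n)^2))) * \<phi> y) (x + (2 * e n) *\<^sub>R z))"
      using e[of n] by (subst integral_lborel_affine) (auto simp: scaleR_conv_of_real)
    also have "(LINT z|lborel. (\<lambda>y. of_real (exp (- (norm (x + (-1) *\<^sub>R y))\<^sup>2 / (4 * (e n)^2))) * \<phi> y) (x + (2 * e n) *\<^sub>R z))
       = (LINT z|lborel. of_real (exp (- (norm z)\<^sup>2)) * \<phi> (x + (2 * e n) *\<^sub>R z))"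
    proof (intro Bochner_Integration.integral_cong refl)
      fix z :: "real^'n"
      have "(norm (x + (-1) *\<^sub>R (x + (2 * e n) *\<^sub>R z)))^2 / (4 * (e n)^2) = (norm z)^2"
        using e[of n] by (simp add: power_mult_distrib)
      thus "(\<lambda>y. of_real (exp (- (norm (x + (-1) *\<^sub>R y))\<^sup>2 / (4 * (e n)^2))) * \<phi> y) (x + (2 * e n) *\<^sub>R z)
         = of_real (exp (- (norm z)\<^sup>2)) * \<phi> (x + (2 * e n) *\<^sub>R z)"
        by (simp only: minus_divide_left[symmetric])
    qed
    also have "of_real (gauss_const ((e n)^2) TYPE(real^'n)) * (of_real ((2 * e n) ^ ?N) * (LINT z|lborel. of_real (exp (- (norm z)\<^sup>2)) * \<phi> (x + (2 * e n) *\<^sub>R z)))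
      = of_real (gauss_const ((e n)^2) TYPE(real^'n) * (2 * e n) ^ ?N) * (LINT z|lborel. of_real (exp (- (norm z)\<^sup>2)) * \<phi> (x + (2 * e n) *\<^sub>R z))"
      by (simp only: of_real_mult mult.assoc)
    also have "gauss_const ((e n)^2) TYPE(real^'n) * (2 * e n) ^ ?N = (2 * sqrt pi) ^ ?N"
    proof -
      have "sqrt (pi / (e n)^2) * (2 * e n) = 2 * sqrt pi" using e[of n] by (simp add: real_sqrt_divide)
      moreover have "gauss_const ((e n)^2) TYPE(real^'n) * (2 * e n) ^ ?N = (sqrt (pi / (e n)^2) * (2 * e n)) ^ ?N"
        unfolding power_mult_distrib by (simp add: gauss_const_def)
      ultimately show ?thesis by (simp only:)
    qed
    finally show ?thesis .
  qed
  have B: "(\<lambda>n. LINT \<xi>|lborel. gauss ((e n)^2) 0 x \<xi> * ft (-1) \<phi> \<xi>) \<longlonglongrightarrow> ft 1 (ft (-1) \<phi>) x"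
    unfolding ft_def[of 1]
  proof (rule integral_dominated_convergence[where w = "\<lambda>\<xi>. norm (ft (-1) \<phi> \<xi>)"])
    show "integrable lborel (\<lambda>\<xi>. norm (ft (-1) \<phi> \<xi>))" by (intro integrable_norm phi)
    show "AE \<xi> in lborel. norm (gauss ((e n)^2) 0 x \<xi> * ft (-1) \<phi> \<xi>) \<le> norm (ft (-1) \<phi> \<xi>)" for n
      by (auto simp: norm_mult norm_gauss mult_left_le_one_le)
    show "AE \<xi> in lborel. (\<lambda>n. gauss ((e n)^2) 0 x \<xi> * ft (-1) \<phi> \<xi>) \<longlonglongrightarrow> cis (1 * (\<xi> \<bullet> x)) * ft (-1) \<phi> \<xi>"
    proof (intro AE_I2 tendsto_mult tendsto_const)
      fix \<xi> :: "real^'n"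
      have "(\<lambda>n. exp (- ((e n)^2) * (norm (\<xi> - 0))^2)) \<longlonglongrightarrow> exp (- (0^2) * (norm (\<xi> - 0))^2)"
        by (intro tendsto_intros e0)
      hence "(\<lambda>n. of_real (exp (- ((e n)^2) * (norm (\<xi> - 0))^2)) * cis (x \<bullet> \<xi>)) \<longlonglongrightarrow> of_real (exp (- (0^2) * (norm (\<xi> - 0))^2)) * cis (x \<bullet> \<xi>)"
        by (intro tendsto_mult tendsto_const tendsto_of_real)
      thus "(\<lambda>n. gauss ((e n)^2) 0 x \<xi>) \<longlonglongrightarrow> cis (1 * (\<xi> \<bullet> x))"
        by (simp add: gauss_def inner_commute)
    qed
  qed measurable
  have C: "(\<lambda>n. of_real ((2 * sqrt pi) ^ ?N) * (LINT z|lborel. of_real (exp (- (norm z)\<^sup>2)) * \<phi> (x + (2 * e n) *\<^sub>R z)))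
      \<longlonglongrightarrow> of_real ((2 * sqrt pi) ^ ?N) * (LINT z|lborel. of_real (exp (- (norm (z::real^'n))\<^sup>2)) * \<phi> x)"
  proof (intro tendsto_mult tendsto_const integral_dominated_convergence[where w = "\<lambda>z::real^'n. M * exp (- 1 * (norm (z - 0))^2)"])
    show "integrable lborel (\<lambda>z::real^'n. M * exp (- 1 * (norm (z - 0))^2))"
      by (intro integrable_mult_right gaussian_real_integrable) simp
    show "AE z in lborel. norm (of_real (exp (- (norm z)\<^sup>2)) * \<phi> (x + (2 * e n) *\<^sub>R z)) \<le> M * exp (- 1 * (norm (z - 0))^2)" for n
      using M by (auto simp: norm_mult mult.commute)
    show "AE z in lborel. (\<lambda>n. of_real (exp (- (norm z)\<^sup>2)) * \<phi> (x + (2 * e n) *\<^sub>R z)) \<longlonglongrightarrow> of_real (exp (- (norm z)\<^sup>2)) * \<phi> x"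
    proof (intro AE_I2 tendsto_mult tendsto_const)
      fix z :: "real^'n"
      have "(\<lambda>n. x + (2 * e n) *\<^sub>R z) \<longlonglongrightarrow> x + (2 * 0) *\<^sub>R z" by (intro tendsto_intros e0)
      moreover have "isCont \<phi> x" using schwartz_continuous[OF S, of UNIV] by (simp add: continuous_on_eq_continuous_at)
      ultimately show "(\<lambda>n. \<phi> (x + (2 * e n) *\<^sub>R z)) \<longlonglongrightarrow> \<phi> x"
        using isCont_tendsto_compose[of x \<phi>] by simp
    qed
  qed measurable
  have "ft 1 (ft (-1) \<phi>) x = of_real ((2 * sqrt pi) ^ ?N) * (LINT z|lborel. of_real (exp (- (norm (z::real^'n))\<^sup>2)) * \<phi> x)"
    by (rule LIMSEQ_unique[OF B[unfolded A] C])
  also have "(LINT z|lborel. of_real (exp (- (norm (z::real^'n))\<^sup>2)) * \<phi> x) = of_real (gauss_const 1 TYPE(real^'n)) * \<phi> x"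
    using integral_gauss[of 1 "0::real^'n"] by (simp add: gauss_def)
  also have "of_real ((2 * sqrt pi) ^ ?N) * (of_real (gauss_const 1 TYPE(real^'n)) * \<phi> x) = of_real ((2 * pi) ^ ?N) * \<phi> x"
  proof -
    have "(2 * sqrt pi) ^ ?N * gauss_const 1 TYPE(real^'n) = (2 * pi) ^ ?N"
    proof -
      have "(2 * sqrt pi) ^ ?N * gauss_const 1 TYPE(real^'n) = (2 * sqrt pi * sqrt pi) ^ ?N"
        unfolding power_mult_distrib by (simp add: gauss_const_def)
      also have "2 * sqrt pi * sqrt pi = 2 * pi" by (simp add: mult.assoc)
      finally show ?thesis .
    qed
    thus ?thesis by (simp only: mult.assoc[symmetric] of_real_mult[symmetric])
  qed
  finally show ?thesis .
qed

text \<open>The Gaussian weight makes Fubini applicable before Plancherel is available; it is removed in the limit \<open>a \<rightarrow> 0\<close>.\<close>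

lemma ft_gauss_energy:
  fixes f :: "'a::euclidean_space \<Rightarrow> complex"
  assumes f: "integrable lborel f" and a: "a > 0" and \<sigma>: "\<sigma> * \<sigma> = 1"
  shows "(NNI \<xi>. ennreal (exp (- a * (norm \<xi>)^2) * (norm (ft \<sigma> f \<xi>))^2)) \<le> ennreal ((2 * pi) ^ DIM('a)) * L2sq f"
proof -
  have [measurable]: "f \<in> borel_measurable borel" using f by auto
  define F where "F = ft \<sigma> f"
  have [measurable]: "F \<in> borel_measurable borel" unfolding F_def by measurable
  define M where "M = (LINT x|lborel. norm (f x))"
  have FM: "norm (F \<xi>) \<le> M" for \<xi> unfolding F_def M_def by (rule ft_bound)
  define h where "h = (\<lambda>y::'a. exp (- (1 / (4 * a)) * (norm (y - 0))^2))"
  have [measurable]: "h \<in> borel_measurable borel" unfolding h_def by measurable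
  define k where "k = gauss_const a TYPE('a)"
  have k: "k > 0" unfolding k_def by (rule gauss_const_pos[OF a])
  \<comment> \<open>Chosen so that the product of \<open>F\<close> and \<open>G\<close> is the
    damped square of the modulus of \<open>F\<close>, while the transform of \<open>G\<close> is a
    Gaussian average of the conjugate of \<open>f\<close>. The multiplication formula links the
    two.\<close>
  define G where "G = (\<lambda>\<xi>. gauss a 0 0 \<xi> * cnj (F \<xi>))"
  have G: "integrable lborel G"
  proof -
    have "integrable lborel (\<lambda>\<xi>. cnj (F \<xi>) * gauss a 0 0 \<xi>)"
      using FM by (intro rapid_integrable rapid_times_bounded[where B = M] gauss_rapid a) auto
    thus ?thesis by (simp add: G_def mult.commute)
  qed
  have ftG: "ft \<sigma> G x = of_real k * (LINT y|lborel. of_real (h (y - x)) * cnj (f y))" for x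
  proof -
    have "ft \<sigma> G x = (LINT \<xi>|lborel. gauss a 0 (\<sigma> *\<^sub>R x) \<xi> * ft (- \<sigma>) (\<lambda>x. cnj (f x)) \<xi>)"
    proof -
      have "cis (\<sigma> * (\<xi> \<bullet> x)) * G \<xi> = gauss a 0 (\<sigma> *\<^sub>R x) \<xi> * ft (- \<sigma>) (\<lambda>x. cnj (f x)) \<xi>" for \<xi>
        by (simp add: G_def F_def cnj_ft[OF f] gauss_def inner_commute mult_ac)
      thus ?thesis by (simp only: ft_def[of \<sigma> G])
    qed
    also have "\<dots> = of_real k * (LINT y|lborel. of_real (exp (- (norm (\<sigma> *\<^sub>R x + (- \<sigma>) *\<^sub>R y))\<^sup>2 / (4 * a))) * cnj (f y))"
      unfolding k_def using f by (intro ft_gauss_pairing a) simp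
    also have "(\<lambda>y. exp (- (norm (\<sigma> *\<^sub>R x + (- \<sigma>) *\<^sub>R y))\<^sup>2 / (4 * a))) = (\<lambda>y. h (y - x))"
    proof
      fix y
      have "\<sigma> *\<^sub>R x + (- \<sigma>) *\<^sub>R y = (- \<sigma>) *\<^sub>R (y - x)" by (simp add: scaleR_diff_right)
      hence "(norm (\<sigma> *\<^sub>R x + (- \<sigma>) *\<^sub>R y))^2 = (\<sigma> * \<sigma>) * (norm (y - x))^2"
        by (simp add: power_mult_distrib power2_eq_square)
      thus "exp (- (norm (\<sigma> *\<^sub>R x + (- \<sigma>) *\<^sub>R y))\<^sup>2 / (4 * a)) = h (y - x)" by (simp add: h_def \<sigma>)
    qed
    finally show ?thesis by (simp only: fun_eq_iff)
  qed
  have pos: "0 \<le> exp (- a * (norm \<xi>)^2) * (norm (F \<xi>))^2" for \<xi> :: 'a by simp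
  have "F \<xi> * G \<xi> = of_real (exp (- a * (norm \<xi>)^2) * (norm (F \<xi>))^2)" for \<xi>
  proof -
    have "F \<xi> * cnj (F \<xi>) = of_real ((norm (F \<xi>))^2)" by (rule complex_norm_square[symmetric])
    thus ?thesis by (simp add: G_def gauss_def mult.left_commute)
  qed
  hence eq1: "(LINT \<xi>|lborel. F \<xi> * G \<xi>) = of_real (LINT \<xi>|lborel. exp (- a * (norm \<xi>)^2) * (norm (F \<xi>))^2)"
    by (simp only: integral_complex_of_real)
  have int: "integrable lborel (\<lambda>\<xi>::'a. exp (- a * (norm \<xi>)^2) * (norm (F \<xi>))^2)"
  proof (rule Bochner_Integration.integrable_bound)
    show "integrable lborel (\<lambda>\<xi>::'a. M^2 * exp (- a * (norm (\<xi> - 0))^2))"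
      by (intro integrable_mult_right gaussian_real_integrable a)
    have "(norm (F \<xi>))^2 \<le> M^2" for \<xi> by (intro power_mono FM) auto
    thus "AE \<xi> in lborel. norm (exp (- a * (norm \<xi>)^2) * (norm (F \<xi>))^2) \<le> norm (M^2 * exp (- a * (norm (\<xi> - 0))^2))"
      by (auto simp: mult.commute)
  qed measurable
  have "(NNI \<xi>. ennreal (exp (- a * (norm \<xi>)^2) * (norm (F \<xi>))^2)) = ennreal (LINT \<xi>|lborel. exp (- a * (norm \<xi>)^2) * (norm (F \<xi>))^2)"
    using int pos by (intro nn_integral_eq_integral) auto
  also have "\<dots> = ennreal (norm (LINT \<xi>|lborel. F \<xi> * G \<xi>))"
    unfolding eq1 norm_of_real using pos by (simp add: integral_nonneg_AE)
  also have "(LINT \<xi>|lborel. F \<xi> * G \<xi>) = (LINT x|lborel. f x * ft \<sigma> G x)"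
    unfolding F_def by (rule ft_multiplication_formula[OF f G])
  also have "ennreal (norm \<dots>) \<le> (NNI x. ennreal (norm (f x * ft \<sigma> G x)))"
  proof (rule integral_norm_bound_ennreal)
    have [measurable]: "G \<in> borel_measurable borel" using G by auto
    show "integrable lborel (\<lambda>x. f x * ft \<sigma> G x)"
    proof (rule Bochner_Integration.integrable_bound)
      show "integrable lborel (\<lambda>x. (LINT x|lborel. norm (G x)) * norm (f x))" by (intro integrable_mult_right integrable_norm f)
      have "norm (ft \<sigma> G x) \<le> \<bar>LINT x|lborel. norm (G x)\<bar>" for x using ft_bound[of \<sigma> G x] by linarith
      thus "AE x in lborel. norm (f x * ft \<sigma> G x) \<le> norm ((LINT x|lborel. norm (G x)) * norm (f x))"
        by (intro AE_I2) (simp add: norm_mult abs_mult mult.commute mult_left_mono)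
    qed measurable
  qed
  also have "\<dots> \<le> (NNI x. ennreal k * (NNI y. ennreal (norm (f x)) * ennreal (norm (f y)) * ennreal (h (y - x))))"
  proof (rule nn_integral_mono)
    fix x
    have "ennreal (norm (LINT y|lborel. of_real (h (y - x)) * cnj (f y))) \<le> (NNI y. ennreal (norm (of_real (h (y - x)) * cnj (f y))))"
    proof (rule integral_norm_bound_ennreal, rule Bochner_Integration.integrable_bound)
      show "integrable lborel (\<lambda>y. norm (f y))" by (intro integrable_norm f)
      show "AE y in lborel. norm (of_real (h (y - x)) * cnj (f y)) \<le> norm (norm (f y))"
        using a by (auto simp: norm_mult h_def mult_left_le_one_le)
    qed measurable
    also have "\<dots> = (NNI y. ennreal (norm (f y)) * ennreal (h (y - x)))"
      by (intro nn_integral_cong) (simp add: norm_mult h_def mult.commute flip: ennreal_mult)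
    finally have "ennreal (norm (f x)) * (ennreal k * ennreal (norm (LINT y|lborel. of_real (h (y - x)) * cnj (f y)))) 
      \<le> ennreal (norm (f x)) * (ennreal k * (NNI y. ennreal (norm (f y)) * ennreal (h (y - x))))"
      by (intro mult_left_mono) auto
    also have "\<dots> = ennreal k * (NNI y. ennreal (norm (f x)) * ennreal (norm (f y)) * ennreal (h (y - x)))"
    proof -
      have "(NNI y. ennreal (norm (f x)) * ennreal (norm (f y)) * ennreal (h (y - x))) = ennreal (norm (f x)) * (NNI y. ennreal (norm (f y)) * ennreal (h (y - x)))"
        unfolding mult.assoc by (rule nn_integral_cmult) measurable
      thus ?thesis by (simp only: mult.left_commute)
    qed
    finally show "ennreal (norm (f x * ft \<sigma> G x)) \<le> ennreal k * (NNI y. ennreal (norm (f x)) * ennreal (norm (f y)) * ennreal (h (y - x)))"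
      unfolding ftG using k by (simp add: norm_mult ennreal_mult)
  qed
  also have "\<dots> = ennreal k * (NNI x. (NNI y. ennreal (norm (f x)) * ennreal (norm (f y)) * ennreal (h (y - x))))"
    by (rule nn_integral_cmult) measurable
  \<comment> \<open>Schur's test by hand: a product of moduli is at most half the sum of the
    squares, and then one of the variables integrates out against the Gaussian
    \<open>h\<close>.\<close>
  also have "ennreal k * (NNI x. (NNI y. ennreal (norm (f x)) * ennreal (norm (f y)) * ennreal (h (y - x))))
    \<le> ennreal k * (NNI x. (NNI y. ennreal ((norm (f x))^2 / 2) * ennreal (h (y - x)) + ennreal ((norm (f y))^2 / 2) * ennreal (h (y - x))))"
  proof (intro mult_left_mono nn_integral_mono)
    fix x y
    have "norm (f x) * norm (f y) \<le> (norm (f x))^2 / 2 + (norm (f y))^2 / 2"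
      using zero_le_power2[of "norm (f x) - norm (f y)"] by (simp add: power2_eq_square algebra_simps)
    hence "ennreal (norm (f x) * norm (f y)) \<le> ennreal ((norm (f x))^2 / 2) + ennreal ((norm (f y))^2 / 2)"
      by (subst ennreal_plus[symmetric]) (simp_all add: ennreal_leI del: ennreal_plus)
    hence "ennreal (norm (f x) * norm (f y)) * ennreal (h (y - x)) \<le> (ennreal ((norm (f x))^2 / 2) + ennreal ((norm (f y))^2 / 2)) * ennreal (h (y - x))"
      by (rule mult_right_mono) simp
    thus "ennreal (norm (f x)) * ennreal (norm (f y)) * ennreal (h (y - x)) \<le> ennreal ((norm (f x))^2 / 2) * ennreal (h (y - x)) + ennreal ((norm (f y))^2 / 2) * ennreal (h (y - x))"
      by (simp add: ennreal_mult distrib_right)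
  qed simp
  also have "(NNI x. (NNI y. ennreal ((norm (f x))^2 / 2) * ennreal (h (y - x)) + ennreal ((norm (f y))^2 / 2) * ennreal (h (y - x)))) = (NNI x. (NNI y. ennreal ((norm (f x))^2 / 2) * ennreal (h (y - x)))) + (NNI x. (NNI y. ennreal ((norm (f y))^2 / 2) * ennreal (h (y - x))))"
    by (simp add: nn_integral_add)
  also have "(NNI x. (NNI y. ennreal ((norm (f y))^2 / 2) * ennreal (h (y - x)))) = (NNI y. (NNI x. ennreal ((norm (f y))^2 / 2) * ennreal (h (y - x))))"
    by (rule lborel_pair.Fubini') measurable
  also have "\<dots> = (NNI y. ennreal ((norm (f y))^2 / 2) * (NNI x. ennreal (h x)))"
  proof (rule nn_integral_cong)
    fix y
    have "(NNI x. ennreal (h (y - x))) = (NNI x. ennreal (h x))"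
      using nn_integral_lborel_reflect[of "\<lambda>x. ennreal (h x)" y] by simp
    thus "(NNI x. ennreal ((norm (f y))^2 / 2) * ennreal (h (y - x))) = ennreal ((norm (f y))^2 / 2) * (NNI x. ennreal (h x))"
      by (simp add: nn_integral_cmult)
  qed
  also have "(NNI x. (NNI y. ennreal ((norm (f x))^2 / 2) * ennreal (h (y - x)))) = (NNI y. ennreal ((norm (f y))^2 / 2) * (NNI x. ennreal (h x)))"
  proof (rule nn_integral_cong)
    fix x
    have "(NNI y. ennreal (h (y - x))) = (NNI x. ennreal (h x))"
      using nn_integral_lborel_translate[of "\<lambda>x. ennreal (h x)" "- x"] by simp
    thus "(NNI y. ennreal ((norm (f x))^2 / 2) * ennreal (h (y - x))) = ennreal ((norm (f x))^2 / 2) * (NNI x. ennreal (h x))"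
      by (simp add: nn_integral_cmult)
  qed
  also have "(NNI y. ennreal ((norm (f y))^2 / 2) * (NNI x. ennreal (h x))) + (NNI y. ennreal ((norm (f y))^2 / 2) * (NNI x. ennreal (h x)))
     = (NNI x. ennreal (h x)) * L2sq f"
  proof -
    have "(NNI y. ennreal ((norm (f y))^2 / 2) * (NNI x. ennreal (h x))) + (NNI y. ennreal ((norm (f y))^2 / 2) * (NNI x. ennreal (h x)))
      = (NNI y. ennreal ((norm (f y))^2 / 2) * (NNI x. ennreal (h x)) + ennreal ((norm (f y))^2 / 2) * (NNI x. ennreal (h x)))"
      by (rule nn_integral_add[symmetric]) measurable
    also have "\<dots> = (NNI y. ennorm2 (f y) * (NNI x. ennreal (h x)))"
    proof (rule nn_integral_cong)
      fix y
      have "ennreal ((norm (f y))^2 / 2) + ennreal ((norm (f y))^2 / 2) = ennorm2 (f y)"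
        by (subst ennreal_plus[symmetric]) auto
      thus "ennreal ((norm (f y))^2 / 2) * (NNI x. ennreal (h x)) + ennreal ((norm (f y))^2 / 2) * (NNI x. ennreal (h x)) = ennorm2 (f y) * (NNI x. ennreal (h x))"
        by (simp flip: distrib_right)
    qed
    also have "\<dots> = (NNI x. ennreal (h x)) * L2sq f"
      unfolding L2sq_def by (subst nn_integral_multc) (auto simp: mult.commute)
    finally show ?thesis .
  qed
  also have "(NNI x. ennreal (h x)) = ennreal (gauss_const (1 / (4 * a)) TYPE('a))"
  proof -
    have "(NNI x. ennreal (h x)) = ennreal (LINT x|lborel. h x)"
      unfolding h_def using a by (intro nn_integral_eq_integral gaussian_real_integrable) auto
    also have "(LINT x|lborel. h x) = gauss_const (1 / (4 * a)) TYPE('a)"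
      unfolding h_def diff_zero using a by (intro gaussian_real_integral) simp
    finally show ?thesis .
  qed
  also have "ennreal k * (ennreal (gauss_const (1 / (4 * a)) TYPE('a)) * L2sq f) = ennreal (k * gauss_const (1 / (4 * a)) TYPE('a)) * L2sq f"
    using k by (subst ennreal_mult') (auto simp: mult.assoc)
  \<comment> \<open>The two Gaussian constants multiply to a value free of \<open>a\<close>, which
    permits the limit \<open>a \<rightarrow> 0\<close>.\<close>
  also have "k * gauss_const (1 / (4 * a)) TYPE('a) = (2 * pi) ^ DIM('a)"
  proof -
    have "pi / a * (pi / (1 / (4 * a))) = (2 * pi)^2" using a by (simp add: power2_eq_square)
    hence "sqrt (pi / a) * sqrt (pi / (1 / (4 * a))) = sqrt ((2 * pi)^2)" by (simp only: real_sqrt_mult[symmetric])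
    also have "\<dots> = 2 * pi" by (subst real_sqrt_abs) simp
    finally have "sqrt (pi / a) * sqrt (pi / (1 / (4 * a))) = 2 * pi" .
    thus ?thesis by (simp only: k_def gauss_const_def power_mult_distrib[symmetric])
  qed
  finally show ?thesis unfolding F_def .
qed

theorem ft_L2_bound:
  fixes f :: "'a::euclidean_space \<Rightarrow> complex"
  assumes f: "integrable lborel f" and \<sigma>: "\<sigma> * \<sigma> = 1"
  shows "L2sq (ft \<sigma> f) \<le> ennreal ((2 * pi) ^ DIM('a)) * L2sq f"
proof -
  have [measurable]: "f \<in> borel_measurable borel" using f by auto
  define e where "e = (\<lambda>n. 1 / real (Suc n))"
  have e: "e n > 0" for n by (simp add: e_def)
  have e0: "e \<longlonglongrightarrow> 0" unfolding e_def by real_asymp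
  let ?g = "\<lambda>n \<xi>. ennreal (exp (- e n * (norm (\<xi>::'a))^2) * (norm (ft \<sigma> f \<xi>))^2)"
  have "L2sq (ft \<sigma> f) = (NNI \<xi>. liminf (\<lambda>n. ?g n \<xi>))"
    unfolding L2sq_def
  proof (rule nn_integral_cong)
    fix \<xi> :: 'a
    have "(\<lambda>n. exp (- e n * (norm \<xi>)^2) * (norm (ft \<sigma> f \<xi>))^2) \<longlonglongrightarrow> exp (- 0 * (norm \<xi>)^2) * (norm (ft \<sigma> f \<xi>))^2"
      by (intro tendsto_intros e0)
    hence "(\<lambda>n. ?g n \<xi>) \<longlonglongrightarrow> ennorm2 (ft \<sigma> f \<xi>)" by (intro tendsto_ennrealI) simp
    thus "ennorm2 (ft \<sigma> f \<xi>) = liminf (\<lambda>n. ?g n \<xi>)"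
      by (rule lim_imp_Liminf[OF sequentially_bot, symmetric])
  qed
  also have "\<dots> \<le> liminf (\<lambda>n. \<integral>\<^sup>+\<xi>. ?g n \<xi> \<partial>lborel)"
    by (intro nn_integral_liminf) measurable
  also have "\<dots> \<le> liminf (\<lambda>n. ennreal ((2 * pi) ^ DIM('a)) * L2sq f)"
    by (intro Liminf_mono always_eventually allI ft_gauss_energy f e \<sigma>)
  also have "\<dots> = ennreal ((2 * pi) ^ DIM('a)) * L2sq f" by (simp add: Liminf_const)
  finally show ?thesis .
qed

lemma L2_imp_integrable_bounded_support:
  assumes "L2 f" shows "integrable lborel (\<lambda>x. f x * indicator (cball 0 R) x)"
proof -
  have "L2 (\<lambda>x::'a. indicator (cball 0 R) x :: complex)"
  proof -
    have "L2sq (\<lambda>x::'a. indicator (cball 0 R) x :: complex) = (NNI x. indicator (cball (0::'a) R) x)"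
      unfolding L2sq_def by (intro nn_integral_cong) (auto split: split_indicator)
    also have "\<dots> = emeasure lborel (cball (0::'a) R)" by simp
    also have "\<dots> < \<infinity>" using emeasure_lborel_cball_finite[of "0::'a" R] by simp
    finally show ?thesis
      unfolding L2_def by (intro conjI borel_measurable_indicator) auto
  qed
  with assms show ?thesis by (rule L2_mult_integrable)
qed

lemma L2_tail:
  fixes f :: "'a::euclidean_space \<Rightarrow> complex"
  assumes f: "L2 f" and e: "e > 0"
  shows "\<exists>m::nat. \<forall>R\<ge>real m. L2sq (\<lambda>x. f x * indicator (- cball 0 R) x) \<le> ennreal e"
proof -
  have [measurable]: "f \<in> borel_measurable borel" using f by (simp add: L2_def)
  have [measurable]: "cball (0::'a) R \<in> sets borel" for R by simp
  let ?F = "\<lambda>n x. ennorm2 (f x * indicator (- cball 0 (real n)) x)"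
  have "(\<lambda>n. \<integral>\<^sup>+x. ?F n x \<partial>lborel) \<longlonglongrightarrow> (\<integral>\<^sup>+x. 0 \<partial>(lborel :: 'a measure))"
  proof (rule nn_integral_dominated_convergence[where w = "\<lambda>x. ennorm2 (f x)"])
    show "(NNI x. ennorm2 (f x)) < \<infinity>" using f by (simp add: L2_def L2sq_def)
    show "AE x in lborel. ?F n x \<le> ennorm2 (f x)" for n
      by (auto split: split_indicator)
    show "AE x in lborel. (\<lambda>n. ?F n x) \<longlonglongrightarrow> 0"
    proof (rule AE_I2)
      fix x :: 'a
      obtain N :: nat where N: "norm x \<le> real N" using real_arch_simple by blast
      have "?F n x = 0" if "n \<ge> N" for n
      proof -
        have "norm x \<le> real n" using N that by (meson of_nat_mono order_trans)
        thus ?thesis by simp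
      qed
      thus "(\<lambda>n. ?F n x) \<longlonglongrightarrow> 0"
        by (intro tendsto_eventually) (auto simp: eventually_sequentially)
    qed
  qed measurable
  hence "(\<lambda>n. L2sq (\<lambda>x. f x * indicator (- cball 0 (real n)) x)) \<longlonglongrightarrow> 0" by (simp add: L2sq_def)
  hence "eventually (\<lambda>n. L2sq (\<lambda>x. f x * indicator (- cball 0 (real n)) x) < ennreal e) sequentially"
    using e by (intro order_tendstoD) auto
  then obtain m where m: "L2sq (\<lambda>x. f x * indicator (- cball 0 (real m)) x) < ennreal e"
    by (auto simp: eventually_sequentially)
  show ?thesis
  proof (intro exI[of _ m] allI impI)
    fix R assume R: "R \<ge> real m"
    have "L2sq (\<lambda>x. f x * indicator (- cball 0 R) x) \<le> L2sq (\<lambda>x. f x * indicator (- cball 0 (real m)) x)"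
      unfolding L2sq_def using R by (intro nn_integral_mono) (auto split: split_indicator)
    thus "L2sq (\<lambda>x. f x * indicator (- cball 0 R) x) \<le> ennreal e" using m by simp
  qed
qed

text \<open>Truncated to balls, \<open>f\<close> is integrable and its transform explicit. Radii
  with tails of order \<open>(1/4) ^ k\<close> make these transforms a fast Cauchy sequence, whose
  limit \<open>g\<close> inherits the multiplication formula. The factor 2 in the bound comes from
  splitting \<open>g\<close> into a member of the sequence and an error.\<close>

theorem L2_fourier_exists:
  fixes f :: "'a::euclidean_space \<Rightarrow> complex"
  assumes f: "L2 f" and \<sigma>: "\<sigma> * \<sigma> = 1"
  obtains g where "L2 g" "L2sq g \<le> ennreal (2 * (2 * pi) ^ DIM('a)) * L2sq f"
    "\<And>\<phi>. rapid \<phi> \<Longrightarrow> (LINT x|lborel. f x * ft \<sigma> \<phi> x) = (LINT x|lborel. g x * \<phi> x)"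
proof -
  let ?c = "(2 * pi) ^ DIM('a)"
  have c: "?c > 0" by simp
  have [measurable]: "f \<in> borel_measurable borel" using f by (simp add: L2_def)
  have [measurable]: "cball (0::'a) R \<in> sets borel" for R by simp
  define tail where "tail = (\<lambda>R. L2sq (\<lambda>x. f x * indicator (- cball 0 R) x))"
  have "\<exists>m::nat. \<forall>R\<ge>real m. tail R \<le> ennreal ((1/4) ^ k / ?c)" for k
    unfolding tail_def by (rule L2_tail[OF f]) simp
  then obtain m where m: "\<And>k R. R \<ge> real (m k) \<Longrightarrow> tail R \<le> ennreal ((1/4) ^ k / ?c)" by metis
  \<comment> \<open>Summing makes the radii increasing and at least \<open>m k\<close>; the added 1
    makes them unbounded.\<close>
  define R where "R = (\<lambda>k::nat. real (\<Sum>i\<le>k. m i + 1))"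
  have R_mono: "R k \<le> R (Suc k)" for k by (simp add: R_def)
  have R_m: "real (m k) \<le> R k" for k
    unfolding R_def of_nat_le_iff by (simp add: lessThan_Suc_atMost[symmetric])
  have R_k: "real k \<le> R k" for k
    unfolding R_def of_nat_le_iff by (induction k) auto
  define fk where "fk = (\<lambda>k x. f x * indicator (cball 0 (R k)) x)"
  have [measurable]: "fk k \<in> borel_measurable borel" for k unfolding fk_def by measurable
  have fk_int: "integrable lborel (fk k)" for k
    unfolding fk_def by (rule L2_imp_integrable_bounded_support[OF f])
  define s where "s = (\<lambda>k. ft \<sigma> (fk k))"
  have [measurable]: "s k \<in> borel_measurable borel" for k unfolding s_def by measurable
  have ft_diff: "ft \<sigma> p x - ft \<sigma> q x = ft \<sigma> (\<lambda>y. p y - q y) x" if "integrable lborel p" "integrable lborel q" for p q x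
    using integrable_cis_times[OF that(1), of \<sigma> x] integrable_cis_times[OF that(2), of \<sigma> x]
    by (simp add: ft_def right_diff_distrib)
  have fast: "(NNI x. ennreal 1 * ennorm2 (s (Suc n) x - s n x)) \<le> ennreal ((1/4) ^ n)" for n
  proof -
    have "(NNI x. ennreal 1 * ennorm2 (s (Suc n) x - s n x)) = L2sq (ft \<sigma> (\<lambda>y. fk (Suc n) y - fk n y))"
      by (simp add: L2sq_def s_def ft_diff[OF fk_int fk_int])
    also have "\<dots> \<le> ennreal ?c * L2sq (\<lambda>y. fk (Suc n) y - fk n y)"
      by (intro ft_L2_bound Bochner_Integration.integrable_diff fk_int \<sigma>)
    also have "L2sq (\<lambda>y. fk (Suc n) y - fk n y) \<le> tail (R n)"
      unfolding L2sq_def tail_def fk_def using R_mono[of n]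
      by (intro nn_integral_mono) (auto split: split_indicator)
    also have "ennreal ?c * tail (R n) \<le> ennreal ?c * ennreal ((1/4) ^ n / ?c)"
      by (intro mult_left_mono m R_m) auto
    also have "\<dots> = ennreal ((1/4) ^ n)" using c by (simp flip: ennreal_mult)
    finally show ?thesis by (simp add: mult_left_mono)
  qed
  define g where "g = (\<lambda>x. lim (\<lambda>n. s n x))"
  have [measurable]: "g \<in> borel_measurable borel" unfolding g_def by measurable
  have close: "L2sq (\<lambda>x. g x - s n x) \<le> ennreal (4 / 2 ^ n)" for n
    using riesz_fischer(2)[of s lborel "\<lambda>_. 1" n] fast by (simp add: L2sq_def g_def)
  have s_L2: "L2sq (s n) \<le> ennreal ?c * L2sq f" for n
  proof -
    have "L2sq (s n) \<le> ennreal ?c * L2sq (fk n)" unfolding s_def by (rule ft_L2_bound[OF fk_int \<sigma>])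
    also have "\<dots> \<le> ennreal ?c * L2sq f"
      unfolding L2sq_def fk_def by (intro mult_left_mono nn_integral_mono) (auto split: split_indicator)
    finally show ?thesis .
  qed
  have lim0: "(\<lambda>n. 4 / 2 ^ n :: real) \<longlonglongrightarrow> 0" by real_asymp
  have bound: "L2sq g \<le> ennreal (2 * ?c) * L2sq f"
  proof (rule LIMSEQ_le_const)
    show "(\<lambda>n. 2 * ennreal (4 / 2 ^ n) + ennreal (2 * ?c) * L2sq f) \<longlonglongrightarrow> ennreal (2 * ?c) * L2sq f"
    proof -
      have "(\<lambda>n. ennreal (4 / 2 ^ n)) \<longlonglongrightarrow> ennreal 0" by (intro tendsto_ennrealI lim0)
      hence "(\<lambda>n. 2 * ennreal (4 / 2 ^ n)) \<longlonglongrightarrow> 2 * ennreal 0"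
        by (intro ennreal_tendsto_cmult) auto
      hence "(\<lambda>n. 2 * ennreal (4 / 2 ^ n) + ennreal (2 * ?c) * L2sq f) \<longlonglongrightarrow> 2 * ennreal 0 + ennreal (2 * ?c) * L2sq f"
        by (intro tendsto_add tendsto_const)
      thus ?thesis by simp
    qed
    have "L2sq g \<le> 2 * ennreal (4 / 2 ^ n) + ennreal (2 * ?c) * L2sq f" for n
    proof -
      have "L2sq (\<lambda>x. (g x - s n x) + s n x) \<le> 2 * L2sq (\<lambda>x. g x - s n x) + 2 * L2sq (s n)"
        by (rule L2sq_add_le) measurable
      also have "\<dots> \<le> 2 * ennreal (4 / 2 ^ n) + 2 * (ennreal ?c * L2sq f)"
        by (intro add_mono mult_left_mono close s_L2) auto
      also have "2 * (ennreal ?c * L2sq f) = ennreal (2 * ?c) * L2sq f"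
        using ennreal_mult[of 2 ?c] by (simp add: mult.assoc)
      finally show ?thesis by simp
    qed
    thus "\<exists>N. \<forall>n\<ge>N. L2sq g \<le> 2 * ennreal (4 / 2 ^ n) + ennreal (2 * ?c) * L2sq f" by blast
  qed
  have g: "L2 g"
    using bound f unfolding L2_def by (auto simp: ennreal_mult_less_top intro: le_less_trans)
  have sL: "L2 (s n)" for n
    using s_L2[of n] f unfolding L2_def by (auto simp: ennreal_mult_less_top intro: le_less_trans)
  show ?thesis
  proof (rule that[OF g bound])
    fix \<phi> :: "'a \<Rightarrow> complex" assume \<phi>: "rapid \<phi>"
    have \<phi>_int: "integrable lborel \<phi>" by (rule rapid_integrable[OF \<phi>])
    have [measurable]: "\<phi> \<in> borel_measurable borel" by (rule rapid_measurable[OF \<phi>])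
    have \<phi>L: "L2 \<phi>" by (rule rapid_imp_L2[OF \<phi>])
    have ft\<phi>: "L2 (ft \<sigma> \<phi>)"
      using ft_L2_bound[OF \<phi>_int \<sigma>] \<phi>L unfolding L2_def by (auto simp: ennreal_mult_less_top intro: le_less_trans)
    have 1: "(\<lambda>n. LINT x|lborel. fk n x * ft \<sigma> \<phi> x) \<longlonglongrightarrow> (LINT x|lborel. f x * ft \<sigma> \<phi> x)"
    proof (rule integral_dominated_convergence[where w = "\<lambda>x. norm (f x * ft \<sigma> \<phi> x)"])
      show "integrable lborel (\<lambda>x. norm (f x * ft \<sigma> \<phi> x))" by (intro integrable_norm L2_mult_integrable f ft\<phi>)
      show "AE x in lborel. norm (fk n x * ft \<sigma> \<phi> x) \<le> norm (f x * ft \<sigma> \<phi> x)" for n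
        by (auto simp: fk_def split: split_indicator)
      show "AE x in lborel. (\<lambda>n. fk n x * ft \<sigma> \<phi> x) \<longlonglongrightarrow> f x * ft \<sigma> \<phi> x"
      proof (rule AE_I2)
        fix x :: 'a
        obtain N :: nat where N: "norm x \<le> real N" using real_arch_simple by blast
        have "fk n x = f x" if "n \<ge> N" for n
        proof -
          have "norm x \<le> R n" using N that R_k[of n] by (meson of_nat_mono order_trans)
          thus ?thesis by (simp add: fk_def)
        qed
        thus "(\<lambda>n. fk n x * ft \<sigma> \<phi> x) \<longlonglongrightarrow> f x * ft \<sigma> \<phi> x"
          by (intro tendsto_eventually) (auto simp: eventually_sequentially)
      qed
    qed measurable
    have eq: "(LINT x|lborel. fk n x * ft \<sigma> \<phi> x) = (LINT x|lborel. s n x * \<phi> x)" for n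
      unfolding s_def by (rule ft_multiplication_formula[OF fk_int \<phi>_int, symmetric])
    have 2: "(\<lambda>n. LINT x|lborel. s n x * \<phi> x) \<longlonglongrightarrow> (LINT x|lborel. g x * \<phi> x)"
    proof (rule Lim_null[THEN iffD2])
      have "ennorm2 ((LINT x|lborel. s n x * \<phi> x) - (LINT x|lborel. g x * \<phi> x)) \<le> ennreal (4 / 2 ^ n) * L2sq \<phi>" for n
      proof -
        have "(LINT x|lborel. s n x * \<phi> x) - (LINT x|lborel. g x * \<phi> x) = - (LINT x|lborel. (g x - s n x) * \<phi> x)"
          using L2_mult_integrable[OF sL \<phi>L] L2_mult_integrable[OF g \<phi>L] by (simp add: left_diff_distrib)
        hence "ennorm2 ((LINT x|lborel. s n x * \<phi> x) - (LINT x|lborel. g x * \<phi> x)) \<le> L2sq (\<lambda>x. g x - s n x) * L2sq \<phi>"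
          using L2_mult_integral_bound[OF L2_diff[OF g sL] \<phi>L] by (simp only: norm_minus_cancel)
        also have "\<dots> \<le> ennreal (4 / 2 ^ n) * L2sq \<phi>" by (intro mult_right_mono close) auto
        finally show ?thesis .
      qed
      moreover obtain L where L: "L2sq \<phi> = ennreal L" "L \<ge> 0" using \<phi>L by (cases "L2sq \<phi>") (auto simp: L2_def)
      ultimately have le: "(norm ((LINT x|lborel. s n x * \<phi> x) - (LINT x|lborel. g x * \<phi> x)))^2 \<le> (4 / 2 ^ n) * L" for n
        by (simp flip: ennreal_mult)
      have l0: "(\<lambda>n. (4 / 2 ^ n) * L) \<longlonglongrightarrow> 0" by (rule tendsto_mult_left_zero[OF lim0])
      have "(\<lambda>n. (norm ((LINT x|lborel. s n x * \<phi> x) - (LINT x|lborel. g x * \<phi> x)))^2) \<longlonglongrightarrow> 0"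
        by (rule tendsto_sandwich[OF always_eventually always_eventually tendsto_const l0]) (intro allI le zero_le_power2)+
      from tendsto_real_sqrt[OF this]
      have "(\<lambda>n. norm ((LINT x|lborel. s n x * \<phi> x) - (LINT x|lborel. g x * \<phi> x))) \<longlonglongrightarrow> 0"
        by (simp only: real_sqrt_abs abs_norm_cancel real_sqrt_zero)
      thus "(\<lambda>n. (LINT x|lborel. s n x * \<phi> x) - (LINT x|lborel. g x * \<phi> x)) \<longlonglongrightarrow> 0"
        by (rule tendsto_norm_zero_cancel)
    qed
    from LIMSEQ_unique[OF 1[unfolded eq] 2] show "(LINT x|lborel. f x * ft \<sigma> \<phi> x) = (LINT x|lborel. g x * \<phi> x)" .
  qed
qed

section \<open>Distributional transforms of Borel and square integrable functions\<close>

lemma tempered_AE_cong: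
  assumes f: "tempered f" and g: "g \<in> borel_measurable lebesgue" and eq: "AE x in lborel. f x = g x"
  shows "tempered g"
  unfolding tempered_def
proof (intro conjI allI impI g)
  fix \<phi> :: "real^'a \<Rightarrow> complex" assume S: "schwartz \<phi>"
  have [measurable]: "\<phi> \<in> borel_measurable lebesgue"
    using rapid_measurable[OF schwartz_rapid[OF S]] by (intro measurable_completion) simp
  note [measurable] = g tempered_measurable[OF f]
  have ae: "AE x in lebesgue. f x * \<phi> x = g x * \<phi> x"
    using AE_completion[OF eq] by eventually_elim simp
  have "(\<lambda>x. f x * \<phi> x) \<in> borel_measurable lebesgue" "(\<lambda>x. g x * \<phi> x) \<in> borel_measurable lebesgue"
    by measurable
  from integrable_cong_AE[OF this ae] tempered_integrable[OF f S]
  show "integrable lebesgue (\<lambda>x. g x * \<phi> x)" by (simp only:)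
qed

lemma fourier_integral_lebesgue_measurable:
  assumes "schwartz \<phi>"
  shows "fourier_integral \<phi> \<in> borel_measurable lebesgue"
proof -
  have [measurable]: "\<phi> \<in> borel_measurable borel" by (rule rapid_measurable[OF schwartz_rapid[OF assms]])
  have "fourier_integral \<phi> \<in> borel_measurable borel" by (subst fourier_integral_ft) measurable
  thus ?thesis by (intro measurable_completion) simp
qed

lemma has_fourier_AE_cong:
  assumes h: "has_fourier f g" and f': "f' \<in> borel_measurable lebesgue" "AE x in lborel. f x = f' x"
    and g': "g' \<in> borel_measurable lebesgue" "AE x in lborel. g x = g' x"
  shows "has_fourier f' g'"
  unfolding has_fourier_def
proof (intro conjI allI impI)
  have t: "tempered f" "tempered g" using h by (auto simp: has_fourier_def)
  note [measurable] = f'(1) g'(1) tempered_measurable[OF t(1)] tempered_measurable[OF t(2)]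
  show "tempered f'" "tempered g'" using t f' g' by (blast intro: tempered_AE_cong)+
  fix \<phi> :: "real^'a \<Rightarrow> complex" assume S: "schwartz \<phi>"
  note [measurable] = fourier_integral_lebesgue_measurable[OF S]
  have [measurable]: "\<phi> \<in> borel_measurable lebesgue"
    using rapid_measurable[OF schwartz_rapid[OF S]] by (intro measurable_completion) simp
  have "(LINT x|lebesgue. f' x * fourier_integral \<phi> x) = (LINT x|lebesgue. f x * fourier_integral \<phi> x)"
  proof (rule integral_cong_AE)
    show "AE x in lebesgue. f' x * fourier_integral \<phi> x = f x * fourier_integral \<phi> x"
      using AE_completion[OF f'(2)] by eventually_elim simp
  qed measurable
  also have "\<dots> = (LINT x|lebesgue. g x * \<phi> x)" using h S by (simp add: has_fourier_def)
  also have "\<dots> = (LINT x|lebesgue. g' x * \<phi> x)"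
  proof (rule integral_cong_AE)
    show "AE x in lebesgue. g x * \<phi> x = g' x * \<phi> x"
      using AE_completion[OF g'(2)] by eventually_elim simp
  qed measurable
  finally show "(LINT x|lebesgue. f' x * fourier_integral \<phi> x) = (LINT x|lebesgue. g' x * \<phi> x)" .
qed

lemma tempered_borel:
  assumes [measurable]: "f \<in> borel_measurable borel"
    and int: "\<And>\<phi>. schwartz \<phi> \<Longrightarrow> integrable lborel (\<lambda>x. f x * \<phi> x)"
  shows "tempered f"
  unfolding tempered_def
proof (intro conjI allI impI)
  show "f \<in> borel_measurable lebesgue" by (intro measurable_completion) simp
  fix \<phi> :: "real^'a \<Rightarrow> complex" assume S: "schwartz \<phi>"
  have [measurable]: "\<phi> \<in> borel_measurable borel" by (rule rapid_measurable[OF schwartz_rapid[OF S]])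
  show "integrable lebesgue (\<lambda>x. f x * \<phi> x)" using int[OF S] by (subst integrable_completion) auto
qed

lemma has_fourier_borel:
  assumes [measurable]: "f \<in> borel_measurable borel" "g \<in> borel_measurable borel"
    and int: "\<And>\<phi>. schwartz \<phi> \<Longrightarrow> integrable lborel (\<lambda>x. f x * \<phi> x)" "\<And>\<phi>. schwartz \<phi> \<Longrightarrow> integrable lborel (\<lambda>x. g x * \<phi> x)"
    and eq: "\<And>\<phi>. schwartz \<phi> \<Longrightarrow> (LINT x|lborel. f x * ft (-1) \<phi> x) = (LINT x|lborel. g x * \<phi> x)"
  shows "has_fourier f g"
  unfolding has_fourier_def
proof (intro conjI allI impI)
  show "tempered f" "tempered g" by (intro tempered_borel int assms; assumption)+
  fix \<phi> :: "real^'a \<Rightarrow> complex" assume S: "schwartz \<phi>"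
  have [measurable]: "\<phi> \<in> borel_measurable borel" by (rule rapid_measurable[OF schwartz_rapid[OF S]])
  have "(LINT x|lebesgue. f x * fourier_integral \<phi> x) = (LINT x|lborel. f x * ft (-1) \<phi> x)"
    by (subst fourier_integral_ft, measurable, rule integral_completion) measurable
  also have "\<dots> = (LINT x|lborel. g x * \<phi> x)" by (rule eq[OF S])
  also have "\<dots> = (LINT x|lebesgue. g x * \<phi> x)"
    by (rule integral_completion[symmetric]) measurable
  finally show "(LINT x|lebesgue. f x * fourier_integral \<phi> x) = (LINT x|lebesgue. g x * \<phi> x)" .
qed

lemma has_fourier_borelD:
  assumes h: "has_fourier f g" and [measurable]: "f \<in> borel_measurable borel" "g \<in> borel_measurable borel"
    and S: "schwartz \<phi>"
  shows "integrable lborel (\<lambda>x. f x * \<phi> x)" "integrable lborel (\<lambda>x. g x * \<phi> x)"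
    "(LINT x|lborel. f x * ft (-1) \<phi> x) = (LINT x|lborel. g x * \<phi> x)"
proof -
  have [measurable]: "\<phi> \<in> borel_measurable borel" by (rule rapid_measurable[OF schwartz_rapid[OF S]])
  have t: "tempered f" "tempered g" using h by (auto simp: has_fourier_def)
  show "integrable lborel (\<lambda>x. f x * \<phi> x)"
    by (rule integrable_completion[THEN iffD1, OF _ tempered_integrable[OF t(1) S]]) measurable
  show "integrable lborel (\<lambda>x. g x * \<phi> x)"
    by (rule integrable_completion[THEN iffD1, OF _ tempered_integrable[OF t(2) S]]) measurable
  have "(LINT x|lborel. f x * ft (-1) \<phi> x) = (LINT x|lebesgue. f x * fourier_integral \<phi> x)"
    by (subst fourier_integral_ft, measurable, rule integral_completion[symmetric]) measurable
  also have "\<dots> = (LINT x|lebesgue. g x * \<phi> x)" using h S by (simp add: has_fourier_def)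
  also have "\<dots> = (LINT x|lborel. g x * \<phi> x)" by (rule integral_completion) measurable
  finally show "(LINT x|lborel. f x * ft (-1) \<phi> x) = (LINT x|lborel. g x * \<phi> x)" .
qed

lemma L2_schwartz_integrable: "L2 f \<Longrightarrow> schwartz \<phi> \<Longrightarrow> integrable lborel (\<lambda>x. f x * \<phi> x)"
  by (rule L2_mult_integrable) (auto intro: rapid_imp_L2 schwartz_rapid)

lemma L2_has_fourier:
  fixes f :: "real^'n \<Rightarrow> complex"
  assumes f: "L2 f"
  obtains g where "L2 g" "L2sq g \<le> ennreal (2 * (2 * pi) ^ CARD('n)) * L2sq f" "has_fourier f g"
proof -
  obtain g where g: "L2 g" "L2sq g \<le> ennreal (2 * (2 * pi) ^ DIM(real^'n)) * L2sq f"
    "\<And>\<phi>. rapid \<phi> \<Longrightarrow> (LINT x|lborel. f x * ft (-1) \<phi> x) = (LINT x|lborel. g x * \<phi> x)"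
    by (rule L2_fourier_exists[OF f, of "-1"]) auto
  show ?thesis
  proof (rule that[OF g(1)])
    show "has_fourier f g"
      by (intro has_fourier_borel L2_measurable f g L2_schwartz_integrable schwartz_rapid)
  qed (use g(2) in simp)
qed

text \<open>The preimage is the transform of \<open>g\<close> with the opposite sign, divided by a
  power of \<open>2 * pi\<close>. Since only pairings with Schwartz functions have to be checked,
  inversion for those suffices.\<close>

lemma L2_has_inverse_fourier:
  fixes g :: "real^'n \<Rightarrow> complex"
  assumes g: "L2 g"
  obtains f where "L2 f" "L2sq f \<le> ennreal 2 * L2sq g" "has_fourier f g"
proof -
  let ?c = "(2 * pi) ^ CARD('n)"
  obtain f where f: "L2 f" "L2sq f \<le> ennreal (2 * (2 * pi) ^ DIM(real^'n)) * L2sq g"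
    "\<And>\<phi>. rapid \<phi> \<Longrightarrow> (LINT x|lborel. g x * ft 1 \<phi> x) = (LINT x|lborel. f x * \<phi> x)"
    by (rule L2_fourier_exists[OF g, of 1]) auto
  let ?k = "complex_of_real (1 / ?c)"
  have c: "?c \<ge> 1" using pi_gt3 by (intro one_le_power) simp
  show ?thesis
  proof (rule that)
    show L: "L2 (\<lambda>x. ?k * f x)" by (rule L2_cmult[OF f(1)])
    have "L2sq (\<lambda>x. ?k * f x) = ennreal ((1 / ?c)^2) * L2sq f"
      using L2_measurable[OF f(1)] by (subst L2sq_cmult) (auto simp: norm_divide norm_power norm_mult)
    also have "\<dots> \<le> ennreal ((1 / ?c)^2) * (ennreal (2 * ?c) * L2sq g)"
      using f(2) by (intro mult_left_mono) auto
    also have "\<dots> = ennreal ((1 / ?c)^2 * (2 * ?c)) * L2sq g"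
      by (subst ennreal_mult) (auto simp: mult.assoc)
    also have "\<dots> \<le> ennreal 2 * L2sq g"
    proof (intro mult_right_mono ennreal_leI)
      have "(1 / ?c)^2 * (2 * ?c) = 2 / ?c" by (simp add: power2_eq_square)
      also have "\<dots> \<le> 2 / 1" using c by (intro divide_left_mono) auto
      finally show "(1 / ?c)^2 * (2 * ?c) \<le> 2" by simp
    qed simp
    finally show "L2sq (\<lambda>x. ?k * f x) \<le> ennreal 2 * L2sq g" .
    show "has_fourier (\<lambda>x. ?k * f x) g"
    proof (intro has_fourier_borel L2_measurable L g L2_schwartz_integrable)
      fix \<phi> :: "real^'n \<Rightarrow> complex" assume S: "schwartz \<phi>"
      have "(LINT x|lborel. ?k * f x * ft (-1) \<phi> x) = ?k * (LINT x|lborel. f x * ft (-1) \<phi> x)"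
        by (simp only: mult.assoc integral_mult_right_zero)
      also have "(LINT x|lborel. f x * ft (-1) \<phi> x) = (LINT x|lborel. g x * ft 1 (ft (-1) \<phi>) x)"
        by (rule f(3)[symmetric]) (rule ft_rapid[OF S])
      also have "\<dots> = (LINT x|lborel. of_real ?c * (g x * \<phi> x))"
        unfolding fourier_inversion[OF S] by (simp only: mult.left_commute)
      also have "\<dots> = of_real ?c * (LINT x|lborel. g x * \<phi> x)" by (rule integral_mult_right_zero)
      also have "?k * (of_real ?c * (LINT x|lborel. g x * \<phi> x)) = (LINT x|lborel. g x * \<phi> x)"
        by (simp add: mult.assoc[symmetric] flip: of_real_mult of_real_power)
      finally show "(LINT x|lborel. ?k * f x * ft (-1) \<phi> x) = (LINT x|lborel. g x * \<phi> x)" .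
    qed
  qed
qed

lemma bounded_schwartz_integrable:
  assumes [measurable]: "f \<in> borel_measurable borel" and "\<And>x. norm (f x) \<le> B" "rapid \<phi>"
  shows "integrable lborel (\<lambda>x. f x * \<phi> x)"
  by (intro rapid_integrable rapid_times_bounded[OF assms(3,1,2)])

text \<open>For the low frequencies of a function of order 1: near the origin its transform is
  integrable but perhaps not square integrable, so the preceding lemma does not apply to it.\<close>

lemma L1_has_inverse_fourier:
  fixes g :: "real^'n \<Rightarrow> complex"
  assumes g: "integrable lborel g"
    and int: "\<And>\<phi>. schwartz \<phi> \<Longrightarrow> integrable lborel (\<lambda>x. g x * \<phi> x)"
  shows "has_fourier (\<lambda>x. of_real (1 / (2 * pi) ^ CARD('n)) * ft 1 g x) g"
proof (rule has_fourier_borel)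
  let ?c = "(2 * pi) ^ CARD('n)"
  let ?k = "complex_of_real (1 / ?c)"
  show [measurable]: "g \<in> borel_measurable borel" using g by auto
  show [measurable]: "(\<lambda>x. ?k * ft 1 g x) \<in> borel_measurable borel" by measurable
  fix \<phi> :: "real^'n \<Rightarrow> complex" assume S: "schwartz \<phi>"
  show "integrable lborel (\<lambda>x. g x * \<phi> x)" by (rule int[OF S])
  have "norm (?k * ft 1 g x) \<le> norm ?k * (LINT x|lborel. norm (g x))" for x
    unfolding norm_mult by (intro mult_left_mono ft_bound) auto
  thus "integrable lborel (\<lambda>x. ?k * ft 1 g x * \<phi> x)"
    by (intro bounded_schwartz_integrable schwartz_rapid S) auto
  have \<phi>: "integrable lborel (ft (-1) \<phi>)" by (intro rapid_integrable ft_rapid S)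
  have "(LINT x|lborel. ?k * ft 1 g x * ft (-1) \<phi> x) = ?k * (LINT x|lborel. ft 1 g x * ft (-1) \<phi> x)"
    by (simp only: mult.assoc integral_mult_right_zero)
  also have "(LINT x|lborel. ft 1 g x * ft (-1) \<phi> x) = (LINT x|lborel. g x * ft 1 (ft (-1) \<phi>) x)"
    by (rule ft_multiplication_formula[OF g \<phi>])
  also have "\<dots> = (LINT x|lborel. of_real ?c * (g x * \<phi> x))"
    unfolding fourier_inversion[OF S] by (simp only: mult.left_commute)
  also have "\<dots> = of_real ?c * (LINT x|lborel. g x * \<phi> x)" by (rule integral_mult_right_zero)
  also have "?k * (of_real ?c * (LINT x|lborel. g x * \<phi> x)) = (LINT x|lborel. g x * \<phi> x)"
    by (simp add: mult.assoc[symmetric] flip: of_real_mult of_real_power)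
  finally show "(LINT x|lborel. ?k * ft 1 g x * ft (-1) \<phi> x) = (LINT x|lborel. g x * \<phi> x)" .
qed

subsection \<open>Fourier transforms of products\<close>

text \<open>The condition on transforms of functions of order 1. Such a \<open>U\<close> may fail to
  be integrable at infinity and square integrable near the origin, hence the repeated splitting at a
  ball.\<close>

definition sob1 :: "(real^3 \<Rightarrow> complex) \<Rightarrow> bool" where
  "sob1 U \<longleftrightarrow> U \<in> borel_measurable borel \<and>
     (NNI \<xi>. ennorm2 \<xi> * ennorm2 (U \<xi>)) < \<infinity>"

lemma sob1_measurable: "sob1 U \<Longrightarrow> U \<in> borel_measurable borel"
  by (simp add: sob1_def)

lemma nn_integral_inverse_square_cball:
  "(NNI (x::real^3). ennreal (1 / (norm x)^2) * indicator (cball 0 R) x) < \<infinity>"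
proof -
  have [measurable]: "ball (0::real^3) 1 \<in> sets borel" "cball (0::real^3) R \<in> sets borel" by auto
  have "(NNI (x::real^3). ennreal (1 / (norm x)^2) * indicator (cball 0 R) x)
     \<le> (NNI (x::real^3). ennreal (1 / (norm x)^2) * indicator (ball 0 1) x + indicator (cball 0 R) x)"
  proof (rule nn_integral_mono)
    fix x :: "real^3"
    show "ennreal (1 / (norm x)^2) * indicator (cball 0 R) x \<le> ennreal (1 / (norm x)^2) * indicator (ball 0 1) x + indicator (cball 0 R) x"
    proof (cases "norm x < 1")
      case True thus ?thesis by (auto split: split_indicator)
    next
      case False
      hence "1 \<le> (norm x)^2" by (simp add: one_le_power)
      hence "1 / (norm x)^2 \<le> 1 / 1" by (intro divide_left_mono) auto
      hence "1 / (norm x)^2 \<le> 1" by simp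
      thus ?thesis using False by (auto split: split_indicator simp: ennreal_le_1)
    qed
  qed
  also have "\<dots> = (NNI (x::real^3). ennreal (1 / (norm x)^2) * indicator (ball 0 1) x) + (NNI (x::real^3). indicator (cball 0 R) x)"
    by (rule nn_integral_add) measurable
  also have "\<dots> < \<infinity>"
    using nn_integral_inner_square emeasure_lborel_cball_finite[of "0::real^3" R]
    by (auto simp: less_top[symmetric] top_unique)
  finally show ?thesis .
qed

text \<open>By the Cauchy-Schwarz inequality against \<open>1 / norm \<xi>\<close>, which is square
  integrable on bounded sets in dimension 3.\<close>

lemma sob1_low_integrable:
  assumes U: "sob1 U" shows "integrable lborel (\<lambda>\<xi>. U \<xi> * indicator (cball 0 R) \<xi>)"
proof (rule integrableI_bounded)
  have [measurable]: "U \<in> borel_measurable borel" using U by (rule sob1_measurable)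
  have [measurable]: "cball (0::real^3) R \<in> sets borel" by auto
  show "(\<lambda>\<xi>. U \<xi> * indicator (cball 0 R) \<xi>) \<in> borel_measurable lborel" by measurable
  have ae: "AE \<xi> in lborel. \<xi> \<noteq> (0::real^3)" by (rule AE_lborel_singleton)
  let ?I = "\<integral>\<^sup>+\<xi>. (ennreal (1 / norm \<xi>) * indicator (cball 0 R) \<xi>) * (ennreal (norm \<xi>) * ennreal (norm (U \<xi>))) \<partial>lborel"
  have "(NNI \<xi>. ennreal (norm (U \<xi> * indicator (cball 0 R) \<xi>))) = ?I"
  proof (rule nn_integral_cong_AE, use ae in eventually_elim)
    fix \<xi> :: "real^3" assume "\<xi> \<noteq> 0"
    hence "ennreal (1 / norm \<xi>) * (ennreal (norm \<xi>) * ennreal (norm (U \<xi>))) = ennreal (norm (U \<xi>))"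
      by (simp flip: ennreal_mult)
    thus "ennreal (norm (U \<xi> * indicator (cball 0 R) \<xi>)) = (ennreal (1 / norm \<xi>) * indicator (cball 0 R) \<xi>) * (ennreal (norm \<xi>) * ennreal (norm (U \<xi>)))"
      by (auto split: split_indicator)
  qed
  moreover have "?I^2 \<le> (NNI (\<xi>::real^3). (ennreal (1 / norm \<xi>) * indicator (cball 0 R) \<xi>)^2) * (NNI \<xi>. (ennreal (norm \<xi>) * ennreal (norm (U \<xi>)))^2)"
    by (rule Cauchy_Schwarz_nn_integral) measurable
  moreover have "(NNI (\<xi>::real^3). (ennreal (1 / norm \<xi>) * indicator (cball 0 R) \<xi>)^2) = (NNI (\<xi>::real^3). ennreal (1 / (norm \<xi>)^2) * indicator (cball 0 R) \<xi>)"
    by (intro nn_integral_cong) (auto split: split_indicator simp: ennreal_power power_divide)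
  moreover have "(NNI \<xi>. (ennreal (norm \<xi>) * ennreal (norm (U \<xi>)))^2) = (NNI \<xi>. ennorm2 \<xi> * ennorm2 (U \<xi>))"
    by (intro nn_integral_cong) (simp add: power_mult_distrib ennreal_power)
  ultimately have "(NNI \<xi>. ennreal (norm (U \<xi> * indicator (cball 0 R) \<xi>)))^2 < \<infinity>"
    using nn_integral_inverse_square_cball[of R] U by (auto simp: sob1_def ennreal_mult_less_top intro: le_less_trans)
  thus "(NNI \<xi>. ennreal (norm (U \<xi> * indicator (cball 0 R) \<xi>))) < \<infinity>"
    by (cases "(NNI \<xi>. ennreal (norm (U \<xi> * indicator (cball 0 R) \<xi>)))") (auto simp: power2_eq_square)
qed

lemma sob1_high_L2:
  assumes U: "sob1 U" and R: "R \<ge> 1" shows "L2 (\<lambda>\<xi>. U \<xi> * indicator (- cball 0 R) \<xi>)"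
proof -
  have [measurable]: "U \<in> borel_measurable borel" using U by (rule sob1_measurable)
  have [measurable]: "cball (0::real^3) R \<in> sets borel" by auto
  have "L2sq (\<lambda>\<xi>. U \<xi> * indicator (- cball 0 R) \<xi>) \<le> (NNI \<xi>. ennorm2 \<xi> * ennorm2 (U \<xi>))"
    unfolding L2sq_def
  proof (rule nn_integral_mono)
    fix \<xi> :: "real^3"
    show "ennorm2 (U \<xi> * indicator (- cball 0 R) \<xi>) \<le> ennorm2 \<xi> * ennorm2 (U \<xi>)"
    proof (cases "norm \<xi> \<le> R")
      case False
      hence "1 \<le> (norm \<xi>)^2" using R by (intro one_le_power) auto
      hence "1 * (norm (U \<xi>))^2 \<le> (norm \<xi>)^2 * (norm (U \<xi>))^2" by (intro mult_right_mono) auto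
      thus ?thesis using False by (simp flip: ennreal_mult)
    qed simp
  qed
  also have "\<dots> < \<infinity>" using U by (simp add: sob1_def)
  finally show ?thesis unfolding L2_def by simp
qed

definition inv3 :: complex where "inv3 = of_real (1 / (2 * pi) ^ 3)"

text \<open>Integrability against \<open>rapid\<close> functions is asked for because
  \<open>ft (-1) \<phi>\<close> is known to be \<open>rapid\<close> only, and temperedness speaks of
  Schwartz functions.\<close>

lemma has_fourier_add:
  fixes f f' g g' :: "real^'n \<Rightarrow> complex"
  assumes h: "has_fourier f g" "has_fourier f' g'"
    and [measurable]: "f \<in> borel_measurable borel" "f' \<in> borel_measurable borel"
      "g \<in> borel_measurable borel" "g' \<in> borel_measurable borel"
    and int: "\<And>\<phi>. rapid \<phi> \<Longrightarrow> integrable lborel (\<lambda>x. f x * \<phi> x)" "\<And>\<phi>. rapid \<phi> \<Longrightarrow> integrable lborel (\<lambda>x. f' x * \<phi> x)"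
  shows "has_fourier (\<lambda>x. f x + f' x) (\<lambda>x. g x + g' x)"
proof (rule has_fourier_borel)
  fix \<phi> :: "real^'n \<Rightarrow> complex" assume S: "schwartz \<phi>"
  note 1 = has_fourier_borelD[OF h(1) assms(3,5) S]
  note 2 = has_fourier_borelD[OF h(2) assms(4,6) S]
  show "integrable lborel (\<lambda>x. (f x + f' x) * \<phi> x)" "integrable lborel (\<lambda>x. (g x + g' x) * \<phi> x)"
    using 1 2 by (simp_all add: distrib_right)
  have "(LINT x|lborel. (f x + f' x) * ft (-1) \<phi> x) = (LINT x|lborel. f x * ft (-1) \<phi> x) + (LINT x|lborel. f' x * ft (-1) \<phi> x)"
    using int[OF ft_rapid[OF S]] by (simp add: distrib_right)
  also have "\<dots> = (LINT x|lborel. (g x + g' x) * \<phi> x)"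
    using 1 2 by (simp add: distrib_right)
  finally show "(LINT x|lborel. (f x + f' x) * ft (-1) \<phi> x) = (LINT x|lborel. (g x + g' x) * \<phi> x)" .
qed measurable

lemma has_fourier_cmult:
  fixes f g :: "real^'n \<Rightarrow> complex"
  assumes "has_fourier f g"
  shows "has_fourier (\<lambda>x. c * f x) (\<lambda>x. c * g x)"
  using assms unfolding has_fourier_def tempered_def by (auto simp: mult.assoc)

text \<open>The low frequencies give a bounded function, the high ones a square integrable function
  controlled by the tail of \<open>U\<close>, which tends to 0 as \<open>R\<close> grows. A product
  of two functions of order 1 becomes accessible in this way.\<close>

lemma sob1_split:
  assumes U: "sob1 U" and h: "has_fourier u U" and [measurable]: "u \<in> borel_measurable borel" and R: "R \<ge> 1"
  obtains b where "L2 b" "L2sq b \<le> 2 * L2sq (\<lambda>\<xi>. U \<xi> * indicator (- cball 0 R) \<xi>)"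
    "AE x in lborel. u x = inv3 * ft 1 (\<lambda>\<xi>. U \<xi> * indicator (cball 0 R) \<xi>) x + b x"
proof -
  have [measurable]: "U \<in> borel_measurable borel" using U by (rule sob1_measurable)
  have [measurable]: "cball (0::real^3) R \<in> sets borel" by auto
  let ?lo = "\<lambda>\<xi>. U \<xi> * indicator (cball 0 R) \<xi>" and ?hi = "\<lambda>\<xi>. U \<xi> * indicator (- cball 0 R) \<xi>"
  obtain b where b: "L2 b" "L2sq b \<le> ennreal 2 * L2sq ?hi" "has_fourier b ?hi"
    using L2_has_inverse_fourier[OF sob1_high_L2[OF U R]] by blast
  have [measurable]: "b \<in> borel_measurable borel" using b(1) by (rule L2_measurable)
  have lo: "integrable lborel ?lo" by (rule sob1_low_integrable[OF U])
  have loint: "integrable lborel (\<lambda>x. ?lo x * \<phi> x)" if S: "schwartz \<phi>" for \<phi>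
  proof -
    obtain M where M: "\<And>x. norm (\<phi> x) \<le> M" using rapid_bounded[OF schwartz_rapid[OF S]] by blast
    have [measurable]: "\<phi> \<in> borel_measurable borel" using rapid_measurable[OF schwartz_rapid[OF S]] .
    show ?thesis
    proof (rule Bochner_Integration.integrable_bound)
      show "integrable lborel (\<lambda>x. M * norm (?lo x))" by (intro integrable_mult_right integrable_norm lo)
      have "norm (?lo x) * norm (\<phi> x) \<le> \<bar>M\<bar> * norm (?lo x)" for x
        using mult_left_mono[of "norm (\<phi> x)" "\<bar>M\<bar>" "norm (?lo x)"] M[of x] by (simp add: mult.commute)
      thus "AE x in lborel. norm (?lo x * \<phi> x) \<le> norm (M * norm (?lo x))"
        by (intro AE_I2) (simp add: norm_mult abs_mult)
    qed measurable
  qed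
  have fa: "has_fourier (\<lambda>x. inv3 * ft 1 ?lo x) ?lo"
    using L1_has_inverse_fourier[OF lo loint] by (simp add: inv3_def)
  have bnd: "norm (inv3 * ft 1 ?lo x) \<le> norm inv3 * (LINT x|lborel. norm (?lo x))" for x
    unfolding norm_mult[of inv3] by (intro mult_left_mono ft_bound) auto
  have "has_fourier (\<lambda>x. inv3 * ft 1 ?lo x + b x) (\<lambda>\<xi>. ?lo \<xi> + ?hi \<xi>)"
  proof (rule has_fourier_add[OF fa b(3)])
    show "integrable lborel (\<lambda>x. inv3 * ft 1 ?lo x * \<phi> x)" if "rapid \<phi>" for \<phi>
      by (rule bounded_schwartz_integrable[OF _ bnd that]) measurable
    show "integrable lborel (\<lambda>x. b x * \<phi> x)" if "rapid \<phi>" for \<phi>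
      by (intro L2_mult_integrable b rapid_imp_L2 that)
  qed measurable
  also have "(\<lambda>\<xi>. ?lo \<xi> + ?hi \<xi>) = U" by (auto simp: fun_eq_iff split: split_indicator)
  finally have "AE x in lborel. u x = inv3 * ft 1 ?lo x + b x"
    using has_fourier_unique_inv[OF h] by simp
  with b show ?thesis by (intro that[of b]) auto
qed

lemma sob1_mult_rapid_L2:
  assumes U: "sob1 U" and h: "has_fourier u U" and [measurable]: "u \<in> borel_measurable borel" and \<phi>: "rapid \<phi>"
  shows "L2 (\<lambda>x. u x * \<phi> x)"
proof -
  have [measurable]: "\<phi> \<in> borel_measurable borel" by (rule rapid_measurable[OF \<phi>])
  have [measurable]: "U \<in> borel_measurable borel" using U by (rule sob1_measurable)
  have [measurable]: "cball (0::real^3) 1 \<in> sets borel" by auto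
  let ?a = "\<lambda>x. inv3 * ft 1 (\<lambda>\<xi>. U \<xi> * indicator (cball 0 1) \<xi>) x"
  obtain b where b: "L2 b" "AE x in lborel. u x = ?a x + b x"
    using sob1_split[OF U h assms(3), of 1] by auto
  have [measurable]: "b \<in> borel_measurable borel" using b(1) by (rule L2_measurable)
  have bnd: "norm (?a x) \<le> norm inv3 * (LINT \<xi>|lborel. norm (U \<xi> * indicator (cball 0 1) \<xi>))" for x
    unfolding norm_mult[of inv3] by (intro mult_left_mono ft_bound) auto
  have 1: "L2 (\<lambda>x. ?a x * \<phi> x)"
    by (rule rapid_imp_L2, rule rapid_times_bounded[OF \<phi> _ bnd]) measurable
  obtain M where M: "\<And>x. norm (\<phi> x) \<le> M" using rapid_bounded[OF \<phi>] by blast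
  have 2: "L2 (\<lambda>x. b x * \<phi> x)"
  proof -
    have "L2sq (\<lambda>x. b x * \<phi> x) \<le> L2sq (\<lambda>x. of_real M * b x)"
      unfolding L2sq_def
    proof (intro nn_integral_mono ennreal_leI power_mono)
      fix x show "norm (b x * \<phi> x) \<le> norm (of_real M * b x)"
        using mult_left_mono[of "norm (\<phi> x)" "\<bar>M\<bar>" "norm (b x)"] M[of x] by (simp add: norm_mult mult.commute)
    qed auto
    thus ?thesis using L2_cmult[OF b(1), of "of_real M"] unfolding L2_def by (auto intro: le_less_trans)
  qed
  have "L2sq (\<lambda>x. u x * \<phi> x) = L2sq (\<lambda>x. ?a x * \<phi> x + b x * \<phi> x)"
    unfolding L2sq_def by (rule nn_integral_cong_AE, use b(2) in eventually_elim) (simp add: distrib_right)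
  thus ?thesis using L2_add[OF 1 2] by (simp add: L2_def)
qed

lemma sob1_mult_rapid_integrable:
  assumes U: "sob1 U" and h: "has_fourier u U" and [measurable]: "u \<in> borel_measurable borel" and \<phi>: "rapid \<phi>"
  shows "integrable lborel (\<lambda>x. u x * \<phi> x)"
proof -
  have [measurable]: "\<phi> \<in> borel_measurable borel" by (rule rapid_measurable[OF \<phi>])
  have [measurable]: "U \<in> borel_measurable borel" using U by (rule sob1_measurable)
  have [measurable]: "cball (0::real^3) 1 \<in> sets borel" by auto
  let ?a = "\<lambda>x. inv3 * ft 1 (\<lambda>\<xi>. U \<xi> * indicator (cball 0 1) \<xi>) x"
  obtain b where b: "L2 b" "AE x in lborel. u x = ?a x + b x"
    using sob1_split[OF U h assms(3), of 1] by auto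
  have [measurable]: "b \<in> borel_measurable borel" using b(1) by (rule L2_measurable)
  have bnd: "norm (?a x) \<le> norm inv3 * (LINT \<xi>|lborel. norm (U \<xi> * indicator (cball 0 1) \<xi>))" for x
    unfolding norm_mult[of inv3] by (intro mult_left_mono ft_bound) auto
  have 1: "integrable lborel (\<lambda>x. ?a x * \<phi> x)" by (rule bounded_schwartz_integrable[OF _ bnd \<phi>]) measurable
  have 2: "integrable lborel (\<lambda>x. b x * \<phi> x)" by (intro L2_mult_integrable b rapid_imp_L2 \<phi>)
  have ae: "AE x in lborel. ?a x * \<phi> x + b x * \<phi> x = u x * \<phi> x"
    using b(2) by eventually_elim (simp add: distrib_right)
  have m: "(\<lambda>x. ?a x * \<phi> x + b x * \<phi> x) \<in> borel_measurable lborel" "(\<lambda>x. u x * \<phi> x) \<in> borel_measurable lborel"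
    by measurable
  from integrable_cong_AE[OF m ae] 1 2 show ?thesis by simp
qed

lemma rapid_weight_finite:
  fixes \<phi> :: "real^3 \<Rightarrow> complex"
  assumes \<phi>: "rapid \<phi>"
  shows "(NNI \<xi>. ennreal (1 / norm \<xi>) * ennorm2 (\<phi> \<xi>)) < \<infinity>"
proof -
  have [measurable]: "\<phi> \<in> borel_measurable borel" by (rule rapid_measurable[OF \<phi>])
  have [measurable]: "cball (0::real^3) 1 \<in> sets borel" by auto
  obtain M where M: "M > 0" "\<And>x. norm (\<phi> x) \<le> M" using rapid_bounded[OF \<phi>] by blast
  have "(NNI \<xi>. ennreal (1 / norm \<xi>) * ennorm2 (\<phi> \<xi>)) \<le>
    (NNI \<xi>. ennreal (M^2) * (ennreal (1 / (norm \<xi>)^2) * indicator (cball 0 1) \<xi>) + ennorm2 (\<phi> \<xi>))"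
  proof (rule nn_integral_mono)
    fix \<xi> :: "real^3"
    show "ennreal (1 / norm \<xi>) * ennorm2 (\<phi> \<xi>) \<le> ennreal (M^2) * (ennreal (1 / (norm \<xi>)^2) * indicator (cball 0 1) \<xi>) + ennorm2 (\<phi> \<xi>)"
    proof (cases "norm \<xi> \<le> 1")
      case True
      have "1 / norm \<xi> \<le> 1 / (norm \<xi>)^2"
      proof (cases "\<xi> = 0")
        case False
        hence "(norm \<xi>)^2 \<le> norm \<xi>" using True by (simp add: power2_eq_square mult_left_le_one_le)
        thus ?thesis using False by (intro divide_left_mono) auto
      qed simp
      moreover have "(norm (\<phi> \<xi>))^2 \<le> M^2" by (intro power_mono M) auto
      ultimately have "ennreal (1 / norm \<xi>) * ennorm2 (\<phi> \<xi>) \<le> ennreal (1 / (norm \<xi>)^2) * ennreal (M^2)"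
        by (intro mult_mono ennreal_leI) auto
      thus ?thesis using True by (simp add: mult.commute add_increasing2)
    next
      case False
      hence "1 / norm \<xi> \<le> 1 / 1" by (intro divide_left_mono) auto
      hence "1 / norm \<xi> \<le> 1" by simp
      hence "ennreal (1 / norm \<xi>) * ennorm2 (\<phi> \<xi>) \<le> 1 * ennorm2 (\<phi> \<xi>)"
        by (intro mult_right_mono) (auto simp: ennreal_le_1)
      thus ?thesis by (simp add: add_increasing)
    qed
  qed
  also have "\<dots> = (NNI \<xi>. ennreal (M^2) * (ennreal (1 / (norm \<xi>)^2) * indicator (cball (0::real^3) 1) \<xi>)) + (NNI \<xi>. ennorm2 (\<phi> \<xi>))"
    by (rule nn_integral_add) measurable
  also have "(NNI \<xi>. ennreal (M^2) * (ennreal (1 / (norm \<xi>)^2) * indicator (cball (0::real^3) 1) \<xi>)) = ennreal (M^2) * (NNI (\<xi>::real^3). ennreal (1 / (norm \<xi>)^2) * indicator (cball 0 1) \<xi>)"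
    by (rule nn_integral_cmult) measurable
  also have "ennreal (M^2) * (NNI (\<xi>::real^3). ennreal (1 / (norm \<xi>)^2) * indicator (cball 0 1) \<xi>) + (NNI \<xi>. ennorm2 (\<phi> \<xi>)) < \<infinity>"
    using nn_integral_inverse_square_cball[of 1] rapid_L2[OF \<phi>] by (simp add: ennreal_mult_less_top)
  finally show ?thesis .
qed

text \<open>The pairing of a space of order 1/2 with one of order -1/2: the weights
  \<open>sqrt (norm \<xi>)\<close> and \<open>sqrt (1 / norm \<xi>)\<close> are inserted and
  separated.\<close>

lemma half_weight_rapid:
  fixes \<phi> :: "real^3 \<Rightarrow> complex" and N :: "real^3 \<Rightarrow> ennreal"
  assumes \<phi>: "rapid \<phi>" and [measurable]: "N \<in> borel_measurable borel"
  shows "(NNI \<xi>. N \<xi> * ennreal (norm (\<phi> \<xi>)))^2 \<le> (NNI \<xi>. ennreal (norm \<xi>) * (N \<xi>)^2)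
     * (NNI \<xi>. ennreal (1 / norm \<xi>) * ennorm2 (\<phi> \<xi>))"
proof -
  have [measurable]: "\<phi> \<in> borel_measurable borel" by (rule rapid_measurable[OF \<phi>])
  have "AE \<xi> in lborel. \<xi> \<noteq> (0::real^3)" by (rule AE_lborel_singleton)
  hence "(NNI \<xi>. N \<xi> * ennreal (norm (\<phi> \<xi>))) = (NNI \<xi>. (ennreal (sqrt (norm \<xi>)) * N \<xi>) * (ennreal (sqrt (1 / norm \<xi>)) * ennreal (norm (\<phi> \<xi>))))"
  proof (intro nn_integral_cong_AE, eventually_elim)
    fix \<xi> :: "real^3" assume "\<xi> \<noteq> 0"
    hence "ennreal (sqrt (norm \<xi>)) * ennreal (sqrt (1 / norm \<xi>)) = 1"
      by (simp flip: ennreal_mult real_sqrt_mult)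
    thus "N \<xi> * ennreal (norm (\<phi> \<xi>)) = (ennreal (sqrt (norm \<xi>)) * N \<xi>) * (ennreal (sqrt (1 / norm \<xi>)) * ennreal (norm (\<phi> \<xi>)))"
      by (metis (no_types, opaque_lifting) mult.assoc mult.commute mult.left_neutral)
  qed
  hence "(NNI \<xi>. N \<xi> * ennreal (norm (\<phi> \<xi>)))^2 \<le> (NNI \<xi>. (ennreal (sqrt (norm \<xi>)) * N \<xi>)^2) * (NNI \<xi>. (ennreal (sqrt (1 / norm \<xi>)) * ennreal (norm (\<phi> \<xi>)))^2)"
    by (simp only:) (rule Cauchy_Schwarz_nn_integral, measurable)
  also have "(NNI \<xi>. (ennreal (sqrt (norm \<xi>)) * N \<xi>)^2) = (NNI \<xi>. ennreal (norm \<xi>) * (N \<xi>)^2)"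
    by (intro nn_integral_cong) (simp add: power_mult_distrib ennreal_power)
  also have "(NNI \<xi>. (ennreal (sqrt (1 / norm \<xi>)) * ennreal (norm (\<phi> \<xi>)))^2) = (NNI \<xi>. ennreal (1 / norm \<xi>) * ennorm2 (\<phi> \<xi>))"
    by (intro nn_integral_cong) (simp add: power_mult_distrib ennreal_power)
  finally show ?thesis .
qed

definition cconv :: "(real^3 \<Rightarrow> complex) \<Rightarrow> (real^3 \<Rightarrow> complex) \<Rightarrow> real^3 \<Rightarrow> complex" where
  "cconv U V \<xi> = (LINT \<eta>|lborel. U \<eta> * V (\<xi> - \<eta>))"

lemma cconv_measurable [measurable]:
  assumes [measurable]: "U \<in> borel_measurable borel" "V \<in> borel_measurable borel"
  shows "cconv U V \<in> borel_measurable borel"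
  unfolding cconv_def[abs_def] by measurable

text \<open>Where the integrand is not integrable, \<open>cconv\<close> is 0 by convention, so the
  bound is unconditional.\<close>

lemma cconv_le_nnconv:
  assumes [measurable]: "U \<in> borel_measurable borel" "V \<in> borel_measurable borel"
  shows "ennreal (norm (cconv U V \<xi>)) \<le> nnconv (\<lambda>\<eta>. ennreal (norm (U \<eta>))) (\<lambda>\<eta>. ennreal (norm (V \<eta>))) \<xi>"
proof (cases "integrable lborel (\<lambda>\<eta>. U \<eta> * V (\<xi> - \<eta>))")
  case True
  have "ennreal (norm (cconv U V \<xi>)) \<le> (NNI \<eta>. ennreal (norm (U \<eta> * V (\<xi> - \<eta>))))"
    unfolding cconv_def by (rule integral_norm_bound_ennreal[OF True])
  thus ?thesis by (simp add: nnconv_def norm_mult ennreal_mult)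
qed (simp add: cconv_def not_integrable_integral_eq)

text \<open>The convolution of the moduli is square integrable with weight \<open>norm \<xi>\<close>
  by \<open>nn_integral_nnconv_sq\<close>, and \<open>half_weight_rapid\<close> pairs it with
  \<open>\<phi>\<close>.\<close>

lemma sob1_conv_integrable:
  assumes U: "sob1 U" and V: "sob1 V" and \<phi>: "rapid \<phi>"
  shows "integrable (lborel \<Otimes>\<^sub>M lborel) (\<lambda>(\<xi>, \<eta>). U \<eta> * V (\<xi> - \<eta>) * \<phi> \<xi>)"
proof (rule integrableI_bounded)
  have [measurable]: "U \<in> borel_measurable borel" "V \<in> borel_measurable borel" using U V by (auto simp: sob1_def)
  have [measurable]: "\<phi> \<in> borel_measurable borel" by (rule rapid_measurable[OF \<phi>])
  show "(\<lambda>(\<xi>, \<eta>). U \<eta> * V (\<xi> - \<eta>) * \<phi> \<xi>) \<in> borel_measurable (lborel \<Otimes>\<^sub>M lborel)"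
    unfolding case_prod_unfold by measurable
  let ?N = "nnconv (\<lambda>\<eta>. ennreal (norm (U \<eta>))) (\<lambda>\<eta>. ennreal (norm (V \<eta>)))"
  have m: "(\<lambda>p. ennreal (norm (U (snd p) * V (fst p - snd p) * \<phi> (fst p)))) \<in> borel_measurable (lborel \<Otimes>\<^sub>M lborel)" by measurable
  have "(\<integral>\<^sup>+p. ennreal (norm (case p of (\<xi>, \<eta>) \<Rightarrow> U \<eta> * V (\<xi> - \<eta>) * \<phi> \<xi>)) \<partial>(lborel \<Otimes>\<^sub>M lborel))
    = (NNI \<xi>. (NNI \<eta>. ennreal (norm (U \<eta> * V (\<xi> - \<eta>) * \<phi> \<xi>))))"
    using lborel.nn_integral_fst[OF m] by (simp add: case_prod_unfold)
  also have "\<dots> = (NNI \<xi>. ?N \<xi> * ennreal (norm (\<phi> \<xi>)))"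
    unfolding nnconv_def by (intro nn_integral_cong) (simp add: norm_mult ennreal_mult nn_integral_multc)
  finally have eq: "(\<integral>\<^sup>+p. ennreal (norm (case p of (\<xi>, \<eta>) \<Rightarrow> U \<eta> * V (\<xi> - \<eta>) * \<phi> \<xi>)) \<partial>(lborel \<Otimes>\<^sub>M lborel))
    = (NNI \<xi>. ?N \<xi> * ennreal (norm (\<phi> \<xi>)))" .
  have "(NNI \<xi>. ennreal (norm \<xi>) * (?N \<xi>)^2) < \<infinity>"
    by (rule le_less_trans[OF nn_integral_nnconv_sq])
       (use U V in \<open>auto simp: sob1_def ennreal_mult_less_top ennreal_power\<close>)
  hence "(NNI \<xi>. ?N \<xi> * ennreal (norm (\<phi> \<xi>)))^2 < \<infinity>"
    by (intro le_less_trans[OF half_weight_rapid[OF \<phi>]]) (use rapid_weight_finite[OF \<phi>] in \<open>auto simp: ennreal_mult_less_top\<close>)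
  thus "(\<integral>\<^sup>+p. ennreal (norm (case p of (\<xi>, \<eta>) \<Rightarrow> U \<eta> * V (\<xi> - \<eta>) * \<phi> \<xi>)) \<partial>(lborel \<Otimes>\<^sub>M lborel)) < \<infinity>"
    unfolding eq by (cases "(NNI \<xi>. ?N \<xi> * ennreal (norm (\<phi> \<xi>)))") (auto simp: power2_eq_square)
qed

text \<open>Two applications of the multiplication formula move both transforms onto
  \<open>ft (-1) \<phi>\<close>, where inversion returns \<open>\<phi> (\<zeta> + \<eta>)\<close>
  with a factor that cancels one of the two \<open>inv3\<close>.\<close>

lemma low_product:
  fixes f g \<phi> :: "real^3 \<Rightarrow> complex"
  assumes f: "integrable lborel f" and g: "integrable lborel g" and S: "schwartz \<phi>"
  shows "(LINT x|lborel. (inv3 * ft 1 f x) * (inv3 * ft 1 g x) * ft (-1) \<phi> x) =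
    inv3 * (LINT \<xi>|lborel. (LINT \<eta>|lborel. f \<eta> * g (\<xi> - \<eta>) * \<phi> \<xi>))"
proof -
  have [measurable]: "f \<in> borel_measurable borel" "g \<in> borel_measurable borel" using f g by auto
  have [measurable]: "\<phi> \<in> borel_measurable borel" by (rule rapid_measurable[OF schwartz_rapid[OF S]])
  obtain M where M: "\<And>x. norm (\<phi> x) \<le> M" using rapid_bounded[OF schwartz_rapid[OF S]] by blast
  let ?\<psi> = "ft (-1) \<phi>"
  have \<psi>: "rapid ?\<psi>" by (rule ft_rapid[OF S])
  have c: "complex_of_real ((2 * pi) ^ CARD(3)) * inv3 = 1" by (simp add: inv3_def flip: of_real_mult of_real_power)
  have g\<psi>: "integrable lborel (\<lambda>x. ft 1 g x * ?\<psi> x)"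
    by (rule bounded_schwartz_integrable[OF _ ft_bound \<psi>]) measurable
  have inner: "ft 1 (\<lambda>x. ft 1 g x * ?\<psi> x) \<eta> = of_real ((2 * pi) ^ CARD(3)) * (LINT \<zeta>|lborel. g \<zeta> * \<phi> (\<zeta> + \<eta>))" for \<eta>
  proof -
    have "ft 1 (\<lambda>x. ft 1 g x * ?\<psi> x) \<eta> = (LINT x|lborel. ft 1 g x * (cis (1 * (x \<bullet> \<eta>)) * ?\<psi> x))"
      unfolding ft_def[of 1 "\<lambda>x. ft 1 g x * ?\<psi> x"] by (simp only: mult.left_commute)
    also have "\<dots> = (LINT \<zeta>|lborel. g \<zeta> * ft 1 (\<lambda>x. cis (1 * (x \<bullet> \<eta>)) * ?\<psi> x) \<zeta>)"
      by (intro ft_multiplication_formula g integrable_cis_times rapid_integrable \<psi>)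
    also have "\<dots> = (LINT \<zeta>|lborel. of_real ((2 * pi) ^ CARD(3)) * (g \<zeta> * \<phi> (\<zeta> + \<eta>)))"
    proof (intro Bochner_Integration.integral_cong refl)
      fix \<zeta> :: "real^3"
      have "ft 1 (\<lambda>x. cis (1 * (x \<bullet> \<eta>)) * ?\<psi> x) \<zeta> = ft 1 ?\<psi> (\<zeta> + \<eta>)"
      proof -
        have "cis (1 * (x \<bullet> \<zeta>)) * (cis (1 * (x \<bullet> \<eta>)) * ?\<psi> x) = cis (1 * (x \<bullet> (\<zeta> + \<eta>))) * ?\<psi> x" for x
          by (simp only: mult.assoc[symmetric] cis_mult inner_add_right distrib_left)
        thus ?thesis by (simp only: ft_def[of 1])
      qed
      thus "g \<zeta> * ft 1 (\<lambda>x. cis (1 * (x \<bullet> \<eta>)) * ?\<psi> x) \<zeta> = of_real ((2 * pi) ^ CARD(3)) * (g \<zeta> * \<phi> (\<zeta> + \<eta>))"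
        by (simp only: fourier_inversion[OF S] mult.left_commute)
    qed
    also have "\<dots> = of_real ((2 * pi) ^ CARD(3)) * (LINT \<zeta>|lborel. g \<zeta> * \<phi> (\<zeta> + \<eta>))"
      by (rule integral_mult_right_zero)
    finally show ?thesis .
  qed
  have "(LINT x|lborel. (inv3 * ft 1 f x) * (inv3 * ft 1 g x) * ?\<psi> x) = (LINT x|lborel. (inv3 * inv3) * (ft 1 f x * (ft 1 g x * ?\<psi> x)))"
    by (simp only: mult.assoc mult.left_commute)
  also have "\<dots> = (inv3 * inv3) * (LINT x|lborel. ft 1 f x * (ft 1 g x * ?\<psi> x))" by (rule integral_mult_right_zero)
  also have "(LINT x|lborel. ft 1 f x * (ft 1 g x * ?\<psi> x)) = (LINT \<eta>|lborel. f \<eta> * ft 1 (\<lambda>x. ft 1 g x * ?\<psi> x) \<eta>)"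
    by (rule ft_multiplication_formula[OF f g\<psi>])
  also have "\<dots> = (LINT \<eta>|lborel. of_real ((2 * pi) ^ CARD(3)) * (f \<eta> * (LINT \<zeta>|lborel. g \<zeta> * \<phi> (\<zeta> + \<eta>))))"
    by (simp only: inner mult.left_commute)
  also have "\<dots> = of_real ((2 * pi) ^ CARD(3)) * (LINT \<eta>|lborel. f \<eta> * (LINT \<zeta>|lborel. g \<zeta> * \<phi> (\<zeta> + \<eta>)))"
    by (rule integral_mult_right_zero)
  also have "(inv3 * inv3) * (of_real ((2 * pi) ^ CARD(3)) * (LINT \<eta>|lborel. f \<eta> * (LINT \<zeta>|lborel. g \<zeta> * \<phi> (\<zeta> + \<eta>))))
     = inv3 * (LINT \<eta>|lborel. f \<eta> * (LINT \<zeta>|lborel. g \<zeta> * \<phi> (\<zeta> + \<eta>)))"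
  proof -
    have "inv3 * inv3 * (C * X) = inv3 * ((C * inv3) * X)" for C X by (simp only: mult.assoc mult.left_commute)
    thus ?thesis by (simp only: c mult_1)
  qed
  also have "(LINT \<eta>|lborel. f \<eta> * (LINT \<zeta>|lborel. g \<zeta> * \<phi> (\<zeta> + \<eta>))) = (LINT \<eta>|lborel. (LINT \<xi>|lborel. \<phi> \<xi> * f \<eta> * g (\<xi> - \<eta>)))"
  proof (intro Bochner_Integration.integral_cong refl)
    fix \<eta> :: "real^3"
    have "(LINT \<zeta>|lborel. g \<zeta> * \<phi> (\<zeta> + \<eta>)) = (LINT \<zeta>|lborel. (\<lambda>\<zeta>. g \<zeta> * \<phi> (\<zeta> + \<eta>)) (- \<eta> + 1 *\<^sub>R \<zeta>))"
      by (subst integral_lborel_affine) auto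
    also have "\<dots> = (LINT \<xi>|lborel. \<phi> \<xi> * g (\<xi> - \<eta>))"
      by (intro Bochner_Integration.integral_cong) (simp_all add: mult.commute)
    finally have "f \<eta> * (LINT \<zeta>|lborel. g \<zeta> * \<phi> (\<zeta> + \<eta>)) = (LINT \<xi>|lborel. f \<eta> * (\<phi> \<xi> * g (\<xi> - \<eta>)))" by simp
    thus "f \<eta> * (LINT \<zeta>|lborel. g \<zeta> * \<phi> (\<zeta> + \<eta>)) = (LINT \<xi>|lborel. \<phi> \<xi> * f \<eta> * g (\<xi> - \<eta>))"
      by (simp only: mult.assoc mult.left_commute)
  qed
  also have "\<dots> = (LINT \<xi>|lborel. (LINT \<eta>|lborel. \<phi> \<xi> * f \<eta> * g (\<xi> - \<eta>)))"
  proof (rule lborel_pair.Fubini_integral[symmetric])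
    show "integrable (lborel \<Otimes>\<^sub>M lborel) (\<lambda>(\<eta>, \<xi>). \<phi> \<xi> * f \<eta> * g (\<xi> - \<eta>))"
      using integrable_conv_kernel[OF f g, of "\<lambda>p. \<phi> (snd p)" M] M by simp
  qed
  also have "\<dots> = (LINT \<xi>|lborel. (LINT \<eta>|lborel. f \<eta> * g (\<xi> - \<eta>) * \<phi> \<xi>))"
    by (simp only: mult.assoc mult.left_commute mult.commute)
  finally show ?thesis .
qed

text \<open>If the frequencies are truncated to a ball, both factors are transforms of integrable functions and the
  claim is Fubini's theorem; the remainders are small in the square mean.\<close>

theorem product_has_fourier:
  assumes U: "sob1 U" "has_fourier u U" and [measurable]: "u \<in> borel_measurable borel"
    and V: "sob1 V" "has_fourier v V" and [measurable]: "v \<in> borel_measurable borel"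
  shows "has_fourier (\<lambda>x. u x * v x) (\<lambda>\<xi>. inv3 * cconv U V \<xi>)"
proof (rule has_fourier_borel)
  have [measurable]: "U \<in> borel_measurable borel" "V \<in> borel_measurable borel" using U V by (auto simp: sob1_def)
  have [measurable]: "cball (0::real^3) R \<in> sets borel" for R by auto
  show "(\<lambda>x. u x * v x) \<in> borel_measurable borel" "(\<lambda>\<xi>. inv3 * cconv U V \<xi>) \<in> borel_measurable borel" by measurable
  \<comment> \<open>The bounded part of \<open>u\<close> is shifted onto the test function, which
    stays \<open>rapid\<close>; the square integrable part is paired with the square integrable
    product of \<open>v\<close> and \<open>\<phi>\<close>.\<close>
  have uv_int: "integrable lborel (\<lambda>x. u x * (v x * \<phi> x))" if \<phi>: "rapid \<phi>" for \<phi>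
  proof -
    have [measurable]: "\<phi> \<in> borel_measurable borel" by (rule rapid_measurable[OF \<phi>])
    define a where "a = (\<lambda>x. inv3 * ft 1 (\<lambda>\<xi>. U \<xi> * indicator (cball 0 1) \<xi>) x)"
    have [measurable]: "a \<in> borel_measurable borel" unfolding a_def by measurable
    obtain b where b: "L2 b" "AE x in lborel. u x = a x + b x"
      using sob1_split[OF U assms(3), of 1] unfolding a_def by auto
    have [measurable]: "b \<in> borel_measurable borel" using b(1) by (rule L2_measurable)
    have bnd: "norm (a x) \<le> norm inv3 * (LINT \<xi>|lborel. norm (U \<xi> * indicator (cball 0 1) \<xi>))" for x
      unfolding a_def norm_mult[of inv3] by (intro mult_left_mono ft_bound) auto
    have "integrable lborel (\<lambda>x. v x * (a x * \<phi> x))"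
      by (rule sob1_mult_rapid_integrable[OF V assms(6) rapid_times_bounded[OF \<phi> _ bnd]]) measurable
    hence 1: "integrable lborel (\<lambda>x. a x * (v x * \<phi> x))" by (simp only: mult.left_commute)
    have 2: "integrable lborel (\<lambda>x. b x * (v x * \<phi> x))"
      by (intro L2_mult_integrable b sob1_mult_rapid_L2[OF V assms(6) \<phi>])
    have ae: "AE x in lborel. a x * (v x * \<phi> x) + b x * (v x * \<phi> x) = u x * (v x * \<phi> x)"
      using b(2) by eventually_elim (simp add: distrib_right)
    have m: "(\<lambda>x. a x * (v x * \<phi> x) + b x * (v x * \<phi> x)) \<in> borel_measurable lborel" "(\<lambda>x. u x * (v x * \<phi> x)) \<in> borel_measurable lborel"
      by measurable
    from integrable_cong_AE[OF m ae] 1 2 show ?thesis by simp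
  qed
  fix \<phi> :: "real^3 \<Rightarrow> complex" assume S: "schwartz \<phi>"
  have \<phi>: "rapid \<phi>" by (rule schwartz_rapid[OF S])
  have [measurable]: "\<phi> \<in> borel_measurable borel" by (rule rapid_measurable[OF \<phi>])
  show "integrable lborel (\<lambda>x. u x * v x * \<phi> x)" using uv_int[OF \<phi>] by (simp only: mult.assoc)
  note conv_int = sob1_conv_integrable[OF U(1) V(1) \<phi>]
  have conv_eq: "(LINT \<eta>|lborel. U \<eta> * V (\<xi> - \<eta>) * \<phi> \<xi>) = cconv U V \<xi> * \<phi> \<xi>" for \<xi>
    unfolding cconv_def by (rule integral_mult_left_zero)
  have "integrable lborel (\<lambda>\<xi>. LINT \<eta>|lborel. U \<eta> * V (\<xi> - \<eta>) * \<phi> \<xi>)"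
    by (rule lborel_pair.integrable_fst[OF conv_int])
  hence "integrable lborel (\<lambda>\<xi>. inv3 * (cconv U V \<xi> * \<phi> \<xi>))" unfolding conv_eq by (rule integrable_mult_right)
  thus "integrable lborel (\<lambda>\<xi>. inv3 * cconv U V \<xi> * \<phi> \<xi>)" by (simp only: mult.assoc)
  let ?\<psi> = "ft (-1) \<phi>"
  have \<psi>: "rapid ?\<psi>" by (rule ft_rapid[OF S])
  have [measurable]: "?\<psi> \<in> borel_measurable borel" by measurable
  obtain M where M: "M > 0" "\<And>x. norm (?\<psi> x) \<le> M" using rapid_bounded[OF \<psi>] by blast
  define Uk where "Uk = (\<lambda>n \<xi>. U \<xi> * indicator (cball 0 (real (Suc n))) \<xi>)"
  define Vk where "Vk = (\<lambda>n \<xi>. V \<xi> * indicator (cball 0 (real (Suc n))) \<xi>)"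
  have [measurable]: "Uk n \<in> borel_measurable borel" "Vk n \<in> borel_measurable borel" for n
    unfolding Uk_def Vk_def by measurable
  have Uk_int: "integrable lborel (Uk n)" and Vk_int: "integrable lborel (Vk n)" for n
    unfolding Uk_def Vk_def by (intro sob1_low_integrable U V)+
  define tU where "tU = (\<lambda>n. L2sq (\<lambda>\<xi>. U \<xi> * indicator (- cball 0 (real (Suc n))) \<xi>))"
  define tV where "tV = (\<lambda>n. L2sq (\<lambda>\<xi>. V \<xi> * indicator (- cball 0 (real (Suc n))) \<xi>))"
  have tail: "(\<lambda>n. L2sq (\<lambda>\<xi>. W \<xi> * indicator (- cball 0 (real (Suc n))) \<xi>)) \<longlonglongrightarrow> 0" if W: "sob1 W" for W
  proof (rule tendsto_0_if_Limsup_eq_0_ennreal, rule antisym)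
    have L: "L2 (\<lambda>\<xi>. W \<xi> * indicator (- cball 0 1) \<xi>)" using sob1_high_L2[OF W] by simp
    show "limsup (\<lambda>n. L2sq (\<lambda>\<xi>. W \<xi> * indicator (- cball 0 (real (Suc n))) \<xi>)) \<le> 0"
    proof (rule ennreal_le_epsilon)
      fix e :: real assume "0 < e"
      then obtain m :: nat where m: "\<And>R. R \<ge> real m \<Longrightarrow> L2sq (\<lambda>x. W x * indicator (- cball 0 1) x * indicator (- cball 0 R) x) \<le> ennreal e"
        using L2_tail[OF L] by blast
      have "L2sq (\<lambda>\<xi>. W \<xi> * indicator (- cball 0 (real (Suc n))) \<xi>) \<le> ennreal e" if "n \<ge> m" for n
      proof -
        have "(\<lambda>\<xi>. W \<xi> * indicator (- cball 0 (real (Suc n))) \<xi>) = (\<lambda>x. W x * indicator (- cball 0 1) x * indicator (- cball 0 (real (Suc n))) x)"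
          by (auto simp: fun_eq_iff split: split_indicator)
        thus ?thesis using m[of "real (Suc n)"] that by simp
      qed
      hence "limsup (\<lambda>n. L2sq (\<lambda>\<xi>. W \<xi> * indicator (- cball 0 (real (Suc n))) \<xi>)) \<le> ennreal e"
        by (intro Limsup_bounded) (auto simp: eventually_sequentially)
      thus "limsup (\<lambda>n. L2sq (\<lambda>\<xi>. W \<xi> * indicator (- cball 0 (real (Suc n))) \<xi>)) \<le> 0 + ennreal e" by simp
    qed
  qed simp
  have tU: "tU \<longlonglongrightarrow> 0" and tV: "tV \<longlonglongrightarrow> 0" unfolding tU_def tV_def by (intro tail U V)+
  define a where "a = (\<lambda>n x. inv3 * ft 1 (Uk n) x)"
  define a' where "a' = (\<lambda>n x. inv3 * ft 1 (Vk n) x)"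
  have [measurable]: "a n \<in> borel_measurable borel" "a' n \<in> borel_measurable borel" for n
    unfolding a_def a'_def by measurable
  have "\<exists>b. L2 b \<and> L2sq b \<le> 2 * tU n \<and> (AE x in lborel. u x = a n x + b x)" for n
    using sob1_split[OF U assms(3), of "real (Suc n)"] unfolding tU_def a_def Uk_def by auto
  then obtain b where b: "\<And>n. L2 (b n)" "\<And>n. L2sq (b n) \<le> 2 * tU n" "\<And>n. AE x in lborel. u x = a n x + b n x" by metis
  have "\<exists>b. L2 b \<and> L2sq b \<le> 2 * tV n \<and> (AE x in lborel. v x = a' n x + b x)" for n
    using sob1_split[OF V assms(6), of "real (Suc n)"] unfolding tV_def a'_def Vk_def by auto
  then obtain b' where b': "\<And>n. L2 (b' n)" "\<And>n. L2sq (b' n) \<le> 2 * tV n" "\<And>n. AE x in lborel. v x = a' n x + b' n x" by metis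
  have [measurable]: "b n \<in> borel_measurable borel" "b' n \<in> borel_measurable borel" for n
    using b(1) b'(1) by (auto simp: L2_def)
  have small: "(\<lambda>n. LINT x|lborel. c n x * g n x) \<longlonglongrightarrow> 0"
    if "\<And>n. L2 (c n)" "\<And>n. L2 (g n)" "\<And>n. L2sq (c n) \<le> 2 * t n" "t \<longlonglongrightarrow> 0" "\<And>n. L2sq (g n) \<le> G" "G < \<infinity>"
    for c g :: "nat \<Rightarrow> real^3 \<Rightarrow> complex" and t G
  proof -
    have "(\<lambda>n. G * (2 * t n)) \<longlonglongrightarrow> G * (2 * 0)" using that(4,6) by (intro ennreal_tendsto_cmult) auto
    hence l: "(\<lambda>n. G * (2 * t n)) \<longlonglongrightarrow> 0" by simp
    have "(\<lambda>n. ennorm2 (LINT x|lborel. c n x * g n x)) \<longlonglongrightarrow> 0"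
    proof (rule tendsto_sandwich[OF always_eventually always_eventually tendsto_const l]; intro allI)
      fix n
      have "ennorm2 (LINT x|lborel. c n x * g n x) \<le> L2sq (c n) * L2sq (g n)"
        by (rule L2_mult_integral_bound) fact+
      also have "\<dots> \<le> (2 * t n) * G" by (intro mult_mono that) auto
      finally show "ennorm2 (LINT x|lborel. c n x * g n x) \<le> G * (2 * t n)" by (simp only: mult.commute)
    qed simp
    hence "(\<lambda>n. ennorm2 (LINT x|lborel. c n x * g n x)) \<longlonglongrightarrow> ennreal 0" by simp
    hence "(\<lambda>n. (norm (LINT x|lborel. c n x * g n x))^2) \<longlonglongrightarrow> 0" by (subst (asm) tendsto_ennreal_iff) auto
    from tendsto_real_sqrt[OF this]
    have "(\<lambda>n. norm (LINT x|lborel. c n x * g n x)) \<longlonglongrightarrow> 0"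
      by (simp only: real_sqrt_abs abs_norm_cancel real_sqrt_zero)
    thus ?thesis by (rule tendsto_norm_zero_cancel)
  qed
  have v\<psi>: "L2 (\<lambda>x. v x * ?\<psi> x)" by (rule sob1_mult_rapid_L2[OF V assms(6) \<psi>])
  have u\<psi>: "L2 (\<lambda>x. u x * ?\<psi> x)" by (rule sob1_mult_rapid_L2[OF U assms(3) \<psi>])
  have b\<psi>_le: "L2sq (\<lambda>x. b' n x * ?\<psi> x) \<le> ennreal (M^2) * L2sq (b' n)" for n
  proof -
    have "L2sq (\<lambda>x. b' n x * ?\<psi> x) \<le> L2sq (\<lambda>x. of_real M * b' n x)"
      unfolding L2sq_def
    proof (intro nn_integral_mono ennreal_leI power_mono)
      fix x show "norm (b' n x * ?\<psi> x) \<le> norm (of_real M * b' n x)"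
        using mult_left_mono[OF M(2)[of x], of "norm (b' n x)"] M(1) by (simp add: norm_mult mult.commute)
    qed auto
    thus ?thesis using M(1) by (simp add: L2sq_cmult)
  qed
  have b\<psi>: "L2 (\<lambda>x. b' n x * ?\<psi> x)" for n
    using b\<psi>_le[of n] b'(1)[of n] unfolding L2_def by (auto simp: ennreal_mult_less_top intro: le_less_trans)
  have "decseq tV"
  proof (rule decseq_SucI)
    fix n show "tV (Suc n) \<le> tV n"
      unfolding tV_def L2sq_def by (intro nn_integral_mono) (auto split: split_indicator)
  qed
  have tV0: "tV n \<le> tV 0" for n using \<open>decseq tV\<close> by (simp add: decseq_def)
  have tV_fin: "tV 0 < \<infinity>" unfolding tV_def using sob1_high_L2[OF V(1), of 1] by (simp add: L2_def)
  define bb where "bb = ennreal (M^2) * (2 * tV 0)"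
  have bb_fin: "bb < \<infinity>" using tV_fin by (simp add: bb_def ennreal_mult_less_top)
  have b\<psi>_bound: "L2sq (\<lambda>x. b' n x * ?\<psi> x) \<le> bb" for n
  proof -
    have "L2sq (\<lambda>x. b' n x * ?\<psi> x) \<le> ennreal (M^2) * L2sq (b' n)" by (rule b\<psi>_le)
    also have "\<dots> \<le> ennreal (M^2) * (2 * tV 0)"
      by (intro mult_left_mono order_trans[OF b'(2)] mult_left_mono tV0) auto
    finally show ?thesis by (simp only: bb_def)
  qed
  have lim1: "(\<lambda>n. LINT x|lborel. b n x * (v x * ?\<psi> x)) \<longlonglongrightarrow> 0"
    using v\<psi> by (intro small[OF b(1) _ b(2) tU order_refl]) (auto simp: L2_def)
  have lim2: "(\<lambda>n. LINT x|lborel. b' n x * (u x * ?\<psi> x)) \<longlonglongrightarrow> 0"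
    using u\<psi> by (intro small[OF b'(1) _ b'(2) tV order_refl]) (auto simp: L2_def)
  have lim3: "(\<lambda>n. LINT x|lborel. b n x * (b' n x * ?\<psi> x)) \<longlonglongrightarrow> 0"
    by (rule small[OF b(1) b\<psi> b(2) tU b\<psi>_bound bb_fin])
  \<comment> \<open>The expansion \<open>u v = a a' + b v + b' u - b b'\<close> is arranged so that
    every remainder pairs a small factor, \<open>b\<close> or \<open>b'\<close>, with a function of
    bounded square norm once the test function is included.\<close>
  have lhs: "(LINT x|lborel. u x * v x * ?\<psi> x) = (LINT x|lborel. a n x * a' n x * ?\<psi> x) + 
      ((LINT x|lborel. b n x * (v x * ?\<psi> x)) + (LINT x|lborel. b' n x * (u x * ?\<psi> x)) - (LINT x|lborel. b n x * (b' n x * ?\<psi> x)))" for n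
  proof -
    have ba: "norm (a n x) \<le> norm inv3 * (LINT \<xi>|lborel. norm (Uk n \<xi>))" for x
      unfolding a_def norm_mult[of inv3] by (intro mult_left_mono ft_bound) auto
    have ba': "norm (a' n x) \<le> norm inv3 * (LINT \<xi>|lborel. norm (Vk n \<xi>))" for x
      unfolding a'_def norm_mult[of inv3] by (intro mult_left_mono ft_bound) auto
    have i0: "integrable lborel (\<lambda>x. a n x * (a' n x * ?\<psi> x))"
      by (intro rapid_integrable rapid_times_bounded[OF _ _ ba] rapid_times_bounded[OF _ _ ba'] \<psi>) measurable
    have i1: "integrable lborel (\<lambda>x. b n x * (v x * ?\<psi> x))" by (intro L2_mult_integrable b v\<psi>)
    have i2: "integrable lborel (\<lambda>x. b' n x * (u x * ?\<psi> x))" by (intro L2_mult_integrable b' u\<psi>)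
    have i3: "integrable lborel (\<lambda>x. b n x * (b' n x * ?\<psi> x))" by (intro L2_mult_integrable b b\<psi>)
    have "(LINT x|lborel. u x * v x * ?\<psi> x) = (LINT x|lborel. a n x * (a' n x * ?\<psi> x) + (b n x * (v x * ?\<psi> x) + b' n x * (u x * ?\<psi> x) - b n x * (b' n x * ?\<psi> x)))"
    proof (rule integral_cong_AE)
      show "AE x in lborel. u x * v x * ?\<psi> x = a n x * (a' n x * ?\<psi> x) + (b n x * (v x * ?\<psi> x) + b' n x * (u x * ?\<psi> x) - b n x * (b' n x * ?\<psi> x))"
        using b(3)[of n] b'(3)[of n]
      proof eventually_elim
        fix x assume *: "u x = a n x + b n x" "v x = a' n x + b' n x"
        show "u x * v x * ?\<psi> x = a n x * (a' n x * ?\<psi> x) + (b n x * (v x * ?\<psi> x) + b' n x * (u x * ?\<psi> x) - b n x * (b' n x * ?\<psi> x))"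
          unfolding * by algebra
      qed
    qed measurable
    also have "\<dots> = (LINT x|lborel. a n x * (a' n x * ?\<psi> x)) + ((LINT x|lborel. b n x * (v x * ?\<psi> x)) + (LINT x|lborel. b' n x * (u x * ?\<psi> x)) - (LINT x|lborel. b n x * (b' n x * ?\<psi> x)))"
      using i0 i1 i2 i3 by simp
    finally show ?thesis by (simp only: mult.assoc)
  qed
  have "(\<lambda>n. (LINT x|lborel. u x * v x * ?\<psi> x) - ((LINT x|lborel. b n x * (v x * ?\<psi> x)) + (LINT x|lborel. b' n x * (u x * ?\<psi> x)) - (LINT x|lborel. b n x * (b' n x * ?\<psi> x))))
      \<longlonglongrightarrow> (LINT x|lborel. u x * v x * ?\<psi> x) - (0 + 0 - 0)"
    by (intro tendsto_diff tendsto_add tendsto_const lim1 lim2 lim3)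
  moreover have "(LINT x|lborel. u x * v x * ?\<psi> x) - ((LINT x|lborel. b n x * (v x * ?\<psi> x)) + (LINT x|lborel. b' n x * (u x * ?\<psi> x)) - (LINT x|lborel. b n x * (b' n x * ?\<psi> x))) = (LINT x|lborel. a n x * a' n x * ?\<psi> x)" for n
    using lhs[of n] by (simp only: add_diff_cancel)
  ultimately have A: "(\<lambda>n. LINT x|lborel. a n x * a' n x * ?\<psi> x) \<longlonglongrightarrow> (LINT x|lborel. u x * v x * ?\<psi> x)"
    by (simp only: add_0_left diff_zero)
  have lowp: "(LINT x|lborel. a n x * a' n x * ?\<psi> x) = inv3 * (LINT p|(lborel \<Otimes>\<^sub>M lborel). (case p of (\<xi>, \<eta>) \<Rightarrow> Uk n \<eta> * Vk n (\<xi> - \<eta>) * \<phi> \<xi>))" for n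
  proof -
    obtain M' where M': "\<And>x. norm (\<phi> x) \<le> M'" using rapid_bounded[OF \<phi>] by blast
    have "integrable (lborel \<Otimes>\<^sub>M lborel) (\<lambda>(\<eta>, \<xi>). \<phi> \<xi> * Uk n \<eta> * Vk n (\<xi> - \<eta>))"
      using integrable_conv_kernel[OF Uk_int Vk_int, of "\<lambda>p. \<phi> (snd p)" M' n n] M' by simp
    hence "integrable (lborel \<Otimes>\<^sub>M lborel) (\<lambda>(\<xi>, \<eta>). \<phi> \<xi> * Uk n \<eta> * Vk n (\<xi> - \<eta>))"
      by (subst (asm) lborel_pair.integrable_product_swap_iff[symmetric]) (simp add: case_prod_unfold)
    hence int: "integrable (lborel \<Otimes>\<^sub>M lborel) (\<lambda>(\<xi>, \<eta>). Uk n \<eta> * Vk n (\<xi> - \<eta>) * \<phi> \<xi>)"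
      by (simp only: mult.assoc mult.left_commute mult.commute)
    show ?thesis
      unfolding a_def a'_def low_product[OF Uk_int Vk_int S]
      using lborel_pair.integral_fst'[OF int] by simp
  qed
  have B: "(\<lambda>n. inv3 * (LINT p|(lborel \<Otimes>\<^sub>M lborel). (case p of (\<xi>, \<eta>) \<Rightarrow> Uk n \<eta> * Vk n (\<xi> - \<eta>) * \<phi> \<xi>)))
     \<longlonglongrightarrow> inv3 * (LINT p|(lborel \<Otimes>\<^sub>M lborel). (case p of (\<xi>, \<eta>) \<Rightarrow> U \<eta> * V (\<xi> - \<eta>) * \<phi> \<xi>))"
  proof (intro tendsto_mult tendsto_const integral_dominated_convergence[where w = "\<lambda>p. norm (case p of (\<xi>, \<eta>) \<Rightarrow> U \<eta> * V (\<xi> - \<eta>) * \<phi> \<xi>)"])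
    show "integrable (lborel \<Otimes>\<^sub>M lborel) (\<lambda>p. norm (case p of (\<xi>, \<eta>) \<Rightarrow> U \<eta> * V (\<xi> - \<eta>) * \<phi> \<xi>))"
      by (rule integrable_norm[OF conv_int])
    show "(\<lambda>p. case p of (\<xi>, \<eta>) \<Rightarrow> U \<eta> * V (\<xi> - \<eta>) * \<phi> \<xi>) \<in> borel_measurable (lborel \<Otimes>\<^sub>M lborel)"
      using conv_int by (rule borel_measurable_integrable)
    show "(\<lambda>p. case p of (\<xi>, \<eta>) \<Rightarrow> Uk n \<eta> * Vk n (\<xi> - \<eta>) * \<phi> \<xi>) \<in> borel_measurable (lborel \<Otimes>\<^sub>M lborel)" for n
      unfolding case_prod_unfold by measurable
    show "AE p in lborel \<Otimes>\<^sub>M lborel. norm (case p of (\<xi>, \<eta>) \<Rightarrow> Uk n \<eta> * Vk n (\<xi> - \<eta>) * \<phi> \<xi>) \<le> norm (case p of (\<xi>, \<eta>) \<Rightarrow> U \<eta> * V (\<xi> - \<eta>) * \<phi> \<xi>)" for n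
      by (intro AE_I2) (auto simp: Uk_def Vk_def split: split_indicator prod.split)
    show "AE p in lborel \<Otimes>\<^sub>M lborel. (\<lambda>n. case p of (\<xi>, \<eta>) \<Rightarrow> Uk n \<eta> * Vk n (\<xi> - \<eta>) * \<phi> \<xi>) \<longlonglongrightarrow> (case p of (\<xi>, \<eta>) \<Rightarrow> U \<eta> * V (\<xi> - \<eta>) * \<phi> \<xi>)"
    proof (rule AE_I2)
      fix p :: "(real^3) \<times> (real^3)"
      obtain \<xi> \<eta> where p: "p = (\<xi>, \<eta>)" by (cases p)
      have c: "eventually (\<lambda>n. norm x \<le> real (Suc n)) sequentially" for x :: "real^3"
      proof -
        obtain N :: nat where "norm x \<le> real N" using real_arch_simple by blast
        thus ?thesis unfolding eventually_sequentially by (intro exI[of _ N]) (auto elim: order_trans)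
      qed
      have "eventually (\<lambda>n. Uk n \<eta> * Vk n (\<xi> - \<eta>) * \<phi> \<xi> = U \<eta> * V (\<xi> - \<eta>) * \<phi> \<xi>) sequentially"
        using c[of \<eta>] c[of "\<xi> - \<eta>"] by eventually_elim (simp add: Uk_def Vk_def)
      thus "(\<lambda>n. case p of (\<xi>, \<eta>) \<Rightarrow> Uk n \<eta> * Vk n (\<xi> - \<eta>) * \<phi> \<xi>) \<longlonglongrightarrow> (case p of (\<xi>, \<eta>) \<Rightarrow> U \<eta> * V (\<xi> - \<eta>) * \<phi> \<xi>)"
        unfolding p by (simp add: tendsto_eventually)
    qed
  qed
  have "(LINT x|lborel. u x * v x * ?\<psi> x) = inv3 * (LINT p|(lborel \<Otimes>\<^sub>M lborel). (case p of (\<xi>, \<eta>) \<Rightarrow> U \<eta> * V (\<xi> - \<eta>) * \<phi> \<xi>))"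
    by (rule LIMSEQ_unique[OF A[unfolded lowp] B])
  also have "(LINT p|(lborel \<Otimes>\<^sub>M lborel). (case p of (\<xi>, \<eta>) \<Rightarrow> U \<eta> * V (\<xi> - \<eta>) * \<phi> \<xi>)) = (LINT \<xi>|lborel. (LINT \<eta>|lborel. U \<eta> * V (\<xi> - \<eta>) * \<phi> \<xi>))"
    using lborel_pair.integral_fst'[OF conv_int] by simp
  also have "\<dots> = (LINT \<xi>|lborel. cconv U V \<xi> * \<phi> \<xi>)" by (simp only: conv_eq)
  also have "inv3 * \<dots> = (LINT \<xi>|lborel. inv3 * cconv U V \<xi> * \<phi> \<xi>)"
    by (simp only: mult.assoc integral_mult_right_zero)
  finally show "(LINT x|lborel. u x * v x * ?\<psi> x) = (LINT \<xi>|lborel. inv3 * cconv U V \<xi> * \<phi> \<xi>)" .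
qed

subsection \<open>Jointly measurable representatives\<close>

lemma weighted_diff_triangle:
  fixes f g h :: "'a::euclidean_space \<Rightarrow> complex"
  assumes [measurable]: "f \<in> borel_measurable borel" "g \<in> borel_measurable borel" "h \<in> borel_measurable borel" "c \<in> borel_measurable borel"
  shows "(NNI x. ennreal (c x) * ennorm2 (f x - h x)) \<le>
    2 * (NNI x. ennreal (c x) * ennorm2 (f x - g x)) + 2 * (NNI x. ennreal (c x) * ennorm2 (g x - h x))"
proof -
  have "(NNI x. ennreal (c x) * ennorm2 (f x - h x)) \<le>
    (NNI x. 2 * (ennreal (c x) * ennorm2 (f x - g x)) + 2 * (ennreal (c x) * ennorm2 (g x - h x)))"
  proof (rule nn_integral_mono)
    fix x
    have "(norm (f x - h x))^2 \<le> 2 * (norm (f x - g x))^2 + 2 * (norm (g x - h x))^2"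
      using norm_add_sq_le[of "f x - g x" "g x - h x"] by simp
    hence "ennorm2 (f x - h x) \<le> 2 * ennorm2 (f x - g x) + 2 * ennorm2 (g x - h x)"
      using ennreal_leI by (fastforce simp: ennreal_mult)
    hence "ennreal (c x) * ennorm2 (f x - h x) \<le> ennreal (c x) * (2 * ennorm2 (f x - g x) + 2 * ennorm2 (g x - h x))"
      by (rule mult_left_mono) simp
    thus "ennreal (c x) * ennorm2 (f x - h x) \<le> 2 * (ennreal (c x) * ennorm2 (f x - g x)) + 2 * (ennreal (c x) * ennorm2 (g x - h x))"
      by (simp only: distrib_left mult.left_commute)
  qed
  also have "\<dots> = (NNI x. 2 * (ennreal (c x) * ennorm2 (f x - g x))) + (NNI x. 2 * (ennreal (c x) * ennorm2 (g x - h x)))"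
    by (rule nn_integral_add) measurable
  also have "\<dots> = 2 * (NNI x. ennreal (c x) * ennorm2 (f x - g x)) + 2 * (NNI x. ennreal (c x) * ennorm2 (g x - h x))"
    by (simp add: nn_integral_cmult)
  finally show ?thesis .
qed

text \<open>The subsequence along which the approximations converge fast depends on the time \<open>t\<close>, but it can be
  chosen measurably, because it is defined by countably many conditions.\<close>

theorem measurable_limit_selection:
  fixes v :: "nat \<Rightarrow> real \<Rightarrow> 'a::euclidean_space \<Rightarrow> complex"
  assumes v: "\<And>k. case_prod (v k) \<in> borel_measurable (borel \<Otimes>\<^sub>M borel)"
    and c[measurable]: "c \<in> borel_measurable borel" and cpos: "AE x in lborel. c x > 0"
  obtains V where "case_prod V \<in> borel_measurable (borel \<Otimes>\<^sub>M borel)"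
    "\<And>t w. w \<in> borel_measurable borel \<Longrightarrow>
      (\<lambda>k. \<integral>\<^sup>+x. ennreal (c x) * ennorm2 (v k t x - w x) \<partial>lborel) \<longlonglongrightarrow> 0 \<Longrightarrow> AE x in lborel. V t x = w x"
proof -
  have v2[measurable (raw)]: "(\<lambda>y. v k (g y) (h y)) \<in> borel_measurable N"
    if "g \<in> borel_measurable N" "h \<in> borel_measurable N" for g h k and N :: "'x measure"
    using measurable_compose[OF measurable_Pair[OF that] v[of k]] by simp
  have v2'[measurable (raw)]: "(\<lambda>y. v k (g y) (h y)) \<in> borel_measurable N"
    if "g \<in> borel_measurable N" "h \<in> borel_measurable N" for g h k and N :: "(real \<times> 'a) measure"
    using measurable_compose[OF measurable_Pair[OF that] v[of k]] by simp
  have vx[measurable]: "v k t \<in> borel_measurable borel" for k t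
    using measurable_compose[OF measurable_Pair1' v[of k], of t] by simp
  \<comment> \<open>Only distances between approximants enter, not the limit \<open>w\<close>, whose
    dependence on \<open>t\<close> is not controlled.\<close>
  define d where "d = (\<lambda>k m t. \<integral>\<^sup>+x. ennreal (c x) * ennorm2 (v k t x - v m t x) \<partial>lborel)"
  have [measurable]: "d k m \<in> borel_measurable borel" for k m
    unfolding d_def by measurable
  define P where "P = (\<lambda>i n t. \<forall>k\<ge>n. \<forall>m\<ge>n. d k m t \<le> ennreal ((1/4) ^ i))"
  \<comment> \<open>Where no index qualifies, the value of \<open>LEAST\<close> is arbitrary but
    still measurable in \<open>t\<close>. The final claim concerns times at which a limit exists,
    and there \<open>ex\<close> supplies an index.\<close>
  define sel where "sel = (\<lambda>i t. LEAST n. P i n t)"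
  have "Measurable.pred borel (P i n)" for i n unfolding P_def by measurable
  hence sel_meas[measurable]: "sel i \<in> measurable borel (count_space UNIV)" for i
    unfolding sel_def by (intro measurable_Least)
  define s where "s = (\<lambda>i t x. v (sel i t) t x)"
  have s_meas[measurable]: "(\<lambda>p. s i (fst p) (snd p)) \<in> borel_measurable (borel \<Otimes>\<^sub>M borel)" for i
    unfolding s_def
  proof (rule measurable_compose_countable[where g = "\<lambda>p. sel i (fst p)" and f = "\<lambda>n p. v n (fst p) (snd p)"])
    show "(\<lambda>p. v n (fst p) (snd p)) \<in> borel_measurable (borel \<Otimes>\<^sub>M borel)" for n
      using v[of n] by (simp add: case_prod_unfold)
  qed measurable
  define V where "V = (\<lambda>t x. lim (\<lambda>i. s i t x))"
  show ?thesis
  proof (rule that)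
    show "case_prod V \<in> borel_measurable (borel \<Otimes>\<^sub>M borel)"
      unfolding V_def case_prod_unfold by (rule borel_measurable_lim_metric) measurable
    fix t and w :: "'a \<Rightarrow> complex"
    assume w[measurable]: "w \<in> borel_measurable borel"
      and lim: "(\<lambda>k. \<integral>\<^sup>+x. ennreal (c x) * ennorm2 (v k t x - w x) \<partial>lborel) \<longlonglongrightarrow> 0"
    define e where "e = (\<lambda>k. \<integral>\<^sup>+x. ennreal (c x) * ennorm2 (v k t x - w x) \<partial>lborel)"
    have e0: "e \<longlonglongrightarrow> 0" using lim by (simp add: e_def)
    have d_e: "d k m t \<le> 2 * e k + 2 * e m" for k m
      unfolding d_def e_def using weighted_diff_triangle[of "v k t" w "v m t" c] by (simp add: norm_minus_commute)
    have e_d: "e k \<le> 2 * d k m t + 2 * e m" for k m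
      unfolding d_def e_def using weighted_diff_triangle[of "v k t" "v m t" w c] by simp
    have ex: "\<exists>n. P i n t" for i
    proof -
      have "eventually (\<lambda>k. e k < ennreal ((1/4) ^ i / 4)) sequentially"
        using e0 by (intro order_tendstoD) auto
      then obtain n where n: "\<And>k. k \<ge> n \<Longrightarrow> e k < ennreal ((1/4) ^ i / 4)" by (auto simp: eventually_sequentially)
      have "d k m t \<le> ennreal ((1/4) ^ i)" if "k \<ge> n" "m \<ge> n" for k m
      proof -
        have "d k m t \<le> 2 * ennreal ((1/4) ^ i / 4) + 2 * ennreal ((1/4) ^ i / 4)"
          by (intro order_trans[OF d_e] add_mono mult_left_mono less_imp_le n that) auto
        also have "\<dots> = ennreal (2 * ((1/4) ^ i / 4) + 2 * ((1/4) ^ i / 4))"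
        proof -
          have "2 * ennreal x + 2 * ennreal y = ennreal (2 * x + 2 * y)" if "x \<ge> 0" "y \<ge> 0" for x y
            using that by (simp add: ennreal_mult)
          thus ?thesis by (simp only: divide_nonneg_nonneg zero_le_power zero_le_numeral zero_le_one)
        qed
        finally show ?thesis by simp
      qed
      thus ?thesis unfolding P_def by blast
    qed
    have Psel: "P i (sel i t) t" for i unfolding sel_def by (rule LeastI_ex[OF ex])
    have sel_mono: "sel i t \<le> sel (Suc i) t" for i
    proof -
      have "P i (sel (Suc i) t) t"
        unfolding P_def
      proof (intro allI impI)
        fix k m assume "sel (Suc i) t \<le> k" "sel (Suc i) t \<le> m"
        hence "d k m t \<le> ennreal ((1/4) ^ Suc i)" using Psel[of "Suc i"] unfolding P_def by blast
        also have "\<dots> \<le> ennreal ((1/4) ^ i)" by (intro ennreal_leI) simp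
        finally show "d k m t \<le> ennreal ((1/4) ^ i)" .
      qed
      hence "(LEAST n. P i n t) \<le> sel (Suc i) t" by (rule Least_le)
      thus ?thesis by (simp add: sel_def)
    qed
    \<comment> \<open>The Cauchy condition at \<open>sel i t\<close> bounds the distance to every
      later approximant; letting \<open>m\<close> tend to infinity bounds the distance to
      \<open>w\<close>.\<close>
    have e_sel: "e (sel i t) \<le> ennreal (2 * (1/4) ^ i)" for i
    proof (rule LIMSEQ_le_const)
      have "(\<lambda>m. 2 * e m) \<longlonglongrightarrow> 2 * 0" by (intro ennreal_tendsto_cmult e0) auto
      hence "(\<lambda>m. ennreal (2 * (1/4) ^ i) + 2 * e m) \<longlonglongrightarrow> ennreal (2 * (1/4) ^ i) + 2 * 0"
        by (intro tendsto_add tendsto_const)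
      thus "(\<lambda>m. ennreal (2 * (1/4) ^ i) + 2 * e m) \<longlonglongrightarrow> ennreal (2 * (1/4) ^ i)" by simp
      have "e (sel i t) \<le> ennreal (2 * (1/4) ^ i) + 2 * e m" if "m \<ge> sel i t" for m
      proof -
        have "d (sel i t) m t \<le> ennreal ((1/4) ^ i)" using Psel[of i] that unfolding P_def by blast
        hence "2 * d (sel i t) m t \<le> 2 * ennreal ((1/4) ^ i)" by (rule mult_left_mono) simp
        also have "\<dots> = ennreal (2 * (1/4) ^ i)" by (simp add: ennreal_mult)
        finally have "2 * d (sel i t) m t + 2 * e m \<le> ennreal (2 * (1/4) ^ i) + 2 * e m" by (rule add_right_mono)
        thus ?thesis using e_d[of "sel i t" m] by (rule order_trans[rotated])
      qed
      thus "\<exists>N. \<forall>m\<ge>N. e (sel i t) \<le> ennreal (2 * (1/4) ^ i) + 2 * e m" by blast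
    qed
    have st[measurable]: "s i t \<in> borel_measurable lborel" for i unfolding s_def by simp
    have fast: "(NNI x. ennreal (c x) * ennorm2 (s (Suc i) t x - s i t x)) \<le> ennreal ((1/4) ^ i)" for i
      using Psel[of i] sel_mono[of i] unfolding s_def P_def d_def by blast
    have close: "(NNI x. ennreal (c x) * ennorm2 (V t x - s i t x)) \<le> ennreal (4 / 2 ^ i)" for i
      unfolding V_def by (rule riesz_fischer(2)[where s = "\<lambda>i. s i t"]) (use st fast cpos in auto)
    have [measurable]: "V t \<in> borel_measurable borel" unfolding V_def using st by (intro borel_measurable_lim_metric) simp
    have "(NNI x. ennreal (c x) * ennorm2 (V t x - w x)) \<le> ennreal (2 * (4 / 2 ^ i) + 2 * (2 * (1/4) ^ i))" for i
    proof -
      have "(NNI x. ennreal (c x) * ennorm2 (V t x - w x)) \<le>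
        2 * (NNI x. ennreal (c x) * ennorm2 (V t x - s i t x)) + 2 * (NNI x. ennreal (c x) * ennorm2 (s i t x - w x))"
        using st by (intro weighted_diff_triangle) auto
      also have "(NNI x. ennreal (c x) * ennorm2 (s i t x - w x)) = e (sel i t)" by (simp add: e_def s_def)
      also have "2 * (NNI x. ennreal (c x) * ennorm2 (V t x - s i t x)) + 2 * e (sel i t) \<le> 2 * ennreal (4 / 2 ^ i) + 2 * ennreal (2 * (1/4) ^ i)"
        by (intro add_mono mult_left_mono close e_sel) auto
      also have "\<dots> = ennreal (2 * (4 / 2 ^ i) + 2 * (2 * (1/4) ^ i))"
      proof -
        have "2 * ennreal x + 2 * ennreal y = ennreal (2 * x + 2 * y)" if "x \<ge> 0" "y \<ge> 0" for x y
          using that by (simp add: ennreal_mult)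
        thus ?thesis by simp
      qed
      finally show ?thesis .
    qed
    moreover have "(\<lambda>i. ennreal (2 * (4 / 2 ^ i) + 2 * (2 * (1/4) ^ i))) \<longlonglongrightarrow> ennreal 0"
    proof (rule tendsto_ennrealI)
      show "(\<lambda>i. 2 * (4 / 2 ^ i) + 2 * (2 * (1/4) ^ i) :: real) \<longlonglongrightarrow> 0"
      proof -
        have "(\<lambda>i. 8 * (1/2) ^ i + 4 * (1/4) ^ i :: real) \<longlonglongrightarrow> 8 * 0 + 4 * 0"
          by (intro tendsto_add tendsto_mult tendsto_const LIMSEQ_power_zero) auto
        thus ?thesis by (simp add: power_one_over)
      qed
    qed
    ultimately have "(NNI x. ennreal (c x) * ennorm2 (V t x - w x)) \<le> ennreal 0"
      by (intro LIMSEQ_le_const) auto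
    hence "(NNI x. ennreal (c x) * ennorm2 (V t x - w x)) = 0" by simp
    hence "AE x in lborel. ennreal (c x) * ennorm2 (V t x - w x) = 0"
      by (subst (asm) nn_integral_0_iff_AE) auto
    thus "AE x in lborel. V t x = w x"
      using cpos by eventually_elim auto
  qed
qed

subsection \<open>Homogeneous Sobolev norms on the Fourier side\<close>

text \<open>Twice the constant of the Plancherel identity in dimension 3, as delivered by
  \<open>L2_has_fourier\<close>.\<close>

definition plancherel_const :: real where "plancherel_const = 2 * (2 * pi) ^ 3"

lemma plancherel_const_pos: "plancherel_const > 0" by (simp add: plancherel_const_def)

lemma has_fourier_fourier: "\<exists>g. has_fourier f g \<Longrightarrow> has_fourier f (fourier f)"
  unfolding fourier_def by (rule someI_ex[where P = "has_fourier f"])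

lemma nn_integral_lebesgue: "nn_integral lebesgue f = nn_integral lborel f"
  by (rule nn_integral_completion)

lemma norm_sq_complex3: "(norm (x :: complex^3))^2 = (\<Sum>j\<in>UNIV. (norm (x $ j))^2)"
  by (simp add: norm_vec_def L2_set_def sum_nonneg)

lemma Lambda_symbol_measurable [measurable]: "Lambda_symbol s \<in> borel_measurable borel"
  unfolding Lambda_symbol_def[abs_def] by measurable

lemma borel_measurable_lebesgueI: "f \<in> borel_measurable borel \<Longrightarrow> f \<in> borel_measurable lebesgue"
  by (rule measurable_completion) simp

lemma has_fourier_borel_representatives:
  assumes h: "has_fourier f g"
  obtains f' g' where "f' \<in> borel_measurable borel" "g' \<in> borel_measurable borel" "AE x in lborel. f x = f' x"
    "AE x in lborel. g x = g' x" "has_fourier f' g'"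
proof -
  have t: "f \<in> borel_measurable lebesgue" "g \<in> borel_measurable lebesgue"
    using h by (auto simp: has_fourier_def tempered_def)
  obtain f' where f': "f' \<in> borel_measurable borel" "AE x in lborel. f x = f' x" using borel_representative[OF t(1)] by blast
  obtain g' where g': "g' \<in> borel_measurable borel" "AE x in lborel. g x = g' x" using borel_representative[OF t(2)] by blast
  show ?thesis
    by (rule that[OF f'(1) g'(1) f'(2) g'(2)]) (intro has_fourier_AE_cong[OF h] borel_measurable_lebesgueI f' g')
qed

lemma multiplier_L2sq_forward:
  fixes h G :: "real^3 \<Rightarrow> complex"
  assumes h: "has_fourier h G" and L: "(NNI x. ennorm2 (h x)) < \<infinity>"
  shows "(NNI x. ennorm2 (G x)) \<le> ennreal plancherel_const * (NNI x. ennorm2 (h x))"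
proof -
  obtain h' G' where *: "h' \<in> borel_measurable borel" "G' \<in> borel_measurable borel" "AE x in lborel. h x = h' x"
    "AE x in lborel. G x = G' x" "has_fourier h' G'" using has_fourier_borel_representatives[OF h] by blast
  have eh: "(NNI x. ennorm2 (h x)) = L2sq h'"
    unfolding L2sq_def by (rule nn_integral_cong_AE, use *(3) in eventually_elim) simp
  have h': "L2 h'" using L *(1) unfolding L2_def eh by simp
  obtain g where g: "L2 g" "L2sq g \<le> ennreal (2 * (2 * pi) ^ CARD(3)) * L2sq h'" "has_fourier h' g"
    using L2_has_fourier[OF h'] by blast
  have "AE x in lborel. G' x = g x" by (rule has_fourier_unique[OF *(5) g(3)])
  with *(4) have "AE x in lborel. G x = g x" by eventually_elim simp
  hence "(NNI x. ennorm2 (G x)) = L2sq g"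
    unfolding L2sq_def by (intro nn_integral_cong_AE, eventually_elim) simp
  thus ?thesis using g(2) by (simp add: eh plancherel_const_def)
qed

text \<open>Borel representatives of the transforms of the components. The values of
  \<open>fourier\<close> are chosen for each function separately and are only Lebesgue measurable,
  which gives no control when a time parameter varies.\<close>

definition frep :: "(real^3 \<Rightarrow> complex^3) \<Rightarrow> (3 \<Rightarrow> real^3 \<Rightarrow> complex) \<Rightarrow> bool" where
  "frep F U \<longleftrightarrow> (\<forall>j. U j \<in> borel_measurable borel \<and> has_fourier (\<lambda>x. F x $ j) (U j))"

definition wnorm :: "real \<Rightarrow> (3 \<Rightarrow> real^3 \<Rightarrow> complex) \<Rightarrow> ennreal" where
  "wnorm s U = (NNI \<xi>. ennreal ((norm \<xi> powr s)^2) * ennreal (\<Sum>j\<in>UNIV. (norm (U j \<xi>))^2))"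

lemma frep_exists:
  assumes "\<forall>j. \<exists>g. has_fourier (\<lambda>x. F x $ j) g"
  obtains U where "frep F U"
proof -
  have "\<exists>g. g \<in> borel_measurable borel \<and> has_fourier (\<lambda>x. F x $ j) g" for j
  proof -
    obtain g where g: "has_fourier (\<lambda>x. F x $ j) g" using assms by blast
    have m: "(\<lambda>x. F x $ j) \<in> borel_measurable lebesgue" "g \<in> borel_measurable lebesgue"
      using g by (auto simp: has_fourier_def tempered_def)
    obtain g' where g': "g' \<in> borel_measurable borel" "AE x in lborel. g x = g' x" using borel_representative[OF m(2)] by blast
    have "has_fourier (\<lambda>x. F x $ j) g'"
      by (rule has_fourier_AE_cong[OF g m(1)]) (auto intro: borel_measurable_lebesgueI g')
    thus ?thesis using g'(1) by blast
  qed
  then obtain U where "\<And>j. U j \<in> borel_measurable borel \<and> has_fourier (\<lambda>x. F x $ j) (U j)" by metis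
  thus ?thesis by (intro that[of U]) (simp add: frep_def)
qed

lemma frep_fourier:
  assumes "frep F U"
  shows "AE \<xi> in lborel. fourier (\<lambda>x. F x $ j) \<xi> = U j \<xi>"
  using assms unfolding frep_def by (intro has_fourier_unique[OF has_fourier_fourier]) auto

lemma frep_unique:
  assumes "frep F U" "frep F U'"
  shows "AE \<xi> in lborel. U j \<xi> = U' j \<xi>"
  using assms unfolding frep_def by (intro has_fourier_unique) auto

lemma frep_vfourier:
  assumes "frep F U"
  shows "AE \<xi> in lborel. \<forall>j. vfourier F \<xi> $ j = U j \<xi>"
  unfolding AE_all_countable vfourier_def vec_lambda_beta by (intro allI frep_fourier[OF assms])

lemma multiplier_has_fourier:
  assumes "in_Hdot s F"
  shows "has_fourier (\<lambda>x. Lambda_pow s F x $ j) (\<lambda>\<xi>. Lambda_symbol s \<xi> * fourier (\<lambda>x. F x $ j) \<xi>)"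
proof -
  have "\<exists>h. has_fourier h (\<lambda>\<xi>. Lambda_symbol s \<xi> * fourier (\<lambda>x. F x $ j) \<xi>)"
    using assms unfolding in_Hdot_def by blast
  hence "has_fourier (fourier_multiplier (Lambda_symbol s) (\<lambda>x. F x $ j)) (\<lambda>\<xi>. Lambda_symbol s \<xi> * fourier (\<lambda>x. F x $ j) \<xi>)"
    unfolding fourier_multiplier_def by (rule someI_ex)
  thus ?thesis by (simp add: Lambda_pow_def)
qed

lemma has_fourier_measurable_fst: "has_fourier f g \<Longrightarrow> f \<in> borel_measurable lebesgue"
  by (simp add: has_fourier_def tempered_def)

lemma Hdot_norm_sq:
  fixes F :: "real^3 \<Rightarrow> complex^3"
  assumes m: "\<And>j. (\<lambda>x. Lambda_pow s F x $ j) \<in> borel_measurable lebesgue"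
    and fin: "\<And>j. (NNI x. ennorm2 (Lambda_pow s F x $ j)) < \<infinity>"
  shows "ennreal ((Hdot_norm s F)^2) = (\<Sum>j\<in>UNIV. (NNI x. ennorm2 (Lambda_pow s F x $ j)))"
proof -
  have int: "integrable lebesgue (\<lambda>x. (norm (Lambda_pow s F x $ j))^2)" for j
    using m fin by (intro integrableI_nonneg) (auto simp: nn_integral_lebesgue)
  have int2: "integrable lebesgue (\<lambda>x. (norm (Lambda_pow s F x))^2)"
    unfolding norm_sq_complex3 by (intro Bochner_Integration.integrable_sum int)
  have "ennreal ((Hdot_norm s F)^2) = ennreal (LINT x|lebesgue. (norm (Lambda_pow s F x))^2)"
    unfolding Hdot_norm_def L2norm_def by (simp add: integral_nonneg_AE)
  also have "\<dots> = (\<integral>\<^sup>+x. ennorm2 (Lambda_pow s F x) \<partial>lebesgue)"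
    by (rule nn_integral_eq_integral[symmetric]) (use int2 in auto)
  also have "\<dots> = (\<integral>\<^sup>+x. (\<Sum>j\<in>UNIV. ennorm2 (Lambda_pow s F x $ j)) \<partial>lebesgue)"
    unfolding norm_sq_complex3 by (simp add: sum_ennreal)
  also have "\<dots> = (\<Sum>j\<in>UNIV. (\<integral>\<^sup>+x. ennorm2 (Lambda_pow s F x $ j) \<partial>lebesgue))"
    using m by (intro nn_integral_sum) measurable
  finally show ?thesis by (simp only: nn_integral_lebesgue)
qed

lemma wnorm_eq_sum:
  assumes "frep F U"
  shows "wnorm s U = (\<Sum>j\<in>UNIV. L2sq (\<lambda>\<xi>. Lambda_symbol s \<xi> * U j \<xi>))"
proof -
  have [measurable]: "U j \<in> borel_measurable borel" for j using assms by (simp add: frep_def)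
  have "wnorm s U = (NNI \<xi>. (\<Sum>j\<in>UNIV. ennorm2 (Lambda_symbol s \<xi> * U j \<xi>)))"
    unfolding wnorm_def
    by (intro nn_integral_cong)
       (simp add: norm_mult Lambda_symbol_def power_mult_distrib ennreal_mult sum_distrib_left flip: sum_ennreal)
  also have "\<dots> = (\<Sum>j\<in>UNIV. L2sq (\<lambda>\<xi>. Lambda_symbol s \<xi> * U j \<xi>))"
    unfolding L2sq_def by (intro nn_integral_sum) measurable
  finally show ?thesis .
qed

text \<open>Uniqueness of the preimage identifies the choice inside \<open>Lambda_pow\<close> with
  the square integrable function provided by \<open>in_Hdot\<close>; the rest is the one-sided
  Plancherel bound for each component.\<close>

theorem Hdot_forward:
  assumes H: "in_Hdot s F" and U: "frep F U"
  shows "wnorm s U \<le> ennreal (plancherel_const * (Hdot_norm s F)^2)"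
proof -
  let ?h = "\<lambda>j x. Lambda_pow s F x $ j"
  have hf: "has_fourier (?h j) (\<lambda>\<xi>. Lambda_symbol s \<xi> * fourier (\<lambda>x. F x $ j) \<xi>)" for j
    by (rule multiplier_has_fourier[OF H])
  have fin: "(NNI x. ennorm2 (?h j x)) < \<infinity>" for j
  proof -
    obtain h where h: "has_fourier h (\<lambda>\<xi>. Lambda_symbol s \<xi> * fourier (\<lambda>x. F x $ j) \<xi>)"
      "integrable lebesgue (\<lambda>x. (norm (h x))^2)" using H unfolding in_Hdot_def by blast
    have "AE x in lborel. ?h j x = h x" by (rule has_fourier_unique_inv[OF hf h(1)])
    hence "(NNI x. ennorm2 (?h j x)) = (NNI x. ennorm2 (h x))"
      by (intro nn_integral_cong_AE) (auto elim!: eventually_mono)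
    also have "\<dots> < \<infinity>" using h(2) by (simp add: integrable_iff_bounded nn_integral_lebesgue)
    finally show ?thesis .
  qed
  have "wnorm s U = (\<Sum>j\<in>UNIV. L2sq (\<lambda>\<xi>. Lambda_symbol s \<xi> * U j \<xi>))" by (rule wnorm_eq_sum[OF U])
  also have "\<dots> \<le> (\<Sum>j\<in>UNIV. ennreal plancherel_const * (NNI x. ennorm2 (?h j x)))"
  proof (rule sum_mono)
    fix j :: 3
    have "L2sq (\<lambda>\<xi>. Lambda_symbol s \<xi> * U j \<xi>) = (NNI \<xi>. ennorm2 (Lambda_symbol s \<xi> * fourier (\<lambda>x. F x $ j) \<xi>))"
      unfolding L2sq_def by (rule nn_integral_cong_AE, use frep_fourier[OF U, of j] in eventually_elim) simp
    thus "L2sq (\<lambda>\<xi>. Lambda_symbol s \<xi> * U j \<xi>) \<le> ennreal plancherel_const * (NNI x. ennorm2 (?h j x))"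
      using multiplier_L2sq_forward[OF hf fin, of j] by simp
  qed
  also have "\<dots> = ennreal plancherel_const * ennreal ((Hdot_norm s F)^2)"
    using Hdot_norm_sq[of s F, OF has_fourier_measurable_fst[OF hf] fin] by (simp add: sum_distrib_left)
  finally show ?thesis using plancherel_const_pos by (simp add: ennreal_mult)
qed

text \<open>The weighted transform is square integrable, so it has a square integrable preimage, and
  by uniqueness this is the function chosen by \<open>Lambda_pow\<close>. Membership belongs to the
  conclusion, because \<open>Hdot_norm\<close> is meaningful only with it.\<close>

theorem Hdot_backward:
  assumes U: "frep F U" and fin: "wnorm s U < \<infinity>"
  shows "in_Hdot s F" "ennreal ((Hdot_norm s F)^2) \<le> 2 * wnorm s U"
proof -
  have [measurable]: "U j \<in> borel_measurable borel" for j using U by (simp add: frep_def)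
  let ?G = "\<lambda>j \<xi>. Lambda_symbol s \<xi> * U j \<xi>"
  have sum: "wnorm s U = (\<Sum>j\<in>UNIV. L2sq (?G j))" by (rule wnorm_eq_sum[OF U])
  have L: "L2 (?G j)" for j
  proof -
    have "L2sq (?G j) \<le> wnorm s U" unfolding sum by (rule member_le_sum) auto
    thus ?thesis using fin unfolding L2_def by auto
  qed
  have "\<exists>h. L2 h \<and> L2sq h \<le> ennreal 2 * L2sq (?G j) \<and> has_fourier h (?G j)" for j
    using L2_has_inverse_fourier[OF L[of j]] by metis
  then obtain h where h: "\<And>j. L2 (h j)" "\<And>j. L2sq (h j) \<le> ennreal 2 * L2sq (?G j)" "\<And>j. has_fourier (h j) (?G j)" by metis
  have fm: "fourier (\<lambda>x. F x $ j) \<in> borel_measurable lebesgue" for j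
    using has_fourier_fourier[of "\<lambda>x. F x $ j"] U unfolding frep_def has_fourier_def tempered_def by blast
  have hm: "h j \<in> borel_measurable lebesgue" for j by (intro borel_measurable_lebesgueI L2_measurable h)
  have hf: "has_fourier (h j) (\<lambda>\<xi>. Lambda_symbol s \<xi> * fourier (\<lambda>x. F x $ j) \<xi>)" for j
  proof (rule has_fourier_AE_cong[OF h(3) hm])
    show "(\<lambda>\<xi>. Lambda_symbol s \<xi> * fourier (\<lambda>x. F x $ j) \<xi>) \<in> borel_measurable lebesgue"
      by (intro borel_measurable_times fm borel_measurable_lebesgueI Lambda_symbol_measurable)
    show "AE \<xi> in lborel. ?G j \<xi> = Lambda_symbol s \<xi> * fourier (\<lambda>x. F x $ j) \<xi>"
      using frep_fourier[OF U, of j] by eventually_elim simp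
  qed simp
  have hL: "integrable lebesgue (\<lambda>x. (norm (h j x))^2)" for j
    using h(1)[of j] hm[of j] by (intro integrableI_nonneg) (auto simp: nn_integral_lebesgue L2_def L2sq_def)
  show H: "in_Hdot s F" unfolding in_Hdot_def using U hf hL unfolding frep_def by blast
  have eq: "AE x in lborel. Lambda_pow s F x $ j = h j x" for j
    by (rule has_fourier_unique_inv[OF multiplier_has_fourier[OF H] hf])
  have L2eq: "(NNI x. ennorm2 (Lambda_pow s F x $ j)) = L2sq (h j)" for j
    unfolding L2sq_def by (rule nn_integral_cong_AE, use eq[of j] in eventually_elim) simp
  have "ennreal ((Hdot_norm s F)^2) = (\<Sum>j\<in>UNIV. L2sq (h j))"
    using Hdot_norm_sq[of s F, OF has_fourier_measurable_fst[OF multiplier_has_fourier[OF H]]] h(1)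
    by (simp add: L2eq L2_def)
  also have "\<dots> \<le> (\<Sum>j\<in>UNIV. 2 * L2sq (?G j))" using h(2) by (intro sum_mono) simp
  also have "\<dots> = 2 * wnorm s U" by (simp add: sum sum_distrib_left)
  finally show "ennreal ((Hdot_norm s F)^2) \<le> 2 * wnorm s U" .
qed

lemma in_Hdot_sob1:
  assumes H: "in_Hdot 1 F" and U: "frep F U"
  shows "sob1 (U j)"
  unfolding sob1_def
proof
  show "U j \<in> borel_measurable borel" using U by (simp add: frep_def)
  have "(NNI \<xi>. ennorm2 \<xi> * ennorm2 (U j \<xi>)) \<le> wnorm 1 U"
    unfolding wnorm_def
    by (intro nn_integral_mono mult_mono ennreal_leI member_le_sum) auto
  also have "\<dots> < \<infinity>" using Hdot_forward[OF H U] by (rule order_le_less_trans) simp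
  finally show "(NNI \<xi>. ennorm2 \<xi> * ennorm2 (U j \<xi>)) < \<infinity>" .
qed

lemma wnorm_1_component:
  "(NNI \<xi>. ennorm2 \<xi> * ennorm2 (U j \<xi>)) \<le> wnorm 1 U"
  unfolding wnorm_def by (intro nn_integral_mono mult_mono ennreal_leI member_le_sum) auto

text \<open>Linearity goes through \<open>has_fourier_add\<close>, whose integrability hypotheses
  hold for functions of order 1; this is where membership in that space enters.\<close>

lemma frep_diff:
  assumes H: "in_Hdot 1 F" "in_Hdot 1 F'" and U: "frep F U" and U': "frep F' U'"
  shows "frep (\<lambda>x. F x - F' x) (\<lambda>j \<xi>. U j \<xi> - U' j \<xi>)"
  unfolding frep_def
proof
  fix j
  have Um[measurable]: "U j \<in> borel_measurable borel" "U' j \<in> borel_measurable borel" using U U' by (auto simp: frep_def)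
  have h: "has_fourier (\<lambda>x. F x $ j) (U j)" "has_fourier (\<lambda>x. F' x $ j) (U' j)" using U U' by (auto simp: frep_def)
  note m = has_fourier_measurable_fst[OF h(1)] has_fourier_measurable_fst[OF h(2)]
  obtain f where f[measurable]: "f \<in> borel_measurable borel" and fe: "AE x in lborel. F x $ j = f x" using borel_representative[OF m(1)] by blast
  obtain g where g[measurable]: "g \<in> borel_measurable borel" and ge: "AE x in lborel. F' x $ j = g x" using borel_representative[OF m(2)] by blast
  have hf: "has_fourier f (U j)" by (rule has_fourier_AE_cong[OF h(1) borel_measurable_lebesgueI[OF f] fe borel_measurable_lebesgueI[OF Um(1)]]) simp
  have hg: "has_fourier g (U' j)" by (rule has_fourier_AE_cong[OF h(2) borel_measurable_lebesgueI[OF g] ge borel_measurable_lebesgueI[OF Um(2)]]) simp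
  have hs: "has_fourier (\<lambda>x. f x + (-1) * g x) (\<lambda>\<xi>. U j \<xi> + (-1) * U' j \<xi>)"
  proof (rule has_fourier_add[OF hf has_fourier_cmult[OF hg] f _ Um(1)])
    fix \<phi> :: "real^3 \<Rightarrow> complex" assume \<phi>: "rapid \<phi>"
    show "integrable lborel (\<lambda>x. f x * \<phi> x)" by (rule sob1_mult_rapid_integrable[OF in_Hdot_sob1[OF H(1) U] hf f \<phi>])
    have "integrable lborel (\<lambda>x. -1 * (g x * \<phi> x))"
      by (intro integrable_mult_right sob1_mult_rapid_integrable[OF in_Hdot_sob1[OF H(2) U'] hg g \<phi>])
    thus "integrable lborel (\<lambda>x. -1 * g x * \<phi> x)" by (simp add: mult.assoc)
  qed measurable
  have "has_fourier (\<lambda>x. (F x - F' x) $ j) (\<lambda>\<xi>. U j \<xi> - U' j \<xi>)"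
  proof (rule has_fourier_AE_cong[OF hs])
    show "(\<lambda>x. (F x - F' x) $ j) \<in> borel_measurable lebesgue" using m by simp
    show "(\<lambda>\<xi>. U j \<xi> - U' j \<xi>) \<in> borel_measurable lebesgue" by (intro borel_measurable_lebesgueI) measurable
    show "AE x in lborel. f x + - 1 * g x = (F x - F' x) $ j" using fe ge by eventually_elim simp
  qed simp
  thus "(\<lambda>\<xi>. U j \<xi> - U' j \<xi>) \<in> borel_measurable borel \<and> has_fourier (\<lambda>x. (F x - F' x) $ j) (\<lambda>\<xi>. U j \<xi> - U' j \<xi>)" by simp
qed

lemma sob1_wnorm_finite:
  assumes "\<And>j. sob1 (U j)"
  shows "wnorm 1 U < \<infinity>"
proof -
  have [measurable]: "U j \<in> borel_measurable borel" for j using assms by (simp add: sob1_def)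
  have "wnorm 1 U = (NNI \<xi>. (\<Sum>j\<in>UNIV. ennorm2 \<xi> * ennorm2 (U j \<xi>)))"
    unfolding wnorm_def by (intro nn_integral_cong) (simp add: sum_distrib_left flip: sum_ennreal)
  also have "\<dots> = (\<Sum>j\<in>UNIV. \<integral>\<^sup>+\<xi>. ennorm2 \<xi> * ennorm2 (U j \<xi>) \<partial>lborel)"
    by (intro nn_integral_sum) measurable
  also have "\<dots> < \<infinity>" using assms by (auto simp: sob1_def less_top)
  finally show ?thesis .
qed

text \<open>Converts approximation in the Bochner space into convergence of transforms in the
  weighted square mean. Finiteness on the Fourier side first yields membership of the difference,
  and then the forward bound applies.\<close>

lemma wnorm_1_diff:
  assumes H: "in_Hdot 1 F" "in_Hdot 1 F'" and U: "frep F U" and U': "frep F' U'"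
  shows "wnorm 1 (\<lambda>j \<xi>. U j \<xi> - U' j \<xi>) \<le> ennreal (plancherel_const * (Hdot_norm 1 (\<lambda>x. F x - F' x))^2)"
proof -
  have fr: "frep (\<lambda>x. F x - F' x) (\<lambda>j \<xi>. U j \<xi> - U' j \<xi>)" by (rule frep_diff[OF assms])
  have "sob1 (\<lambda>\<xi>. U j \<xi> - U' j \<xi>)" for j
  proof -
    have s: "sob1 (U j)" "sob1 (U' j)" using in_Hdot_sob1 assms by auto
    have [measurable]: "U j \<in> borel_measurable borel" "U' j \<in> borel_measurable borel" using s by (auto simp: sob1_def)
    have "(NNI \<xi>. ennorm2 \<xi> * ennorm2 (U j \<xi> - U' j \<xi>)) \<le>
      2 * (NNI \<xi>. ennorm2 \<xi> * ennorm2 (U j \<xi> - 0)) +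
      2 * (NNI \<xi>. ennorm2 \<xi> * ennorm2 (0 - U' j \<xi>))"
      by (rule weighted_diff_triangle) auto
    also have "\<dots> < \<infinity>" using s by (auto simp: sob1_def ennreal_mult_less_top less_top)
    finally show ?thesis by (simp add: sob1_def)
  qed
  hence "wnorm 1 (\<lambda>j \<xi>. U j \<xi> - U' j \<xi>) < \<infinity>" by (rule sob1_wnorm_finite)
  from Hdot_forward[OF Hdot_backward(1)[OF fr this] fr] show ?thesis .
qed

lemma AE_lebesgue_on_half_line:
  "(AE t in lebesgue_on {0..}. P t) \<longleftrightarrow> (AE t in lborel. (0::real) \<le> t \<longrightarrow> P t)"
  by (simp add: AE_restrict_space_iff AE_completion_iff)

text \<open>A simple function of time takes finitely many values, so its transform is a finite sum
  of products of a function of time and one of frequency. \<open>measurable_limit_selection\<close>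
  with weight \<open>(norm \<xi>)^2\<close> carries joint measurability to the limit.\<close>

theorem jointly_measurable_transform:
  fixes F :: "real \<Rightarrow> real^3 \<Rightarrow> complex^3"
  assumes L: "in_Lp_Hdot p 1 F"
  obtains V :: "3 \<Rightarrow> real \<Rightarrow> real^3 \<Rightarrow> complex"
  where "\<And>j. case_prod (V j) \<in> borel_measurable (borel \<Otimes>\<^sub>M borel)"
    "AE t in lborel. 0 \<le> t \<longrightarrow> in_Hdot 1 (F t) \<and> frep (F t) (\<lambda>j. V j t)"
proof -
  obtain S :: "nat \<Rightarrow> real \<Rightarrow> real^3 \<Rightarrow> complex^3" where
    simple: "\<And>k. simple_function (lebesgue_on {0..}) (S k)" and SH: "\<And>k t. t \<ge> 0 \<Longrightarrow> in_Hdot 1 (S k t)"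
    and lim: "AE t in lebesgue_on {0..}. (\<lambda>k. Hdot_norm 1 (\<lambda>x. S k t x - F t x)) \<longlonglongrightarrow> 0"
    using L unfolding in_Lp_Hdot_def strongly_measurable_Hdot_def by blast
  have FH: "AE t in lebesgue_on {0..}. in_Hdot 1 (F t)" using L by (simp add: in_Lp_Hdot_def)
  define A where "A k = S k ` {0..}" for k
  have fin: "finite (A k)" for k using simple[of k] by (simp add: simple_function_def A_def)
  define R where "R G = (SOME U. frep G U)" for G :: "real^3 \<Rightarrow> complex^3"
  have R: "frep G (R G)" if "in_Hdot 1 G" for G
  proof -
    have "\<forall>j. \<exists>g. has_fourier (\<lambda>x. G x $ j) g" using that by (auto simp: in_Hdot_def)
    then obtain U where "frep G U" by (rule frep_exists)
    thus ?thesis unfolding R_def by (rule someI[where P = "frep G"])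
  qed
  have RA: "frep G (R G)" if "G \<in> A k" for G k using that SH by (auto simp: A_def intro: R)
  \<comment> \<open>The level sets of \<open>S k\<close> are only Lebesgue measurable; their
    indicators are replaced by Borel functions at the price of a null set of times.\<close>
  have "\<exists>b::real \<Rightarrow> complex. b \<in> borel_measurable borel \<and> (AE t in lborel. (if 0 \<le> t \<and> S k t = G then 1 else 0) = b t)"
    if "G \<in> A k" for k G
  proof -
    have "S k -` {G} \<inter> {0..} \<in> sets (lebesgue_on {0..})"
      using simple[of k] that by (auto simp: simple_function_def A_def)
    hence [measurable]: "S k -` {G} \<inter> {0..} \<in> sets lebesgue" by (simp add: sets_restrict_space_iff)
    have "(indicator (S k -` {G} \<inter> {0..}) :: real \<Rightarrow> complex) \<in> borel_measurable lebesgue" by measurable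
    also have "(indicator (S k -` {G} \<inter> {0..}) :: real \<Rightarrow> complex) = (\<lambda>t. if 0 \<le> t \<and> S k t = G then 1 else 0)"
      by (auto simp: indicator_def fun_eq_iff)
    finally show ?thesis by (rule borel_representative) blast
  qed
  hence bex: "\<forall>k. \<forall>G\<in>A k. \<exists>b::real \<Rightarrow> complex. b \<in> borel_measurable borel \<and> (AE t in lborel. (if 0 \<le> t \<and> S k t = G then 1 else 0) = b t)"
    by blast
  define b :: "nat \<Rightarrow> (real^3 \<Rightarrow> complex^3) \<Rightarrow> real \<Rightarrow> complex" where
    "b k G = (SOME b. b \<in> borel_measurable borel \<and> (AE t in lborel. (if 0 \<le> t \<and> S k t = G then 1 else 0) = b t))" for k G
  have "b k G \<in> borel_measurable borel \<and> (AE t in lborel. (if 0 \<le> t \<and> S k t = G then 1 else 0) = b k G t)" if "G \<in> A k" for k G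
    unfolding b_def by (rule someI_ex[OF bex[rule_format, OF that]])
  hence b: "\<And>k G. G \<in> A k \<Longrightarrow> b k G \<in> borel_measurable borel"
      "\<And>k G. G \<in> A k \<Longrightarrow> AE t in lborel. (if 0 \<le> t \<and> S k t = G then 1 else 0) = b k G t" by auto
  \<comment> \<open>For almost every \<open>t \<ge> 0\<close> this equals
    \<open>R (S k t) j\<close>, but in a form that shows joint measurability.\<close>
  define v where "v j k t \<xi> = (\<Sum>G\<in>A k. b k G t * R G j \<xi>)" for j k t \<xi>
  have "AE t in lborel. \<forall>k. \<forall>G\<in>A k. (if 0 \<le> t \<and> S k t = G then 1 else 0) = b k G t"
    using b(2) fin by (simp add: AE_all_countable AE_finite_all)
  hence vS: "AE t in lborel. 0 \<le> t \<longrightarrow> (\<forall>k j \<xi>. v j k t \<xi> = R (S k t) j \<xi>)"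
  proof eventually_elim
    fix t assume t: "\<forall>k. \<forall>G\<in>A k. (if 0 \<le> t \<and> S k t = G then 1 else 0) = b k G t"
    show "0 \<le> t \<longrightarrow> (\<forall>k j \<xi>. v j k t \<xi> = R (S k t) j \<xi>)"
    proof (intro impI allI)
      fix k j \<xi> assume t0: "0 \<le> t"
      have "v j k t \<xi> = (\<Sum>G\<in>A k. if S k t = G then R G j \<xi> else 0)"
        unfolding v_def by (rule sum.cong) (use t t0 in \<open>auto simp flip: t\<close>)
      thus "v j k t \<xi> = R (S k t) j \<xi>" using t0 fin[of k] by (simp add: A_def)
    qed
  qed
  have vm: "case_prod (v j k) \<in> borel_measurable (borel \<Otimes>\<^sub>M borel)" for j k
    unfolding v_def case_prod_unfold
  proof (intro borel_measurable_sum borel_measurable_times)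
    fix G assume G: "G \<in> A k"
    show "(\<lambda>x. b k G (fst x)) \<in> borel_measurable (borel \<Otimes>\<^sub>M borel)"
      using b(1)[OF G] by measurable
    have "R G j \<in> borel_measurable borel" using RA[OF G] by (simp add: frep_def)
    thus "(\<lambda>x. R G j (snd x)) \<in> borel_measurable (borel \<Otimes>\<^sub>M borel)" by measurable
  qed
  have cpos: "AE \<xi> in lborel. (norm (\<xi>::real^3))^2 > 0"
    using AE_lborel_singleton[of "0::real^3"] by eventually_elim simp
  define good where "good j V \<longleftrightarrow> case_prod V \<in> borel_measurable (borel \<Otimes>\<^sub>M borel) \<and> (\<forall>t w. w \<in> borel_measurable borel \<longrightarrow>
      (\<lambda>k. \<integral>\<^sup>+\<xi>. ennorm2 \<xi> * ennorm2 (v j k t \<xi> - w \<xi>) \<partial>lborel) \<longlonglongrightarrow> 0 \<longrightarrow> (AE \<xi> in lborel. V t \<xi> = w \<xi>))" for j V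
  have "\<exists>V. good j V" for j
  proof -
    have [measurable]: "(\<lambda>\<xi>::real^3. (norm \<xi>)^2) \<in> borel_measurable borel" by measurable
    obtain V where "case_prod V \<in> borel_measurable (borel \<Otimes>\<^sub>M borel)" "\<And>t w. w \<in> borel_measurable borel \<Longrightarrow>
      (\<lambda>k. \<integral>\<^sup>+\<xi>. ennorm2 \<xi> * ennorm2 (v j k t \<xi> - w \<xi>) \<partial>lborel) \<longlonglongrightarrow> 0 \<Longrightarrow> AE \<xi> in lborel. V t \<xi> = w \<xi>"
      by (rule measurable_limit_selection[where v = "v j" and c = "\<lambda>\<xi>. (norm \<xi>)^2", OF vm _ cpos]) auto
    thus ?thesis unfolding good_def by blast
  qed
  then obtain V where good: "\<And>j. good j (V j)" using choice[of good] by blast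
  hence Vm: "\<And>j. case_prod (V j) \<in> borel_measurable (borel \<Otimes>\<^sub>M borel)"
    and V: "\<And>j t w. w \<in> borel_measurable borel \<Longrightarrow>
      (\<lambda>k. \<integral>\<^sup>+\<xi>. ennorm2 \<xi> * ennorm2 (v j k t \<xi> - w \<xi>) \<partial>lborel) \<longlonglongrightarrow> 0 \<Longrightarrow> AE \<xi> in lborel. V j t \<xi> = w \<xi>"
    unfolding good_def by blast+
  show ?thesis
  proof (rule that[OF Vm])
    show "AE t in lborel. 0 \<le> t \<longrightarrow> in_Hdot 1 (F t) \<and> frep (F t) (\<lambda>j. V j t)"
      using vS FH[unfolded AE_lebesgue_on_half_line] lim[unfolded AE_lebesgue_on_half_line]
    proof eventually_elim
      fix t assume v: "0 \<le> t \<longrightarrow> (\<forall>k j \<xi>. v j k t \<xi> = R (S k t) j \<xi>)" and F: "0 \<le> t \<longrightarrow> in_Hdot 1 (F t)"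
        and l: "0 \<le> t \<longrightarrow> (\<lambda>k. Hdot_norm 1 (\<lambda>x. S k t x - F t x)) \<longlonglongrightarrow> 0"
      show "0 \<le> t \<longrightarrow> in_Hdot 1 (F t) \<and> frep (F t) (\<lambda>j. V j t)"
      proof (intro impI conjI)
        assume t: "0 \<le> t"
        show Ft: "in_Hdot 1 (F t)" using F t by blast
        define W where "W = R (F t)"
        have W: "frep (F t) W" unfolding W_def by (rule R[OF Ft])
        have Vt: "AE \<xi> in lborel. V j t \<xi> = W j \<xi>" for j
        proof (rule V)
          show "W j \<in> borel_measurable borel" using W by (simp add: frep_def)
          have le: "(NNI \<xi>. ennorm2 \<xi> * ennorm2 (v j k t \<xi> - W j \<xi>)) \<le>
            ennreal (plancherel_const * (Hdot_norm 1 (\<lambda>x. S k t x - F t x))^2)" for k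
          proof -
            have "(NNI \<xi>. ennorm2 \<xi> * ennorm2 (v j k t \<xi> - W j \<xi>)) \<le>
              wnorm 1 (\<lambda>j \<xi>. R (S k t) j \<xi> - W j \<xi>)"
              using wnorm_1_component[of "\<lambda>j \<xi>. R (S k t) j \<xi> - W j \<xi>" j] v t by simp
            also have "\<dots> \<le> ennreal (plancherel_const * (Hdot_norm 1 (\<lambda>x. S k t x - F t x))^2)"
              by (rule wnorm_1_diff[OF SH[OF t] Ft R[OF SH[OF t]] W])
            finally show ?thesis .
          qed
          have "(\<lambda>k. ennreal (plancherel_const * (Hdot_norm 1 (\<lambda>x. S k t x - F t x))^2)) \<longlonglongrightarrow> ennreal (plancherel_const * 0^2)"
            using l t by (intro tendsto_ennrealI tendsto_mult tendsto_power tendsto_const) auto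
          hence z: "(\<lambda>k. ennreal (plancherel_const * (Hdot_norm 1 (\<lambda>x. S k t x - F t x))^2)) \<longlonglongrightarrow> 0" by simp
          show "(\<lambda>k. \<integral>\<^sup>+\<xi>. ennorm2 \<xi> * ennorm2 (v j k t \<xi> - W j \<xi>) \<partial>lborel) \<longlonglongrightarrow> 0"
            by (rule tendsto_sandwich[OF _ _ tendsto_const z]) (auto simp: le)
        qed
        show "frep (F t) (\<lambda>j. V j t)"
          unfolding frep_def
        proof (intro allI conjI)
          fix j
          show Vb: "V j t \<in> borel_measurable borel"
            using measurable_compose[OF measurable_Pair1'[of t borel borel] Vm[of j]] by simp
          have h: "has_fourier (\<lambda>x. F t x $ j) (W j)" using W by (simp add: frep_def)
          show "has_fourier (\<lambda>x. F t x $ j) (V j t)"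
          proof (rule has_fourier_AE_cong[OF h has_fourier_measurable_fst[OF h] _ borel_measurable_lebesgueI[OF Vb]])
            show "AE x in lborel. W j x = V j t x" using Vt[of j] by eventually_elim simp
          qed simp
        qed
      qed
    qed
  qed
qed

subsection \<open>The nonlinearity\<close>

lemma tensor_hat_frep:
  assumes H: "in_Hdot 1 (complexify u)" and U: "frep (complexify u) U"
  shows "has_fourier (\<lambda>x. of_real (u x $ k * u x $ l)) (\<lambda>\<xi>. inv3 * cconv (U k) (U l) \<xi>)"
proof -
  have Um[measurable]: "U j \<in> borel_measurable borel" for j using U by (simp add: frep_def)
  have h: "has_fourier (\<lambda>x. of_real (u x $ j)) (U j)" for j using U by (simp add: frep_def complexify_def)
  note m = has_fourier_measurable_fst[OF h]
  have "\<exists>f. f \<in> borel_measurable borel \<and> (AE x in lborel. complex_of_real (u x $ j) = f x)" for j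
    using borel_representative[OF m[of j]] by metis
  then obtain f where f: "\<And>j. f j \<in> borel_measurable borel" "\<And>j. AE x in lborel. complex_of_real (u x $ j) = f j x" by metis
  have hf: "has_fourier (f j) (U j)" for j
    by (rule has_fourier_AE_cong[OF h borel_measurable_lebesgueI[OF f(1)] f(2) borel_measurable_lebesgueI[OF Um]]) simp
  have "has_fourier (\<lambda>x. f k x * f l x) (\<lambda>\<xi>. inv3 * cconv (U k) (U l) \<xi>)"
    by (intro product_has_fourier in_Hdot_sob1[OF H U] hf f)
  thus ?thesis
  proof (rule has_fourier_AE_cong)
    show "(\<lambda>x. complex_of_real (u x $ k * u x $ l)) \<in> borel_measurable lebesgue"
      unfolding of_real_mult by (intro borel_measurable_times m)
    show "AE x in lborel. f k x * f l x = complex_of_real (u x $ k * u x $ l)"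
      using f(2)[of k] f(2)[of l] by eventually_elim simp
    show "(\<lambda>\<xi>. inv3 * cconv (U k) (U l) \<xi>) \<in> borel_measurable lebesgue"
      by (intro borel_measurable_lebesgueI) measurable
  qed simp
qed

text \<open>The transform of \<open>P div (u \<otimes> u)\<close>, where \<open>U\<close> is that of \<open>u\<close>.\<close>

definition nlin :: "(3 \<Rightarrow> real^3 \<Rightarrow> complex) \<Rightarrow> 3 \<Rightarrow> real^3 \<Rightarrow> complex" where
  "nlin U j \<xi> = (\<Sum>k\<in>UNIV. of_real ((if j = k then 1 else 0) - \<xi> $ j * \<xi> $ k / (norm \<xi>)^2) *
     (\<Sum>l\<in>UNIV. \<i> * of_real (\<xi> $ l) * (inv3 * cconv (U k) (U l) \<xi>)))"

text \<open>The sum of moduli rather than the Euclidean norm, because componentwise Duhamel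
  inequalities can be added. \<open>mass_sq_le\<close> and \<open>sum_sq_le_mass\<close> compare the
  squares at the cost of a factor 3.\<close>

definition mass :: "(3 \<Rightarrow> real^3 \<Rightarrow> complex) \<Rightarrow> real^3 \<Rightarrow> ennreal" where
  "mass U \<xi> = ennreal (\<Sum>j\<in>UNIV. norm (U j \<xi>))"

lemma nlin_leray:
  assumes H: "in_Hdot 1 (complexify u)" and U: "frep (complexify u) U"
  shows "AE \<xi> in lborel. leray_hat (div_hat (tensor_hat u)) \<xi> $ j = nlin U j \<xi>"
proof -
  have "AE \<xi> in lborel. \<forall>k l. fourier (\<lambda>x. of_real (u x $ k * u x $ l)) \<xi> = inv3 * cconv (U k) (U l) \<xi>"
    unfolding AE_all_countable
    using has_fourier_unique[OF has_fourier_fourier] tensor_hat_frep[OF H U] by blast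
  thus ?thesis
    by eventually_elim (simp only: leray_hat_def div_hat_def tensor_hat_def nlin_def vec_lambda_beta)
qed

lemma norm_inv3_le: "norm inv3 \<le> 1"
proof -
  have "1 \<le> (2 * pi) ^ 3" using pi_gt3 by (intro one_le_power) simp
  thus ?thesis by (simp add: inv3_def norm_divide norm_power field_simps)
qed

text \<open>The constant is \<open>2 * 3\<^sup>3\<close>: the entries of the projector are at most \<open>2\<close>, and there are three sums over three indices.\<close>

lemma nlin_bound:
  assumes [measurable]: "\<And>j. U j \<in> borel_measurable borel"
  shows "ennreal (\<Sum>j\<in>UNIV. norm (nlin U j \<xi>)) \<le> ennreal (54 * norm \<xi>) * nnconv (mass U) (mass U) \<xi>"
proof (cases "\<xi> = 0 \<or> nnconv (mass U) (mass U) \<xi> = \<infinity>")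
  case True
  thus ?thesis by (auto simp: nlin_def ennreal_mult_top)
next
  case False
  then obtain n where n: "nnconv (mass U) (mass U) \<xi> = ennreal n" "n \<ge> 0" by (metis ennreal_cases infinity_ennreal_def)
  have c: "norm (cconv (U k) (U l) \<xi>) \<le> n" for k l
  proof -
    have "ennreal (norm (cconv (U k) (U l) \<xi>)) \<le> nnconv (\<lambda>\<eta>. ennreal (norm (U k \<eta>))) (\<lambda>\<eta>. ennreal (norm (U l \<eta>))) \<xi>"
      by (rule cconv_le_nnconv) measurable
    also have "\<dots> \<le> nnconv (mass U) (mass U) \<xi>"
      unfolding nnconv_def mass_def by (intro nn_integral_mono mult_mono ennreal_leI member_le_sum) auto
    finally show ?thesis using n by simp
  qed
  have inner: "norm (\<Sum>l\<in>UNIV. \<i> * of_real (\<xi> $ l) * (inv3 * cconv (U k) (U l) \<xi>)) \<le> 3 * (norm \<xi> * n)" for k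
  proof -
    have "norm (\<Sum>l\<in>UNIV. \<i> * of_real (\<xi> $ l) * (inv3 * cconv (U k) (U l) \<xi>)) \<le> (\<Sum>l\<in>(UNIV::3 set). norm \<xi> * (1 * n))"
    proof (rule sum_norm_le)
      fix l :: 3
      have "norm (\<i> * of_real (\<xi> $ l) * (inv3 * cconv (U k) (U l) \<xi>)) = \<bar>\<xi> $ l\<bar> * (norm inv3 * norm (cconv (U k) (U l) \<xi>))"
        by (simp add: norm_mult)
      also have "\<dots> \<le> norm \<xi> * (1 * n)"
        using n(2) by (intro mult_mono c norm_inv3_le component_le_norm_cart) auto
      finally show "norm (\<i> * of_real (\<xi> $ l) * (inv3 * cconv (U k) (U l) \<xi>)) \<le> norm \<xi> * (1 * n)" .
    qed
    thus ?thesis by simp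
  qed
  have sym: "\<bar>(if j = k then 1 else 0) - \<xi> $ j * \<xi> $ k / (norm \<xi>)^2\<bar> \<le> 2" for j k
  proof -
    have "\<bar>\<xi> $ j * \<xi> $ k / (norm \<xi>)^2\<bar> = \<bar>\<xi> $ j\<bar> * \<bar>\<xi> $ k\<bar> / (norm \<xi>)^2" by (simp add: abs_mult)
    also have "\<dots> \<le> (norm \<xi> * norm \<xi>) / (norm \<xi>)^2"
      by (intro divide_right_mono mult_mono component_le_norm_cart) auto
    also have "\<dots> \<le> 1" by (simp add: power2_eq_square)
    finally have 1: "\<bar>\<xi> $ j * \<xi> $ k / (norm \<xi>)^2\<bar> \<le> 1" .
    have "\<bar>(if j = k then 1 else 0) - \<xi> $ j * \<xi> $ k / (norm \<xi>)^2\<bar> \<le> \<bar>if j = k then 1 else 0\<bar> + \<bar>\<xi> $ j * \<xi> $ k / (norm \<xi>)^2\<bar>"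
      by (rule abs_triangle_ineq4)
    also have "\<dots> \<le> 1 + 1" by (intro add_mono 1) simp
    finally show ?thesis by simp
  qed
  have "norm (nlin U j \<xi>) \<le> 18 * (norm \<xi> * n)" for j
  proof -
    have "norm (nlin U j \<xi>) \<le> (\<Sum>k\<in>(UNIV::3 set). 2 * (3 * (norm \<xi> * n)))"
      unfolding nlin_def
    proof (rule sum_norm_le)
      fix k :: 3
      show "norm (of_real ((if j = k then 1 else 0) - \<xi> $ j * \<xi> $ k / (norm \<xi>)^2) * (\<Sum>l\<in>UNIV. \<i> * of_real (\<xi> $ l) * (inv3 * cconv (U k) (U l) \<xi>)))
        \<le> 2 * (3 * (norm \<xi> * n))"
        unfolding norm_mult norm_of_real by (intro mult_mono sym inner) auto
    qed
    thus ?thesis by simp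
  qed
  hence "(\<Sum>j\<in>UNIV. norm (nlin U j \<xi>)) \<le> (\<Sum>j\<in>(UNIV::3 set). 18 * (norm \<xi> * n))" by (intro sum_mono) auto
  also have "\<dots> = 54 * norm \<xi> * n" by simp
  finally have "ennreal (\<Sum>j\<in>UNIV. norm (nlin U j \<xi>)) \<le> ennreal (54 * norm \<xi> * n)" by (rule ennreal_leI)
  also have "\<dots> = ennreal (54 * norm \<xi>) * ennreal n" by (rule ennreal_mult) (use n in auto)
  finally show ?thesis by (simp only: n)
qed

lemma lebesgue_AE_eq_borel:
  fixes f g :: "'a::euclidean_space \<Rightarrow> 'b::euclidean_space"
  assumes g: "g \<in> borel_measurable borel" and eq: "AE x in lborel. f x = g x"
  shows "f \<in> borel_measurable lebesgue" "integral\<^sup>L lebesgue f = integral\<^sup>L lborel g"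
proof -
  have gl: "g \<in> borel_measurable lebesgue" using g by (intro measurable_completion) simp
  have ae: "AE x in lebesgue. g x = f x"
    using eq by (subst AE_completion_iff) (auto elim!: eventually_mono)
  show fl: "f \<in> borel_measurable lebesgue" by (rule borel_measurable_AE[OF gl ae])
  have "integral\<^sup>L lebesgue f = integral\<^sup>L lebesgue g"
    by (rule integral_cong_AE[OF fl gl]) (use ae in \<open>auto elim!: eventually_mono\<close>)
  also have "\<dots> = integral\<^sup>L lborel g" using g by (intro integral_completion) simp
  finally show "integral\<^sup>L lebesgue f = integral\<^sup>L lborel g" .
qed

lemma rapid_norm_mult:
  assumes \<phi>: "rapid \<phi>"
  shows "rapid (\<lambda>x. of_real (norm x) * \<phi> x)"
  unfolding rapid_def
proof (intro conjI allI)
  have [measurable]: "\<phi> \<in> borel_measurable borel" by (rule rapid_measurable[OF \<phi>])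
  show "(\<lambda>x. of_real (norm x) * \<phi> x) \<in> borel_measurable borel" by measurable
  fix N :: nat
  obtain B where B: "\<And>x. (1 + norm x) ^ Suc N * norm (\<phi> x) \<le> B" using \<phi> unfolding rapid_def by blast
  have "(1 + norm x) ^ N * norm (of_real (norm x) * \<phi> x) \<le> B" for x
  proof -
    have "(1 + norm x) ^ N * norm (of_real (norm x) * \<phi> x) = (1 + norm x) ^ N * norm x * norm (\<phi> x)" by (simp add: norm_mult)
    also have "\<dots> \<le> (1 + norm x) ^ N * (1 + norm x) * norm (\<phi> x)" by (intro mult_right_mono mult_left_mono) auto
    also have "\<dots> \<le> B" using B[of x] by (simp add: mult.commute mult.left_commute)
    finally show ?thesis .
  qed
  thus "\<exists>M. \<forall>x. (1 + norm x) ^ N * norm (of_real (norm x) * \<phi> x) \<le> M" by blast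
qed

lemma ennreal_le_1_plus_sq: "(x::ennreal) \<le> 1 + x^2"
proof (cases x)
  case (real r)
  have "r \<le> 1 + r^2" using sum_squares_bound[of r 1] real by simp
  hence "ennreal r \<le> ennreal (1 + r^2)" by (rule ennreal_leI)
  also have "\<dots> = 1 + (ennreal r)^2" using real by (simp add: ennreal_power)
  finally show ?thesis by (simp only: real)
qed (simp add: power2_eq_square)

lemma mass_sq_le: "(mass U \<xi>)^2 \<le> 3 * ennreal (\<Sum>j\<in>UNIV. (norm (U j \<xi>))^2)"
proof -
  have "(\<Sum>j\<in>(UNIV::3 set). norm (U j \<xi>))^2 \<le> 3 * (\<Sum>j\<in>UNIV. (norm (U j \<xi>))^2)"
    using sum_squared_le_sum_of_squares[of "\<lambda>j. norm (U j \<xi>)" "UNIV :: 3 set"] by simp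
  hence "ennreal ((\<Sum>j\<in>(UNIV::3 set). norm (U j \<xi>))^2) \<le> ennreal (3 * (\<Sum>j\<in>UNIV. (norm (U j \<xi>))^2))" by (rule ennreal_leI)
  thus ?thesis unfolding mass_def by (simp add: ennreal_power sum_nonneg ennreal_mult)
qed

lemma norm_powr_half_sq: "(norm x powr (1/2))^2 = norm x"
  by (simp add: powr_half_sqrt)

lemma mass_measurable [measurable]:
  assumes [measurable]: "\<And>j. U j \<in> borel_measurable borel"
  shows "mass U \<in> borel_measurable borel"
  unfolding mass_def[abs_def] by measurable

lemma nn_integral_mass_le:
  assumes [measurable]: "\<And>j. U j \<in> borel_measurable borel"
  shows "(NNI \<xi>. ennreal ((norm \<xi> powr s)^2) * (mass U \<xi>)^2) \<le> 3 * wnorm s U"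
proof -
  have "(NNI \<xi>. ennreal ((norm \<xi> powr s)^2) * (mass U \<xi>)^2) \<le>
    (NNI \<xi>. 3 * (ennreal ((norm \<xi> powr s)^2) * ennreal (\<Sum>j\<in>UNIV. (norm (U j \<xi>))^2)))"
  proof (rule nn_integral_mono)
    fix \<xi>
    have "ennreal ((norm \<xi> powr s)^2) * (mass U \<xi>)^2 \<le> ennreal ((norm \<xi> powr s)^2) * (3 * ennreal (\<Sum>j\<in>UNIV. (norm (U j \<xi>))^2))"
      by (intro mult_left_mono mass_sq_le) simp
    thus "ennreal ((norm \<xi> powr s)^2) * (mass U \<xi>)^2 \<le> 3 * (ennreal ((norm \<xi> powr s)^2) * ennreal (\<Sum>j\<in>UNIV. (norm (U j \<xi>))^2))"
      by (simp only: mult.left_commute)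
  qed
  also have "\<dots> = 3 * wnorm s U" unfolding wnorm_def by (rule nn_integral_cmult) measurable
  finally show ?thesis .
qed

lemma sum_sq_le_mass: "ennreal (\<Sum>j\<in>UNIV. (norm (U j \<xi>))^2) \<le> (mass U \<xi>)^2"
proof -
  have "(\<Sum>j\<in>(UNIV::3 set). (norm (U j \<xi>))^2) \<le> (\<Sum>j\<in>UNIV. norm (U j \<xi>) * (\<Sum>k\<in>UNIV. norm (U k \<xi>)))"
    unfolding power2_eq_square by (intro sum_mono mult_left_mono member_le_sum) auto
  also have "\<dots> = (\<Sum>j\<in>UNIV. norm (U j \<xi>))^2" by (simp add: power2_eq_square sum_distrib_right)
  finally have "ennreal (\<Sum>j\<in>(UNIV::3 set). (norm (U j \<xi>))^2) \<le> ennreal ((\<Sum>j\<in>UNIV. norm (U j \<xi>))^2)" by (rule ennreal_leI)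
  thus ?thesis unfolding mass_def by (simp add: ennreal_power sum_nonneg)
qed

lemma wnorm_le_nn_integral_mass:
  "wnorm s U \<le> (NNI \<xi>. ennreal ((norm \<xi> powr s)^2) * (mass U \<xi>)^2)"
  unfolding wnorm_def by (intro nn_integral_mono mult_left_mono sum_sq_le_mass) simp

subsection \<open>Mild solutions on the Fourier side\<close>

text \<open>\<open>V\<close> is jointly measurable but represents the transform at almost every time
  only. This suffices inside time integrals; values at single times are supplied by
  \<open>Uh\<close> below.\<close>

locale mild_transform =
  fixes u0 :: "real^3 \<Rightarrow> real^3" and u :: "real \<Rightarrow> real^3 \<Rightarrow> real^3"
    and U0 :: "3 \<Rightarrow> real^3 \<Rightarrow> complex" and V :: "3 \<Rightarrow> real \<Rightarrow> real^3 \<Rightarrow> complex"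
  assumes mild: "mild_solution u0 u" and U0: "frep (complexify u0) U0"
    and V_measurable: "\<And>j. case_prod (V j) \<in> borel_measurable (borel \<Otimes>\<^sub>M borel)"
    and V: "AE t in lborel. 0 \<le> t \<longrightarrow> in_Hdot 1 (complexify (u t)) \<and> frep (complexify (u t)) (\<lambda>j. V j t)"
begin

lemma V_measurable2 [measurable (raw)]:
  assumes "g \<in> borel_measurable N" "h \<in> borel_measurable N"
  shows "(\<lambda>y. V j (g y) (h y)) \<in> borel_measurable N"
  using measurable_compose[OF measurable_Pair[OF assms] V_measurable[of j]] by simp

lemma V_measurable1 [measurable]: "V j s \<in> borel_measurable borel"
proof -
  have "(\<lambda>\<xi>. V j s \<xi>) \<in> borel_measurable borel" by measurable
  thus ?thesis by simp
qed

lemma U0_measurable [measurable]: "U0 j \<in> borel_measurable borel"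
  using U0 by (simp add: frep_def)

definition Q :: "3 \<Rightarrow> real \<Rightarrow> real^3 \<Rightarrow> complex" where "Q j s \<xi> = nlin (\<lambda>k. V k s) j \<xi>"

lemma Q_measurable2 [measurable (raw)]:
  assumes [measurable]: "g \<in> borel_measurable N" "h \<in> borel_measurable N"
  shows "(\<lambda>y. Q j (g y) (h y)) \<in> borel_measurable N"
proof -
  have "(\<lambda>p. Q j (fst p) (snd p)) \<in> borel_measurable (borel \<Otimes>\<^sub>M borel)"
    unfolding Q_def nlin_def cconv_def
  proof (intro borel_measurable_sum borel_measurable_times)
    fix k l :: 3
    have [measurable]: "(\<lambda>\<xi>::real^3. \<xi> $ i) \<in> borel_measurable borel" for i
      by (intro borel_measurable_continuous_onI continuous_intros)
    show "(\<lambda>p. complex_of_real ((if j = k then 1 else 0) - snd p $ j * snd p $ k / (norm (snd p))^2)) \<in> borel_measurable (borel \<Otimes>\<^sub>M borel)"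
      by measurable
    show "(\<lambda>p::real \<times> (real^3). complex_of_real (snd p $ l)) \<in> borel_measurable (borel \<Otimes>\<^sub>M borel)" by measurable
    show "(\<lambda>p. LINT \<eta>|lborel. V k (fst p) \<eta> * V l (fst p) (snd p - \<eta>)) \<in> borel_measurable (borel \<Otimes>\<^sub>M borel)"
      by measurable
  qed measurable
  from measurable_compose[OF measurable_Pair[OF assms] this] show ?thesis by simp
qed

definition NN :: "real \<Rightarrow> real^3 \<Rightarrow> ennreal" where
  "NN s = nnconv (mass (\<lambda>k. V k s)) (mass (\<lambda>k. V k s))"

lemma NN_measurable2 [measurable (raw)]:
  assumes [measurable]: "g \<in> borel_measurable N" "h \<in> borel_measurable N"
  shows "(\<lambda>y. NN (g y) (h y)) \<in> borel_measurable N"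
proof -
  have "(\<lambda>p. NN (fst p) (snd p)) \<in> borel_measurable (borel \<Otimes>\<^sub>M borel)"
    unfolding NN_def nnconv_def mass_def by measurable
  from measurable_compose[OF measurable_Pair[OF assms] this] show ?thesis by simp
qed

text \<open>The squared norm of order 1 up to equivalence, formed with \<open>V\<close>. By
  \<open>weighted_f_sq\<close> it is the quantity \<open>E\<close> of the scalar inequality at
  almost every time.\<close>

definition W :: "real \<Rightarrow> ennreal" where
  "W s = (NNI \<eta>. ennorm2 \<eta> * (mass (\<lambda>k. V k s) \<eta>)^2)"

lemma W_measurable [measurable]: "W \<in> borel_measurable borel"
  unfolding W_def[abs_def] mass_def by measurable

lemma NN_sq: "(NNI \<xi>. ennreal (norm \<xi>) * (NN s \<xi>)^2) \<le> ennreal kernel_const * (W s)^2"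
  using nn_integral_nnconv_sq[of "mass (\<lambda>k. V k s)" "mass (\<lambda>k. V k s)"]
  by (simp add: NN_def W_def power2_eq_square)

lemma Q_bound: "ennreal (\<Sum>j\<in>UNIV. norm (Q j s \<xi>)) \<le> ennreal (54 * norm \<xi>) * NN s \<xi>"
  unfolding Q_def NN_def by (rule nlin_bound) measurable

text \<open>Here the exponent 4 of the mild solution enters: \<open>W\<close> is quadratic in the
  norm of order 1, so its square is controlled by the fourth power. The 9 is the square of the 3 in
  \<open>nn_integral_mass_le\<close>.\<close>

lemma W_finite: "(NNI s. (W s)^2 * indicator {0..} s) < \<infinity>"
proof -
  let ?H = "\<lambda>t. Hdot_norm 1 (complexify (u t))"
  have "integrable (lebesgue_on {0..}) (\<lambda>t. ?H t ^ 4)"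
    using mild unfolding mild_solution_def in_Lp_Hdot_def by blast
  hence "integrable (lebesgue_on {0..}) (\<lambda>t. 9 * plancherel_const^2 * ?H t ^ 4)" by (rule integrable_mult_right)
  hence "(\<integral>\<^sup>+t. ennreal (norm (9 * plancherel_const^2 * ?H t ^ 4)) \<partial>lebesgue_on {0..}) < \<infinity>" by (simp only: integrable_iff_bounded)
  also have "(\<integral>\<^sup>+t. ennreal (norm (9 * plancherel_const^2 * ?H t ^ 4)) \<partial>lebesgue_on {0..}) = (NNI t. ennreal (9 * plancherel_const^2 * ?H t ^ 4) * indicator {0..} t)"
    by (subst nn_integral_restrict_space) (auto simp: nn_integral_lebesgue)
  finally have fin: "(NNI t. ennreal (9 * plancherel_const^2 * ?H t ^ 4) * indicator {0..} t) < \<infinity>" .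
  have "(NNI s. (W s)^2 * indicator {0..} s) \<le> (NNI t. ennreal (9 * plancherel_const^2 * ?H t ^ 4) * indicator {0..} t)"
  proof (rule nn_integral_mono_AE, use V in eventually_elim)
    fix s assume s: "0 \<le> s \<longrightarrow> in_Hdot 1 (complexify (u s)) \<and> frep (complexify (u s)) (\<lambda>j. V j s)"
    show "(W s)^2 * indicator {0..} s \<le> ennreal (9 * plancherel_const^2 * ?H s ^ 4) * indicator {0..} s"
    proof (cases "0 \<le> s")
      case True
      with s have h: "in_Hdot 1 (complexify (u s))" "frep (complexify (u s)) (\<lambda>j. V j s)" by auto
      have "W s \<le> 3 * wnorm 1 (\<lambda>j. V j s)"
        using nn_integral_mass_le[of "\<lambda>j. V j s" 1] by (simp add: W_def)
      also have "\<dots> \<le> 3 * ennreal (plancherel_const * (?H s)^2)" by (intro mult_left_mono Hdot_forward h) simp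
      also have "\<dots> = ennreal (3 * (plancherel_const * (?H s)^2))" using plancherel_const_pos by (simp add: ennreal_mult)
      finally have "(W s)^2 \<le> (ennreal (3 * (plancherel_const * (?H s)^2)))^2" by (rule power_mono) simp
      also have "\<dots> = ennreal ((3 * (plancherel_const * (?H s)^2))^2)" using plancherel_const_pos by (intro ennreal_power) simp
      also have "(3 * (plancherel_const * (?H s)^2))^2 = 9 * plancherel_const^2 * ?H s ^ 4" by (simp add: power_mult_distrib)
      finally show ?thesis using True by simp
    qed simp
  qed
  thus ?thesis using fin by (rule order_le_less_trans)
qed

text \<open>The derivative in the nonlinearity is moved to the test function, which stays
  \<open>rapid\<close>; then \<open>half_weight_rapid\<close> bounds the square of the pairing by a
  multiple of \<open>(W s)^2\<close>. The inequality \<open>x \<le> 1 + x^2\<close> makes a bound on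
  the square sufficient on a bounded time interval.\<close>

lemma Q_tested_finite:
  assumes \<phi>: "rapid \<phi>"
  shows "(NNI s. (NNI \<xi>. ennreal (norm (Q j s \<xi>)) * ennreal (norm (\<phi> \<xi>))) * indicator {0..t} s) < \<infinity>"
proof -
  have [measurable]: "\<phi> \<in> borel_measurable borel" by (rule rapid_measurable[OF \<phi>])
  let ?\<psi> = "\<lambda>\<xi>. of_real (norm \<xi>) * \<phi> \<xi>"
  have \<psi>: "rapid ?\<psi>" by (rule rapid_norm_mult[OF \<phi>])
  have [measurable]: "?\<psi> \<in> borel_measurable borel" by (rule rapid_measurable[OF \<psi>])
  define c where "c = (NNI \<xi>. ennreal (1 / norm \<xi>) * ennorm2 (?\<psi> \<xi>))"
  have c: "c < \<infinity>" unfolding c_def by (rule rapid_weight_finite[OF \<psi>])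
  have inner: "(NNI \<xi>. ennreal (norm (Q j s \<xi>)) * ennreal (norm (\<phi> \<xi>))) \<le> 54 * (1 + (ennreal kernel_const * (W s)^2) * c)" for s
  proof -
    have "(NNI \<xi>. ennreal (norm (Q j s \<xi>)) * ennreal (norm (\<phi> \<xi>))) \<le> (NNI \<xi>. 54 * (NN s \<xi> * ennreal (norm (?\<psi> \<xi>))))"
    proof (rule nn_integral_mono)
      fix \<xi>
      have "ennreal (norm (Q j s \<xi>)) \<le> ennreal (\<Sum>j\<in>UNIV. norm (Q j s \<xi>))" by (intro ennreal_leI member_le_sum) auto
      also have "\<dots> \<le> ennreal (54 * norm \<xi>) * NN s \<xi>" by (rule Q_bound)
      finally have "ennreal (norm (Q j s \<xi>)) * ennreal (norm (\<phi> \<xi>)) \<le> (ennreal (54 * norm \<xi>) * NN s \<xi>) * ennreal (norm (\<phi> \<xi>))"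
        by (rule mult_right_mono) simp
      also have "\<dots> = 54 * (NN s \<xi> * ennreal (norm (?\<psi> \<xi>)))"
        by (simp add: norm_mult ennreal_mult mult.assoc mult.left_commute)
      finally show "ennreal (norm (Q j s \<xi>)) * ennreal (norm (\<phi> \<xi>)) \<le> 54 * (NN s \<xi> * ennreal (norm (?\<psi> \<xi>)))" .
    qed
    also have "\<dots> = 54 * (NNI \<xi>. NN s \<xi> * ennreal (norm (?\<psi> \<xi>)))" by (rule nn_integral_cmult) measurable
    also have "\<dots> \<le> 54 * (1 + (NNI \<xi>. NN s \<xi> * ennreal (norm (?\<psi> \<xi>)))^2)"
      by (intro mult_left_mono ennreal_le_1_plus_sq) simp
    also have "\<dots> \<le> 54 * (1 + (ennreal kernel_const * (W s)^2) * c)"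
    proof (intro mult_left_mono add_left_mono)
      have "(NNI \<xi>. NN s \<xi> * ennreal (norm (?\<psi> \<xi>)))^2 \<le> (NNI \<xi>. ennreal (norm \<xi>) * (NN s \<xi>)^2) * c"
        unfolding c_def by (rule half_weight_rapid[OF \<psi>]) measurable
      also have "\<dots> \<le> (ennreal kernel_const * (W s)^2) * c" by (intro mult_right_mono NN_sq) simp
      finally show "(NNI \<xi>. NN s \<xi> * ennreal (norm (?\<psi> \<xi>)))^2 \<le> (ennreal kernel_const * (W s)^2) * c" .
    qed simp
    finally show ?thesis .
  qed
  have "(NNI s. (NNI \<xi>. ennreal (norm (Q j s \<xi>)) * ennreal (norm (\<phi> \<xi>))) * indicator {0..t} s) \<le>
    (NNI s. 54 * indicator {0..t} s + (54 * ennreal kernel_const * c) * ((W s)^2 * indicator {0..} s))"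
  proof (rule nn_integral_mono)
    fix s :: real
    show "(NNI \<xi>. ennreal (norm (Q j s \<xi>)) * ennreal (norm (\<phi> \<xi>))) * indicator {0..t} s \<le>
      54 * indicator {0..t} s + (54 * ennreal kernel_const * c) * ((W s)^2 * indicator {0..} s)"
    proof (cases "s \<in> {0..t}")
      case True
      have "54 * (1 + (ennreal kernel_const * (W s)^2) * c) = 54 + (54 * ennreal kernel_const * c) * (W s)^2"
        by (simp add: distrib_left ac_simps)
      with inner[of s] True show ?thesis by simp
    qed simp
  qed
  also have "\<dots> = 54 * (NNI s. indicator {0..t} s) + (54 * ennreal kernel_const * c) * (NNI s. (W s)^2 * indicator {0..} s)"
    by (subst nn_integral_add) (auto simp: nn_integral_cmult)
  also have "\<dots> < \<infinity>" using W_finite c by (auto simp: emeasure_lborel_Icc_eq ennreal_mult_less_top ennreal_mult_eq_top_iff less_top)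
  finally show ?thesis .
qed

text \<open>Testing with a strictly positive Gaussian and exchanging the integrals gives finiteness
  for almost every \<open>\<xi>\<close>. Integer end times keep the exceptional set a countable
  union, independent of the time.\<close>

lemma Q_time_integrable:
  "AE \<xi> in lborel. \<forall>j. \<forall>n::nat. (NNI s. ennreal (norm (Q j s \<xi>)) * indicator {0..real n} s) < \<infinity>"
  unfolding AE_all_countable
proof (intro allI)
  fix j :: 3 and n :: nat
  let ?g = "gauss 1 (0::real^3) 0"
  have g: "norm (?g \<xi>) > 0" for \<xi> by (simp add: gauss_0)
  have [measurable]: "?g \<in> borel_measurable borel" by (intro rapid_measurable schwartz_rapid schwartz_gauss) simp
  have "(NNI \<xi>. (NNI s. ennreal (norm (Q j s \<xi>)) * indicator {0..real n} s) * ennreal (norm (?g \<xi>))) =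
    (NNI (\<xi>::real^3). (NNI (s::real). ennreal (norm (Q j s \<xi>)) * ennreal (norm (?g \<xi>)) * indicator {0..real n} s))"
    by (subst nn_integral_multc[symmetric]) (auto intro!: nn_integral_cong simp: ac_simps)
  also have "\<dots> = (NNI (s::real). (NNI (\<xi>::real^3). ennreal (norm (Q j s \<xi>)) * ennreal (norm (?g \<xi>)) * indicator {0..real n} s))"
    by (rule lborel_pair.Fubini') measurable
  also have "\<dots> = (NNI s. (NNI \<xi>. ennreal (norm (Q j s \<xi>)) * ennreal (norm (?g \<xi>))) * indicator {0..real n} s)"
    by (subst nn_integral_multc) auto
  also have "\<dots> < \<infinity>" by (intro Q_tested_finite schwartz_rapid schwartz_gauss) simp
  finally have "(NNI \<xi>. (NNI s. ennreal (norm (Q j s \<xi>)) * indicator {0..real n} s) * ennreal (norm (?g \<xi>))) \<noteq> \<infinity>" by simp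
  hence "AE \<xi> in lborel. (NNI s. ennreal (norm (Q j s \<xi>)) * indicator {0..real n} s) * ennreal (norm (?g \<xi>)) \<noteq> \<infinity>"
    by (intro nn_integral_noteq_infinite) auto
  thus "AE \<xi> in lborel. (NNI s. ennreal (norm (Q j s \<xi>)) * indicator {0..real n} s) < \<infinity>"
  proof eventually_elim
    fix \<xi> assume "(NNI s. ennreal (norm (Q j s \<xi>)) * indicator {0..real n} s) * ennreal (norm (?g \<xi>)) \<noteq> \<infinity>"
    thus "(NNI s. ennreal (norm (Q j s \<xi>)) * indicator {0..real n} s) < \<infinity>"
      using g[of \<xi>] by (auto simp: ennreal_mult_eq_top_iff less_top)
  qed
qed

definition A :: "3 \<Rightarrow> real \<Rightarrow> real \<Rightarrow> real^3 \<Rightarrow> complex" where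
  "A j t s \<xi> = (if 0 \<le> s \<and> s \<le> t then of_real (exp (- (t - s) * (norm \<xi>)^2)) * Q j s \<xi> else 0)"

text \<open>The right-hand side of Duhamel's formula read pointwise in \<open>\<xi>\<close>: jointly
  measurable, and a representative of the transform at every single time by
  \<open>Uh_transform\<close>.\<close>

definition Uh :: "3 \<Rightarrow> real \<Rightarrow> real^3 \<Rightarrow> complex" where
  "Uh j t \<xi> = of_real (exp (- t * (norm \<xi>)^2)) * U0 j \<xi> - (LINT s|lborel. A j t s \<xi>)"

lemma A_measurable2 [measurable (raw)]:
  assumes [measurable]: "g \<in> borel_measurable N" "h \<in> borel_measurable N" "k \<in> borel_measurable N"
  shows "(\<lambda>y. A j (g y) (h y) (k y)) \<in> borel_measurable N"
  unfolding A_def by measurable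

lemma Uh_measurable2 [measurable (raw)]:
  assumes [measurable]: "g \<in> borel_measurable N" "h \<in> borel_measurable N"
  shows "(\<lambda>y. Uh j (g y) (h y)) \<in> borel_measurable N"
proof -
  have "(\<lambda>p. Uh j (fst p) (snd p)) \<in> borel_measurable (borel \<Otimes>\<^sub>M borel)"
    unfolding Uh_def by measurable
  from measurable_compose[OF measurable_Pair[OF assms] this] show ?thesis by simp
qed

lemma Uh_measurable1 [measurable]: "Uh j t \<in> borel_measurable borel"
proof -
  have "(\<lambda>\<xi>. Uh j t \<xi>) \<in> borel_measurable borel" by measurable
  thus ?thesis by simp
qed

lemma norm_A_le: "norm (A j t s \<xi>) \<le> norm (Q j s \<xi>) * indicator {0..t} s"
proof (cases "0 \<le> s \<and> s \<le> t")
  case True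
  have "exp (- (t - s) * (norm \<xi>)^2) \<le> 1" using True by (simp add: mult_nonpos_nonneg)
  hence "exp (- (t - s) * (norm \<xi>)^2) * norm (Q j s \<xi>) \<le> 1 * norm (Q j s \<xi>)" by (rule mult_right_mono) simp
  thus ?thesis using True by (simp add: A_def norm_mult)
qed (auto simp: A_def)

lemma Uh_0: "Uh j 0 \<xi> = U0 j \<xi>"
proof -
  have "(LINT s|lborel. A j 0 s \<xi>) = (LINT (s::real)|lborel. 0 :: complex)"
  proof (rule integral_cong_AE)
    show "AE s in lborel. A j 0 s \<xi> = 0" using AE_lborel_singleton[of "0::real"] by eventually_elim (auto simp: A_def)
  qed measurable
  thus ?thesis by (simp add: Uh_def)
qed

lemma A_tested_integrable:
  assumes \<phi>: "rapid \<phi>"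
  shows "integrable (lborel \<Otimes>\<^sub>M lborel) (\<lambda>(s, \<xi>). A j t s \<xi> * \<phi> \<xi>)"
proof (rule integrableI_bounded)
  have [measurable]: "\<phi> \<in> borel_measurable borel" by (rule rapid_measurable[OF \<phi>])
  show "(\<lambda>(s, \<xi>). A j t s \<xi> * \<phi> \<xi>) \<in> borel_measurable (lborel \<Otimes>\<^sub>M lborel)" unfolding case_prod_unfold by measurable
  have "(\<integral>\<^sup>+p. ennreal (norm (case p of (s, \<xi>) \<Rightarrow> A j t s \<xi> * \<phi> \<xi>)) \<partial>(lborel \<Otimes>\<^sub>M lborel)) =
    (NNI (s::real). (NNI (\<xi>::real^3). ennreal (norm (A j t s \<xi> * \<phi> \<xi>))))"
    by (subst lborel.nn_integral_fst[symmetric]) (auto simp: case_prod_unfold)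
  also have "\<dots> \<le> (NNI s. (NNI \<xi>. ennreal (norm (Q j s \<xi>)) * ennreal (norm (\<phi> \<xi>))) * indicator {0..t} s)"
  proof (rule nn_integral_mono)
    fix s :: real
    have "(NNI (\<xi>::real^3). ennreal (norm (A j t s \<xi> * \<phi> \<xi>))) \<le> (NNI \<xi>. (ennreal (norm (Q j s \<xi>)) * ennreal (norm (\<phi> \<xi>))) * indicator {0..t} s)"
    proof (rule nn_integral_mono)
      fix \<xi> :: "real^3"
      have "norm (A j t s \<xi> * \<phi> \<xi>) \<le> (norm (Q j s \<xi>) * indicator {0..t} s) * norm (\<phi> \<xi>)"
        unfolding norm_mult by (intro mult_right_mono norm_A_le) simp
      hence "ennreal (norm (A j t s \<xi> * \<phi> \<xi>)) \<le> ennreal ((norm (Q j s \<xi>) * indicator {0..t} s) * norm (\<phi> \<xi>))" by (rule ennreal_leI)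
      also have "\<dots> = (ennreal (norm (Q j s \<xi>)) * ennreal (norm (\<phi> \<xi>))) * indicator {0..t} s"
        by (auto simp: indicator_def ennreal_mult)
      finally show "ennreal (norm (A j t s \<xi> * \<phi> \<xi>)) \<le> (ennreal (norm (Q j s \<xi>)) * ennreal (norm (\<phi> \<xi>))) * indicator {0..t} s" .
    qed
    also have "\<dots> = (NNI \<xi>. ennreal (norm (Q j s \<xi>)) * ennreal (norm (\<phi> \<xi>))) * indicator {0..t} s"
      by (rule nn_integral_multc) measurable
    finally show "(NNI (\<xi>::real^3). ennreal (norm (A j t s \<xi> * \<phi> \<xi>))) \<le> (NNI \<xi>. ennreal (norm (Q j s \<xi>)) * ennreal (norm (\<phi> \<xi>))) * indicator {0..t} s" .
  qed
  also have "\<dots> < \<infinity>" by (rule Q_tested_finite[OF \<phi>])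
  finally show "(\<integral>\<^sup>+p. ennreal (norm (case p of (s, \<xi>) \<Rightarrow> A j t s \<xi> * \<phi> \<xi>)) \<partial>(lborel \<Otimes>\<^sub>M lborel)) < \<infinity>" .
qed

lemma frep_tested_integrable:
  assumes "frep F U'" "schwartz \<phi>"
  shows "integrable lborel (\<lambda>\<xi>. U' j \<xi> * \<phi> \<xi>)"
proof -
  have "integrable lebesgue (\<lambda>\<xi>. U' j \<xi> * \<phi> \<xi>)"
    using assms unfolding frep_def has_fourier_def tempered_def by blast
  moreover have "(\<lambda>\<xi>. U' j \<xi> * \<phi> \<xi>) \<in> borel_measurable lborel"
  proof -
    have [measurable]: "U' j \<in> borel_measurable borel" using assms(1) by (simp add: frep_def)
    have [measurable]: "\<phi> \<in> borel_measurable borel" by (rule rapid_measurable[OF schwartz_rapid[OF assms(2)]])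
    show ?thesis by measurable
  qed
  ultimately show ?thesis by (simp add: integrable_completion)
qed

text \<open>Fubini's theorem turns the tested Duhamel formula into equality of the pairings of
  \<open>Uh j t\<close> and of the true transform with every Gaussian, and Gaussians determine a
  function almost everywhere.\<close>

theorem Uh_transform:
  assumes t: "0 \<le> t"
  shows "frep (complexify (u t)) (\<lambda>j. Uh j t)"
proof -
  have "\<forall>j. \<exists>g. has_fourier (\<lambda>x. complexify (u t) x $ j) g" using mild t unfolding mild_solution_def by blast
  then obtain U' where U': "frep (complexify (u t)) U'" by (rule frep_exists)
  have [measurable]: "U' j \<in> borel_measurable borel" for j using U' by (simp add: frep_def)
  have eq: "AE \<xi> in lborel. U' j \<xi> - Uh j t \<xi> = 0" for j
  proof (rule gaussian_tested_zero)
    let ?B = "\<lambda>\<xi>. LINT s|lborel. A j t s \<xi>"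
    let ?e = "\<lambda>\<xi>::real^3. complex_of_real (exp (- t * (norm \<xi>)^2))"
    have dm: "(\<lambda>\<xi>. U' j \<xi> - Uh j t \<xi>) \<in> borel_measurable borel" by measurable
    thus "(\<lambda>\<xi>. U' j \<xi> - Uh j t \<xi>) \<in> borel_measurable lebesgue" by (rule borel_measurable_lebesgueI)
    have int: "integrable lborel (\<lambda>\<xi>. U' j \<xi> * \<phi> \<xi>)" "integrable lborel (\<lambda>\<xi>. ?e \<xi> * U0 j \<xi> * \<phi> \<xi>)"
      "integrable lborel (\<lambda>\<xi>. ?B \<xi> * \<phi> \<xi>)" if S: "schwartz \<phi>" for \<phi>
    proof -
      have [measurable]: "\<phi> \<in> borel_measurable borel" by (rule rapid_measurable[OF schwartz_rapid[OF S]])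
      show "integrable lborel (\<lambda>\<xi>. U' j \<xi> * \<phi> \<xi>)" by (rule frep_tested_integrable[OF U' S])
      show "integrable lborel (\<lambda>\<xi>. ?e \<xi> * U0 j \<xi> * \<phi> \<xi>)"
      proof (rule Bochner_Integration.integrable_bound[OF frep_tested_integrable[OF U0 S]])
        show "AE \<xi> in lborel. norm (?e \<xi> * U0 j \<xi> * \<phi> \<xi>) \<le> norm (U0 j \<xi> * \<phi> \<xi>)"
        proof (rule AE_I2)
          fix \<xi> :: "real^3"
          have "exp (- t * (norm \<xi>)^2) \<le> 1" using t by simp
          hence "exp (- t * (norm \<xi>)^2) * norm (U0 j \<xi> * \<phi> \<xi>) \<le> 1 * norm (U0 j \<xi> * \<phi> \<xi>)" by (rule mult_right_mono) simp
          thus "norm (?e \<xi> * U0 j \<xi> * \<phi> \<xi>) \<le> norm (U0 j \<xi> * \<phi> \<xi>)" by (simp add: norm_mult mult.assoc)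
        qed
      qed measurable
      have "integrable lborel (\<lambda>\<xi>. LINT s|lborel. A j t s \<xi> * \<phi> \<xi>)"
        by (rule lborel_pair.integrable_snd[OF A_tested_integrable[OF schwartz_rapid[OF S]]])
      thus "integrable lborel (\<lambda>\<xi>. ?B \<xi> * \<phi> \<xi>)" by simp
    qed
    show "integrable lebesgue (\<lambda>\<xi>. (U' j \<xi> - Uh j t \<xi>) * \<phi> \<xi>)" if S: "schwartz \<phi>" for \<phi>
    proof -
      have [measurable]: "\<phi> \<in> borel_measurable borel" by (rule rapid_measurable[OF schwartz_rapid[OF S]])
      have "integrable lborel (\<lambda>\<xi>. U' j \<xi> * \<phi> \<xi> - (?e \<xi> * U0 j \<xi> * \<phi> \<xi> - ?B \<xi> * \<phi> \<xi>))"
        by (intro Bochner_Integration.integrable_diff int S)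
      hence "integrable lborel (\<lambda>\<xi>. (U' j \<xi> - Uh j t \<xi>) * \<phi> \<xi>)" by (simp only: Uh_def left_diff_distrib)
      thus ?thesis by (subst integrable_completion) auto
    qed
    fix a :: real and b :: "real^3" assume a: "a > 0"
    define \<phi> where "\<phi> = gauss a b 0"
    have S: "schwartz \<phi>" unfolding \<phi>_def by (rule schwartz_gauss[OF a])
    have [measurable]: "\<phi> \<in> borel_measurable borel" by (rule rapid_measurable[OF schwartz_rapid[OF S]])
    define N where "N = (\<lambda>s. LINT \<xi>|lebesgue. heat_hat (t - s) (leray_hat (div_hat (tensor_hat (u s)))) \<xi> $ j * \<phi> \<xi>)"
    have duh: "(LINT \<xi>|lebesgue. vfourier (complexify (u t)) \<xi> $ j * \<phi> \<xi>) =
       (LINT \<xi>|lebesgue. heat_hat t (vfourier (complexify u0)) \<xi> $ j * \<phi> \<xi>) - (LINT s:{0..t}|lebesgue. N s)"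
      using mild t S unfolding mild_solution_def N_def Let_def by blast
    have 1: "(LINT \<xi>|lebesgue. vfourier (complexify (u t)) \<xi> $ j * \<phi> \<xi>) = (LINT \<xi>|lborel. U' j \<xi> * \<phi> \<xi>)"
    proof (rule lebesgue_AE_eq_borel)
      show "AE \<xi> in lborel. vfourier (complexify (u t)) \<xi> $ j * \<phi> \<xi> = U' j \<xi> * \<phi> \<xi>"
        using frep_vfourier[OF U'] by eventually_elim simp
    qed measurable
    have 2: "(LINT \<xi>|lebesgue. heat_hat t (vfourier (complexify u0)) \<xi> $ j * \<phi> \<xi>) = (LINT \<xi>|lborel. ?e \<xi> * U0 j \<xi> * \<phi> \<xi>)"
    proof (rule lebesgue_AE_eq_borel)
      show "AE \<xi> in lborel. heat_hat t (vfourier (complexify u0)) \<xi> $ j * \<phi> \<xi> = ?e \<xi> * U0 j \<xi> * \<phi> \<xi>"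
        using frep_vfourier[OF U0] by eventually_elim (simp add: heat_hat_def)
    qed measurable
    have N: "AE s in lborel. indicator {0..t} s *\<^sub>R N s = (LINT \<xi>|lborel. A j t s \<xi> * \<phi> \<xi>)"
      using V
    proof eventually_elim
      fix s assume s: "0 \<le> s \<longrightarrow> in_Hdot 1 (complexify (u s)) \<and> frep (complexify (u s)) (\<lambda>j. V j s)"
      show "indicator {0..t} s *\<^sub>R N s = (LINT \<xi>|lborel. A j t s \<xi> * \<phi> \<xi>)"
      proof (cases "0 \<le> s \<and> s \<le> t")
        case True
        have "N s = (LINT \<xi>|lborel. A j t s \<xi> * \<phi> \<xi>)"
          unfolding N_def
        proof (rule lebesgue_AE_eq_borel)
          show "AE \<xi> in lborel. heat_hat (t - s) (leray_hat (div_hat (tensor_hat (u s)))) \<xi> $ j * \<phi> \<xi> = A j t s \<xi> * \<phi> \<xi>"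
            using nlin_leray[of "u s" "\<lambda>j. V j s" j] s True by (auto elim!: eventually_mono simp: heat_hat_def A_def Q_def)
        qed measurable
        thus ?thesis using True by simp
      qed (auto simp: A_def)
    qed
    have "(LINT s:{0..t}|lebesgue. N s) = (LINT s|lborel. LINT \<xi>|lborel. A j t s \<xi> * \<phi> \<xi>)"
      unfolding set_lebesgue_integral_def by (rule lebesgue_AE_eq_borel[OF _ N]) measurable
    also have "\<dots> = (LINT \<xi>|lborel. LINT s|lborel. A j t s \<xi> * \<phi> \<xi>)"
      by (rule lborel_pair.Fubini_integral[symmetric, OF A_tested_integrable[OF schwartz_rapid[OF S]]])
    also have "\<dots> = (LINT \<xi>|lborel. ?B \<xi> * \<phi> \<xi>)" by simp
    finally have 3: "(LINT s:{0..t}|lebesgue. N s) = (LINT \<xi>|lborel. ?B \<xi> * \<phi> \<xi>)" .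
    have "(LINT \<xi>|lebesgue. (U' j \<xi> - Uh j t \<xi>) * of_real (exp (- a * (norm (\<xi> - b))^2))) = (LINT \<xi>|lborel. (U' j \<xi> - Uh j t \<xi>) * \<phi> \<xi>)"
      by (subst integral_completion) (auto simp: \<phi>_def gauss_0)
    also have "\<dots> = (LINT \<xi>|lborel. U' j \<xi> * \<phi> \<xi> - (?e \<xi> * U0 j \<xi> * \<phi> \<xi> - ?B \<xi> * \<phi> \<xi>))"
      by (simp only: Uh_def left_diff_distrib)
    also have "\<dots> = (LINT \<xi>|lborel. U' j \<xi> * \<phi> \<xi>) - ((LINT \<xi>|lborel. ?e \<xi> * U0 j \<xi> * \<phi> \<xi>) - (LINT \<xi>|lborel. ?B \<xi> * \<phi> \<xi>))"
      by (subst Bochner_Integration.integral_diff[OF int(1)[OF S] Bochner_Integration.integrable_diff[OF int(2,3)[OF S]]],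
          subst Bochner_Integration.integral_diff[OF int(2,3)[OF S]]) (rule refl)
    also have "\<dots> = 0" using duh unfolding 1 2 3 by simp
    finally show "(LINT \<xi>|lebesgue. (U' j \<xi> - Uh j t \<xi>) * of_real (exp (- a * (norm (\<xi> - b))^2))) = 0" .
  qed
  show ?thesis
    unfolding frep_def
  proof (intro allI conjI)
    fix j
    show Um: "Uh j t \<in> borel_measurable borel" by measurable
    have h: "has_fourier (\<lambda>x. complexify (u t) x $ j) (U' j)" using U' by (simp add: frep_def)
    show "has_fourier (\<lambda>x. complexify (u t) x $ j) (Uh j t)"
    proof (rule has_fourier_AE_cong[OF h has_fourier_measurable_fst[OF h] _ borel_measurable_lebesgueI[OF Um]])
      show "AE x in lborel. U' j x = Uh j t x" using eq[of j] by eventually_elim simp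
    qed simp
  qed
qed

text \<open>By the semigroup law, the integral over \<open>[0, \<tau>]\<close> in
  \<open>Uh j t\<close> is the one in \<open>Uh j \<tau>\<close> times the heat factor for the time
  \<open>t - \<tau>\<close>, so it cancels and only \<open>[\<tau>, t]\<close> remains. The
  exceptional set is that of \<open>Q_time_integrable\<close>.\<close>

lemma Uh_duhamel:
  assumes \<tau>: "0 \<le> \<tau>" "\<tau> \<le> t"
  shows "AE \<xi> in lborel. \<forall>j. ennreal (norm (Uh j t \<xi>)) \<le> ennreal (exp (- (t - \<tau>) * (norm \<xi>)^2)) * ennreal (norm (Uh j \<tau> \<xi>)) +
    (NNI s. ennreal (exp (- (t - s) * (norm \<xi>)^2)) * ennreal (norm (Q j s \<xi>)) * indicator {\<tau>..t} s)"
  using Q_time_integrable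
proof eventually_elim
  fix \<xi> :: "real^3" assume fin: "\<forall>j. \<forall>n::nat. (NNI s. ennreal (norm (Q j s \<xi>)) * indicator {0..real n} s) < \<infinity>"
  have int: "integrable lborel (\<lambda>s. A j t' s \<xi>)" for j t'
  proof (rule integrableI_bounded)
    obtain n :: nat where n: "t' \<le> real n" using real_arch_simple by blast
    have "(NNI s. ennreal (norm (A j t' s \<xi>))) \<le> (NNI s. ennreal (norm (Q j s \<xi>)) * indicator {0..real n} s)"
    proof (rule nn_integral_mono)
      fix s
      show "ennreal (norm (A j t' s \<xi>)) \<le> ennreal (norm (Q j s \<xi>)) * indicator {0..real n} s"
        using ennreal_leI[OF norm_A_le[of j t' s \<xi>]] n by (cases "0 \<le> s \<and> s \<le> t'") (auto simp: A_def)
    qed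
    thus "(NNI s. ennreal (norm (A j t' s \<xi>))) < \<infinity>" using fin order_le_less_trans by blast
  qed measurable
  show "\<forall>j. ennreal (norm (Uh j t \<xi>)) \<le> ennreal (exp (- (t - \<tau>) * (norm \<xi>)^2)) * ennreal (norm (Uh j \<tau> \<xi>)) +
    (NNI s. ennreal (exp (- (t - s) * (norm \<xi>)^2)) * ennreal (norm (Q j s \<xi>)) * indicator {\<tau>..t} s)"
  proof
    fix j
    let ?e = "exp (- (t - \<tau>) * (norm \<xi>)^2)"
    let ?R = "LINT s|lborel. A j t s \<xi> - of_real ?e * A j \<tau> s \<xi>"
    have ee: "exp (- t * (norm \<xi>)^2) = ?e * exp (- \<tau> * (norm \<xi>)^2)"
      by (simp add: algebra_simps flip: exp_add)
    have "?R = (LINT s|lborel. A j t s \<xi>) - of_real ?e * (LINT s|lborel. A j \<tau> s \<xi>)"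
      by (subst Bochner_Integration.integral_diff) (auto intro: int)
    hence "Uh j t \<xi> = of_real ?e * Uh j \<tau> \<xi> - ?R"
      unfolding Uh_def ee by (simp add: algebra_simps)
    hence "norm (Uh j t \<xi>) \<le> norm (of_real ?e * Uh j \<tau> \<xi>) + norm ?R"
      using norm_triangle_ineq4[of "of_real ?e * Uh j \<tau> \<xi>" ?R] by simp
    also have "norm (of_real ?e * Uh j \<tau> \<xi>) = ?e * norm (Uh j \<tau> \<xi>)" by (simp add: norm_mult)
    finally have "ennreal (norm (Uh j t \<xi>)) \<le> ennreal (?e * norm (Uh j \<tau> \<xi>) + norm ?R)" by (rule ennreal_leI)
    also have "\<dots> = ennreal ?e * ennreal (norm (Uh j \<tau> \<xi>)) + ennreal (norm ?R)" by (simp add: ennreal_mult)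
    also have "\<dots> \<le> ennreal ?e * ennreal (norm (Uh j \<tau> \<xi>)) +
      (NNI s. ennreal (exp (- (t - s) * (norm \<xi>)^2)) * ennreal (norm (Q j s \<xi>)) * indicator {\<tau>..t} s)"
    proof (rule add_left_mono)
      have "ennreal (norm ?R) \<le> (NNI s. ennreal (norm (A j t s \<xi> - of_real ?e * A j \<tau> s \<xi>)))"
        by (intro integral_norm_bound_ennreal Bochner_Integration.integrable_diff integrable_mult_right int)
      also have "\<dots> \<le> (NNI s. ennreal (exp (- (t - s) * (norm \<xi>)^2)) * ennreal (norm (Q j s \<xi>)) * indicator {\<tau>..t} s)"
      proof (rule nn_integral_mono)
        fix s
        show "ennreal (norm (A j t s \<xi> - of_real ?e * A j \<tau> s \<xi>)) \<le> ennreal (exp (- (t - s) * (norm \<xi>)^2)) * ennreal (norm (Q j s \<xi>)) * indicator {\<tau>..t} s"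
        proof (cases "0 \<le> s \<and> s \<le> \<tau>")
          case True
          have "exp (- (t - s) * (norm \<xi>)^2) = ?e * exp (- (\<tau> - s) * (norm \<xi>)^2)"
            by (simp add: algebra_simps flip: exp_add)
          hence "complex_of_real (exp (- (t - s) * (norm \<xi>)^2)) = of_real ?e * of_real (exp (- (\<tau> - s) * (norm \<xi>)^2))"
            by (simp only: of_real_mult)
          hence "A j t s \<xi> - of_real ?e * A j \<tau> s \<xi> = 0" using True \<tau> by (simp add: A_def)
          thus ?thesis by (simp only: norm_zero ennreal_0 zero_le)
        next
          case False
          show ?thesis
          proof (cases "0 \<le> s \<and> s \<le> t")
            case True
            with False \<tau> show ?thesis by (simp add: A_def norm_mult ennreal_mult)
          next
            case F2: False
            with False \<tau> show ?thesis by (auto simp: A_def)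
          qed
        qed
      qed
      finally show "ennreal (norm ?R) \<le> (NNI s. ennreal (exp (- (t - s) * (norm \<xi>)^2)) * ennreal (norm (Q j s \<xi>)) * indicator {\<tau>..t} s)" .
    qed
    finally show "ennreal (norm (Uh j t \<xi>)) \<le> ennreal ?e * ennreal (norm (Uh j \<tau> \<xi>)) +
      (NNI s. ennreal (exp (- (t - s) * (norm \<xi>)^2)) * ennreal (norm (Q j s \<xi>)) * indicator {\<tau>..t} s)" .
  qed
qed

end

section \<open>Reduction to the scalar heat inequality\<close>

context mild_transform
begin

definition f :: "real \<Rightarrow> real^3 \<Rightarrow> ennreal" where
  "f t \<xi> = ennreal (sqrt (norm \<xi>)) * mass (\<lambda>j. Uh j t) \<xi>"

text \<open>The factor \<open>norm \<xi>\<close> of \<open>Q_bound\<close> is left to the kernel of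
  the scalar inequality, while the half power contributed by \<open>f\<close> stays here. This makes
  \<open>54^2 * kernel_const\<close> the constant \<open>K\<close>.\<close>

definition D :: "real \<Rightarrow> real^3 \<Rightarrow> ennreal" where
  "D s \<xi> = ennreal (54 * sqrt (norm \<xi>)) * NN s \<xi>"

lemma f_sq: "(f t \<xi>)^2 = ennreal (norm \<xi>) * (mass (\<lambda>j. Uh j t) \<xi>)^2"
  by (simp add: f_def power_mult_distrib ennreal_power)

lemma mass_eq_sum: "mass U \<xi> = (\<Sum>j\<in>UNIV. ennreal (norm (U j \<xi>)))"
  by (simp add: mass_def)

lemma weighted_f_sq:
  "AE s in lborel. 0 \<le> s \<longrightarrow> (NNI \<xi>. ennreal (norm \<xi>) * (f s \<xi>)^2) = W s"
  using V
proof eventually_elim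
  fix s assume s: "0 \<le> s \<longrightarrow> in_Hdot 1 (complexify (u s)) \<and> frep (complexify (u s)) (\<lambda>j. V j s)"
  show "0 \<le> s \<longrightarrow> (NNI \<xi>. ennreal (norm \<xi>) * (f s \<xi>)^2) = W s"
  proof
    assume s0: "0 \<le> s"
    have "AE \<xi> in lborel. \<forall>j. Uh j s \<xi> = V j s \<xi>"
      unfolding AE_all_countable using s s0 frep_unique[OF Uh_transform[OF s0]] by blast
    thus "(NNI \<xi>. ennreal (norm \<xi>) * (f s \<xi>)^2) = W s"
      unfolding W_def
    proof (intro nn_integral_cong_AE, eventually_elim)
      fix \<xi> assume "\<forall>j. Uh j s \<xi> = V j s \<xi>"
      hence "mass (\<lambda>j. Uh j s) \<xi> = mass (\<lambda>j. V j s) \<xi>" by (simp add: mass_def)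
      moreover have "ennreal (norm \<xi>) * (ennreal (norm \<xi>) * x) = ennorm2 \<xi> * x" for x
        by (simp add: power2_eq_square ennreal_mult mult.assoc)
      ultimately show "ennreal (norm \<xi>) * (f s \<xi>)^2 = ennorm2 \<xi> * (mass (\<lambda>k. V k s) \<xi>)^2"
        by (simp add: f_sq)
    qed
  qed
qed

lemma f_duhamel:
  assumes \<tau>: "0 \<le> \<tau>" "\<tau> \<le> t"
  shows "AE \<xi> in lborel. f t \<xi> \<le> ennreal (exp (- (t - \<tau>) * (norm \<xi>)^2)) * f \<tau> \<xi> +
    (NNI s. ennreal (norm \<xi> * exp (- (t - s) * (norm \<xi>)^2)) * D s \<xi> * indicator {\<tau>..t} s)"
  using Uh_duhamel[OF \<tau>]
proof eventually_elim
  fix \<xi> :: "real^3"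
  let ?e = "ennreal (exp (- (t - \<tau>) * (norm \<xi>)^2))" and ?c = "ennreal (sqrt (norm \<xi>))"
  let ?I = "\<lambda>j s. ennreal (exp (- (t - s) * (norm \<xi>)^2)) * ennreal (norm (Q j s \<xi>)) * indicator {\<tau>..t} s"
  assume d: "\<forall>j. ennreal (norm (Uh j t \<xi>)) \<le> ?e * ennreal (norm (Uh j \<tau> \<xi>)) + (NNI s. ?I j s)"
  have "mass (\<lambda>j. Uh j t) \<xi> \<le> (\<Sum>j\<in>UNIV. ?e * ennreal (norm (Uh j \<tau> \<xi>)) + (NNI s. ?I j s))"
    unfolding mass_eq_sum using d by (intro sum_mono) auto
  also have "\<dots> = ?e * mass (\<lambda>j. Uh j \<tau>) \<xi> + (\<Sum>j\<in>UNIV. \<integral>\<^sup>+s. ?I j s \<partial>lborel)"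
    unfolding mass_eq_sum by (simp only: sum.distrib sum_distrib_left)
  also have "(\<Sum>j\<in>UNIV. \<integral>\<^sup>+s. ?I j s \<partial>lborel) = (NNI s. (\<Sum>j\<in>UNIV. ?I j s))"
    by (rule nn_integral_sum[symmetric]) measurable
  finally have "f t \<xi> \<le> ?c * (?e * mass (\<lambda>j. Uh j \<tau>) \<xi> + (NNI s. (\<Sum>j\<in>UNIV. ?I j s)))"
    unfolding f_def by (rule mult_left_mono) simp
  also have "\<dots> = ?e * f \<tau> \<xi> + ?c * (NNI s. (\<Sum>j\<in>UNIV. ?I j s))"
    unfolding f_def by (simp only: distrib_left mult.left_commute)
  also have "?c * (NNI s. (\<Sum>j\<in>UNIV. ?I j s)) = (NNI s. ?c * (\<Sum>j\<in>UNIV. ?I j s))"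
    by (rule nn_integral_cmult[symmetric]) measurable
  also have "?e * f \<tau> \<xi> + (NNI s. ?c * (\<Sum>j\<in>UNIV. ?I j s)) \<le> ?e * f \<tau> \<xi> +
    (NNI s. ennreal (norm \<xi> * exp (- (t - s) * (norm \<xi>)^2)) * D s \<xi> * indicator {\<tau>..t} s)"
  proof (intro add_left_mono nn_integral_mono)
    fix s
    let ?x = "ennreal (exp (- (t - s) * (norm \<xi>)^2))" and ?i = "indicator {\<tau>..t} s :: ennreal"
    have "?c * (\<Sum>j\<in>UNIV. ?I j s) = ?c * ?x * ?i * (\<Sum>j\<in>UNIV. ennreal (norm (Q j s \<xi>)))"
      by (simp only: sum_distrib_left) (simp only: ac_simps)
    also have "\<dots> = ?c * ?x * ?i * ennreal (\<Sum>j\<in>UNIV. norm (Q j s \<xi>))" by simp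
    also have "\<dots> \<le> ?c * ?x * ?i * (ennreal (54 * norm \<xi>) * NN s \<xi>)"
      by (rule mult_left_mono[OF Q_bound]) simp
    also have "\<dots> = (?c * ennreal (54 * norm \<xi>)) * ?x * NN s \<xi> * ?i" by (simp only: ac_simps)
    also have "?c * ennreal (54 * norm \<xi>) = ennreal (norm \<xi>) * ennreal (54 * sqrt (norm \<xi>))"
      by (subst (1 2) ennreal_mult[symmetric]) (simp_all add: ac_simps)
    also have "ennreal (norm \<xi>) * ennreal (54 * sqrt (norm \<xi>)) * ?x * NN s \<xi> * ?i = (ennreal (norm \<xi>) * ?x) * D s \<xi> * ?i"
      unfolding D_def by (simp only: ac_simps)
    also have "ennreal (norm \<xi>) * ?x = ennreal (norm \<xi> * exp (- (t - s) * (norm \<xi>)^2))" by (rule ennreal_mult[symmetric]) auto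
    finally show "?c * (\<Sum>j\<in>UNIV. ?I j s) \<le> ennreal (norm \<xi> * exp (- (t - s) * (norm \<xi>)^2)) * D s \<xi> * ?i" .
  qed
  finally show "f t \<xi> \<le> ?e * f \<tau> \<xi> + (NNI s. ennreal (norm \<xi> * exp (- (t - s) * (norm \<xi>)^2)) * D s \<xi> * indicator {\<tau>..t} s)" .
qed

lemma D_sq_bound: "(NNI \<xi>. (D s \<xi>)^2) \<le> ennreal (54^2 * kernel_const) * (W s)^2"
proof -
  have "(NNI \<xi>. (D s \<xi>)^2) = (NNI \<xi>. ennreal (54^2) * (ennreal (norm \<xi>) * (NN s \<xi>)^2))"
  proof (rule nn_integral_cong)
    fix \<xi> :: "real^3"
    have "(ennreal (54 * sqrt (norm \<xi>)))^2 = ennreal (54^2 * norm \<xi>)" by (simp add: ennreal_power power_mult_distrib)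
    also have "\<dots> = ennreal (54^2) * ennreal (norm \<xi>)" by (rule ennreal_mult) auto
    finally show "(D s \<xi>)^2 = ennreal (54^2) * (ennreal (norm \<xi>) * (NN s \<xi>)^2)"
      unfolding D_def by (simp only: power_mult_distrib mult.assoc)
  qed
  also have "\<dots> = ennreal (54^2) * (NNI \<xi>. ennreal (norm \<xi>) * (NN s \<xi>)^2)" by (rule nn_integral_cmult) measurable
  also have "\<dots> \<le> ennreal (54^2) * (ennreal kernel_const * (W s)^2)" by (rule mult_left_mono[OF NN_sq]) simp
  also have "\<dots> = ennreal (54^2 * kernel_const) * (W s)^2"
    using kernel_const_pos by (subst ennreal_mult) (auto simp: mult.assoc)
  finally show ?thesis .
qed

lemma heat_inequality: "heat_inequality lborel norm f D (54^2 * kernel_const)"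
proof (intro heat_inequality.intro heat_inequality_axioms.intro f_duhamel)
  show "sigma_finite_measure (lborel :: (real^3) measure)" by (rule lborel.sigma_finite_measure_axioms)
  show "case_prod f \<in> borel_measurable (borel \<Otimes>\<^sub>M lborel)" unfolding f_def mass_def case_prod_unfold by measurable
  show "case_prod D \<in> borel_measurable (borel \<Otimes>\<^sub>M lborel)" unfolding D_def case_prod_unfold by measurable
  show "AE s in lborel. 0 \<le> s \<longrightarrow> (NNI x. (D s x)^2) \<le> ennreal (54^2 * kernel_const) * (NNI x. ennreal (norm x) * (f s x)^2)^2"
    using weighted_f_sq by eventually_elim (use D_sq_bound in auto)
  have "(NNI s. (NNI x. ennreal (norm x) * (f s x)^2)^2 * indicator {0..} s) = (NNI s. (W s)^2 * indicator {0..} s)"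
    by (rule nn_integral_cong_AE, use weighted_f_sq in eventually_elim) (simp add: indicator_def)
  thus "(NNI s. (NNI x. ennreal (norm x) * (f s x)^2)^2 * indicator {0..} s) < \<infinity>"
    using W_finite by simp
  show "0 \<le> 54^2 * kernel_const" using kernel_const_pos by simp
qed auto

theorem Hdot_decay:
  fixes a C \<theta> :: real
  defines "K \<equiv> 54^2 * kernel_const"
  assumes a: "a > 0" "144 * K * a \<le> 1" and C: "C \<ge> 0" and \<theta>: "\<theta> > 0" and t: "t \<ge> 0"
    and Y0: "(NNI \<xi>. ennreal (norm \<xi>) * (mass U0 \<xi>)^2) \<le> ennreal a"
    and linear: "\<And>t. 0 \<le> t \<Longrightarrow> (NNI \<xi>. ennreal (exp (- 2 * t * (norm \<xi>)^2)) * (ennreal (norm \<xi>) * (mass U0 \<xi>)^2)) \<le> ennreal (C * (1 + t) powr - \<theta>)"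
  shows "in_Hdot (1/2) (complexify (u t))"
    and "(Hdot_norm (1/2) (complexify (u t)))^2 \<le> 2 * ((6 * C + 2 * (3 * C + 144 * K * C * (4 * a + 96 * C) + 8 * a)) * (1 + t) powr - min \<theta> 1)"
proof -
  have m0: "mass (\<lambda>j. Uh j 0) = mass U0" by (simp add: mass_def Uh_0 fun_eq_iff)
  interpret heat_inequality lborel norm f D K unfolding K_def by (rule heat_inequality)
  interpret decaying_heat_inequality lborel norm f D K a C \<theta>
    by unfold_locales (use a C \<theta> Y0 linear in \<open>auto simp: Y_def f_sq m0\<close>)
  let ?R = "(6 * C + 2 * (3 * C + 144 * K * C * (4 * a + 96 * C) + 8 * a)) * (1 + t) powr - min \<theta> 1"
  have R0: "?R \<ge> 0" using a C K_nonneg by (intro mult_nonneg_nonneg add_nonneg_nonneg) auto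
  have "wnorm (1/2) (\<lambda>j. Uh j t) \<le> (NNI \<xi>. ennreal ((norm \<xi> powr (1/2))^2) * (mass (\<lambda>j. Uh j t) \<xi>)^2)"
    by (rule wnorm_le_nn_integral_mass)
  also have "\<dots> = Y t" by (simp only: norm_powr_half_sq Y_def f_sq)
  also have "\<dots> \<le> ennreal ?R" by (rule Y_decay[OF t])
  finally have w: "wnorm (1/2) (\<lambda>j. Uh j t) \<le> ennreal ?R" .
  hence fin: "wnorm (1/2) (\<lambda>j. Uh j t) < \<infinity>" by (rule order_le_less_trans) simp
  show "in_Hdot (1/2) (complexify (u t))" by (rule Hdot_backward(1)[OF Uh_transform[OF t] fin])
  have "ennreal ((Hdot_norm (1/2) (complexify (u t)))^2) \<le> 2 * wnorm (1/2) (\<lambda>j. Uh j t)"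
    by (rule Hdot_backward(2)[OF Uh_transform[OF t] fin])
  also have "\<dots> \<le> 2 * ennreal ?R" by (rule mult_left_mono[OF w]) simp
  also have "\<dots> = ennreal (2 * ?R)" using R0 by (subst ennreal_mult) auto
  finally show "(Hdot_norm (1/2) (complexify (u t)))^2 \<le> 2 * ?R"
    using R0 by (subst (asm) ennreal_le_iff) auto
qed

end

subsection \<open>Decay of the heat flow\<close>

text \<open>For \<open>y \<ge> 2 ^ m\<close> one has
  \<open>exp (- y^2) \<le> 2 / y ^ 4 \<le> 2 / 16 ^ m\<close>, and with \<open>k = m + 1\<close> the
  constant is \<open>2 * 16 = 32\<close>. Dominating the Gaussian by indicators of balls makes a
  hypothesis on the mass of balls applicable.\<close>

lemma exp_le_dyadic:
  fixes y :: real
  assumes y: "y \<ge> 0"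
  shows "ennreal (exp (- y\<^sup>2)) \<le> (\<Sum>k. ennreal (32 * (1/16) ^ k) * indicator {..<2 ^ k} y)"
proof -
  define k where "k = (LEAST k. y < 2 ^ k)"
  have ex: "\<exists>k. y < 2 ^ k" by (rule real_arch_pow) simp
  have k: "y < 2 ^ k" unfolding k_def by (rule LeastI_ex[OF ex])
  have "exp (- y\<^sup>2) \<le> 32 * (1/16) ^ k"
  proof (cases k)
    case 0
    have "exp (- y\<^sup>2) \<le> 1" by simp
    moreover have "32 * (1/16) ^ k = (32::real)" using 0 by simp
    ultimately show ?thesis by linarith
  next
    case (Suc m)
    have "\<not> y < 2 ^ m" using not_less_Least[of m "\<lambda>k. y < 2 ^ k"] Suc by (simp add: k_def)
    hence ym: "2 ^ m \<le> y" by simp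
    have "y ^ 4 / 2 \<le> 1 + y^2 + (y^2)^2 / 2" by (simp flip: power_mult)
    also have "\<dots> \<le> exp (y^2)" by (rule exp_lower_Taylor_quadratic) simp
    finally have "y ^ 4 / 2 \<le> exp (y^2)" .
    moreover have "(2 ^ m) ^ 4 \<le> y ^ 4" by (intro power_mono ym) simp
    ultimately have "(2 ^ m) ^ 4 / 2 \<le> exp (y^2)" by simp
    also have "(2 ^ m :: real) ^ 4 = 16 ^ m" by (simp flip: power_mult add: mult.commute[of m 4]) (simp add: power_mult)
    finally have "1 / exp (y^2) \<le> 1 / (16 ^ m / 2)" by (intro divide_left_mono) auto
    thus ?thesis using Suc by (simp add: exp_minus field_simps)
  qed
  hence "ennreal (exp (- y\<^sup>2)) \<le> ennreal (32 * (1/16) ^ k) * indicator {..<2 ^ k} y"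
    using k by (simp add: ennreal_leI)
  also have "\<dots> \<le> (\<Sum>k. ennreal (32 * (1/16) ^ k) * indicator {..<2 ^ k} y)"
    by (rule ennreal_le_suminf)
  finally show ?thesis .
qed

text \<open>The ball of radius \<open>2 ^ k * R\<close> with \<open>R = (1 + t) powr (-1/2)\<close>
  has mass at most \<open>C * 4 ^ k * (1 + t) powr - \<theta>\<close>, because
  \<open>\<theta> \<le> 1\<close>. Against \<open>32 * (1/16) ^ k\<close> this is a geometric series
  of ratio 1/4, whence \<open>32 * 4/3 = 128/3\<close>. The total mass covers \<open>t < 1\<close>,
  where the rate is at least 1/2.\<close>

lemma heat_decay:
  fixes g :: "'a::euclidean_space \<Rightarrow> ennreal"
  assumes g[measurable]: "g \<in> borel_measurable borel" and C: "C \<ge> 0" and m: "m \<ge> 0" and \<theta>: "0 < \<theta>" "\<theta> \<le> 1"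
    and ball: "\<And>\<rho>. \<rho> > 0 \<Longrightarrow> (NNI \<xi>. g \<xi> * indicator (ball 0 \<rho>) \<xi>) \<le> ennreal (C * \<rho> powr (2 * \<theta>))"
    and total: "(NNI \<xi>. g \<xi>) \<le> ennreal m" and t: "t \<ge> 0"
  shows "(NNI \<xi>. ennreal (exp (- 2 * t * (norm \<xi>)^2)) * g \<xi>) \<le> ennreal ((2 * m + 128/3 * C) * (1 + t) powr - \<theta>)"
proof (cases "t < 1")
  case True
  have "(1 + t) powr \<theta> \<le> 2 powr 1"
    using True t \<theta> by (intro order_trans[OF powr_mono2 powr_mono]) auto
  hence "1 / 2 \<le> (1 + t) powr - \<theta>" using t by (simp add: powr_minus field_simps)
  hence "2 * m * (1 / 2) \<le> 2 * m * (1 + t) powr - \<theta>" using m by (intro mult_left_mono) auto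
  also have "\<dots> \<le> (2 * m + 128/3 * C) * (1 + t) powr - \<theta>" using C by (intro mult_right_mono) auto
  finally have le: "m \<le> (2 * m + 128/3 * C) * (1 + t) powr - \<theta>" by simp
  have "(NNI \<xi>. ennreal (exp (- 2 * t * (norm \<xi>)^2)) * g \<xi>) \<le> (NNI \<xi>. 1 * g \<xi>)"
    using t by (intro nn_integral_mono mult_right_mono) auto
  also have "\<dots> \<le> ennreal m" using total by simp
  also have "\<dots> \<le> ennreal ((2 * m + 128/3 * C) * (1 + t) powr - \<theta>)" by (rule ennreal_leI[OF le])
  finally show ?thesis .
next
  case False
  hence t1: "t \<ge> 1" by simp
  have [measurable]: "ball (0::'a) \<rho> \<in> sets borel" for \<rho> by simp
  \<comment> \<open>The frequency scale of diffusion: \<open>1 / R^2 = 1 + t \<le> 2 * t\<close> for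
    \<open>t \<ge> 1\<close>, so the heat factor is at most
    \<open>exp (- (norm \<xi> / R)^2)\<close>.\<close>
  define R where "R = (1 + t) powr (- 1/2)"
  have R: "R > 0" using t by (simp add: R_def)
  have "R^2 = R powr 2" using R by simp
  also have "\<dots> = (1 + t) powr (- 1)" by (simp add: R_def powr_powr)
  also have "\<dots> = 1 / (1 + t)" using t by (simp add: powr_minus_divide)
  finally have R2: "1 / R^2 = 1 + t" by simp
  have Rp: "R powr (2 * \<theta>) = (1 + t) powr - \<theta>" by (simp add: R_def powr_powr)
  have "(NNI \<xi>. ennreal (exp (- 2 * t * (norm \<xi>)^2)) * g \<xi>) \<le>
    (NNI \<xi>. (\<Sum>k. ennreal (32 * (1/16) ^ k) * (g \<xi> * indicator (ball 0 (2 ^ k * R)) \<xi>)))"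
  proof (rule nn_integral_mono)
    fix \<xi> :: 'a
    let ?y = "norm \<xi> / R"
    have "?y^2 = (1 + t) * (norm \<xi>)^2" by (simp add: power_divide flip: R2)
    also have "\<dots> \<le> 2 * t * (norm \<xi>)^2" using t1 by (intro mult_right_mono) auto
    finally have "ennreal (exp (- 2 * t * (norm \<xi>)^2)) \<le> ennreal (exp (- ?y\<^sup>2))" by (intro ennreal_leI) simp
    also have "\<dots> \<le> (\<Sum>k. ennreal (32 * (1/16) ^ k) * indicator {..<2 ^ k} ?y)"
      using R by (intro exp_le_dyadic) simp
    also have "\<dots> = (\<Sum>k. ennreal (32 * (1/16) ^ k) * indicator (ball 0 (2 ^ k * R)) \<xi>)"
      using R by (simp add: indicator_def divide_less_eq)
    finally have "ennreal (exp (- 2 * t * (norm \<xi>)^2)) * g \<xi> \<le> (\<Sum>k. ennreal (32 * (1/16) ^ k) * indicator (ball 0 (2 ^ k * R)) \<xi>) * g \<xi>"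
      by (rule mult_right_mono) simp
    also have "\<dots> = (\<Sum>k. ennreal (32 * (1/16) ^ k) * indicator (ball 0 (2 ^ k * R)) \<xi> * g \<xi>)"
      by (rule ennreal_suminf_multc[symmetric])
    also have "\<dots> = (\<Sum>k. ennreal (32 * (1/16) ^ k) * (g \<xi> * indicator (ball 0 (2 ^ k * R)) \<xi>))"
      by (simp only: ac_simps)
    finally show "ennreal (exp (- 2 * t * (norm \<xi>)^2)) * g \<xi> \<le> (\<Sum>k. ennreal (32 * (1/16) ^ k) * (g \<xi> * indicator (ball 0 (2 ^ k * R)) \<xi>))" .
  qed
  also have "\<dots> = (\<Sum>k. \<integral>\<^sup>+\<xi>. ennreal (32 * (1/16) ^ k) * (g \<xi> * indicator (ball 0 (2 ^ k * R)) \<xi>) \<partial>lborel)"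
    by (rule nn_integral_suminf) measurable
  also have "\<dots> \<le> (\<Sum>k. ennreal (32 * C * R powr (2 * \<theta>) * (1/4) ^ k))"
  proof (rule suminf_le)
    fix k
    have "(NNI \<xi>. ennreal (32 * (1/16) ^ k) * (g \<xi> * indicator (ball 0 (2 ^ k * R)) \<xi>)) =
      ennreal (32 * (1/16) ^ k) * (NNI \<xi>. g \<xi> * indicator (ball 0 (2 ^ k * R)) \<xi>)"
      by (rule nn_integral_cmult) measurable
    also have "\<dots> \<le> ennreal (32 * (1/16) ^ k) * ennreal (C * (2 ^ k * R) powr (2 * \<theta>))"
      using R by (intro mult_left_mono ball) auto
    also have "\<dots> = ennreal (32 * (1/16) ^ k * (C * (2 ^ k * R) powr (2 * \<theta>)))"
      using C by (intro ennreal_mult[symmetric]) auto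
    also have "\<dots> \<le> ennreal (32 * C * R powr (2 * \<theta>) * (1/4) ^ k)"
    proof (rule ennreal_leI)
      have "(2 ^ k) powr (2 * \<theta>) \<le> (2 ^ k) powr 2" using \<theta> by (intro powr_mono) auto
      also have "\<dots> = (4::real) ^ k" by (simp add: power2_eq_square flip: power_mult_distrib)
      finally have "32 * (1/16) ^ k * (C * ((2 ^ k) powr (2 * \<theta>) * R powr (2 * \<theta>))) \<le> 32 * (1/16) ^ k * (C * (4 ^ k * R powr (2 * \<theta>)))"
        using C by (intro mult_left_mono mult_right_mono) auto
      also have "\<dots> = 32 * C * R powr (2 * \<theta>) * ((1/16) ^ k * 4 ^ k)" by (simp only: ac_simps)
      also have "(1/16) ^ k * 4 ^ k = (1/4 :: real) ^ k" by (simp flip: power_mult_distrib)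
      finally show "32 * (1/16) ^ k * (C * (2 ^ k * R) powr (2 * \<theta>)) \<le> 32 * C * R powr (2 * \<theta>) * (1/4) ^ k"
        using R by (simp add: powr_mult)
    qed
    finally show "(NNI \<xi>. ennreal (32 * (1/16) ^ k) * (g \<xi> * indicator (ball 0 (2 ^ k * R)) \<xi>)) \<le> ennreal (32 * C * R powr (2 * \<theta>) * (1/4) ^ k)" .
  qed auto
  also have "\<dots> = ennreal (32 * C * R powr (2 * \<theta>) * (1 / (1 - 1/4)))"
    using C by (intro suminf_ennreal_eq sums_mult geometric_sums) auto
  also have "\<dots> \<le> ennreal ((2 * m + 128/3 * C) * (1 + t) powr - \<theta>)"
    unfolding Rp using m by (intro ennreal_leI) (simp add: algebra_simps)
  finally show ?thesis .
qed

section \<open>From the decay character to the theorem\<close>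

lemma has_decay_character_indicator:
  fixes v :: "real^3 \<Rightarrow> complex^3"
  assumes "has_decay_character v (ereal q)" "- 3/2 < q"
  shows "finite_positive_indicator v q"
proof -
  show ?thesis
    using assms(1) unfolding has_decay_character_def
  proof (elim disjE exE conjE)
    fix r assume "ereal q = ereal r" "finite_positive_indicator v r"
    thus ?thesis by (simp only: ereal.inject)
  next
    assume "ereal q = ereal (- real CARD(3) / 2)"
    hence "q = - real CARD(3) / 2" by (simp only: ereal.inject)
    thus ?thesis using assms(2) by simp
  qed simp
qed

text \<open>Near 0 the finite limit bounds the mass by a multiple of
  \<open>\<rho> powr (2 * q + 3)\<close>, and the exponent may be lowered to
  \<open>2 * \<theta>\<close> for \<open>\<rho> \<le> 1\<close>; for larger radii the finite total
  mass is enough. The cap of \<open>\<theta>\<close> at 1 is what \<open>heat_decay\<close> asks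
  for.\<close>

lemma low_frequency_mass:
  fixes F :: "real^3 \<Rightarrow> complex^3"
  assumes H: "in_Hdot (1/2) F" and U: "frep F U" and q: "- 3/2 < q"
    and dc: "finite_positive_indicator (Lambda_pow (1/2) F) q"
  defines "\<theta> \<equiv> min (3/2 + q) 1"
  obtains C where "C \<ge> 0" "\<And>\<rho>. \<rho> > 0 \<Longrightarrow>
    (NNI \<xi>. (ennreal (norm \<xi>) * (mass U \<xi>)^2) * indicator (ball 0 \<rho>) \<xi>) \<le> ennreal (C * \<rho> powr (2 * \<theta>))"
proof -
  have [measurable]: "U j \<in> borel_measurable borel" for j using U by (simp add: frep_def)
  have [measurable]: "ball (0::real^3) \<rho> \<in> sets borel" for \<rho> by simp
  let ?h = "\<lambda>\<xi>. norm \<xi> * (\<Sum>j\<in>UNIV. (norm (U j \<xi>))^2)"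
  define I where "I \<rho> = (LINT \<xi>|lborel. indicator (ball 0 \<rho>) \<xi> *\<^sub>R ?h \<xi>)" for \<rho> :: real
  have h0: "?h \<xi> \<ge> 0" for \<xi> by (simp add: sum_nonneg)
  have hw: "(NNI \<xi>. ennreal (?h \<xi>)) = wnorm (1/2) U"
    unfolding wnorm_def norm_powr_half_sq by (simp add: ennreal_mult sum_nonneg)
  have hint: "integrable lborel ?h"
  proof (rule integrableI_nonneg)
    have "wnorm (1/2) U < \<infinity>" using Hdot_forward[OF H U] by (rule order_le_less_trans) simp
    thus "(NNI \<xi>. ennreal (?h \<xi>)) < \<infinity>" by (simp only: hw)
    show "AE \<xi> in lborel. 0 \<le> ?h \<xi>" using h0 by simp
  qed measurable
  have bint: "integrable lborel (\<lambda>\<xi>. indicator (ball 0 \<rho>) \<xi> *\<^sub>R ?h \<xi>)" for \<rho>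
    using hint by (intro integrable_mult_indicator) auto
  define m where "m = (LINT \<xi>|lborel. ?h \<xi>)"
  have m0: "m \<ge> 0" unfolding m_def using h0 by simp
  have Im: "I \<rho> \<le> m" for \<rho>
    unfolding I_def m_def by (rule integral_mono[OF bint hint]) (use h0 in \<open>auto simp: indicator_def\<close>)
  have vf: "AE \<xi> in lborel. (norm (vfourier (Lambda_pow (1/2) F) \<xi>))^2 = ?h \<xi>"
  proof -
    have "AE \<xi> in lborel. \<forall>j. fourier (\<lambda>x. Lambda_pow (1/2) F x $ j) \<xi> = Lambda_symbol (1/2) \<xi> * fourier (\<lambda>x. F x $ j) \<xi>"
      unfolding AE_all_countable using has_fourier_unique[OF has_fourier_fourier] multiplier_has_fourier[OF H] by blast
    moreover have "AE \<xi> in lborel. \<forall>j. fourier (\<lambda>x. F x $ j) \<xi> = U j \<xi>"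
      unfolding AE_all_countable using frep_fourier[OF U] by blast
    ultimately show ?thesis
    proof eventually_elim
      fix \<xi> :: "real^3" assume "\<forall>j. fourier (\<lambda>x. Lambda_pow (1/2) F x $ j) \<xi> = Lambda_symbol (1/2) \<xi> * fourier (\<lambda>x. F x $ j) \<xi>"
        "\<forall>j. fourier (\<lambda>x. F x $ j) \<xi> = U j \<xi>"
      thus "(norm (vfourier (Lambda_pow (1/2) F) \<xi>))^2 = ?h \<xi>"
        by (simp add: norm_sq_complex3 vfourier_def Lambda_symbol_def norm_mult power_mult_distrib norm_powr_half_sq sum_distrib_left)
    qed
  qed
  have Iv: "(LINT \<xi>:ball 0 \<rho>|lebesgue. (norm (vfourier (Lambda_pow (1/2) F) \<xi>))^2) = I \<rho>" for \<rho>
    unfolding set_lebesgue_integral_def I_def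
  proof (rule lebesgue_AE_eq_borel)
    show "AE \<xi> in lborel. indicat_real (ball 0 \<rho>) \<xi> *\<^sub>R (norm (vfourier (Lambda_pow (1/2) F) \<xi>))^2 = indicator (ball 0 \<rho>) \<xi> *\<^sub>R ?h \<xi>"
      using vf by eventually_elim simp
  qed measurable
  obtain P where P: "has_decay_indicator (Lambda_pow (1/2) F) q P" "P < \<infinity>" "0 < P"
    using dc unfolding finite_positive_indicator_def by blast
  obtain p where p: "P = ereal p" using P by (cases P) auto
  have "((\<lambda>\<rho>. ereal (\<rho> powr (- 2 * q - 3) * I \<rho>)) \<longlongrightarrow> ereal p) (at_right 0)"
    using P(1) unfolding has_decay_indicator_def Iv p by simp
  hence "((\<lambda>\<rho>. \<rho> powr (- 2 * q - 3) * I \<rho>) \<longlongrightarrow> p) (at_right 0)" by simp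
  hence "eventually (\<lambda>\<rho>. \<rho> powr (- 2 * q - 3) * I \<rho> < p + 1) (at_right 0)" by (rule order_tendstoD) simp
  then obtain \<delta>0 where \<delta>0: "\<delta>0 > 0" "\<And>\<rho>. 0 < \<rho> \<Longrightarrow> \<rho> < \<delta>0 \<Longrightarrow> \<rho> powr (- 2 * q - 3) * I \<rho> < p + 1"
    unfolding eventually_at_right_field by blast
  define \<delta> where "\<delta> = min \<delta>0 1"
  have \<delta>: "\<delta> > 0" "\<delta> \<le> 1" using \<delta>0(1) by (auto simp: \<delta>_def)
  have p0: "p > 0" using P(3) p by simp
  have \<theta>: "2 * \<theta> \<le> 2 * q + 3" "\<theta> > 0" using q by (auto simp: \<theta>_def min_def)
  \<comment> \<open>The summand \<open>p + 1\<close> serves radii below \<open>\<delta>\<close>,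
    where the limit is effective; the other one is the total mass divided by
    \<open>\<delta> powr (2 * \<theta>)\<close> and serves all remaining radii.\<close>
  define C where "C = p + 1 + m * \<delta> powr (- 2 * \<theta>)"
  have IC: "I \<rho> \<le> C * \<rho> powr (2 * \<theta>)" if \<rho>: "\<rho> > 0" for \<rho>
  proof (cases "\<rho> < \<delta>")
    case True
    have "I \<rho> = \<rho> powr (2 * q + 3) * (\<rho> powr (- 2 * q - 3) * I \<rho>)"
      using \<rho> by (simp add: mult.assoc[symmetric] flip: powr_add)
    also have "\<dots> \<le> \<rho> powr (2 * q + 3) * (p + 1)"
      using \<delta>0(2)[OF \<rho>] True by (intro mult_left_mono) (auto simp: \<delta>_def)
    also have "\<dots> \<le> \<rho> powr (2 * \<theta>) * (p + 1)"
      using \<rho> True \<delta> \<theta> p0 by (intro mult_right_mono powr_mono') auto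
    also have "\<dots> \<le> \<rho> powr (2 * \<theta>) * C" using m0 by (intro mult_left_mono) (auto simp: C_def)
    finally show ?thesis by (simp only: mult.commute)
  next
    case False
    have "1 = \<delta> powr (- 2 * \<theta>) * \<delta> powr (2 * \<theta>)" using \<delta> by (simp flip: powr_add)
    also have "\<dots> \<le> \<delta> powr (- 2 * \<theta>) * \<rho> powr (2 * \<theta>)"
      using False \<delta> \<theta> by (intro mult_left_mono powr_mono2) auto
    finally have "m * 1 \<le> m * (\<delta> powr (- 2 * \<theta>) * \<rho> powr (2 * \<theta>))" using m0 by (rule mult_left_mono)
    also have "\<dots> = (m * \<delta> powr (- 2 * \<theta>)) * \<rho> powr (2 * \<theta>)" by simp
    also have "\<dots> \<le> C * \<rho> powr (2 * \<theta>)" using p0 by (intro mult_right_mono) (auto simp: C_def)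
    finally show ?thesis using Im[of \<rho>] by simp
  qed
  show ?thesis
  proof (rule that[of "3 * C"])
    show C0: "3 * C \<ge> 0" using p0 m0 by (simp add: C_def)
    fix \<rho> :: real assume \<rho>: "\<rho> > 0"
    have "(NNI \<xi>. (ennreal (norm \<xi>) * (mass U \<xi>)^2) * indicator (ball 0 \<rho>) \<xi>) \<le>
      (NNI \<xi>. 3 * ennreal (indicator (ball 0 \<rho>) \<xi> *\<^sub>R ?h \<xi>))"
    proof (rule nn_integral_mono)
      fix \<xi> :: "real^3"
      have "ennreal (norm \<xi>) * (mass U \<xi>)^2 \<le> ennreal (norm \<xi>) * (3 * ennreal (\<Sum>j\<in>UNIV. (norm (U j \<xi>))^2))"
        by (intro mult_left_mono mass_sq_le) simp
      also have "\<dots> = 3 * ennreal (?h \<xi>)" by (subst ennreal_mult) (auto simp: sum_nonneg mult.left_commute)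
      finally show "(ennreal (norm \<xi>) * (mass U \<xi>)^2) * indicator (ball 0 \<rho>) \<xi> \<le> 3 * ennreal (indicator (ball 0 \<rho>) \<xi> *\<^sub>R ?h \<xi>)"
        by (simp add: indicator_def)
    qed
    also have "\<dots> = 3 * (NNI \<xi>. ennreal (indicator (ball 0 \<rho>) \<xi> *\<^sub>R ?h \<xi>))"
      by (rule nn_integral_cmult) measurable
    also have "(NNI \<xi>. ennreal (indicator (ball 0 \<rho>) \<xi> *\<^sub>R ?h \<xi>)) = ennreal (I \<rho>)"
      unfolding I_def by (rule nn_integral_eq_integral[OF bint]) (use h0 in \<open>auto simp: indicator_def\<close>)
    also have "3 * ennreal (I \<rho>) \<le> 3 * ennreal (C * \<rho> powr (2 * \<theta>))"
      by (intro mult_left_mono ennreal_leI IC \<rho>) simp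
    also have "\<dots> = ennreal (3 * C * \<rho> powr (2 * \<theta>))"
      using C0 by (subst mult.assoc, subst (2) ennreal_mult) auto
    finally show "(NNI \<xi>. (ennreal (norm \<xi>) * (mass U \<xi>)^2) * indicator (ball 0 \<rho>) \<xi>) \<le> ennreal (3 * C * \<rho> powr (2 * \<theta>))" .
  qed
qed

theorem theorem1p1:
  "\<exists>\<epsilon>0::real. \<epsilon>0 > 0 \<and>
     (\<forall>\<epsilon>. 0 < \<epsilon> \<and> \<epsilon> \<le> \<epsilon>0 \<longrightarrow>
       (\<forall>(u0 :: real^3 \<Rightarrow> real^3) (q :: real).
          in_Hdot (1/2) (complexify u0) \<longrightarrow>
          weakly_div_free u0 \<longrightarrow>
          Hdot_norm (1/2) (complexify u0) < \<epsilon> \<longrightarrow>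
          has_decay_character (Lambda_pow (1/2) (complexify u0)) (ereal q) \<longrightarrow>
          - 3/2 < q \<longrightarrow>
          (\<exists>C::real. \<forall>u. mild_solution u0 u \<longrightarrow>
             (\<forall>t>0. in_Hdot (1/2) (complexify (u t)) \<and>
                (Hdot_norm (1/2) (complexify (u t)))^2
                  \<le> C * (1 + t) powr (- min (3/2 + q) 1)))))"
proof -
  define K where "K = 54^2 * kernel_const"
  have K: "K > 0" using kernel_const_pos by (simp add: K_def)
  \<comment> \<open>With the \<open>a\<close> chosen below, the condition
    \<open>144 * K * a \<le> 1\<close> reads
    \<open>432 * K * plancherel_const * \<epsilon>^2 \<le> 1\<close>; the bound by 1 allows the use
    of \<open>\<epsilon>^2 \<le> \<epsilon>\<close>.\<close>
  define \<epsilon>0 where "\<epsilon>0 = min 1 (1 / (432 * K * plancherel_const))"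
  show ?thesis
  proof (rule exI[of _ \<epsilon>0], intro conjI allI impI)
    show "\<epsilon>0 > 0" using K plancherel_const_pos by (simp add: \<epsilon>0_def)
    fix \<epsilon> q :: real and u0 :: "real^3 \<Rightarrow> real^3"
    assume \<epsilon>: "0 < \<epsilon> \<and> \<epsilon> \<le> \<epsilon>0" and H: "in_Hdot (1/2) (complexify u0)"
      and small: "Hdot_norm (1/2) (complexify u0) < \<epsilon>"
      and dc: "has_decay_character (Lambda_pow (1/2) (complexify u0)) (ereal q)" and q: "- 3/2 < q"
    define \<theta> where "\<theta> = min (3/2 + q) 1"
    have \<theta>: "0 < \<theta>" "\<theta> \<le> 1" using q by (auto simp: \<theta>_def)
    have "\<forall>j. \<exists>g. has_fourier (\<lambda>x. complexify u0 x $ j) g" using H by (auto simp: in_Hdot_def)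
    then obtain U0 where U0: "frep (complexify u0) U0" by (rule frep_exists)
    have [measurable]: "U0 j \<in> borel_measurable borel" for j using U0 by (simp add: frep_def)
    \<comment> \<open>The 3 is the price of \<open>mass\<close> in
      \<open>nn_integral_mass_le\<close>, and \<open>plancherel_const\<close> that of
      \<open>Hdot_forward\<close>.\<close>
    define a where "a = 3 * plancherel_const * \<epsilon>^2"
    have a: "a > 0" using \<epsilon> plancherel_const_pos by (simp add: a_def)
    have aK: "144 * K * a \<le> 1"
    proof -
      have "\<epsilon>^2 \<le> \<epsilon>" using \<epsilon> by (simp add: \<epsilon>0_def power2_eq_square mult_left_le)
      also have "\<epsilon> \<le> 1 / (432 * K * plancherel_const)" using \<epsilon> by (simp add: \<epsilon>0_def)
      finally have "(432 * K * plancherel_const) * \<epsilon>^2 \<le> (432 * K * plancherel_const) * (1 / (432 * K * plancherel_const))" using K plancherel_const_pos by (intro mult_left_mono) auto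
      thus ?thesis using K plancherel_const_pos by (simp add: a_def)
    qed
    let ?g = "\<lambda>\<xi>. ennreal (norm \<xi>) * (mass U0 \<xi>)^2"
    have Y0: "(NNI \<xi>. ?g \<xi>) \<le> ennreal a"
    proof -
      have n: "Hdot_norm (1/2) (complexify u0) \<ge> 0" by (simp add: Hdot_norm_def L2norm_def)
      have "(NNI \<xi>. ?g \<xi>) \<le> 3 * wnorm (1/2) U0"
        using nn_integral_mass_le[of U0 "1/2"] by (simp only: norm_powr_half_sq) measurable
      also have "\<dots> \<le> 3 * ennreal (plancherel_const * (Hdot_norm (1/2) (complexify u0))^2)"
        by (intro mult_left_mono Hdot_forward[OF H U0]) simp
      also have "\<dots> = ennreal (3 * (plancherel_const * (Hdot_norm (1/2) (complexify u0))^2))" using plancherel_const_pos by (subst (2) ennreal_mult) auto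
      also have "\<dots> \<le> ennreal a"
      proof (rule ennreal_leI)
        have "(Hdot_norm (1/2) (complexify u0))^2 \<le> \<epsilon>^2" using small n by (intro power_mono) auto
        thus "3 * (plancherel_const * (Hdot_norm (1/2) (complexify u0))^2) \<le> a" using plancherel_const_pos by (simp add: a_def)
      qed
      finally show ?thesis .
    qed
    \<comment> \<open>As constructed, \<open>C1\<close> depends on \<open>u0\<close> through the
      value of the decay indicator, the total mass and the radius below which the limit is
      effective.\<close>
    obtain C1 where C1: "C1 \<ge> 0" "\<And>\<rho>. \<rho> > 0 \<Longrightarrow> (NNI \<xi>. ?g \<xi> * indicator (ball 0 \<rho>) \<xi>) \<le> ennreal (C1 * \<rho> powr (2 * \<theta>))"
      unfolding \<theta>_def using low_frequency_mass[OF H U0 q has_decay_character_indicator[OF dc q]] by blast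
    define C where "C = 2 * a + 128/3 * C1"
    have C: "C \<ge> 0" using a C1(1) by (simp add: C_def)
    have linear: "(NNI \<xi>. ennreal (exp (- 2 * t * (norm \<xi>)^2)) * ?g \<xi>) \<le> ennreal (C * (1 + t) powr - \<theta>)" if "t \<ge> 0" for t
      unfolding C_def by (rule heat_decay) (use C1 Y0 a \<theta> that in auto)
    \<comment> \<open>Fixed before any solution is chosen; the leading 2 is that of
      \<open>Hdot_backward\<close>.\<close>
    define B where "B = 2 * (6 * C + 2 * (3 * C + 144 * K * C * (4 * a + 96 * C) + 8 * a))"
    show "\<exists>C::real. \<forall>u. mild_solution u0 u \<longrightarrow> (\<forall>t>0. in_Hdot (1/2) (complexify (u t)) \<and>
      (Hdot_norm (1/2) (complexify (u t)))^2 \<le> C * (1 + t) powr (- min (3/2 + q) 1))"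
    proof (rule exI[of _ B], intro allI impI)
      fix u and t :: real assume u: "mild_solution u0 u" and t: "t > 0"
      have "in_Lp_Hdot 4 1 (\<lambda>t. complexify (u t))" using u by (simp add: mild_solution_def)
      then obtain V where V: "\<And>j. case_prod (V j) \<in> borel_measurable (borel \<Otimes>\<^sub>M borel)"
        "AE t in lborel. 0 \<le> t \<longrightarrow> in_Hdot 1 (complexify (u t)) \<and> frep (complexify (u t)) (\<lambda>j. V j t)"
        using jointly_measurable_transform by blast
      interpret mild_transform u0 u U0 V by unfold_locales (use u U0 V in auto)
      have min: "min \<theta> 1 = min (3/2 + q) 1" by (simp add: \<theta>_def)
      note d = Hdot_decay[of a C \<theta> t, folded K_def, OF a aK C \<theta>(1) less_imp_le[OF t] Y0 linear, unfolded min]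
      show "in_Hdot (1/2) (complexify (u t)) \<and> (Hdot_norm (1/2) (complexify (u t)))^2 \<le> B * (1 + t) powr (- min (3/2 + q) 1)"
        using d unfolding B_def by (simp only: mult.assoc)
    qed
  qed
qed

end
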